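(* Let $X$ be a quasi-diffusion process corresponding to $L$. Let $R\in(0,\infty)$, $p\ge d_0$, let $g$ be a Borel bounded function on $\bar B_{2R}$ and $f\in L_p(B_{2R})$. For $x_0\in B_{2R}$ define $$u(x_0)=E_{x_0}\int_0^{\tau_{2R}}f(x_t)\,dt+E_{x_0}g(x_{\tau_{2R}}),$$ where $\tau_{2R}$ is the first exit time of $x_t$ from $B_{2R}$. Then for any $\phi\in W^2_{d_0}(B_{2R})$ and any point $x_0\in B_{2R}$ at which $u-\phi$ has a local maximum we have $$\lim_{\varepsilon\downarrow0}\operatorname*{ess\,sup}_{B_\varepsilon(x_0)}(L\phi+f)\ge0.$$
   Context: Fix the dimension $d$, $\delta\in(0,1)$ and a number denoted $\|b\|\in(0,\infty)$. $\mathbb S_\delta$ is the set of symmetric $d\times d$ matrices with eigenvalues in $[\delta,\delta^{-1}]$. $a:\mathbb R^d\to\mathbb S_\delta$ and $b:\mathbb R^d\to\mathbb R^d$ are Borel with $\|b\|_{L_d(\mathbb R^d)}\le\|b\|$ (the right side is the fixed number). $L=(1/2)a^{ij}(x)D_{ij}+b^i(x)D_i$, where $D_i=\partial/\partial x^i$, $D_{ij}=D_iD_j$, with summation over repeated indices. A quasi-diffusion process corresponding to $L$ is a continuous time-homogeneous Markov process $X=(x_t,\infty,\mathcal M_t,P_x)$ in $\mathbb R^d$ with infinite lifetime (in Dynkin's sense; $P_x$ is the law for the starting point $x$, $E_x$ the expectation) such that for any $x\in\mathbb R^d$, $t\ge0$, $E_x\int_0^t|b(x_s)|\,ds<\infty$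 and, for any twice continuously differentiable compactly supported $u$, $u(x)=E_xu(x_t)-E_x\int_0^tLu(x_s)\,ds$. $B_R(y)=\{x:|x-y|<R\}$, $B_R=B_R(0)$; $\tau_R$ is the first exit time of $x_t$ from $B_R$. $W^2_p$ is the usual Sobolev space; elements of $W^2_{d_0}(B_{2R})$ are taken in their continuous versions (recall $d_0>d/2$). The constant $d_0=d_0(d,\delta,\|b\|)\in(d/2,d)$ is a fixed constant, known from earlier work of Krylov, with the following two properties for every (finite) $p\ge d_0$, every Borel $a:\mathbb R^d\to\mathbb S_\delta$, every Borel $b:\mathbb R^d\to\mathbb R^d$ with $\|b\|_{L_d(\mathbb R^d)}$ not exceeding the fixed number $\|b\|$, every quasi-diffusion process $X$ corresponding to the operator $L$ with these coefficients, and every Borel $f\ge0$ on $\mathbb R^d$. (i) For all $R\in(0,\infty)$, $E_0\int_0^{\tau_R}f(x_t)\,dt\le NR^{2-d/p}\|f\|_{L_p(B_R)}$ with $N=N(p,d,\delta,\|b\|)$. (ii) There are $N,\mu'>0$ and $R_0\ge2$, depending only on $p,d,\delta,\|b\|$, such that for all $\lambda>0$, $R\in[0,\infty)$, $E_0\int_0^\infty e^{-\lambda\phi_t(B_R^c)}f(x_t)\,dt\le N(R\sqrt\lambda+R_0)^{2-d/p}\lambda^{d/(2p)-1}\|\Psi_{R,\lambda}^{-1}f\|_{L_p(\mathbb R^d)}$, where $\phi_t(\Gamma)=\int_0^tI_\Gamma(x_s)\,ds$ and $\Psi_{R,\lambda}(x)=\exp(\sqrt\lambda\,\mu'\,\mathrm{dist}(x,B_{R+R_0/\sqrt\lambda}))$.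 *)

theory Defs
  imports "HOL-Probability.Probability"
begin

text \<open>Elements of \<open>L\<^sub>p\<close> are represented by Borel functions.\<close>

definition Lp_norm :: "real \<Rightarrow> (real^'n) set \<Rightarrow> (real^'n \<Rightarrow> 'b::real_normed_vector) \<Rightarrow> ennreal" where
  "Lp_norm p S f =
     (let I = (\<integral>\<^sup>+x\<in>S. ennreal (norm (f x) powr p) \<partial>lborel)
      in if I = \<infinity> then \<infinity> else ennreal (enn2real I powr (1 / p)))"

definition Lp_on :: "real \<Rightarrow> (real^'n) set \<Rightarrow> (real^'n \<Rightarrow> real) set" where
  "Lp_on p S = {f. set_borel_measurable lborel S f \<and> Lp_norm p S f < \<infinity>}"

definition partial_deriv :: "'n \<Rightarrow> (real^'n \<Rightarrow> real) \<Rightarrow> real^'n \<Rightarrow> real" where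
  "partial_deriv i u x = frechet_derivative u (at x) (axis i 1)"

text \<open>The usual class of \<open>k\<close> times continuously differentiable functions: requiring total rather than
  partial differentiability of the derivatives of order less than \<open>k\<close> makes no difference,
  since those of order \<open>k\<close> are continuous.\<close>

primrec Ck :: "nat \<Rightarrow> (real^'n \<Rightarrow> real) \<Rightarrow> bool" where
  "Ck 0 u \<longleftrightarrow> continuous_on UNIV u"
| "Ck (Suc k) u \<longleftrightarrow> (\<forall>x. u differentiable (at x)) \<and> (\<forall>i. Ck k (partial_deriv i u))"

definition compactly_supported_in :: "(real^'n) set \<Rightarrow> (real^'n \<Rightarrow> real) \<Rightarrow> bool" where
  "compactly_supported_in S u \<longleftrightarrow>
     compact (closure {x. u x \<noteq> 0}) \<and> closure {x. u x \<noteq> 0} \<subseteq> S"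

definition locally_integrable_on :: "(real^'n) set \<Rightarrow> (real^'n \<Rightarrow> real) \<Rightarrow> bool" where
  "locally_integrable_on S u \<longleftrightarrow> (\<forall>K. compact K \<and> K \<subseteq> S \<longrightarrow> set_integrable lborel K u)"

definition weak_partial_deriv ::
  "(real^'n) set \<Rightarrow> 'n \<Rightarrow> (real^'n \<Rightarrow> real) \<Rightarrow> (real^'n \<Rightarrow> real) \<Rightarrow> bool" where
  "weak_partial_deriv S i u v \<longleftrightarrow>
     locally_integrable_on S u \<and> locally_integrable_on S v \<and>
     (\<forall>\<zeta>. (\<forall>k. Ck k \<zeta>) \<and> compactly_supported_in S \<zeta> \<longrightarrow>
        (LINT x:S|lborel. u x * partial_deriv i \<zeta> x) = - (LINT x:S|lborel. v x * \<zeta> x))"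

text \<open>\<open>sobolev2 p S u Du D2u\<close>: \<open>u\<close> belongs to \<open>W\<^sup>2\<^sub>p(S)\<close>, and \<open>Du i\<close>, \<open>D2u i j\<close> are (versions of)
  its generalized derivatives \<open>D\<^sub>i u\<close>, \<open>D\<^sub>i D\<^sub>j u\<close>.\<close>

definition sobolev2 :: "real \<Rightarrow> (real^'n) set \<Rightarrow> (real^'n \<Rightarrow> real) \<Rightarrow>
    ('n \<Rightarrow> real^'n \<Rightarrow> real) \<Rightarrow> ('n \<Rightarrow> 'n \<Rightarrow> real^'n \<Rightarrow> real) \<Rightarrow> bool" where
  "sobolev2 p S u Du D2u \<longleftrightarrow>
     u \<in> Lp_on p S \<and>
     (\<forall>i. Du i \<in> Lp_on p S \<and> weak_partial_deriv S i u (Du i)) \<and>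
     (\<forall>i j. D2u i j \<in> Lp_on p S \<and> weak_partial_deriv S i (Du j) (D2u i j))"

definition sym_spectrum_in :: "real \<Rightarrow> (real^'n^'n) set" where
  "sym_spectrum_in \<delta> =
     {A. transpose A = A \<and> (\<forall>c v. v \<noteq> 0 \<and> A *v v = c *\<^sub>R v \<longrightarrow> \<delta> \<le> c \<and> c \<le> 1 / \<delta>)}"

definition admissible_coeffs ::
  "real \<Rightarrow> real \<Rightarrow> (real^'n \<Rightarrow> real^'n^'n) \<Rightarrow> (real^'n \<Rightarrow> real^'n) \<Rightarrow> bool" where
  "admissible_coeffs \<delta> B a b \<longleftrightarrow>
     a \<in> borel_measurable borel \<and> (\<forall>x. a x \<in> sym_spectrum_in \<delta>) \<and>
     b \<in> borel_measurable borel \<and> Lp_norm (real CARD('n)) UNIV b \<le> ennreal B"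

text \<open>\<open>L\<close> as a function of the first and second derivatives of its argument, so that it applies to
  classical and to generalized derivatives alike.\<close>

definition diff_op :: "(real^'n \<Rightarrow> real^'n^'n) \<Rightarrow> (real^'n \<Rightarrow> real^'n) \<Rightarrow>
    ('n \<Rightarrow> real^'n \<Rightarrow> real) \<Rightarrow> ('n \<Rightarrow> 'n \<Rightarrow> real^'n \<Rightarrow> real) \<Rightarrow> real^'n \<Rightarrow> real" where
  "diff_op a b Du D2u x =
     (1/2) * (\<Sum>i\<in>UNIV. \<Sum>j\<in>UNIV. a x $ i $ j * D2u i j x) + (\<Sum>i\<in>UNIV. b x $ i * Du i x)"

abbreviation classical_op ::
  "(real^'n \<Rightarrow> real^'n^'n) \<Rightarrow> (real^'n \<Rightarrow> real^'n) \<Rightarrow> (real^'n \<Rightarrow> real) \<Rightarrow> real^'n \<Rightarrow> real" where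
  "classical_op a b u \<equiv>
     diff_op a b (\<lambda>i. partial_deriv i u) (\<lambda>i j. partial_deriv i (partial_deriv j u))"

text \<open>A continuous time-homogeneous Markov process \<open>(x\<^sub>t, \<infinity>, \<M>\<^sub>t, P\<^sub>x)\<close> in the sense of Dynkin.
  Only the measurable space of \<open>M\<close> matters: it carries all the measures \<open>P\<^sub>x\<close>. Only times \<open>t \<ge> 0\<close>
  are meaningful. The assumption \<open>shift\<close> is part of Dynkin's definition in the homogeneous
  case; it makes the shift operators \<open>\<theta>\<^sub>t\<close> available. The strong Markov property is not assumed.\<close>

locale continuous_markov_process =
  fixes M :: "'w measure"
    and X :: "real \<Rightarrow> 'w \<Rightarrow> real^'n"
    and F :: "real \<Rightarrow> 'w measure"
    and P :: "real^'n \<Rightarrow> 'w measure"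
  assumes prob: "prob_space (P x)"
    and sets_P: "sets (P x) = sets M"
    and subalg: "0 \<le> t \<Longrightarrow> subalgebra M (F t)"
    and filtr: "0 \<le> s \<Longrightarrow> s \<le> t \<Longrightarrow> sets (F s) \<subseteq> sets (F t)"
    and adapted: "0 \<le> t \<Longrightarrow> X t \<in> borel_measurable (F t)"
    and continuous: "\<omega> \<in> space M \<Longrightarrow> continuous_on {0..} (\<lambda>t. X t \<omega>)"
    and transition_measurable: "0 \<le> t \<Longrightarrow> \<Gamma> \<in> sets borel \<Longrightarrow>
      (\<lambda>x. measure (P x) {\<omega> \<in> space M. X t \<omega> \<in> \<Gamma>}) \<in> borel_measurable borel"
    and start: "AE \<omega> in P x. X 0 \<omega> = x"
    and markov: "0 \<le> t \<Longrightarrow> 0 \<le> s \<Longrightarrow> \<Gamma> \<in> sets borel \<Longrightarrow>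
      AE \<omega> in P x. real_cond_exp (P x) (F t) (\<lambda>\<omega>'. indicator \<Gamma> (X (t + s) \<omega>')) \<omega>
                    = measure (P (X t \<omega>)) {\<omega>' \<in> space M. X s \<omega>' \<in> \<Gamma>}"
    and shift: "0 \<le> t \<Longrightarrow> \<omega> \<in> space M \<Longrightarrow>
      \<exists>\<omega>'\<in>space M. \<forall>s\<ge>0. X s \<omega>' = X (t + s) \<omega>"

locale quasi_diffusion =
  continuous_markov_process M X F P
  for M :: "'w measure" and X :: "real \<Rightarrow> 'w \<Rightarrow> real^'n" and F P +
  fixes a :: "real^'n \<Rightarrow> real^'n^'n" and b :: "real^'n \<Rightarrow> real^'n"
  assumes drift_integrable: "0 \<le> t \<Longrightarrow>
      (\<integral>\<^sup>+\<omega>. (\<integral>\<^sup>+s\<in>{0..t}. ennreal (norm (b (X s \<omega>))) \<partial>lborel) \<partial>P x) < \<infinity>"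
    and dynkin_formula: "0 \<le> t \<Longrightarrow> Ck 2 u \<Longrightarrow> compactly_supported_in UNIV u \<Longrightarrow>
      u x = (LINT \<omega>|P x. u (X t \<omega>))
          - (LINT \<omega>|P x. (LINT s:{0..t}|lborel. classical_op a b u (X s \<omega>)))"

text \<open>The infimum of the empty set is \<open>\<infinity>\<close>.\<close>

definition exit_time :: "(real \<Rightarrow> 'w \<Rightarrow> real^'n) \<Rightarrow> real \<Rightarrow> 'w \<Rightarrow> ereal" where
  "exit_time X r \<omega> = (INF t\<in>{t. 0 \<le> t \<and> X t \<omega> \<notin> ball 0 r}. ereal t)"

definition before_exit :: "(real \<Rightarrow> 'w \<Rightarrow> real^'n) \<Rightarrow> real \<Rightarrow> 'w \<Rightarrow> real set" where
  "before_exit X r \<omega> = {t. 0 \<le> t \<and> ereal t < exit_time X r \<omega>}"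

definition occupation :: "(real \<Rightarrow> 'w \<Rightarrow> real^'n) \<Rightarrow> (real^'n) set \<Rightarrow> real \<Rightarrow> 'w \<Rightarrow> real" where
  "occupation X \<Gamma> t \<omega> = (LINT s:{0..t}|lborel. indicator \<Gamma> (X s \<omega>))"

definition exit_estimate :: "'w itself \<Rightarrow> 'n::finite itself \<Rightarrow> real \<Rightarrow> real \<Rightarrow> real \<Rightarrow> bool" where
  "exit_estimate _ _ \<delta> B p \<longleftrightarrow>
     (\<exists>N>0. \<forall>a b (M :: 'w measure) (X :: real \<Rightarrow> 'w \<Rightarrow> real^'n) F P.
        admissible_coeffs \<delta> B a b \<and> quasi_diffusion M X F P a b \<longrightarrow>
        (\<forall>R f. 0 < R \<and> f \<in> borel_measurable borel \<and> (\<forall>x. 0 \<le> f x) \<longrightarrow>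
           (\<integral>\<^sup>+\<omega>. (\<integral>\<^sup>+t\<in>before_exit X R \<omega>. ennreal (f (X t \<omega>)) \<partial>lborel) \<partial>P 0)
             \<le> ennreal (N * R powr (2 - real CARD('n) / p)) * Lp_norm p (ball 0 R) f))"

definition weight :: "real \<Rightarrow> real \<Rightarrow> real \<Rightarrow> real \<Rightarrow> real^'n \<Rightarrow> real" where
  "weight \<mu> R0 R l x = exp (sqrt l * \<mu> * infdist x (ball 0 (R + R0 / sqrt l)))"

definition resolvent_estimate :: "'w itself \<Rightarrow> 'n::finite itself \<Rightarrow> real \<Rightarrow> real \<Rightarrow> real \<Rightarrow> bool" where
  "resolvent_estimate _ _ \<delta> B p \<longleftrightarrow>
     (\<exists>N>0. \<exists>\<mu>>0. \<exists>R0\<ge>2. \<forall>a b (M :: 'w measure) (X :: real \<Rightarrow> 'w \<Rightarrow> real^'n) F P.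
        admissible_coeffs \<delta> B a b \<and> quasi_diffusion M X F P a b \<longrightarrow>
        (\<forall>l R f. 0 < l \<and> 0 \<le> R \<and> f \<in> borel_measurable borel \<and> (\<forall>x. 0 \<le> f x) \<longrightarrow>
           (\<integral>\<^sup>+\<omega>. (\<integral>\<^sup>+t\<in>{0..}.
               ennreal (exp (- l * occupation X (- ball 0 R) t \<omega>) * f (X t \<omega>)) \<partial>lborel) \<partial>P 0)
             \<le> ennreal (N * (R * sqrt l + R0) powr (2 - real CARD('n) / p)
                          * l powr (real CARD('n) / (2 * p) - 1))
               * Lp_norm p UNIV (\<lambda>x. f x / weight \<mu> R0 R l x)))"

text \<open>The defining properties of \<open>d\<^sub>0 = d\<^sub>0(d, \<delta>, \<parallel>b\<parallel>)\<close>, with \<open>B\<close> in the role of \<open>\<parallel>b\<parallel>\<close>. HOL cannot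
  quantify over all sample spaces at once, so the estimates are only required for processes whose
  sample space lives in the type \<open>'w\<close>; as a hypothesis this is weaker than requiring them for
  all processes.\<close>

definition krylov_exponent :: "'w itself \<Rightarrow> 'n::finite itself \<Rightarrow> real \<Rightarrow> real \<Rightarrow> real \<Rightarrow> bool" where
  "krylov_exponent W D \<delta> B d0 \<longleftrightarrow>
     real CARD('n) / 2 < d0 \<and> d0 < real CARD('n) \<and>
     (\<forall>p\<ge>d0. exit_estimate W D \<delta> B p \<and> resolvent_estimate W D \<delta> B p)"

text \<open>The value of \<open>g\<close> at the exit place is replaced by \<open>0\<close> on the event that there is no exit.\<close>

definition prob_solution :: "(real \<Rightarrow> 'w \<Rightarrow> real^'n) \<Rightarrow> (real^'n \<Rightarrow> 'w measure) \<Rightarrow> real \<Rightarrow>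
    (real^'n \<Rightarrow> real) \<Rightarrow> (real^'n \<Rightarrow> real) \<Rightarrow> real^'n \<Rightarrow> real" where
  "prob_solution X P r f g x =
     (LINT \<omega>|P x. (LINT t:before_exit X r \<omega>|lborel. f (X t \<omega>)))
     + (LINT \<omega>|P x. (if exit_time X r \<omega> < \<infinity>
                      then g (X (real_of_ereal (exit_time X r \<omega>)) \<omega>) else 0))"

end

theory Submission
  imports Defs
begin

text \<open>Suppose \<open>L\<phi> + f \<le> -c < 0\<close> almost everywhere near \<open>x0\<close>, and let \<open>\<rho>\<close> be the minimum of \<open>1\<close> and
  the exit time from a small ball around \<open>x0\<close>. The process is not assumed strong Markov, but \<open>\<rho>\<close> is
  approximated from above by times in finite grids, to which the simple Markov property applies.
  Together with the local maximum and the continuity of \<open>\<phi>\<close> (no continuity of \<open>u\<close> is needed)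
  this yields \<open>\<phi>(x0) \<le> E(\<integral>\<^sub>0\<^sup>\<rho> f(X\<^sub>t) dt + \<phi>(X\<^sub>\<rho>))\<close>. Dynkin's formula for mollifications \<open>\<phi>\<^sub>n\<close>
  of \<open>\<phi>\<close>, obtained by the same discretization, then bounds \<open>c E \<rho>\<close> by the limit of
  \<open>E \<integral>\<^sub>0\<^sup>\<rho> (L\<phi>\<^sub>n + f + c)\<^sup>+(X\<^sub>t) dt\<close>. The exit estimate with exponent \<open>d0\<close> bounds this integral by the
  \<open>L\<^sub>p\<close>-norm of \<open>L(\<phi>\<^sub>n - \<phi>)\<close> for \<open>p = d0\<close>, which tends to zero: in the drift term \<open>b\<close> lies in \<open>L\<^sub>d\<close>,
  and the gradients converge in \<open>L\<^sub>q\<close> for the Sobolev exponent \<open>q = d d0 / (d - d0)\<close>. But \<open>E \<rho> > 0\<close>.\<close>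

section \<open>The Markov property on path space\<close>

text \<open>The obstacle: the maximum of \<open>u - \<phi>\<close> speaks of \<open>u\<close>, of
  which no regularity is known, while the equation speaks of \<open>\<phi>\<close>, whose second
  derivatives exist only almost everywhere. So limits are never taken in \<open>u\<close>: the
  Markov property at a fixed time trades the remaining payoff for \<open>u (X t)\<close>, the
  maximum trades \<open>u\<close> for \<open>\<phi>\<close>, and only then does the grid become
  finer. Stopping at time 1 keeps each grid finite. Inequalities that hold almost everywhere can be
  used along paths because the exit estimate bounds the occupation measure by an \<open>L_p\<close>
  norm; it is assumed for the starting point 0 and moved to \<open>x0\<close> by translating process
  and coefficients. The function \<open>f\<close> is never approximated: where
  \<open>L\<phi> + f + c \<le> 0\<close>, the positive part of \<open>L\<phi>_n + f + c\<close> is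
  at most \<open>|L\<phi>_n - L\<phi>|\<close>. The exponent \<open>q\<close> satisfies
  \<open>1/d0 = 1/d + 1/q\<close>, so a gradient in \<open>L_q\<close> times a drift in
  \<open>L_d\<close> lies in \<open>L_d0\<close>. The Sobolev inequality asks for
  \<open>1 < d0 < d\<close>. The lower bound follows from \<open>d0 > d/2\<close> when
  \<open>d \<ge> 2\<close>; in dimension one the exit estimate is contradictory.\<close>

lemma kernel_nn_integral:
  fixes h :: "'z \<Rightarrow> ennreal"
  assumes K: "\<And>y. subalgebra (K y) N"
    and meas: "\<And>A. A \<in> sets N \<Longrightarrow> (\<lambda>y. emeasure (K y) A) \<in> borel_measurable L"
    and T[measurable]: "\<Theta> \<in> measurable Q N" and Y[measurable]: "Y \<in> measurable Q L"
    and B[measurable]: "B \<in> sets Q"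
    and eq: "\<And>A. A \<in> sets N \<Longrightarrow>
      emeasure Q (B \<inter> (\<Theta> -` A \<inter> space Q)) = (\<integral>\<^sup>+\<omega>. indicator B \<omega> * emeasure (K (Y \<omega>)) A \<partial>Q)"
    and h: "h \<in> borel_measurable N"
  shows "(\<lambda>y. \<integral>\<^sup>+z. h z \<partial>K y) \<in> borel_measurable L
    \<and> (\<integral>\<^sup>+\<omega>. indicator B \<omega> * h (\<Theta> \<omega>) \<partial>Q) = (\<integral>\<^sup>+\<omega>. indicator B \<omega> * (\<integral>\<^sup>+z. h z \<partial>K (Y \<omega>)) \<partial>Q)"
  \<comment> \<open>Functional monotone class argument: \<open>B\<close> is an event of the past,
    \<open>Y\<close> the present state and \<open>\<Theta>\<close> the future. Measurability of the
    kernel integral is carried along in the induction because each step integrates it again on the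
    right-hand side.\<close>
  using h
proof (induction rule: borel_measurable_induct)
  case (cong f g)
  have sp: "space N = space (K y)" for y using K[of y] by (simp add: subalgebra_def)
  have 1: "(\<integral>\<^sup>+z. f z \<partial>K y) = (\<integral>\<^sup>+z. g z \<partial>K y)" for y
    using cong(3) by (intro nn_integral_cong) (simp add: sp[of y])
  have "\<omega> \<in> space Q \<Longrightarrow> f (\<Theta> \<omega>) = g (\<Theta> \<omega>)" for \<omega>
    using cong(3) measurable_space[OF T] by auto
  then have "(\<integral>\<^sup>+\<omega>. indicator B \<omega> * f (\<Theta> \<omega>) \<partial>Q) = (\<integral>\<^sup>+\<omega>. indicator B \<omega> * g (\<Theta> \<omega>) \<partial>Q)"
    by (intro nn_integral_cong) simp
  with cong(4) show ?case unfolding 1 by simp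
next
  case (set A)
  have sub: "A \<in> sets (K y)" for y using K[of y] set by (auto simp: subalgebra_def)
  have "(\<integral>\<^sup>+\<omega>. indicator B \<omega> * indicator A (\<Theta> \<omega>) \<partial>Q)
      = (\<integral>\<^sup>+\<omega>. indicator (B \<inter> (\<Theta> -` A \<inter> space Q)) \<omega> \<partial>Q)"
    by (intro nn_integral_cong) (auto simp: indicator_def)
  also have "\<dots> = emeasure Q (B \<inter> (\<Theta> -` A \<inter> space Q))"
    using set by (intro nn_integral_indicator) (auto intro!: sets.Int measurable_sets[OF T])
  finally show ?case using meas[OF set] eq[OF set] by (simp add: sub)
next
  case (mult u c)
  note mult(2)[measurable]
  have m: "u \<in> borel_measurable (K y)" for y
    using measurable_from_subalg[OF K] mult by blast
  have um[measurable]: "(\<lambda>y. \<integral>\<^sup>+z. u z \<partial>K y) \<in> borel_measurable L" using mult by blast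
  have "(\<integral>\<^sup>+\<omega>. indicator B \<omega> * (c * u (\<Theta> \<omega>)) \<partial>Q) = (\<integral>\<^sup>+\<omega>. c * (indicator B \<omega> * u (\<Theta> \<omega>)) \<partial>Q)"
    by (simp add: ac_simps)
  also have "\<dots> = c * (\<integral>\<^sup>+\<omega>. indicator B \<omega> * u (\<Theta> \<omega>) \<partial>Q)"
    by (intro nn_integral_cmult) measurable
  also have "\<dots> = c * (\<integral>\<^sup>+\<omega>. indicator B \<omega> * (\<integral>\<^sup>+z. u z \<partial>K (Y \<omega>)) \<partial>Q)"
    using mult by simp
  also have "\<dots> = (\<integral>\<^sup>+\<omega>. c * (indicator B \<omega> * (\<integral>\<^sup>+z. u z \<partial>K (Y \<omega>))) \<partial>Q)"
    by (intro nn_integral_cmult[symmetric]) measurable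
  finally show ?case
    using um by (simp add: nn_integral_cmult m ac_simps)
next
  case (add u v)
  have m: "u \<in> borel_measurable (K y)" "v \<in> borel_measurable (K y)" for y
    using measurable_from_subalg[OF K] add by blast+
  have um[measurable]: "(\<lambda>y. \<integral>\<^sup>+z. u z \<partial>K y) \<in> borel_measurable L"
    "(\<lambda>y. \<integral>\<^sup>+z. v z \<partial>K y) \<in> borel_measurable L" using add by blast+
  note add(1,3)[measurable]
  show ?case
    using add um by (simp add: nn_integral_add m distrib_left)
next
  case (seq U)
  have m: "U i \<in> borel_measurable (K y)" for i y
    using measurable_from_subalg[OF K] seq by blast
  note seq(1)[measurable]
  have um[measurable]: "(\<lambda>y. \<integral>\<^sup>+z. U i z \<partial>K y) \<in> borel_measurable L" for i using seq by blast
  have sup: "(SUP i. U i) x = (SUP i. U i x)" for x by (simp add: image_comp)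
  have 1: "(\<integral>\<^sup>+z. (SUP i. U i) z \<partial>K y) = (SUP i. \<integral>\<^sup>+z. U i z \<partial>K y)" for y
    unfolding sup by (rule nn_integral_monotone_convergence_SUP[OF seq(3) m])
  have "(\<integral>\<^sup>+\<omega>. indicator B \<omega> * (SUP i. U i) (\<Theta> \<omega>) \<partial>Q)
     = (\<integral>\<^sup>+\<omega>. (SUP i. indicator B \<omega> * U i (\<Theta> \<omega>)) \<partial>Q)"
    unfolding sup by (simp add: SUP_mult_left_ennreal)
  also have "\<dots> = (SUP i. \<integral>\<^sup>+\<omega>. indicator B \<omega> * U i (\<Theta> \<omega>) \<partial>Q)"
    using seq(3) by (intro nn_integral_monotone_convergence_SUP)
      (auto simp: incseq_def le_fun_def intro!: mult_left_mono)
  also have "\<dots> = (SUP i. \<integral>\<^sup>+\<omega>. indicator B \<omega> * (\<integral>\<^sup>+z. U i z \<partial>K (Y \<omega>)) \<partial>Q)"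
    using seq by simp
  also have "\<dots> = (\<integral>\<^sup>+\<omega>. (SUP i. indicator B \<omega> * (\<integral>\<^sup>+z. U i z \<partial>K (Y \<omega>))) \<partial>Q)"
    using seq(3) by (intro nn_integral_monotone_convergence_SUP[symmetric])
      (auto simp: incseq_def le_fun_def intro!: mult_left_mono nn_integral_mono)
  finally show ?case
    unfolding 1 by (auto simp: SUP_mult_left_ennreal)
qed

section \<open>Basic measurability and the Markov property at a single later time\<close>

context continuous_markov_process
begin

lemma space_P[simp]: "space (P x) = space M"
  using sets_P sets_eq_imp_space_eq by blast

lemma space_F: "0 \<le> t \<Longrightarrow> space (F t) = space M"
  using subalg by (auto simp: subalgebra_def)

lemma sets_F: "0 \<le> t \<Longrightarrow> A \<in> sets (F t) \<Longrightarrow> A \<in> sets (P x)"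
  using subalg by (auto simp: subalgebra_def sets_P)

lemma subalgebra_P: "0 \<le> t \<Longrightarrow> subalgebra (P x) (F t)"
  using subalg by (auto simp: subalgebra_def sets_P)

lemma X_F: "0 \<le> s \<Longrightarrow> s \<le> t \<Longrightarrow> X s \<in> borel_measurable (F t)"
  using adapted[of s] filtr[of s t] space_F[of s] space_F[of t]
  by (auto simp: measurable_def)

lemma X_P: "0 \<le> s \<Longrightarrow> X s \<in> borel_measurable (P x)"
  using X_F[of s s] measurable_from_subalg[OF subalgebra_P] by blast

lemma X_sets: "0 \<le> t \<Longrightarrow> \<Gamma> \<in> sets borel \<Longrightarrow> {\<omega> \<in> space M. X t \<omega> \<in> \<Gamma>} \<in> sets (P x)"
  using measurable_sets[OF X_P, of t \<Gamma> x] by (auto simp: vimage_def Int_def conj_commute)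

lemma finite_P: "finite_measure (P x)"
  using prob prob_space_def by blast

lemma transition_emeasure: "0 \<le> t \<Longrightarrow> \<Gamma> \<in> sets borel \<Longrightarrow>
    (\<lambda>x. emeasure (P x) {\<omega> \<in> space M. X t \<omega> \<in> \<Gamma>}) \<in> borel_measurable borel"
  using transition_measurable[of t \<Gamma>]
  by (simp add: finite_measure.emeasure_eq_measure[OF finite_P])

text \<open>Integrating the conditional expectation in \<open>markov\<close> over a past event
  \<open>A\<close> leaves an identity between measures, to which monotone class arguments
  apply.\<close>

lemma markov_emeasure:
  assumes t: "0 \<le> t" and s: "0 \<le> s" and G: "\<Gamma> \<in> sets borel" and A: "A \<in> sets (F t)"
  shows "emeasure (P x) (A \<inter> {\<omega> \<in> space M. X (t + s) \<omega> \<in> \<Gamma>})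
    = (\<integral>\<^sup>+\<omega>. indicator A \<omega> * emeasure (P (X t \<omega>)) {\<omega>' \<in> space M. X s \<omega>' \<in> \<Gamma>} \<partial>P x)"
proof -
  interpret prob_space "P x" by (rule prob)
  interpret S: finite_measure_subalgebra "P x" "F t"
    by unfold_locales (rule subalgebra_P[OF t])
  have Am[measurable]: "A \<in> sets (P x)" using sets_F t A by blast
  let ?q = "\<lambda>\<omega>. measure (P (X t \<omega>)) {\<omega>' \<in> space M. X s \<omega>' \<in> \<Gamma>}"
  have qm: "?q \<in> borel_measurable (P x)"
    using measurable_compose[OF X_P[OF t] transition_measurable[OF s G]] .
  have Xm: "{\<omega> \<in> space M. X (t + s) \<omega> \<in> \<Gamma>} \<in> sets (P x)" using X_sets G t s by auto
  have im: "(\<lambda>\<omega>'. indicator \<Gamma> (X (t + s) \<omega>') :: real) \<in> borel_measurable (P x)"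
    by (rule measurable_compose[OF X_P borel_measurable_indicator[OF G]]) (use t s in simp)
  have int: "integrable (P x) (\<lambda>\<omega>'. indicator \<Gamma> (X (t + s) \<omega>') :: real)"
    by (rule integrable_const_bound[where B=1, OF _ im]) (auto simp: indicator_def)
  have "measure (P x) (A \<inter> {\<omega> \<in> space M. X (t + s) \<omega> \<in> \<Gamma>})
    = (\<integral>\<omega>. indicator (A \<inter> {\<omega> \<in> space M. X (t + s) \<omega> \<in> \<Gamma>}) \<omega> \<partial>P x)"
    using Xm by (simp, intro arg_cong[where f=prob]) auto
  also have "\<dots> = (LINT \<omega>:A|P x. indicator \<Gamma> (X (t + s) \<omega>))"
    unfolding set_lebesgue_integral_def
    by (intro Bochner_Integration.integral_cong) (auto simp: indicator_def)
  also have "\<dots> = (LINT \<omega>:A|P x. real_cond_exp (P x) (F t) (\<lambda>\<omega>'. indicator \<Gamma> (X (t + s) \<omega>')) \<omega>)"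
    by (rule S.real_cond_exp_intA[OF int A])
  also have "\<dots> = (LINT \<omega>:A|P x. ?q \<omega>)"
    using markov[OF t s G, of x] Am qm
    by (intro set_lebesgue_integral_cong_AE) auto
  finally have 1: "measure (P x) (A \<inter> {\<omega> \<in> space M. X (t + s) \<omega> \<in> \<Gamma>}) = (\<integral>\<omega>. indicator A \<omega> * ?q \<omega> \<partial>P x)"
    by (simp add: set_lebesgue_integral_def)
  have "integrable (P x) (\<lambda>\<omega>. indicator A \<omega> * ?q \<omega>)"
    using qm prob_space.prob_le_1[OF prob]
    by (intro integrable_const_bound[where B=1]) (auto simp: indicator_def)
  then have "(\<integral>\<^sup>+\<omega>. ennreal (indicator A \<omega> * ?q \<omega>) \<partial>P x) = ennreal (\<integral>\<omega>. indicator A \<omega> * ?q \<omega> \<partial>P x)"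
    by (intro nn_integral_eq_integral) auto
  with 1 show ?thesis
    by (simp add: emeasure_eq_measure ennreal_mult' finite_measure.emeasure_eq_measure[OF finite_P] ennreal_indicator)
qed

text \<open>Instance of \<open>kernel_nn_integral\<close> on the state space, with the law of
  \<open>X s\<close> under \<open>P y\<close>, that is, the transition function, as kernel.\<close>

lemma markov_state:
  assumes t: "0 \<le> t" and s: "0 \<le> s" and A: "A \<in> sets (F t)" and h: "h \<in> borel_measurable borel"
  shows "(\<lambda>y. \<integral>\<^sup>+\<omega>. h (X s \<omega>) \<partial>P y) \<in> borel_measurable borel"
    and "(\<integral>\<^sup>+\<omega>. indicator A \<omega> * h (X (t + s) \<omega>) \<partial>P x)
       = (\<integral>\<^sup>+\<omega>. indicator A \<omega> * (\<integral>\<^sup>+\<omega>'. h (X s \<omega>') \<partial>P (X t \<omega>)) \<partial>P x)"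
proof -
  have eq: "X s -` B \<inter> space M = {\<omega> \<in> space M. X s \<omega> \<in> B}" for s B by auto
  have em: "emeasure (distr (P y) borel (X s)) B = emeasure (P y) {\<omega> \<in> space M. X s \<omega> \<in> B}"
    if "B \<in> sets borel" for y B
    using that by (subst emeasure_distr) (auto simp: X_P s eq)
  have "(\<lambda>y. \<integral>\<^sup>+z. h z \<partial>distr (P y) borel (X s)) \<in> borel_measurable borel
    \<and> (\<integral>\<^sup>+\<omega>. indicator A \<omega> * h (X (t + s) \<omega>) \<partial>P x)
      = (\<integral>\<^sup>+\<omega>. indicator A \<omega> * (\<integral>\<^sup>+z. h z \<partial>distr (P (X t \<omega>)) borel (X s)) \<partial>P x)"
    using t s sets_F[OF t A] h
    by (intro kernel_nn_integral[where N=borel])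
      (auto simp: subalgebra_def X_P em transition_emeasure markov_emeasure[OF t s _ A] eq)
  then show "(\<lambda>y. \<integral>\<^sup>+\<omega>. h (X s \<omega>) \<partial>P y) \<in> borel_measurable borel"
    "(\<integral>\<^sup>+\<omega>. indicator A \<omega> * h (X (t + s) \<omega>) \<partial>P x)
       = (\<integral>\<^sup>+\<omega>. indicator A \<omega> * (\<integral>\<^sup>+\<omega>'. h (X s \<omega>') \<partial>P (X t \<omega>)) \<partial>P x)"
    using h s by (simp_all add: nn_integral_distr X_P)
qed

text \<open>The sigma-algebra of \<open>M\<close> may contain events about which the axioms say
  nothing: \<open>P y C\<close> need not be measurable in \<open>y\<close> for them, and
  \<open>theta\<close> need not respect them. Functionals of the future are therefore taken
  measurable with respect to the events generated by the path alone.\<close>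

definition path_alg :: "'w measure" where
  "path_alg = sigma (space M) {X t -` A \<inter> space M | t A. 0 \<le> t \<and> A \<in> sets borel}"

lemma space_path_alg[simp]: "space path_alg = space M"
  by (simp add: path_alg_def space_measure_of_conv)

lemma X_path[measurable]: "0 \<le> t \<Longrightarrow> X t \<in> borel_measurable path_alg"
  unfolding path_alg_def
  by (rule measurableI) (auto simp: space_measure_of_conv intro!: in_measure_of)

lemma subalgebra_path: "subalgebra (P x) path_alg"
proof -
  have "{X t -` A \<inter> space M | t A. 0 \<le> t \<and> A \<in> sets borel} \<subseteq> sets (P x)"
    using measurable_sets[OF X_P, of _ _ x] by auto
  then have "sets path_alg \<subseteq> sets (P x)"
    unfolding path_alg_def using sets.sigma_sets_subset[of _ "P x"] by (subst sets_measure_of) auto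
  then show ?thesis by (simp add: subalgebra_def)
qed

lemma path_P: "Z \<in> borel_measurable path_alg \<Longrightarrow> Z \<in> borel_measurable (P x)"
  using measurable_from_subalg[OF subalgebra_path] .

text \<open>The axiom \<open>shift\<close> provides some point with the shifted path, and any choice
  will do: two choices have the same path, so no event of \<open>path_alg\<close> distinguishes
  them.\<close>

definition theta :: "real \<Rightarrow> 'w \<Rightarrow> 'w" where
  "theta t \<omega> = (SOME \<omega>'. \<omega>' \<in> space M \<and> (\<forall>s\<ge>0. X s \<omega>' = X (t + s) \<omega>))"

lemma theta:
  assumes "0 \<le> t" "\<omega> \<in> space M"
  shows "theta t \<omega> \<in> space M" "0 \<le> s \<Longrightarrow> X s (theta t \<omega>) = X (t + s) \<omega>"
proof -
  have "\<exists>\<omega>'. \<omega>' \<in> space M \<and> (\<forall>s\<ge>0. X s \<omega>' = X (t + s) \<omega>)" using shift[OF assms] by blast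
  from someI_ex[OF this] show "theta t \<omega> \<in> space M" "0 \<le> s \<Longrightarrow> X s (theta t \<omega>) = X (t + s) \<omega>"
    by (auto simp: theta_def)
qed

text \<open>It suffices to look at the generators, and the preimage of an event at time
  \<open>s\<close> is the same event at time \<open>t + s\<close>, whatever the choice made in
  \<open>theta\<close>.\<close>

lemma theta_measurable:
  assumes t: "0 \<le> t" shows "theta t \<in> measurable path_alg path_alg"
  unfolding path_alg_def
proof (rule measurable_sigma_sets[OF sets_measure_of])
  fix y assume "y \<in> {X s -` A \<inter> space M |s A. 0 \<le> s \<and> A \<in> sets borel}"
  then obtain s A where sA: "0 \<le> s" "A \<in> sets borel" "y = X s -` A \<inter> space M" by blast
  have "theta t -` y \<inter> space M = X (t + s) -` A \<inter> space path_alg"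
    using theta[OF t] sA by auto
  then show "theta t -` y \<inter> space (sigma (space M) {X t -` A \<inter> space M |t A. 0 \<le> t \<and> A \<in> sets borel})
      \<in> sets (sigma (space M) {X t -` A \<inter> space M |t A. 0 \<le> t \<and> A \<in> sets borel})"
    using measurable_sets[OF X_path, of "t + s" A] sA t by (simp add: path_alg_def space_measure_of_conv)
qed (use theta[OF t] in \<open>auto simp: space_measure_of_conv\<close>)

lemma theta_measurable_P: "0 \<le> t \<Longrightarrow> theta t \<in> measurable (P x) path_alg"
  using measurable_from_subalg[OF subalgebra_path theta_measurable] .

text \<open>The induction adds times at the front: the condition at the earliest time
  \<open>q\<close> joins the past event \<open>A\<close>, and the other times are then seen from the
  state at \<open>q\<close>. \<open>r\<close> is the time at which the clock is reset to zero; it is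
  arbitrary in the induction because the hypothesis is used with \<open>q\<close> in the place of
  \<open>r\<close>.\<close>

lemma markov_cylinder:
  assumes J: "finite J" and G: "\<And>s. \<Gamma> s \<in> sets borel"
  shows "0 \<le> r \<Longrightarrow> (\<And>s. s \<in> J \<Longrightarrow> r \<le> s) \<Longrightarrow>
    (\<lambda>y. emeasure (P y) {\<omega> \<in> space M. \<forall>s\<in>J. X (s - r) \<omega> \<in> \<Gamma> s}) \<in> borel_measurable borel \<and>
    (\<forall>t x A. 0 \<le> t \<longrightarrow> A \<in> sets (F t) \<longrightarrow>
      emeasure (P x) (A \<inter> {\<omega> \<in> space M. \<forall>s\<in>J. X (t + (s - r)) \<omega> \<in> \<Gamma> s})
      = (\<integral>\<^sup>+\<omega>. indicator A \<omega> * emeasure (P (X t \<omega>)) {\<omega>' \<in> space M. \<forall>s\<in>J. X (s - r) \<omega>' \<in> \<Gamma> s} \<partial>P x))"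
  using J
proof (induction J arbitrary: r rule: finite_linorder_min_induct)
  case empty
  have "emeasure (P y) (space M) = 1" for y
    using prob_space.emeasure_space_1[OF prob, of y] by simp
  moreover have "A \<inter> space M = A" if "0 \<le> t" "A \<in> sets (F t)" for A t
    using that sets.sets_into_space[of A "F t"] space_F[of t] by auto
  ultimately show ?case by (auto intro!: nn_integral_indicator[symmetric] sets_F)
next
  case (insert q J)
  have rq: "r \<le> q" "0 \<le> q" using insert.prems(2)[of q] insert.prems(1) by simp_all
  define k where "k y = emeasure (P y) {\<omega> \<in> space M. \<forall>s\<in>J. X (s - q) \<omega> \<in> \<Gamma> s}" for y
  have IH: "k \<in> borel_measurable borel"
    "\<And>t x A. 0 \<le> t \<Longrightarrow> A \<in> sets (F t) \<Longrightarrow>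
      emeasure (P x) (A \<inter> {\<omega> \<in> space M. \<forall>s\<in>J. X (t + (s - q)) \<omega> \<in> \<Gamma> s})
      = (\<integral>\<^sup>+\<omega>. indicator A \<omega> * k (X t \<omega>) \<partial>P x)"
    using insert(3)[OF rq(2)] insert(2) less_imp_le unfolding k_def by blast+
  have km: "(\<lambda>y. indicator (\<Gamma> q) y * k y) \<in> borel_measurable borel"
    using IH(1) G by measurable
  have key: "emeasure (P x) (A \<inter> {\<omega> \<in> space M. \<forall>s\<in>insert q J. X (t + (s - r)) \<omega> \<in> \<Gamma> s})
     = (\<integral>\<^sup>+\<omega>. indicator A \<omega> * (indicator (\<Gamma> q) (X (t + (q - r)) \<omega>) * k (X (t + (q - r)) \<omega>)) \<partial>P x)"
    if t: "0 \<le> t" and A: "A \<in> sets (F t)" for A t x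
  proof -
    let ?t = "t + (q - r)"
    have tt: "0 \<le> ?t" using t rq by simp
    have A': "A \<inter> {\<omega> \<in> space M. X ?t \<omega> \<in> \<Gamma> q} \<in> sets (F ?t)"
    proof (rule sets.Int)
      show "A \<in> sets (F ?t)" using filtr[of t ?t] t A rq by auto
      show "{\<omega> \<in> space M. X ?t \<omega> \<in> \<Gamma> q} \<in> sets (F ?t)"
        using measurable_sets[OF adapted[OF tt] G[of q]] space_F[OF tt]
        by (simp add: vimage_def Int_def conj_commute)
    qed
    have "A \<inter> {\<omega> \<in> space M. \<forall>s\<in>insert q J. X (t + (s - r)) \<omega> \<in> \<Gamma> s}
      = (A \<inter> {\<omega> \<in> space M. X ?t \<omega> \<in> \<Gamma> q}) \<inter> {\<omega> \<in> space M. \<forall>s\<in>J. X (?t + (s - q)) \<omega> \<in> \<Gamma> s}"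
      by (auto simp: algebra_simps)
    then have "emeasure (P x) (A \<inter> {\<omega> \<in> space M. \<forall>s\<in>insert q J. X (t + (s - r)) \<omega> \<in> \<Gamma> s})
      = (\<integral>\<^sup>+\<omega>. indicator (A \<inter> {\<omega> \<in> space M. X ?t \<omega> \<in> \<Gamma> q}) \<omega> * k (X ?t \<omega>) \<partial>P x)"
      using IH(2)[OF tt A'] by simp
    also have "\<dots> = (\<integral>\<^sup>+\<omega>. indicator A \<omega> * (indicator (\<Gamma> q) (X ?t \<omega>) * k (X ?t \<omega>)) \<partial>P x)"
      by (intro nn_integral_cong) (auto simp: indicator_def)
    finally show ?thesis .
  qed
  have qr: "0 \<le> q - r" using rq by simp
  \<comment> \<open>The case \<open>t = 0\<close> with the whole space as past event writes the
    cylinder probability as the mean of a function of one state. \<open>markov_state\<close> then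
    gives its measurability in \<open>y\<close> and the Markov identity for it.\<close>
  have k1: "emeasure (P y) {\<omega> \<in> space M. \<forall>s\<in>insert q J. X (s - r) \<omega> \<in> \<Gamma> s}
    = (\<integral>\<^sup>+\<omega>. indicator (\<Gamma> q) (X (q - r) \<omega>) * k (X (q - r) \<omega>) \<partial>P y)" for y
  proof -
    have "space M \<in> sets (F 0)" using space_F[of 0] sets.top[of "F 0"] by simp
    from key[of 0 "space M" y, OF _ this] show ?thesis
      by (simp add: Int_def) (rule nn_integral_cong, simp)
  qed
  show ?case
    unfolding k1 using markov_state[OF _ qr _ km] key
    by (metis (no_types, lifting) order.refl sets.top)
qed

text \<open>Cylinders over finitely many times are closed under intersection and generate
  \<open>path_alg\<close>, so the pi-lambda theorem applies. Both claims are proved together because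
  the identity integrates \<open>emeasure (P y) C\<close> as a function of \<open>y\<close>.\<close>

lemma markov_path_sets:
  assumes "C \<in> sets path_alg"
  shows "(\<lambda>y. emeasure (P y) C) \<in> borel_measurable borel \<and>
    (\<forall>t x A. 0 \<le> t \<longrightarrow> A \<in> sets (F t) \<longrightarrow>
      emeasure (P x) (A \<inter> (theta t -` C \<inter> space M))
      = (\<integral>\<^sup>+\<omega>. indicator A \<omega> * emeasure (P (X t \<omega>)) C \<partial>P x))"
proof -
  define G where "G = {{\<omega> \<in> space M. \<forall>s\<in>J. X s \<omega> \<in> \<Gamma> s} | J \<Gamma>. finite J \<and> J \<subseteq> {0..} \<and> (\<forall>s. \<Gamma> s \<in> sets (borel :: (real^'n) measure))}"
  have Gsub: "G \<subseteq> Pow (space M)" by (auto simp: G_def)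
  have Gpath: "G \<subseteq> sets path_alg"
  proof
    fix g assume "g \<in> G"
    then obtain J \<Gamma> where g: "g = {\<omega> \<in> space M. \<forall>s\<in>J. X s \<omega> \<in> \<Gamma> s}" "finite J" "J \<subseteq> {0..}" "\<forall>s. \<Gamma> s \<in> sets (borel :: (real^'n) measure)"
      unfolding G_def by blast
    have "{\<omega> \<in> space path_alg. \<forall>s\<in>J. X s \<omega> \<in> \<Gamma> s} \<in> sets path_alg"
    proof (rule sets.sets_Collect_finite_All[OF _ g(2)])
      fix s assume "s \<in> J"
      then have "X s -` \<Gamma> s \<inter> space path_alg \<in> sets path_alg"
        using g by (intro measurable_sets[OF X_path]) auto
      then show "{\<omega> \<in> space path_alg. X s \<omega> \<in> \<Gamma> s} \<in> sets path_alg"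
        by (simp add: vimage_def Int_def conj_commute)
    qed
    then show "g \<in> sets path_alg" using g by simp
  qed
  have istab: "Int_stable G"
  proof (rule Int_stableI)
    fix a b assume "a \<in> G" "b \<in> G"
    then obtain J \<Gamma> J' \<Gamma>' where a: "a = {\<omega> \<in> space M. \<forall>s\<in>J. X s \<omega> \<in> \<Gamma> s}" "finite J" "J \<subseteq> {0..}" "\<forall>s. \<Gamma> s \<in> sets (borel :: (real^'n) measure)"
      and b: "b = {\<omega> \<in> space M. \<forall>s\<in>J'. X s \<omega> \<in> \<Gamma>' s}" "finite J'" "J' \<subseteq> {0..}" "\<forall>s. \<Gamma>' s \<in> sets (borel :: (real^'n) measure)"
      unfolding G_def by blast
    \<comment> \<open>A time that occurs in only one of the two index sets gets the trivial
      condition \<open>UNIV\<close> from the other.\<close>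
    let ?H = "\<lambda>s. (if s \<in> J then \<Gamma> s else UNIV) \<inter> (if s \<in> J' then \<Gamma>' s else UNIV)"
    have "a \<inter> b = {\<omega> \<in> space M. \<forall>s\<in>J \<union> J'. X s \<omega> \<in> ?H s}"
      unfolding a b by auto
    moreover have "finite (J \<union> J')" "J \<union> J' \<subseteq> {0..}" "\<forall>s. ?H s \<in> sets borel" using a b by auto
    ultimately show "a \<inter> b \<in> G"
      unfolding G_def by (intro CollectI exI[of _ "J \<union> J'"] exI[of _ ?H]) simp
  qed
  have sp: "sets path_alg = sigma_sets (space M) G"
  proof
    have "{X t -` A \<inter> space M | t A. 0 \<le> t \<and> A \<in> sets borel} \<subseteq> G"
    proof
      fix z assume "z \<in> {X t -` A \<inter> space M | t A. 0 \<le> t \<and> A \<in> sets borel}"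
      then obtain t A where "0 \<le> t" "A \<in> sets borel" "z = X t -` A \<inter> space M" by blast
      then show "z \<in> G" unfolding G_def by (intro CollectI exI[of _ "{t}"] exI[of _ "\<lambda>_. A"]) auto
    qed
    then show "sets path_alg \<subseteq> sigma_sets (space M) G"
      unfolding path_alg_def by (subst sets_measure_of) (auto intro!: sigma_sets_mono')
    show "sigma_sets (space M) G \<subseteq> sets path_alg"
      using sets.sigma_sets_subset[OF Gpath] by simp
  qed
  have em1: "emeasure (P y) (space M) = 1" for y
    using prob_space.emeasure_space_1[OF prob, of y] by simp
  have subP: "C \<in> sets (P y)" if "C \<in> sigma_sets (space M) G" for C y
    using that sp subalgebra_path[of y] by (auto simp: subalgebra_def)
  have subT: "A \<inter> (theta t -` C \<inter> space M) \<in> sets (P x)"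
    if "C \<in> sigma_sets (space M) G" "0 \<le> t" "A \<in> sets (F t)" for C t A x
    using measurable_sets[OF theta_measurable_P[of t x], of C] sets_F[of t A x] that sp by auto
  show ?thesis
    using istab Gsub assms[unfolded sp]
  proof (induction rule: sigma_sets_induct_disjoint)
    case (basic C)
    then obtain J \<Gamma> where C: "C = {\<omega> \<in> space M. \<forall>s\<in>J. X s \<omega> \<in> \<Gamma> s}" "finite J" "J \<subseteq> {0..}" "\<forall>s. \<Gamma> s \<in> sets (borel :: (real^'n) measure)"
      unfolding G_def by blast
    have "theta t -` C \<inter> space M = {\<omega> \<in> space M. \<forall>s\<in>J. X (t + s) \<omega> \<in> \<Gamma> s}" if "0 \<le> t" for t
      using C(1) theta(1)[OF that] theta(2)[OF that _ subsetD[OF C(3), simplified]] by auto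
    with markov_cylinder[of J \<Gamma> 0] C show ?case by auto
  next
    case empty
    then show ?case by simp
  next
    case (compl C)
    have e: "emeasure (P y) (space M - C) = 1 - emeasure (P y) C" for y
      using emeasure_compl[of C "P y"] subP[OF compl(1)] finite_measure.emeasure_finite[OF finite_P]
        em1 by simp
    have "emeasure (P x) (A \<inter> (theta t -` (space M - C) \<inter> space M))
        = (\<integral>\<^sup>+\<omega>. indicator A \<omega> * (1 - emeasure (P (X t \<omega>)) C) \<partial>P x)"
      if t: "0 \<le> t" and A: "A \<in> sets (F t)" for t x A
    proof -
      have mc: "(\<lambda>\<omega>. emeasure (P (X t \<omega>)) C) \<in> borel_measurable (P x)"
        using compl(2) measurable_compose[OF X_P[OF t]] by blast
      have AP[measurable]: "A \<in> sets (P x)" using sets_F t A by blast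
      have "A \<inter> (theta t -` (space M - C) \<inter> space M) = A - (A \<inter> (theta t -` C \<inter> space M))"
        using theta(1)[OF t] sets.sets_into_space[OF A] space_F[OF t] by auto
      then have "emeasure (P x) (A \<inter> (theta t -` (space M - C) \<inter> space M))
        = emeasure (P x) A - emeasure (P x) (A \<inter> (theta t -` C \<inter> space M))"
        using subT[OF compl(1) t A, of x] finite_measure.emeasure_finite[OF finite_P] AP
        by (simp add: emeasure_Diff)
      also have "\<dots> = (\<integral>\<^sup>+\<omega>. indicator A \<omega> \<partial>P x) - (\<integral>\<^sup>+\<omega>. indicator A \<omega> * emeasure (P (X t \<omega>)) C \<partial>P x)"
        using compl(2) t A AP by simp
      also have "\<dots> = (\<integral>\<^sup>+\<omega>. indicator A \<omega> - indicator A \<omega> * emeasure (P (X t \<omega>)) C \<partial>P x)"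
      proof (rule nn_integral_diff[symmetric])
        have "(\<integral>\<^sup>+\<omega>. indicator A \<omega> * emeasure (P (X t \<omega>)) C \<partial>P x) = emeasure (P x) (A \<inter> (theta t -` C \<inter> space M))"
          using compl(2) t A by simp
        also have "\<dots> < \<infinity>" using finite_measure.emeasure_finite[OF finite_P] by (simp add: less_top)
        finally show "(\<integral>\<^sup>+\<omega>. indicator A \<omega> * emeasure (P (X t \<omega>)) C \<partial>P x) \<noteq> \<infinity>" by simp
        show "AE \<omega> in P x. indicator A \<omega> * emeasure (P (X t \<omega>)) C \<le> indicator A \<omega>"
          using prob_space.emeasure_le_1[OF prob] by (auto simp: indicator_def)
      qed (use mc in measurable)
      also have "\<dots> = (\<integral>\<^sup>+\<omega>. indicator A \<omega> * (1 - emeasure (P (X t \<omega>)) C) \<partial>P x)"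
        by (intro nn_integral_cong) (auto simp: indicator_def)
      finally show ?thesis .
    qed
    then show ?case unfolding e using compl(2) by auto
  next
    case (union C)
    have Cm: "C i \<in> sigma_sets (space M) G" for i using union(2) by auto
    have e: "emeasure (P y) (\<Union>i. C i) = (\<Sum>i. emeasure (P y) (C i))" for y
      using union(1) subP[OF Cm] by (intro suminf_emeasure[symmetric]) auto
    have "emeasure (P x) (A \<inter> (theta t -` (\<Union>i. C i) \<inter> space M))
        = (\<integral>\<^sup>+\<omega>. indicator A \<omega> * (\<Sum>i. emeasure (P (X t \<omega>)) (C i)) \<partial>P x)"
      if t: "0 \<le> t" and A: "A \<in> sets (F t)" for t x A
    proof -
      have mc[measurable]: "(\<lambda>\<omega>. emeasure (P (X t \<omega>)) (C i)) \<in> borel_measurable (P x)" for i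
        using union(3) measurable_compose[OF X_P[OF t]] by blast
      have AP[measurable]: "A \<in> sets (P x)" using sets_F t A by blast
      have "A \<inter> (theta t -` (\<Union>i. C i) \<inter> space M) = (\<Union>i. A \<inter> (theta t -` C i \<inter> space M))" by auto
      then have "emeasure (P x) (A \<inter> (theta t -` (\<Union>i. C i) \<inter> space M))
        = (\<Sum>i. emeasure (P x) (A \<inter> (theta t -` C i \<inter> space M)))"
        using subT[OF Cm t A] union(1)
        by (simp only:, intro suminf_emeasure[symmetric]) (auto simp: disjoint_family_on_def)
      also have "\<dots> = (\<Sum>i. \<integral>\<^sup>+\<omega>. indicator A \<omega> * emeasure (P (X t \<omega>)) (C i) \<partial>P x)"
        using union(3) t A by simp
      also have "\<dots> = (\<integral>\<^sup>+\<omega>. (\<Sum>i. indicator A \<omega> * emeasure (P (X t \<omega>)) (C i)) \<partial>P x)"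
        by (intro nn_integral_suminf[symmetric]) measurable
      finally show ?thesis by simp
    qed
    moreover have "(\<lambda>y. \<Sum>i. emeasure (P y) (C i)) \<in> borel_measurable borel"
      using union(3) by (intro borel_measurable_suminf_order) blast
    ultimately show ?case unfolding e by blast
  qed
qed

lemma markov_path:
  assumes t: "0 \<le> t" and A: "A \<in> sets (F t)" and Z: "Z \<in> borel_measurable path_alg"
  shows "(\<lambda>y. \<integral>\<^sup>+\<omega>. Z \<omega> \<partial>P y) \<in> borel_measurable borel"
    and "(\<integral>\<^sup>+\<omega>. indicator A \<omega> * Z (theta t \<omega>) \<partial>P x)
       = (\<integral>\<^sup>+\<omega>. indicator A \<omega> * (\<integral>\<^sup>+\<omega>'. Z \<omega>' \<partial>P (X t \<omega>)) \<partial>P x)"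
proof -
  have "(\<lambda>y. \<integral>\<^sup>+\<omega>. Z \<omega> \<partial>P y) \<in> borel_measurable borel \<and> (\<integral>\<^sup>+\<omega>. indicator A \<omega> * Z (theta t \<omega>) \<partial>P x)
       = (\<integral>\<^sup>+\<omega>. indicator A \<omega> * (\<integral>\<^sup>+\<omega>'. Z \<omega>' \<partial>P (X t \<omega>)) \<partial>P x)"
    using t A sets_F markov_path_sets Z
    by (intro kernel_nn_integral[where N=path_alg])
      (auto simp: subalgebra_path theta_measurable_P X_P)
  then show "(\<lambda>y. \<integral>\<^sup>+\<omega>. Z \<omega> \<partial>P y) \<in> borel_measurable borel"
    "(\<integral>\<^sup>+\<omega>. indicator A \<omega> * Z (theta t \<omega>) \<partial>P x)
       = (\<integral>\<^sup>+\<omega>. indicator A \<omega> * (\<integral>\<^sup>+\<omega>'. Z \<omega>' \<partial>P (X t \<omega>)) \<partial>P x)" by blast+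
qed

text \<open>Reduction to positive and negative parts. Integrability under every \<open>P y\<close>
  matters because the inner integral is a Bochner integral, which is 0 by convention for a function
  that is not integrable; the two parts could not be recombined then.\<close>

lemma markov_integral:
  fixes Z :: "'w \<Rightarrow> real"
  assumes t: "0 \<le> t" and A: "A \<in> sets (F t)" and Z: "Z \<in> borel_measurable path_alg"
    and int: "\<And>y. integrable (P y) Z"
    and intA: "integrable (P x) (\<lambda>\<omega>. indicator A \<omega> * Z (theta t \<omega>))"
  shows "integrable (P x) (\<lambda>\<omega>. indicator A \<omega> * (\<integral>\<omega>'. Z \<omega>' \<partial>P (X t \<omega>)))"
    and "(\<integral>\<omega>. indicator A \<omega> * Z (theta t \<omega>) \<partial>P x)
       = (\<integral>\<omega>. indicator A \<omega> * (\<integral>\<omega>'. Z \<omega>' \<partial>P (X t \<omega>)) \<partial>P x)"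
proof -
  note Z[measurable]
  have AP[measurable]: "A \<in> sets (P x)" using sets_F t A by blast
  have main: "integrable (P x) (\<lambda>\<omega>. indicator A \<omega> * (\<integral>\<omega>'. V \<omega>' \<partial>P (X t \<omega>))) \<and> (\<integral>\<omega>. indicator A \<omega> * V (theta t \<omega>) \<partial>P x)
       = (\<integral>\<omega>. indicator A \<omega> * (\<integral>\<omega>'. V \<omega>' \<partial>P (X t \<omega>)) \<partial>P x)"
    if V[measurable]: "V \<in> borel_measurable path_alg" and V0: "\<And>\<omega>. 0 \<le> V \<omega>" and Vi: "\<And>y. integrable (P y) V"
      and ViA: "integrable (P x) (\<lambda>\<omega>. indicator A \<omega> * V (theta t \<omega>))" for V :: "'w \<Rightarrow> real"
  proof -
    have e: "(\<integral>\<^sup>+\<omega>'. ennreal (V \<omega>') \<partial>P y) = ennreal (\<integral>\<omega>'. V \<omega>' \<partial>P y)" for y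
      using Vi V0 by (intro nn_integral_eq_integral) auto
    have kn: "(\<lambda>y. \<integral>\<^sup>+\<omega>'. ennreal (V \<omega>') \<partial>P y) \<in> borel_measurable borel"
      by (rule markov_path(1)[OF t A]) measurable
    have "(\<lambda>y. enn2real (\<integral>\<^sup>+\<omega>'. ennreal (V \<omega>') \<partial>P y)) \<in> borel_measurable borel" using kn by measurable
    then have km: "(\<lambda>y. \<integral>\<omega>'. V \<omega>' \<partial>P y) \<in> borel_measurable borel"
      unfolding e using V0 by (simp add: integral_nonneg)
    have km': "(\<lambda>\<omega>. \<integral>\<omega>'. V \<omega>' \<partial>P (X t \<omega>)) \<in> borel_measurable (P x)"
      using measurable_compose[OF X_P[OF t] km] .
    have "(\<integral>\<^sup>+\<omega>. ennreal (indicator A \<omega> * (\<integral>\<omega>'. V \<omega>' \<partial>P (X t \<omega>))) \<partial>P x)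
        = (\<integral>\<^sup>+\<omega>. indicator A \<omega> * (\<integral>\<^sup>+\<omega>'. ennreal (V \<omega>') \<partial>P (X t \<omega>)) \<partial>P x)"
      unfolding e by (intro nn_integral_cong) (simp add: indicator_def)
    also have "\<dots> = (\<integral>\<^sup>+\<omega>. indicator A \<omega> * ennreal (V (theta t \<omega>)) \<partial>P x)"
      by (rule markov_path(2)[OF t A, symmetric]) measurable
    also have "\<dots> = (\<integral>\<^sup>+\<omega>. ennreal (indicator A \<omega> * V (theta t \<omega>)) \<partial>P x)"
      by (intro nn_integral_cong) (simp add: indicator_def)
    also have "\<dots> = ennreal (\<integral>\<omega>. indicator A \<omega> * V (theta t \<omega>) \<partial>P x)"
      using ViA V0 by (intro nn_integral_eq_integral) auto
    finally have *: "(\<integral>\<^sup>+\<omega>. ennreal (indicator A \<omega> * (\<integral>\<omega>'. V \<omega>' \<partial>P (X t \<omega>))) \<partial>P x)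
      = ennreal (\<integral>\<omega>. indicator A \<omega> * V (theta t \<omega>) \<partial>P x)" .
    have "has_bochner_integral (P x) (\<lambda>\<omega>. indicator A \<omega> * (\<integral>\<omega>'. V \<omega>' \<partial>P (X t \<omega>)))
       (\<integral>\<omega>. indicator A \<omega> * V (theta t \<omega>) \<partial>P x)"
      using km' V0 by (intro has_bochner_integral_nn_integral[OF _ _ _ *]) auto
    then show ?thesis by (auto simp: has_bochner_integral_iff)
  qed
  let ?p = "\<lambda>\<omega>. max 0 (Z \<omega>)" and ?m = "\<lambda>\<omega>. max 0 (- Z \<omega>)"
  have ip: "integrable (P y) ?p" "integrable (P y) ?m" for y using int[of y] by auto
  have "integrable (P x) (\<lambda>\<omega>. max 0 (indicator A \<omega> * Z (theta t \<omega>)))"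
    "integrable (P x) (\<lambda>\<omega>. max 0 (- (indicator A \<omega> * Z (theta t \<omega>))))" using intA by auto
  moreover have "max 0 (indicator A \<omega> * Z (theta t \<omega>)) = indicator A \<omega> * ?p (theta t \<omega>)"
    "max 0 (- (indicator A \<omega> * Z (theta t \<omega>))) = indicator A \<omega> * ?m (theta t \<omega>)" for \<omega>
    by (simp_all add: indicator_def)
  ultimately have ipA: "integrable (P x) (\<lambda>\<omega>. indicator A \<omega> * ?p (theta t \<omega>))"
    "integrable (P x) (\<lambda>\<omega>. indicator A \<omega> * ?m (theta t \<omega>))" by simp_all
  note mp = main[OF _ _ ip(1) ipA(1)] and mm = main[OF _ _ ip(2) ipA(2)]
  have d: "(\<integral>\<omega>'. Z \<omega>' \<partial>P y) = (\<integral>\<omega>'. ?p \<omega>' \<partial>P y) - (\<integral>\<omega>'. ?m \<omega>' \<partial>P y)" for y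
    by (subst Bochner_Integration.integral_diff[symmetric, OF ip]) (auto intro!: Bochner_Integration.integral_cong)
  have z: "indicator A \<omega> * Z (theta t \<omega>) = indicator A \<omega> * ?p (theta t \<omega>) - indicator A \<omega> * ?m (theta t \<omega>)" for \<omega>
    by (simp add: indicator_def max_def)
  show "integrable (P x) (\<lambda>\<omega>. indicator A \<omega> * (\<integral>\<omega>'. Z \<omega>' \<partial>P (X t \<omega>)))"
    unfolding d right_diff_distrib using mp mm by auto
  show "(\<integral>\<omega>. indicator A \<omega> * Z (theta t \<omega>) \<partial>P x)
       = (\<integral>\<omega>. indicator A \<omega> * (\<integral>\<omega>'. Z \<omega>' \<partial>P (X t \<omega>)) \<partial>P x)"
    unfolding d z right_diff_distrib using mp mm ipA by auto
qed

section \<open>Exit times from balls\<close>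

text \<open>Encoded as the exit of the translated process from a ball about 0, since this is the
  form in which the exit estimate speaks about it once process and coefficients have been
  translated.\<close>

definition exit_from :: "real^'n \<Rightarrow> real \<Rightarrow> 'w \<Rightarrow> ereal" where
  "exit_from c r = exit_time (\<lambda>t \<omega>. X t \<omega> - c) r"

lemma exit_from_0: "exit_from 0 r = exit_time X r"
  by (simp add: exit_from_def)

lemma exit_from_eq: "exit_from c r \<omega> = (INF t\<in>{t. 0 \<le> t \<and> X t \<omega> \<notin> ball c r}. ereal t)"
  unfolding exit_from_def exit_time_def by (simp add: dist_norm norm_minus_commute)

lemma exit_from_nonneg: "0 \<le> exit_from c r \<omega>"
  unfolding exit_from_eq by (rule INF_greatest) auto

lemma exit_from_le: "0 \<le> t \<Longrightarrow> X t \<omega> \<notin> ball c r \<Longrightarrow> exit_from c r \<omega> \<le> ereal t"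
  unfolding exit_from_eq by (rule INF_lower) auto

text \<open>By continuity of the path, the times spent outside the open ball form a closed set, so
  the infimum is a minimum.\<close>

lemma exit_from_attained:
  assumes w: "\<omega> \<in> space M" and fin: "exit_from c r \<omega> < \<infinity>"
  obtains \<tau> where "0 \<le> \<tau>" "exit_from c r \<omega> = ereal \<tau>" "X \<tau> \<omega> \<notin> ball c r"
    "\<And>s. 0 \<le> s \<Longrightarrow> s < \<tau> \<Longrightarrow> X s \<omega> \<in> ball c r"
proof -
  let ?D = "{t. 0 \<le> t \<and> X t \<omega> \<notin> ball c r}"
  have ne: "?D \<noteq> {}"
  proof
    assume "?D = {}"
    then have "exit_from c r \<omega> = \<infinity>" unfolding exit_from_eq by (simp only:) (simp add: top_ereal_def)
    with fin show False by simp
  qed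
  have "closed ({0..} \<inter> (\<lambda>t. X t \<omega>) -` (- ball c r))"
    by (rule continuous_closed_preimage[OF continuous[OF w]]) auto
  also have "{0..} \<inter> (\<lambda>t. X t \<omega>) -` (- ball c r) = ?D" by auto
  finally have cl: "closed ?D" .
  have bd: "bdd_below ?D" by (rule bdd_belowI[of _ 0]) auto
  have inD: "Inf ?D \<in> ?D" by (rule closed_contains_Inf[OF ne bd cl])
  have "exit_from c r \<omega> = ereal (Inf ?D)"
  proof (rule antisym)
    show "exit_from c r \<omega> \<le> ereal (Inf ?D)" using inD by (intro exit_from_le) auto
    show "ereal (Inf ?D) \<le> exit_from c r \<omega>"
      unfolding exit_from_eq using cInf_lower[OF _ bd] by (intro INF_greatest) simp
  qed
  moreover have "X s \<omega> \<in> ball c r" if "0 \<le> s" "s < Inf ?D" for s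
    using cInf_lower[OF _ bd, of s] that by fastforce
  ultimately show ?thesis using inD by (intro that[of "Inf ?D"]) blast+
qed

text \<open>Since the exit time is attained, the condition on the right includes the time
  \<open>t\<close> itself. It involves the path up to \<open>t\<close> only, which puts the event
  into \<open>F t\<close> rather than into a right limit of the filtration.\<close>

lemma exit_from_gt_iff:
  assumes w: "\<omega> \<in> space M" and t: "0 \<le> t"
  shows "ereal t < exit_from c r \<omega> \<longleftrightarrow> (\<forall>s\<in>{0..t}. X s \<omega> \<in> ball c r)"
proof
  assume "ereal t < exit_from c r \<omega>"
  then show "\<forall>s\<in>{0..t}. X s \<omega> \<in> ball c r"
    using exit_from_le[of _ \<omega> c r] by (metis atLeastAtMost_iff ereal_less_eq(3) leD order_trans)
next
  assume A: "\<forall>s\<in>{0..t}. X s \<omega> \<in> ball c r"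
  show "ereal t < exit_from c r \<omega>"
  proof (rule ccontr)
    assume n: "\<not> ereal t < exit_from c r \<omega>"
    then have "exit_from c r \<omega> < \<infinity>" using less_ereal.simps(4) order_le_less_trans linorder_not_less by blast
    with exit_from_attained[OF w] obtain \<tau> where "0 \<le> \<tau>" "exit_from c r \<omega> = ereal \<tau>" "X \<tau> \<omega> \<notin> ball c r"
      by metis
    with A n show False by auto
  qed
qed

text \<open>On \<open>{0..t}\<close> the distance to \<open>c\<close> attains its maximum, so
  staying in the open ball means keeping the distance below \<open>r - 1 / Suc k\<close> for some
  \<open>k\<close>. This closed condition passes from a countable dense set of times to all times,
  which makes the event a countable combination of events at single times.\<close>

lemma ball_event:
  assumes t: "0 \<le> t" and N: "\<And>s. 0 \<le> s \<Longrightarrow> s \<le> t \<Longrightarrow> X s \<in> borel_measurable N" and sp: "space N = space M"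
  shows "{\<omega> \<in> space M. \<forall>s\<in>{0..t}. X s \<omega> \<in> ball c r} \<in> sets N"
proof -
  obtain D where D: "countable D" "D \<subseteq> {0..t}" "{0..t} \<subseteq> closure D" using separable[of "{0..t}"] by metis
  have eq: "(\<forall>s\<in>{0..t}. X s \<omega> \<in> ball c r) \<longleftrightarrow> (\<exists>k::nat. \<forall>s\<in>D. dist c (X s \<omega>) \<le> r - 1 / Suc k)"
    (is "?L \<longleftrightarrow> ?R") if w: "\<omega> \<in> space M" for \<omega>
  proof -
    have cont: "continuous_on {0..t} (\<lambda>s. dist c (X s \<omega>))"
      using continuous[OF w] by (intro continuous_intros) (auto elim: continuous_on_subset)
    have ?R if ?L
    proof -
      obtain m where m: "m \<in> {0..t}" "\<And>s. s \<in> {0..t} \<Longrightarrow> dist c (X s \<omega>) \<le> dist c (X m \<omega>)"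
        using continuous_attains_sup[OF _ _ cont] t by (metis atLeastAtMost_iff compact_Icc empty_iff order_refl)
      then have "0 < r - dist c (X m \<omega>)" using \<open>?L\<close> by auto
      then obtain k where "1 / Suc k < r - dist c (X m \<omega>)" using nat_approx_posE by metis
      then have "dist c (X s \<omega>) \<le> r - 1 / Suc k" if "s \<in> D" for s
        using m(2)[of s] D(2) that by fastforce
      then show ?R by blast
    qed
    moreover have ?L if ?R
    proof -
    from \<open>?R\<close> obtain k where k: "\<forall>s\<in>D. dist c (X s \<omega>) \<le> r - 1 / Suc k" by blast
    have "closed {s \<in> {0..t}. dist c (X s \<omega>) \<le> r - 1 / Suc k}"
      by (intro continuous_on_closed_Collect_le cont continuous_intros) auto
    then have "closure D \<subseteq> {s \<in> {0..t}. dist c (X s \<omega>) \<le> r - 1 / Suc k}"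
      using k D by (intro closure_minimal) auto
    then have "dist c (X s \<omega>) \<le> r - 1 / Suc k" if "s \<in> {0..t}" for s using D(3) that by blast
    moreover have "r - 1 / Suc k < r" by simp
    ultimately show ?L by (meson le_less_trans mem_ball)
    qed
    ultimately show ?thesis by blast
  qed
  have "{\<omega> \<in> space N. \<exists>k::nat. \<forall>s\<in>D. dist c (X s \<omega>) \<le> r - 1 / Suc k} \<in> sets N"
  proof (intro sets.sets_Collect_countable_Ex sets.sets_Collect_countable_All' D(1))
    fix k :: nat and s assume "s \<in> D"
    then have [measurable]: "X s \<in> borel_measurable N" using D N by auto
    show "{\<omega> \<in> space N. dist c (X s \<omega>) \<le> r - 1 / Suc k} \<in> sets N" by measurable
  qed
  moreover have "{\<omega> \<in> space M. \<forall>s\<in>{0..t}. X s \<omega> \<in> ball c r} = {\<omega> \<in> space N. \<exists>k::nat. \<forall>s\<in>D. dist c (X s \<omega>) \<le> r - 1 / Suc k}"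
    using eq sp by auto
  ultimately show ?thesis by simp
qed

lemma ball_event_F: "0 \<le> t \<Longrightarrow> {\<omega> \<in> space M. \<forall>s\<in>{0..t}. X s \<omega> \<in> ball c r} \<in> sets (F t)"
  by (rule ball_event) (auto simp: X_F space_F)

lemma exit_from_measurable[measurable]: "exit_from c r \<in> borel_measurable path_alg"
proof (rule borel_measurableI_greater)
  fix y :: ereal
  consider "y < 0" | "y = \<infinity>" | t where "y = ereal t" "0 \<le> t" by (cases y) (force simp: zero_ereal_def)+
  then show "{\<omega> \<in> space path_alg. y < exit_from c r \<omega>} \<in> sets path_alg"
  proof cases
    case 1
    then have "{\<omega> \<in> space path_alg. y < exit_from c r \<omega>} = space path_alg"
      using exit_from_nonneg[of c r] by (auto intro: less_le_trans)
    then show ?thesis by (simp only: sets.top)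
  next
    case 3
    then have "{\<omega> \<in> space path_alg. y < exit_from c r \<omega>} = {\<omega> \<in> space M. \<forall>s\<in>{0..t}. X s \<omega> \<in> ball c r}"
      using exit_from_gt_iff by auto
    also have "\<dots> \<in> sets path_alg" using 3 by (intro ball_event) auto
    finally show ?thesis .
  qed simp
qed

lemma X_joint[measurable]: "(\<lambda>(\<omega>, s). X (max 0 s) \<omega>) \<in> borel_measurable (path_alg \<Otimes>\<^sub>M borel)"
proof -
  \<comment> \<open>The path is sampled at the last multiple of \<open>1 / Suc n\<close> before
    \<open>s\<close>: sampling takes countably many values, hence is jointly measurable, and
    converges by continuity. \<open>max 0 s\<close> is there because only times
    \<open>s \<ge> 0\<close> are meaningful.\<close>
  define q where "q n s = real (nat \<lfloor>max 0 s * real (Suc n)\<rfloor>) / real (Suc n)" for n and s :: real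
  have qlim: "(\<lambda>n. q n s) \<longlonglongrightarrow> max 0 s" for s
  proof (rule real_tendsto_sandwich)
    have a: "q n s \<le> max 0 s" for n
    proof -
      have "real (nat \<lfloor>max 0 s * real (Suc n)\<rfloor>) \<le> max 0 s * real (Suc n)" by (intro of_nat_floor) simp
      then show ?thesis unfolding q_def by (simp add: field_simps)
    qed
    have b: "max 0 s - 1 / real (Suc n) \<le> q n s" for n
    proof -
      have "max 0 s * real (Suc n) \<le> real (nat \<lfloor>max 0 s * real (Suc n)\<rfloor>) + 1" by linarith
      then have "(max 0 s * real (Suc n) - 1) / real (Suc n) \<le> q n s"
        unfolding q_def by (intro divide_right_mono) auto
      then show ?thesis by (simp add: diff_divide_distrib)
    qed
    show "\<forall>\<^sub>F n in sequentially. q n s \<le> max 0 s" "\<forall>\<^sub>F n in sequentially. max 0 s - 1 / real (Suc n) \<le> q n s"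
      using a b by auto
    show "(\<lambda>n. max 0 s - 1 / real (Suc n)) \<longlonglongrightarrow> max 0 s"
      using tendsto_diff[OF tendsto_const LIMSEQ_inverse_real_of_nat, of "max 0 s"] by (simp add: inverse_eq_divide)
  qed (rule tendsto_const)
  show ?thesis
  proof (rule borel_measurable_LIMSEQ_metric)
    fix n
    have 1: "(\<lambda>p. X (real i / real (Suc n)) (fst p)) \<in> borel_measurable (path_alg \<Otimes>\<^sub>M borel)" for i
      by (rule measurable_compose[OF measurable_fst X_path]) simp
    show "(\<lambda>p. X (q n (snd p)) (fst p)) \<in> borel_measurable (path_alg \<Otimes>\<^sub>M borel)"
      unfolding q_def
      by (rule measurable_compose_countable[where g="\<lambda>p. nat \<lfloor>max 0 (snd p) * real (Suc n)\<rfloor>", OF 1]) measurable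
  next
    fix p :: "'w \<times> real" assume "p \<in> space (path_alg \<Otimes>\<^sub>M borel)"
    then have w: "fst p \<in> space M" by (auto simp: space_pair_measure)
    have "((\<lambda>s. X s (fst p)) \<longlongrightarrow> X (max 0 (snd p)) (fst p)) (at (max 0 (snd p)) within {0..})"
      using continuous[OF w] by (auto simp: continuous_on_def)
    then show "(\<lambda>n. X (q n (snd p)) (fst p)) \<longlonglongrightarrow> (case p of (\<omega>, s) \<Rightarrow> X (max 0 s) \<omega>)"
      unfolding case_prod_beta using continuous[OF w]
      by (intro continuous_on_tendsto_compose[where s="{0..}" and f="\<lambda>s. X s (fst p)"] qlim) (auto simp: q_def)
  qed
qed

lemma X_joint': 
  assumes "f \<in> borel_measurable path_alg" "\<And>\<omega>. \<omega> \<in> space M \<Longrightarrow> 0 \<le> f \<omega>"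
  shows "(\<lambda>\<omega>. X (f \<omega>) \<omega>) \<in> borel_measurable path_alg"
proof -
  note assms(1)[measurable]
  have "(\<lambda>\<omega>. X (max 0 (f \<omega>)) \<omega>) \<in> borel_measurable path_alg"
    using measurable_compose[OF _ X_joint, of "\<lambda>\<omega>. (\<omega>, f \<omega>)" path_alg] by simp
  then show ?thesis using assms(2) by (subst measurable_cong[where g="\<lambda>\<omega>. X (max 0 (f \<omega>)) \<omega>"]) (auto simp: max_def)
qed

lemma path_nn_measurable:
  fixes h :: "real^'n \<Rightarrow> ennreal"
  assumes h[measurable]: "h \<in> borel_measurable borel" and U: "\<And>\<omega>. U \<omega> \<subseteq> {0..}"
    and Um[measurable]: "Measurable.pred (path_alg \<Otimes>\<^sub>M borel) (\<lambda>(\<omega>, s). s \<in> U \<omega>)"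
  shows "(\<lambda>\<omega>. \<integral>\<^sup>+s\<in>U \<omega>. h (X s \<omega>) \<partial>lborel) \<in> borel_measurable path_alg"
proof -
  have e: "h (X s \<omega>) * indicator (U \<omega>) s = h (X (max 0 s) \<omega>) * indicator {s. s \<in> U \<omega>} s" for s \<omega>
    using U[of \<omega>] by (auto simp: indicator_def max_def)
  have [measurable]: "Measurable.pred (path_alg \<Otimes>\<^sub>M lborel) (\<lambda>p. snd p \<in> U (fst p))"
    using Um by (simp add: case_prod_beta cong: measurable_cong_sets sets_pair_measure_cong)
  have [measurable]: "(\<lambda>p. X (max 0 (snd p)) (fst p)) \<in> borel_measurable (path_alg \<Otimes>\<^sub>M lborel)"
    using X_joint by (simp add: case_prod_beta cong: measurable_cong_sets sets_pair_measure_cong)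
  have "(\<lambda>p. h (X (max 0 (snd p)) (fst p)) * (if snd p \<in> U (fst p) then 1 else 0)) \<in> borel_measurable (path_alg \<Otimes>\<^sub>M lborel)"
    by measurable
  then have "(\<lambda>\<omega>. \<integral>\<^sup>+s. h (X (max 0 s) \<omega>) * (if s \<in> U \<omega> then 1 else 0) \<partial>lborel) \<in> borel_measurable path_alg"
    by (intro lborel.borel_measurable_nn_integral) (simp add: case_prod_beta)
  then show ?thesis unfolding e by (simp add: indicator_def)
qed

lemma path_integral_measurable:
  fixes h :: "real^'n \<Rightarrow> real"
  assumes h[measurable]: "h \<in> borel_measurable borel" and U: "\<And>\<omega>. U \<omega> \<subseteq> {0..}"
    and Um[measurable]: "Measurable.pred (path_alg \<Otimes>\<^sub>M borel) (\<lambda>(\<omega>, s). s \<in> U \<omega>)"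
  shows "(\<lambda>\<omega>. LINT s:U \<omega>|lborel. h (X s \<omega>)) \<in> borel_measurable path_alg"
proof -
  have e: "indicator (U \<omega>) s *\<^sub>R h (X s \<omega>) = (if s \<in> U \<omega> then 1 else 0) * h (X (max 0 s) \<omega>)" for s \<omega>
    using U[of \<omega>] by (auto simp: indicator_def max_def)
  have [measurable]: "Measurable.pred (path_alg \<Otimes>\<^sub>M lborel) (\<lambda>p. snd p \<in> U (fst p))"
    using Um by (simp add: case_prod_beta cong: measurable_cong_sets sets_pair_measure_cong)
  have [measurable]: "(\<lambda>p. X (max 0 (snd p)) (fst p)) \<in> borel_measurable (path_alg \<Otimes>\<^sub>M lborel)"
    using X_joint by (simp add: case_prod_beta cong: measurable_cong_sets sets_pair_measure_cong)
  have "(\<lambda>p. (if snd p \<in> U (fst p) then 1 else 0) * h (X (max 0 (snd p)) (fst p))) \<in> borel_measurable (path_alg \<Otimes>\<^sub>M lborel)"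
    by measurable
  then show ?thesis unfolding set_lebesgue_integral_def e
    by (intro lborel.borel_measurable_lebesgue_integral) (simp add: case_prod_beta)
qed

lemma path_measurable:
  fixes h :: "real^'n \<Rightarrow> real"
  assumes h: "h \<in> borel_measurable borel" and w: "\<omega> \<in> space M" and U: "U \<subseteq> {0..}" "U \<in> sets borel"
  shows "set_borel_measurable lborel U (\<lambda>s. h (X s \<omega>))"
proof -
  have "(\<lambda>s. X (max 0 s) \<omega>) \<in> borel_measurable borel"
    using measurable_compose[OF measurable_Pair1' X_joint, of \<omega>] w by simp
  then have [measurable]: "(\<lambda>s. h (X (max 0 s) \<omega>)) \<in> borel_measurable borel" using h measurable_compose by blast
  note U(2)[measurable]
  have "indicator U s *\<^sub>R h (X s \<omega>) = indicator U s *\<^sub>R h (X (max 0 s) \<omega>)" for s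
    using U by (auto simp: indicator_def max_def)
  moreover have "(\<lambda>s. indicator U s *\<^sub>R h (X (max 0 s) \<omega>)) \<in> borel_measurable lborel" by simp
  ultimately show ?thesis unfolding set_borel_measurable_def by (simp only:)
qed

definition before :: "real^'n \<Rightarrow> real \<Rightarrow> 'w \<Rightarrow> real set" where
  "before c r \<omega> = {t. 0 \<le> t \<and> ereal t < exit_from c r \<omega>}"

lemma before_pred[measurable]: "Measurable.pred (path_alg \<Otimes>\<^sub>M borel) (\<lambda>(\<omega>, s). s \<in> before c r \<omega>)"
  unfolding before_def case_prod_beta by measurable

lemma before_sets: "before c r \<omega> \<in> sets borel"
  unfolding before_def by measurable

lemma before_mem: "\<omega> \<in> space M \<Longrightarrow> t \<in> before c r \<omega> \<Longrightarrow> X t \<omega> \<in> ball c r"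
  using exit_from_le[of t \<omega> c r] unfolding before_def by force

end

section \<open>Dynkin's formula at stopped exit times\<close>

lemma norm_integral_le_nn_integral:
  fixes f :: "'a \<Rightarrow> 'b::{banach, second_countable_topology}"
  shows "ennreal (norm (integral\<^sup>L M f)) \<le> (\<integral>\<^sup>+x. ennreal (norm (f x)) \<partial>M)"
  by (cases "integrable M f") (auto simp: integral_norm_bound_ennreal not_integrable_integral_eq)

text \<open>The extremal values of the quadratic form on the unit sphere are eigenvalues. One
  argument covers both: the sign \<open>s\<close> is 1 for the maximum and -1 for the
  minimum.\<close>

lemma spectrum_quadratic_bound:
  fixes A :: "real^'n^'n"
  assumes A: "A \<in> sym_spectrum_in \<delta>" and v: "norm v = 1"
  shows "v \<bullet> (A *v v) \<le> 1 / \<delta>" "\<delta> \<le> v \<bullet> (A *v v)"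
proof -
  have sym: "x \<bullet> (A *v y) = (A *v x) \<bullet> y" for x y
    using A unfolding sym_spectrum_in_def by (metis (mono_tags, lifting) dot_lmul_matrix mem_Collect_eq transpose_matrix_vector)
  have eig: "\<exists>v. v \<noteq> 0 \<and> A *v v = (s * \<mu>) *\<^sub>R v"
    if m: "norm v = 1" "s * (v \<bullet> (A *v v)) = \<mu>" "\<And>w. norm w = 1 \<Longrightarrow> s * (w \<bullet> (A *v w)) \<le> \<mu>" and s: "s = 1 \<or> s = -1" for s \<mu> v
  proof -
    \<comment> \<open>This form is nonnegative by maximality and vanishes at \<open>v\<close>. Hence
      its linear term at \<open>v\<close> vanishes in every direction \<open>w\<close>, which says
      that \<open>v\<close> is an eigenvector.\<close>
    define q where "q w = \<mu> * (w \<bullet> w) - s * (w \<bullet> (A *v w))" for w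
    have q0: "0 \<le> q w" for w
    proof (cases "w = 0")
      case False
      have n: "norm ((1 / norm w) *\<^sub>R w) = 1" using False by simp
      from m(3)[OF n] have "s * (w \<bullet> (A *v w)) / (norm w)^2 \<le> \<mu>"
        by (simp add: matrix_vector_mult_scaleR power2_eq_square)
      then have "s * (w \<bullet> (A *v w)) \<le> \<mu> * (norm w)^2" using False by (simp add: divide_le_eq)
      then show ?thesis by (simp add: q_def power2_norm_eq_inner)
    qed (simp add: q_def)
    have qv: "q v = 0" using m(1,2) by (simp add: q_def power2_norm_eq_inner[symmetric])
    have z: "(\<mu> *\<^sub>R v - s *\<^sub>R (A *v v)) \<bullet> w = 0" for w
    proof (rule ccontr)
      define \<beta> where "\<beta> = (\<mu> *\<^sub>R v - s *\<^sub>R (A *v v)) \<bullet> w"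
      assume "(\<mu> *\<^sub>R v - s *\<^sub>R (A *v v)) \<bullet> w \<noteq> 0"
      then have b: "\<beta> \<noteq> 0" by (simp add: \<beta>_def)
      have ex: "q (v + t *\<^sub>R w) = 2 * t * \<beta> + t^2 * q w" for t
      proof -
        have "q (v + t *\<^sub>R w) = q v + 2 * t * \<beta> + t^2 * q w"
          unfolding q_def \<beta>_def using sym[of v w]
          by (simp add: matrix_vector_right_distrib matrix_vector_mult_scaleR inner_add_left inner_add_right
              inner_diff_left inner_commute algebra_simps power2_eq_square)
        then show ?thesis using qv by simp
      qed
      \<comment> \<open>Almost the minimizer \<open>- \<beta> / q w\<close> of the parabola; the
        added 1 avoids a division by zero, and the value is still negative.\<close>
      define t where "t = - \<beta> / (q w + 1)"
      have "0 \<le> 2 * t * \<beta> + t^2 * q w" using q0[of "v + t *\<^sub>R w"] ex by simp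
      also have "\<dots> = - (\<beta>^2) * (q w + 2) / (q w + 1)^2"
        using q0[of w] unfolding t_def by (simp add: divide_simps power2_eq_square) (simp add: algebra_simps)
      also have "\<dots> < 0" using b q0[of w] by (simp add: divide_neg_pos mult_neg_pos)
      finally show False by simp
    qed
    then have "\<mu> *\<^sub>R v - s *\<^sub>R (A *v v) = 0" using inner_eq_zero_iff by blast
    then have "\<mu> *\<^sub>R v = s *\<^sub>R (A *v v)" by simp
    then have "(s * \<mu>) *\<^sub>R v = A *v v" using s by auto
    then show ?thesis using m(1) by (intro exI[of _ v]) auto
  qed
  have cont: "continuous_on (sphere 0 1) (\<lambda>v. s * (v \<bullet> (A *v v)))" for s
    by (intro continuous_intros linear_continuous_on) (simp add: matrix_vector_mul_bounded_linear)
  have ne: "sphere (0::real^'n) 1 \<noteq> {}" using v by (auto intro: exI[of _ v])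
  have ex: "\<exists>\<mu>. (\<exists>v. v \<noteq> 0 \<and> A *v v = (s * \<mu>) *\<^sub>R v) \<and> (\<forall>w. norm w = 1 \<longrightarrow> s * (w \<bullet> (A *v w)) \<le> \<mu>)"
    if s: "s = 1 \<or> s = -1" for s
  proof -
    obtain v where v: "v \<in> sphere 0 1" "\<forall>w\<in>sphere 0 1. s * (w \<bullet> (A *v w)) \<le> s * (v \<bullet> (A *v v))"
      using continuous_attains_sup[OF compact_sphere ne cont] by blast
    show ?thesis
      using eig[OF _ refl _ s, of v] v by (intro exI[of _ "s * (v \<bullet> (A *v v))"]) simp
  qed
  have spec: "\<delta> \<le> c \<and> c \<le> 1 / \<delta>" if "\<exists>v. v \<noteq> 0 \<and> A *v v = c *\<^sub>R v" for c
    using A that unfolding sym_spectrum_in_def by blast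
  obtain \<mu> where 1: "\<mu> \<le> 1 / \<delta>" "\<forall>w. norm w = 1 \<longrightarrow> w \<bullet> (A *v w) \<le> \<mu>"
    using ex[of 1] spec by force
  obtain \<mu>' where 2: "\<delta> \<le> - \<mu>'" "\<forall>w. norm w = 1 \<longrightarrow> - (w \<bullet> (A *v w)) \<le> \<mu>'"
    using ex[of "-1"] spec by force
  show "v \<bullet> (A *v v) \<le> 1 / \<delta>" "\<delta> \<le> v \<bullet> (A *v v)" using 1 2 v by force+
qed

text \<open>Polarization: four times the entry is the difference of the form at
  \<open>axis i 1 + axis j 1\<close> and at \<open>axis i 1 - axis j 1\<close>. Both values lie
  between 0 and \<open>4 / \<delta>\<close> because these vectors have norm at most 2, also when
  \<open>i = j\<close>.\<close>

lemma spectrum_entry_bound: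
  fixes A :: "real^'n^'n"
  assumes A: "A \<in> sym_spectrum_in \<delta>" and d: "0 < \<delta>"
  shows "\<bar>A $ i $ j\<bar> \<le> 1 / \<delta>"
proof -
  let ?q = "\<lambda>v. v \<bullet> (A *v v)"
  have sym: "A $ j $ i = A $ i $ j"
    using A by (metis (mono_tags, lifting) mem_Collect_eq sym_spectrum_in_def transpose_def vec_lambda_beta)
  have e: "axis k 1 \<bullet> (A *v axis l 1) = A $ k $ l" for k l
    by (simp add: inner_axis' matrix_vector_mult_basis column_def)
  have B: "0 \<le> ?q v \<and> ?q v \<le> (norm v)^2 / \<delta>" for v
  proof (cases "v = 0")
    case False
    have "norm ((1 / norm v) *\<^sub>R v) = 1" using False by simp
    from spectrum_quadratic_bound[OF A this]
    have *: "?q v / (norm v)^2 \<le> 1 / \<delta>" "\<delta> \<le> ?q v / (norm v)^2"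
      by (simp_all add: matrix_vector_mult_scaleR power2_eq_square)
    then have "?q v \<le> 1 / \<delta> * (norm v)^2" using False by (simp add: divide_le_eq)
    moreover have "0 \<le> ?q v" using *(2) d False by (smt (verit) divide_neg_pos zero_less_norm_iff zero_less_power)
    ultimately show ?thesis by simp
  qed (simp add: matrix_vector_mult_0_right)
  have p: "?q (axis i 1 + axis j 1) - ?q (axis i 1 - axis j 1) = 4 * A $ i $ j"
    using sym by (simp add: matrix_vector_right_distrib matrix_vector_mult_diff_distrib inner_add_left inner_add_right
        inner_diff_left inner_diff_right e)
  have n: "norm (axis i 1 + axis j (1::real) :: real^'n) \<le> 2" "norm (axis i 1 - axis j (1::real) :: real^'n) \<le> 2"
    using norm_triangle_ineq[of "axis i 1 :: real^'n" "axis j 1"] norm_triangle_ineq4[of "axis i 1 :: real^'n" "axis j 1"]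
    by simp_all
  have n2: "(norm (axis i 1 + axis j (1::real) :: real^'n))^2 \<le> 4" "(norm (axis i 1 - axis j (1::real) :: real^'n))^2 \<le> 4"
    using power_mono[OF n(1), of 2] power_mono[OF n(2), of 2] by simp_all
  have "?q (axis i 1 + axis j 1) \<le> 4 / \<delta>" "?q (axis i 1 - axis j 1) \<le> 4 / \<delta>"
    using B[of "axis i 1 + axis j 1"] B[of "axis i 1 - axis j 1"] divide_right_mono[OF n2(1), of \<delta>] divide_right_mono[OF n2(2), of \<delta>] d
    by linarith+
  then have "\<bar>4 * A $ i $ j\<bar> \<le> 4 / \<delta>"
    using p B[of "axis i 1 + axis j 1"] B[of "axis i 1 - axis j 1"] by linarith
  then show ?thesis by (simp add: field_simps)
qed

lemma Ck_continuous: "Ck k u \<Longrightarrow> continuous_on UNIV u"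
  by (cases k) (auto simp: continuous_on_eq_continuous_at intro: differentiable_imp_continuous_within)

lemma partial_deriv_outside_support:
  assumes "x \<notin> closure {x. u x \<noteq> 0}"
  shows "partial_deriv i u x = 0"
proof -
  have "(u has_derivative (\<lambda>_. 0)) (at x)"
    by (rule has_derivative_transform_within_open[OF has_derivative_const[of 0], where s="- closure {x. u x \<noteq> 0}"])
      (use assms closure_subset[of "{x. u x \<noteq> 0}"] in auto)
  then show ?thesis by (simp add: partial_deriv_def frechet_derivative_at[symmetric])
qed

lemma support_partial_deriv: "closure {x. partial_deriv i u x \<noteq> 0} \<subseteq> closure {x. u x \<noteq> 0}"
  using partial_deriv_outside_support[of _ u i] by (intro closure_minimal) auto

lemma bounded_compact_support:
  fixes u :: "real^'n \<Rightarrow> real"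
  assumes "continuous_on UNIV u" "compact K" "closure {x. u x \<noteq> 0} \<subseteq> K"
  obtains C where "0 \<le> C" "\<And>x. \<bar>u x\<bar> \<le> C"
proof -
  have "bounded (u ` K)"
    using assms by (intro compact_imp_bounded compact_continuous_image) (auto elim: continuous_on_subset)
  then obtain C where C: "\<And>x. x \<in> K \<Longrightarrow> \<bar>u x\<bar> \<le> C" by (auto simp: bounded_iff)
  have "\<bar>u x\<bar> \<le> max C 0" for x
  proof (cases "u x = 0")
    case False
    then have "x \<in> K" using assms(3) closure_subset[of "{x. u x \<noteq> 0}"] by blast
    then show ?thesis using C[of x] by simp
  qed simp
  then show ?thesis by (intro that[of "max C 0"]) auto
qed

lemma diff_op_bound:
  assumes a: "a x \<in> sym_spectrum_in \<delta>" and d: "0 < \<delta>"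
    and D: "\<And>i. \<bar>Du i x\<bar> \<le> D1" and D2: "\<And>i j. \<bar>D2u i j x\<bar> \<le> D2"
  shows "\<bar>diff_op a b Du D2u (x :: real^'n)\<bar> \<le> (real CARD('n))^2 * D2 / \<delta> + real CARD('n) * D1 * norm (b x)"
proof -
  have "\<bar>a x $ i $ j * D2u i j x\<bar> \<le> 1 / \<delta> * D2" for i j
    unfolding abs_mult using spectrum_entry_bound[OF a d] D2 d by (intro mult_mono) auto
  then have "\<bar>\<Sum>i\<in>UNIV. \<Sum>j\<in>UNIV. a x $ i $ j * D2u i j x\<bar> \<le> (\<Sum>i\<in>(UNIV::'n set). \<Sum>j\<in>(UNIV::'n set). 1 / \<delta> * D2)"
    by (intro order_trans[OF sum_abs] sum_mono order_trans[OF sum_abs])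
  then have 1: "\<bar>\<Sum>i\<in>UNIV. \<Sum>j\<in>UNIV. a x $ i $ j * D2u i j x\<bar> \<le> (real CARD('n))^2 * D2 / \<delta>"
    by (simp add: power2_eq_square)
  have "\<bar>b x $ i * Du i x\<bar> \<le> norm (b x) * D1" for i
    unfolding abs_mult using D component_le_norm_cart[of "b x" i] by (intro mult_mono) auto
  then have "\<bar>\<Sum>i\<in>UNIV. b x $ i * Du i x\<bar> \<le> (\<Sum>i\<in>(UNIV::'n set). norm (b x) * D1)"
    by (intro order_trans[OF sum_abs] sum_mono)
  then have 2: "\<bar>\<Sum>i\<in>UNIV. b x $ i * Du i x\<bar> \<le> real CARD('n) * D1 * norm (b x)" by (simp add: ac_simps)
  show ?thesis using 1 2 unfolding diff_op_def by linarith
qed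

lemma diff_op_measurable:
  fixes a :: "real^'n \<Rightarrow> real^'n^'n"
  assumes [measurable]: "a \<in> borel_measurable borel" "b \<in> borel_measurable borel"
    "\<And>i. Du i \<in> borel_measurable borel" "\<And>i j. D2u i j \<in> borel_measurable borel"
  shows "diff_op a b Du D2u \<in> borel_measurable borel"
proof -
  have [measurable]: "(\<lambda>x. b x $ i) \<in> borel_measurable borel" for i
    by (rule borel_measurable_continuous_on[OF _ assms(2), where f="\<lambda>v. v $ i"]) (intro continuous_intros)
  have [measurable]: "(\<lambda>x. a x $ i $ j) \<in> borel_measurable borel" for i j
    by (rule borel_measurable_continuous_on[OF _ assms(1), where f="\<lambda>v. v $ i $ j"]) (intro continuous_intros)
  show ?thesis unfolding diff_op_def[abs_def] by measurable
qed

section \<open>The stopped exit time and its approximation from above by grid times\<close>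

context continuous_markov_process
begin

text \<open>Truncation at \<open>T\<close> makes the time finite on every path and lets a finite
  grid of \<open>{0..T}\<close> cover all its values.\<close>

definition stop :: "real^'n \<Rightarrow> real \<Rightarrow> real \<Rightarrow> 'w \<Rightarrow> real" where
  "stop c r T \<omega> = real_of_ereal (min (ereal T) (exit_from c r \<omega>))"

text \<open>The index of the first of the points \<open>k * T / n\<close> that is not before the
  stopped time. Rounding up is essential: whether the index is \<open>k\<close> is then known at
  time \<open>k * T / n\<close>.\<close>

definition grid :: "real^'n \<Rightarrow> real \<Rightarrow> real \<Rightarrow> nat \<Rightarrow> 'w \<Rightarrow> nat" where
  "grid c r T n \<omega> = nat \<lceil>stop c r T \<omega> * real n / T\<rceil>"

lemma stop_eq: "0 \<le> T \<Longrightarrow> ereal (stop c r T \<omega>) = min (ereal T) (exit_from c r \<omega>)"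
  unfolding stop_def using exit_from_nonneg[of c r \<omega>]
  by (cases "exit_from c r \<omega>") (auto simp: min_def)

lemma stop_bounds: "0 \<le> T \<Longrightarrow> 0 \<le> stop c r T \<omega>" "0 \<le> T \<Longrightarrow> stop c r T \<omega> \<le> T"
  using stop_eq[of T c r \<omega>] exit_from_nonneg[of c r \<omega>]
  by (metis ereal_less_eq(3) ereal_less_eq(5) min.boundedI, metis ereal_less_eq(3) min.cobounded1)

lemma stop_measurable[measurable]: "stop c r T \<in> borel_measurable path_alg"
  unfolding stop_def[abs_def] by measurable

lemma stop_before: "0 \<le> T \<Longrightarrow> 0 \<le> s \<Longrightarrow> s < stop c r T \<omega> \<Longrightarrow> s \<in> before c r \<omega>"
  using stop_eq[of T c r \<omega>] unfolding before_def
  by (metis (mono_tags, lifting) ereal_less(2) less_ereal.simps(1) mem_Collect_eq min_less_iff_conj)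

lemma stop_le_iff:
  assumes "\<omega> \<in> space M" "0 \<le> t" "t < T"
  shows "stop c r T \<omega> \<le> t \<longleftrightarrow> \<not> (\<forall>s\<in>{0..t}. X s \<omega> \<in> ball c r)"
proof -
  have "stop c r T \<omega> \<le> t \<longleftrightarrow> min (ereal T) (exit_from c r \<omega>) \<le> ereal t"
    using stop_eq[of T c r \<omega>] assms by (metis ereal_less_eq(3) less_imp_le order_trans)
  also have "\<dots> \<longleftrightarrow> \<not> ereal t < exit_from c r \<omega>" using assms by (auto simp: min_le_iff_disj)
  finally show ?thesis using exit_from_gt_iff[OF assms(1,2)] by simp
qed

lemma stop_pos:
  assumes "\<omega> \<in> space M" "0 < T" "X 0 \<omega> \<in> ball c r" shows "0 < stop c r T \<omega>"
  using stop_le_iff[OF assms(1) order_refl assms(2), of c r] assms(3) by auto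

text \<open>Whether the time is the exit time or \<open>T\<close>, the path lies in the open ball
  before it, and the interval before it is nonempty because the path starts inside. Continuity gives
  the closed ball at the end.\<close>

lemma stop_cball:
  assumes w: "\<omega> \<in> space M" and T: "0 < T" and X0: "X 0 \<omega> \<in> ball c r"
  shows "X (stop c r T \<omega>) \<omega> \<in> cball c r"
proof -
  let ?\<rho> = "stop c r T \<omega>"
  have pos: "0 < ?\<rho>" by (rule stop_pos[OF assms])
  have "X ?\<rho> \<omega> \<in> closure ((\<lambda>s. X s \<omega>) ` {0..<?\<rho>})"
  proof -
    have "continuous_on (closure {0..<?\<rho>}) (\<lambda>s. X s \<omega>)"
      using continuous[OF w] pos by (auto elim: continuous_on_subset)
    from image_closure_subset[OF this closed_closure closure_subset] show ?thesis using pos by auto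
  qed
  also have "\<dots> \<subseteq> cball c r"
    using stop_before[of T _ c r \<omega>] before_mem[OF w] T by (intro closure_minimal) (auto simp: less_imp_le)
  finally show ?thesis .
qed

lemma grid_le_iff:
  assumes "0 < n" "0 < T" shows "grid c r T n \<omega> \<le> k \<longleftrightarrow> stop c r T \<omega> \<le> real k * T / real n"
proof -
  have "grid c r T n \<omega> \<le> k \<longleftrightarrow> stop c r T \<omega> * real n / T \<le> real k"
    unfolding grid_def nat_le_iff ceiling_le_iff by simp
  also have "\<dots> \<longleftrightarrow> stop c r T \<omega> \<le> real k * T / real n" using assms by (simp add: field_simps)
  finally show ?thesis .
qed

lemma grid_le: "0 < n \<Longrightarrow> 0 < T \<Longrightarrow> grid c r T n \<omega> \<le> n"
  using stop_bounds(2)[of T c r \<omega>] by (subst grid_le_iff) auto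

lemma grid_event:
  assumes n: "0 < n" and T: "0 < T" and k: "k \<le> n"
  shows "{\<omega> \<in> space M. grid c r T n \<omega> = k} \<in> sets (F (real k * T / real n))"
proof -
  have le: "{\<omega> \<in> space M. grid c r T n \<omega> \<le> k} \<in> sets (F (real k * T / real n))" if k: "k \<le> n" for k
  proof (cases "k = n")
    \<comment> \<open>The last grid point is exceptional: it always lies at or after the stopped
      time. Before it, \<open>k * T / n < T\<close>, and having stopped means having left the
      ball.\<close>
    case True
    then have "{\<omega> \<in> space M. grid c r T n \<omega> \<le> k} = space (F (real k * T / real n))"
      using grid_le[OF n T, of c r] space_F T by auto
    then show ?thesis by (simp only: sets.top)
  next
    case False
    let ?t = "real k * T / real n"
    have t: "0 \<le> ?t" "?t < T" using k False T n by (auto simp: divide_less_eq)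
    have "{\<omega> \<in> space M. grid c r T n \<omega> \<le> k} = space (F ?t) - {\<omega> \<in> space M. \<forall>s\<in>{0..?t}. X s \<omega> \<in> ball c r}"
      using space_F[OF t(1)] stop_le_iff[OF _ t, of _ c r] unfolding grid_le_iff[OF n T] by auto
    also have "\<dots> \<in> sets (F ?t)" using ball_event_F[OF t(1)] by blast
    finally show ?thesis .
  qed
  show ?thesis
  proof (cases k)
    case 0
    then show ?thesis using le[OF k] by simp
  next
    case (Suc j)
    have "{\<omega> \<in> space M. grid c r T n \<omega> \<le> j} \<in> sets (F (real j * T / real n))"
      using k Suc by (intro le) simp
    also have "\<dots> \<subseteq> sets (F (real k * T / real n))"
      using T Suc by (intro filtr) (auto intro!: divide_right_mono)
    finally have j: "{\<omega> \<in> space M. grid c r T n \<omega> \<le> j} \<in> sets (F (real k * T / real n))" .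
    have "{\<omega> \<in> space M. grid c r T n \<omega> = k} = {\<omega> \<in> space M. grid c r T n \<omega> \<le> k} - {\<omega> \<in> space M. grid c r T n \<omega> \<le> j}"
      using Suc by auto
    then show ?thesis using le[OF k] j by simp
  qed
qed

lemma grid_ge: "0 < n \<Longrightarrow> 0 < T \<Longrightarrow> stop c r T \<omega> \<le> real (grid c r T n \<omega>) * T / real n"
  using grid_le_iff[of n T c r \<omega> "grid c r T n \<omega>"] by simp

lemma grid_tendsto:
  assumes T: "0 < T"
  shows "(\<lambda>n. real (grid c r T (Suc n) \<omega>) * T / real (Suc n)) \<longlonglongrightarrow> stop c r T \<omega>"
proof (rule real_tendsto_sandwich)
  show "\<forall>\<^sub>F n in sequentially. stop c r T \<omega> \<le> real (grid c r T (Suc n) \<omega>) * T / real (Suc n)"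
    using grid_ge[OF zero_less_Suc T] by (intro always_eventually) blast
  have "real (grid c r T (Suc n) \<omega>) * T / real (Suc n) \<le> stop c r T \<omega> + T * (1 / real (Suc n))" for n
  proof -
    have "real (grid c r T (Suc n) \<omega>) \<le> stop c r T \<omega> * real (Suc n) / T + 1"
      using stop_bounds(1)[of T c r \<omega>] T unfolding grid_def by (simp add: of_nat_nat)
    then have "real (grid c r T (Suc n) \<omega>) * T / real (Suc n) \<le> (stop c r T \<omega> * real (Suc n) / T + 1) * T / real (Suc n)"
      using T by (intro divide_right_mono mult_right_mono) auto
    also have "\<dots> = stop c r T \<omega> + T * (1 / real (Suc n))"
      using T by (simp add: distrib_right add_divide_distrib del: of_nat_Suc)
    finally show ?thesis .
  qed
  then show "\<forall>\<^sub>F n in sequentially. real (grid c r T (Suc n) \<omega>) * T / real (Suc n) \<le> stop c r T \<omega> + T * (1 / real (Suc n))"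
    by auto
  show "(\<lambda>n. stop c r T \<omega> + T * (1 / real (Suc n))) \<longlonglongrightarrow> stop c r T \<omega>"
    using tendsto_add[OF tendsto_const tendsto_mult_right[OF LIMSEQ_inverse_real_of_nat], of "stop c r T \<omega>" T]
    by (simp add: inverse_eq_divide)
qed (rule tendsto_const)

lemma X_grid_tendsto:
  assumes T: "0 < T" and w: "\<omega> \<in> space M"
  shows "(\<lambda>n. X (real (grid c r T (Suc n) \<omega>) * T / real (Suc n)) \<omega>) \<longlonglongrightarrow> X (stop c r T \<omega>) \<omega>"
  using T stop_bounds(1)[of T c r \<omega>]
  by (intro continuous_on_tendsto_compose[OF continuous[OF w] grid_tendsto]) auto

lemma grid_measurable[measurable]: "grid c r T n \<in> measurable path_alg (count_space UNIV)"
  unfolding grid_def[abs_def] by measurable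

end

text \<open>The derivatives of a compactly supported function are bounded and \<open>a\<close> is
  bounded by its spectrum, so the drift is the only unbounded factor;
  \<open>drift_integrable\<close> then controls the operator along the path. One constant
  \<open>C\<close> serves for \<open>u\<close> and for the operator.\<close>

lemma classical_op_bound:
  fixes u :: "real^'n \<Rightarrow> real"
  assumes a: "\<And>x. a x \<in> sym_spectrum_in \<delta>" and d: "0 < \<delta>"
    and u: "Ck 2 u" "compactly_supported_in UNIV u"
  obtains C where "0 \<le> C" "\<And>x. \<bar>u x\<bar> \<le> C" "\<And>x. \<bar>classical_op a b u x\<bar> \<le> C * (1 + norm (b x))"
proof -
  let ?K = "closure {x. u x \<noteq> 0}"
  have K: "compact ?K" using u(2) by (simp add: compactly_supported_in_def)
  have "Ck (Suc (Suc 0)) u" using u(1) by (simp add: numeral_2_eq_2)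
  then have c: "continuous_on UNIV u" "\<And>i. continuous_on UNIV (partial_deriv i u)"
      "\<And>i j. continuous_on UNIV (partial_deriv i (partial_deriv j u))"
    by (auto intro: Ck_continuous[of "Suc (Suc 0)"] Ck_continuous[of "Suc 0"] Ck_continuous[of 0] simp del: Ck.simps(1))
  have s1: "closure {x. partial_deriv i u x \<noteq> 0} \<subseteq> ?K" for i by (rule support_partial_deriv)
  have s2: "closure {x. partial_deriv i (partial_deriv j u) x \<noteq> 0} \<subseteq> ?K" for i j
    using support_partial_deriv s1 by (rule order_trans)
  obtain C0 where C0: "0 \<le> C0" "\<And>x. \<bar>u x\<bar> \<le> C0" using bounded_compact_support[OF c(1) K order_refl] by metis
  have "\<forall>i. \<exists>C. \<forall>x. \<bar>partial_deriv i u x\<bar> \<le> C" using bounded_compact_support[OF c(2) K s1] by metis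
  then obtain C1 where C1: "\<And>i x. \<bar>partial_deriv i u x\<bar> \<le> C1 i" by metis
  have "\<forall>i. \<forall>j. \<exists>C. \<forall>x. \<bar>partial_deriv i (partial_deriv j u) x\<bar> \<le> C"
    using bounded_compact_support[OF c(3) K s2] by metis
  then obtain C2 where C2: "\<And>i j x. \<bar>partial_deriv i (partial_deriv j u) x\<bar> \<le> C2 i j" by metis
  define D1 where "D1 = (\<Sum>i\<in>UNIV. \<bar>C1 i\<bar>)"
  define D2 where "D2 = (\<Sum>i\<in>UNIV. \<Sum>j\<in>UNIV. \<bar>C2 i j\<bar>)"
  have D1: "\<bar>partial_deriv i u x\<bar> \<le> D1" for i x
    using C1[where i=i and x=x] member_le_sum[of i UNIV "\<lambda>i. \<bar>C1 i\<bar>"] unfolding D1_def by fastforce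
  have "\<bar>C2 i j\<bar> \<le> D2" for i j
    unfolding D2_def
    using member_le_sum[of i UNIV "\<lambda>i. \<Sum>j\<in>UNIV. \<bar>C2 i j\<bar>"] member_le_sum[of j UNIV "\<lambda>j. \<bar>C2 i j\<bar>"]
    by (fastforce simp: sum_nonneg)
  then have D2: "\<bar>partial_deriv i (partial_deriv j u) x\<bar> \<le> D2" for i j x
    using C2[where i=i and j=j and x=x] by (meson abs_ge_self order_trans)
  have D0: "0 \<le> D1" "0 \<le> D2" by (simp_all add: D1_def D2_def sum_nonneg)
  define E1 where "E1 = (real CARD('n))^2 * D2 / \<delta>"
  define E2 where "E2 = real CARD('n) * D1"
  have E: "0 \<le> E1" "0 \<le> E2" using D0 d by (simp_all add: E1_def E2_def)
  let ?C = "C0 + E1 + E2"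
  have "\<bar>classical_op a b u x\<bar> \<le> ?C * (1 + norm (b x))" for x
  proof -
    have "\<bar>classical_op a b u x\<bar> \<le> E1 + E2 * norm (b x)"
      unfolding E1_def E2_def by (rule diff_op_bound[of a x, OF a d D1 D2])
    also have "\<dots> \<le> ?C + ?C * norm (b x)" using E C0 by (intro add_mono mult_right_mono) auto
    finally show ?thesis by (simp add: distrib_left)
  qed
  moreover have "\<bar>u x\<bar> \<le> ?C" for x using C0(2)[of x] E by simp
  ultimately show ?thesis using E C0 by (intro that[of ?C]) auto
qed

lemma Ck_borel: "Ck k u \<Longrightarrow> u \<in> borel_measurable borel"
  using Ck_continuous borel_measurable_continuous_onI by blast

lemma classical_op_measurable:
  fixes u :: "real^'n \<Rightarrow> real"
  assumes "a \<in> borel_measurable borel" "b \<in> borel_measurable borel" "Ck 2 u"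
  shows "classical_op a b u \<in> borel_measurable borel"
  using assms by (intro diff_op_measurable) (auto simp: numeral_2_eq_2 intro: Ck_borel[of "Suc 0"] Ck_borel[of 0])

context continuous_markov_process
begin

lemma Icc_pred: "Measurable.pred (path_alg \<Otimes>\<^sub>M borel) (\<lambda>(\<omega>, s). s \<in> {0..t::real})"
  unfolding case_prod_beta
  by (rule measurable_compose[OF measurable_snd]) (unfold atLeastAtMost_iff, measurable)

lemma Icc_path_measurable:
  assumes "h \<in> borel_measurable borel"
  shows "(\<lambda>\<omega>. LINT s:{0..t}|lborel. h (X s \<omega>) :: real) \<in> borel_measurable path_alg"
  by (rule path_integral_measurable[OF assms _ Icc_pred]) auto

lemma Icc_path_nn_measurable:
  assumes "h \<in> borel_measurable borel"
  shows "(\<lambda>\<omega>. \<integral>\<^sup>+s\<in>{0..t}. h (X s \<omega>) \<partial>lborel) \<in> borel_measurable path_alg"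
  by (rule path_nn_measurable[OF assms _ Icc_pred]) auto

end

context quasi_diffusion
begin

lemma linear_growth_integrable:
  assumes b: "b \<in> borel_measurable borel" and t: "0 \<le> t" and C: "0 \<le> C"
  shows "(\<integral>\<^sup>+\<omega>. (\<integral>\<^sup>+s\<in>{0..t}. ennreal (C * (1 + norm (b (X s \<omega>)))) \<partial>lborel) \<partial>P x) < \<infinity>"
proof -
  have [measurable]: "(\<lambda>y. ennreal (norm (b y))) \<in> borel_measurable borel" using b by measurable
  have mb: "(\<lambda>s. ennreal (norm (b (X s \<omega>))) * indicator {0..t} s) \<in> borel_measurable lborel" if "\<omega> \<in> space M" for \<omega>
  proof -
    have "(\<lambda>y. norm (b y)) \<in> borel_measurable borel" using b by measurable
    from path_measurable[OF this that, of "{0..t}"]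
    have [measurable]: "(\<lambda>s. indicator {0..t} s *\<^sub>R norm (b (X s \<omega>))) \<in> borel_measurable borel"
      by (simp add: set_borel_measurable_def)
    have "(\<lambda>s. ennreal (indicator {0..t} s *\<^sub>R norm (b (X s \<omega>)))) \<in> borel_measurable lborel" by measurable
    moreover have "ennreal (indicator {0..t} s *\<^sub>R norm (b (X s \<omega>))) = ennreal (norm (b (X s \<omega>))) * indicator {0..t} s" for s
      by (simp add: indicator_def)
    ultimately show ?thesis by (simp only:)
  qed
  have "(\<integral>\<^sup>+\<omega>. (\<integral>\<^sup>+s\<in>{0..t}. ennreal (C * (1 + norm (b (X s \<omega>)))) \<partial>lborel) \<partial>P x)
      = (\<integral>\<^sup>+\<omega>. ennreal C * (ennreal t + (\<integral>\<^sup>+s\<in>{0..t}. ennreal (norm (b (X s \<omega>))) \<partial>lborel)) \<partial>P x)"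
  proof (rule nn_integral_cong)
    fix \<omega> assume "\<omega> \<in> space (P x)"
    then have w: "\<omega> \<in> space M" by simp
    have "(\<integral>\<^sup>+s\<in>{0..t}. ennreal (C * (1 + norm (b (X s \<omega>)))) \<partial>lborel)
        = (\<integral>\<^sup>+s. ennreal C * (indicator {0..t} s + ennreal (norm (b (X s \<omega>))) * indicator {0..t} s) \<partial>lborel)"
      using C by (intro nn_integral_cong) (auto simp: indicator_def ennreal_mult ennreal_plus)
    also have "\<dots> = ennreal C * (ennreal t + (\<integral>\<^sup>+s\<in>{0..t}. ennreal (norm (b (X s \<omega>))) \<partial>lborel))"
      using t mb[OF w] by (subst nn_integral_cmult) (auto simp: nn_integral_add)
    finally show "(\<integral>\<^sup>+s\<in>{0..t}. ennreal (C * (1 + norm (b (X s \<omega>)))) \<partial>lborel)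
      = ennreal C * (ennreal t + (\<integral>\<^sup>+s\<in>{0..t}. ennreal (norm (b (X s \<omega>))) \<partial>lborel))" .
  qed
  also have "\<dots> = ennreal C * (ennreal t * emeasure (P x) (space M) + (\<integral>\<^sup>+\<omega>. (\<integral>\<^sup>+s\<in>{0..t}. ennreal (norm (b (X s \<omega>))) \<partial>lborel) \<partial>P x))"
  proof -
    have [measurable]: "(\<lambda>\<omega>. \<integral>\<^sup>+s\<in>{0..t}. ennreal (norm (b (X s \<omega>))) \<partial>lborel) \<in> borel_measurable (P x)"
      by (rule path_P[OF Icc_path_nn_measurable]) measurable
    show ?thesis by (simp add: nn_integral_cmult nn_integral_add)
  qed
  also have "\<dots> < \<infinity>"
    using drift_integrable[OF t, of x] prob_space.emeasure_space_1[OF prob, of x]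
    by (simp add: ennreal_mult_less_top ennreal_add_less_top)
  finally show ?thesis .
qed

section \<open>The martingale of a test function and its optional stopping\<close>

context
  fixes u :: "real^'n \<Rightarrow> real" and \<delta> B :: real
  assumes adm: "admissible_coeffs \<delta> B a b" and d: "0 < \<delta>"
    and u: "Ck 2 u" "compactly_supported_in UNIV u"
begin

text \<open>Dynkin's formula says that this has mean zero under every \<open>P x\<close>; combined
  with the Markov property it gives increments of mean zero on past events, that is, a
  martingale.\<close>

definition mart :: "real \<Rightarrow> 'w \<Rightarrow> real" where
  "mart t \<omega> = u (X t \<omega>) - u (X 0 \<omega>) - (LINT s:{0..t}|lborel. classical_op a b u (X s \<omega>))"

lemma op_meas: "classical_op a b u \<in> borel_measurable borel"
  using adm u by (intro classical_op_measurable) (auto simp: admissible_coeffs_def)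

lemma op_dominated:
  obtains C where "0 \<le> C" "\<And>x. \<bar>u x\<bar> \<le> C"
    "\<And>x t. 0 \<le> t \<Longrightarrow> (\<integral>\<^sup>+\<omega>. (\<integral>\<^sup>+s\<in>{0..t}. ennreal \<bar>classical_op a b u (X s \<omega>)\<bar> \<partial>lborel) \<partial>P x) < \<infinity>"
proof -
  obtain C where C: "0 \<le> C" "\<And>x. \<bar>u x\<bar> \<le> C" "\<And>x. \<bar>classical_op a b u x\<bar> \<le> C * (1 + norm (b x))"
    using classical_op_bound[of a \<delta> u b] adm d u unfolding admissible_coeffs_def by blast
  have "(\<integral>\<^sup>+\<omega>. (\<integral>\<^sup>+s\<in>{0..t}. ennreal \<bar>classical_op a b u (X s \<omega>)\<bar> \<partial>lborel) \<partial>P x) < \<infinity>" if t: "0 \<le> t" for x t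
  proof -
    have "(\<integral>\<^sup>+\<omega>. (\<integral>\<^sup>+s\<in>{0..t}. ennreal \<bar>classical_op a b u (X s \<omega>)\<bar> \<partial>lborel) \<partial>P x)
      \<le> (\<integral>\<^sup>+\<omega>. (\<integral>\<^sup>+s\<in>{0..t}. ennreal (C * (1 + norm (b (X s \<omega>)))) \<partial>lborel) \<partial>P x)"
      using C(3) by (intro nn_integral_mono mult_right_mono ennreal_leI) auto
    also have "\<dots> < \<infinity>" using linear_growth_integrable[OF _ t C(1)] adm by (auto simp: admissible_coeffs_def)
    finally show ?thesis .
  qed
  with C show ?thesis by (intro that[of C]) auto
qed

lemma op_finite:
  "0 \<le> t \<Longrightarrow> (\<integral>\<^sup>+\<omega>. (\<integral>\<^sup>+s\<in>{0..t}. ennreal \<bar>classical_op a b u (X s \<omega>)\<bar> \<partial>lborel) \<partial>P x) < \<infinity>"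
  by (rule op_dominated)

lemma u_bounded: "\<exists>C\<ge>0. \<forall>x. \<bar>u x\<bar> \<le> C"
  by (rule op_dominated) blast

lemma op_path_integrable: "0 \<le> t \<Longrightarrow> integrable (P x) (\<lambda>\<omega>. LINT s:{0..t}|lborel. classical_op a b u (X s \<omega>))"
proof (rule integrableI_bounded)
  assume t: "0 \<le> t"
  show "(\<lambda>\<omega>. LINT s:{0..t}|lborel. classical_op a b u (X s \<omega>)) \<in> borel_measurable (P x)"
    by (rule path_P[OF Icc_path_measurable[OF op_meas]])
  have "(\<integral>\<^sup>+\<omega>. ennreal (norm (LINT s:{0..t}|lborel. classical_op a b u (X s \<omega>))) \<partial>P x)
      \<le> (\<integral>\<^sup>+\<omega>. (\<integral>\<^sup>+s\<in>{0..t}. ennreal \<bar>classical_op a b u (X s \<omega>)\<bar> \<partial>lborel) \<partial>P x)"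
    unfolding set_lebesgue_integral_def
    by (intro nn_integral_mono order_trans[OF norm_integral_le_nn_integral]) (simp add: indicator_def)
  also have "\<dots> < \<infinity>" using op_finite[OF t] .
  finally show "(\<integral>\<^sup>+\<omega>. ennreal (norm (LINT s:{0..t}|lborel. classical_op a b u (X s \<omega>))) \<partial>P x) < \<infinity>" .
qed

lemma u_path_integrable:
  assumes "f \<in> borel_measurable path_alg" "\<And>\<omega>. \<omega> \<in> space M \<Longrightarrow> 0 \<le> f \<omega>"
  shows "integrable (P x) (\<lambda>\<omega>. u (X (f \<omega>) \<omega>))"
proof -
  interpret prob_space "P x" by (rule prob)
  obtain C where C: "\<And>x. \<bar>u x\<bar> \<le> C" using u_bounded by blast
  show ?thesis
    using C measurable_compose[OF path_P[OF X_joint'[OF assms]] Ck_borel[OF u(1)]]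
    by (intro integrable_const_bound[where B=C]) auto
qed

lemma mart_measurable: "0 \<le> t \<Longrightarrow> mart t \<in> borel_measurable path_alg"
  unfolding mart_def[abs_def] using Icc_path_measurable[OF op_meas]
    measurable_compose[OF X_path Ck_borel[OF u(1)], of t] measurable_compose[OF X_path Ck_borel[OF u(1)], of 0]
  by (intro borel_measurable_diff) auto

lemma mart_integrable: "0 \<le> t \<Longrightarrow> integrable (P x) (mart t)"
  unfolding mart_def[abs_def]
  using u_path_integrable[of "\<lambda>_. t" x] u_path_integrable[of "\<lambda>_. 0" x] op_path_integrable by auto

lemma mart_expectation: 
  assumes t: "0 \<le> t" shows "(\<integral>\<omega>. mart t \<omega> \<partial>P x) = 0"
proof -
  interpret prob_space "P x" by (rule prob)
  have 0: "(\<integral>\<omega>. u (X 0 \<omega>) \<partial>P x) = (\<integral>\<omega>. u x \<partial>P x)"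
    using start[of x] u_path_integrable[of "\<lambda>_. 0" x, THEN borel_measurable_integrable]
    by (intro integral_cong_AE) auto
  have "(\<integral>\<omega>. mart t \<omega> \<partial>P x) = (\<integral>\<omega>. u (X t \<omega>) \<partial>P x) - (\<integral>\<omega>. u (X 0 \<omega>) \<partial>P x)
      - (\<integral>\<omega>. (LINT s:{0..t}|lborel. classical_op a b u (X s \<omega>)) \<partial>P x)"
    unfolding mart_def using u_path_integrable[of "\<lambda>_. t" x] u_path_integrable[of "\<lambda>_. 0" x] op_path_integrable[OF t] t by simp
  then show ?thesis using dynkin_formula[OF t u, of x] 0 prob_space by simp
qed

text \<open>A time integral may be split at an intermediate time only if the integrand is integrable
  along the path, since otherwise the Bochner integral is 0 by convention. Hence the pathwise
  identities below are almost sure ones.\<close>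

lemma op_set_integrable_AE:
  assumes t: "0 \<le> t"
  shows "AE \<omega> in P x. set_integrable lborel {0..t} (\<lambda>s. classical_op a b u (X s \<omega>))"
proof -
  have m: "(\<lambda>\<omega>. \<integral>\<^sup>+s\<in>{0..t}. ennreal \<bar>classical_op a b u (X s \<omega>)\<bar> \<partial>lborel) \<in> borel_measurable (P x)"
    using op_meas by (intro path_P Icc_path_nn_measurable[where h="\<lambda>y. ennreal \<bar>classical_op a b u y\<bar>"]) measurable
  have "(\<integral>\<^sup>+\<omega>. (\<integral>\<^sup>+s\<in>{0..t}. ennreal \<bar>classical_op a b u (X s \<omega>)\<bar> \<partial>lborel) \<partial>P x) \<noteq> \<infinity>"
    using op_finite[OF t, of x] by simp
  from nn_integral_PInf_AE[OF m this] AE_space show ?thesis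
  proof eventually_elim
    case (elim \<omega>)
    then have w: "\<omega> \<in> space M" by simp
    have "(\<integral>\<^sup>+s. ennreal (norm (indicator {0..t} s *\<^sub>R classical_op a b u (X s \<omega>))) \<partial>lborel)
      = (\<integral>\<^sup>+s\<in>{0..t}. ennreal \<bar>classical_op a b u (X s \<omega>)\<bar> \<partial>lborel)"
      by (intro nn_integral_cong) (simp add: indicator_def)
    also have "\<dots> < \<infinity>" using elim by (simp add: less_top)
    finally show ?case
      using path_measurable[OF op_meas w, of "{0..t}"] unfolding set_integrable_def set_borel_measurable_def
      by (intro integrableI_bounded) auto
  qed
qed

text \<open>\<open>mart\<close> is an additive functional: the terms at time \<open>t\<close>
  telescope, and the integral over the later times is the integral along the shifted path after a
  translation of the time variable.\<close>

lemma mart_shift: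
  assumes w: "\<omega> \<in> space M" and t: "0 \<le> t" "t \<le> T"
    and i: "set_integrable lborel {0..T} (\<lambda>s. classical_op a b u (X s \<omega>))"
  shows "mart T \<omega> - mart t \<omega> = mart (T - t) (theta t \<omega>)"
proof -
  let ?g = "\<lambda>s. classical_op a b u (X s \<omega>)"
  have i1: "set_integrable lborel {0..t} ?g" and i2: "set_integrable lborel {t<..T} ?g"
    by (rule set_integrable_subset[OF i]; use t in auto)+
  have "{0..T} = {0..t} \<union> {t<..T}" using t by auto
  then have "(LINT s:{0..T}|lborel. ?g s) = (LINT s:{0..t}|lborel. ?g s) + (LINT s:{t<..T}|lborel. ?g s)"
    by (simp add: set_integral_Un[OF _ i1 i2] ivl_disj_int)
  also have "(LINT s:{t<..T}|lborel. ?g s) = (LINT s:{t..T}|lborel. ?g s)"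
  proof -
    have i3: "set_integrable lborel {t..T} ?g" by (rule set_integrable_subset[OF i]) (use t in auto)
    have "AE s in lborel. s \<noteq> t" by (rule AE_lborel_singleton)
    then have "AE s in lborel. indicator {t<..T} s *\<^sub>R ?g s = indicator {t..T} s *\<^sub>R ?g s"
      by eventually_elim (auto simp: indicator_def)
    then show ?thesis
      using i2 i3 unfolding set_lebesgue_integral_def set_integrable_def by (intro integral_cong_AE) auto
  qed
  also have "\<dots> = (LINT s:{0..T - t}|lborel. ?g (t + s))"
    unfolding set_lebesgue_integral_def
    by (subst lborel_integral_real_affine[where c=1 and t=t])
      (auto intro!: Bochner_Integration.integral_cong simp: indicator_def)
  also have "\<dots> = (LINT s:{0..T - t}|lborel. classical_op a b u (X s (theta t \<omega>)))"
    by (rule set_lebesgue_integral_cong) (auto simp: theta(2)[OF t(1) w])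
  finally show ?thesis
    unfolding mart_def using theta(2)[OF t(1) w, of 0] theta(2)[OF t(1) w, of "T - t"] t by simp
qed

text \<open>Given the past, the increment is \<open>mart (T - t)\<close> for the process started
  afresh at \<open>X t\<close>, and this has mean zero for every starting point.\<close>

lemma mart_increment:
  assumes t: "0 \<le> t" "t \<le> T" and A: "A \<in> sets (F t)"
  shows "(\<integral>\<omega>. indicator A \<omega> * (mart T \<omega> - mart t \<omega>) \<partial>P x) = 0"
proof -
  have Tt: "0 \<le> T - t" "0 \<le> T" using t by auto
  have AP: "A \<in> sets (P x)" using sets_F[OF t(1) A] .
  have ae: "AE \<omega> in P x. indicator A \<omega> * (mart T \<omega> - mart t \<omega>) = indicator A \<omega> * mart (T - t) (theta t \<omega>)"
    using op_set_integrable_AE[OF Tt(2)] AE_space by eventually_elim (simp add: mart_shift[OF _ t])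
  have m: "(\<lambda>\<omega>. indicator A \<omega> * mart (T - t) (theta t \<omega>)) \<in> borel_measurable (P x)"
    using measurable_compose[OF theta_measurable_P[OF t(1)] mart_measurable[OF Tt(1)]] AP
    by (intro borel_measurable_times) auto
  have m2: "(\<lambda>\<omega>. indicator A \<omega> * (mart T \<omega> - mart t \<omega>)) \<in> borel_measurable (P x)"
    using path_P[OF mart_measurable[OF Tt(2)], of x] path_P[OF mart_measurable[OF t(1)], of x] AP
    by (intro borel_measurable_times borel_measurable_diff) auto
  have "integrable (P x) (\<lambda>\<omega>. indicator A \<omega> * (mart T \<omega> - mart t \<omega>))"
    using integrable_mult_indicator[OF AP, of "\<lambda>\<omega>. mart T \<omega> - mart t \<omega>"] mart_integrable[OF Tt(2), of x] mart_integrable[OF t(1), of x]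
    by auto
  then have i: "integrable (P x) (\<lambda>\<omega>. indicator A \<omega> * mart (T - t) (theta t \<omega>))"
    using integrable_cong_AE[OF m2 m ae] by simp
  have "(\<integral>\<omega>. indicator A \<omega> * (mart T \<omega> - mart t \<omega>) \<partial>P x) = (\<integral>\<omega>. indicator A \<omega> * mart (T - t) (theta t \<omega>) \<partial>P x)"
    by (rule integral_cong_AE[OF m2 m ae])
  also have "\<dots> = 0"
    unfolding markov_integral(2)[OF t(1) A mart_measurable[OF Tt(1)] mart_integrable[OF Tt(1)] i]
    by (simp add: mart_expectation[OF Tt(1)])
  finally show ?thesis .
qed

text \<open>Optional stopping for a time with finitely many values: the increment from the grid time
  to \<open>T\<close> is split according to the value of \<open>grid\<close>, and each piece is an
  increment over a past event.\<close>

lemma mart_grid: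
  assumes n: "0 < n" and T: "0 < T"
  shows "integrable (P x) (\<lambda>\<omega>. mart (real (grid c r T n \<omega>) * T / real n) \<omega>)"
    and "(\<integral>\<omega>. mart (real (grid c r T n \<omega>) * T / real n) \<omega> \<partial>P x) = 0"
proof -
  let ?A = "\<lambda>k. {\<omega> \<in> space M. grid c r T n \<omega> = k}"
  let ?t = "\<lambda>k. real k * T / real n"
  have t: "0 \<le> ?t k" "k \<le> n \<Longrightarrow> ?t k \<le> T" for k using T n by (auto simp: divide_le_eq)
  have AP: "?A k \<in> sets (P x)" if "k \<le> n" for k using sets_F[OF t(1) grid_event[OF n T that]] .
  have dec: "mart T \<omega> - mart (?t (grid c r T n \<omega>)) \<omega> = (\<Sum>k\<le>n. indicator (?A k) \<omega> * (mart T \<omega> - mart (?t k) \<omega>))"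
    if "\<omega> \<in> space M" for \<omega>
  proof -
    have "(\<Sum>k\<le>n. indicator (?A k) \<omega> * (mart T \<omega> - mart (?t k) \<omega>))
      = (\<Sum>k\<le>n. if k = grid c r T n \<omega> then mart T \<omega> - mart (?t k) \<omega> else 0)"
      using that by (intro sum.cong) (auto simp: indicator_def)
    then show ?thesis using grid_le[OF n T, of c r \<omega>] by simp
  qed
  have ik: "integrable (P x) (\<lambda>\<omega>. indicator (?A k) \<omega> * (mart T \<omega> - mart (?t k) \<omega>))" if "k \<le> n" for k
    using integrable_mult_indicator[OF AP[OF that], of "\<lambda>\<omega>. mart T \<omega> - mart (?t k) \<omega>"] mart_integrable[OF t(1), of x] mart_integrable[of T x] T
    by auto
  have isum: "integrable (P x) (\<lambda>\<omega>. \<Sum>k\<le>n. indicator (?A k) \<omega> * (mart T \<omega> - mart (?t k) \<omega>))"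
    by (intro Bochner_Integration.integrable_sum ik) simp
  have id: "integrable (P x) (\<lambda>\<omega>. mart T \<omega> - mart (?t (grid c r T n \<omega>)) \<omega>)"
    using isum by (rule Bochner_Integration.integrable_cong[THEN iffD1, rotated 2]) (auto simp: dec)
  have "(\<integral>\<omega>. mart T \<omega> - mart (?t (grid c r T n \<omega>)) \<omega> \<partial>P x)
      = (\<integral>\<omega>. (\<Sum>k\<le>n. indicator (?A k) \<omega> * (mart T \<omega> - mart (?t k) \<omega>)) \<partial>P x)"
    by (intro Bochner_Integration.integral_cong) (auto simp: dec)
  also have "\<dots> = (\<Sum>k\<le>n. (\<integral>\<omega>. indicator (?A k) \<omega> * (mart T \<omega> - mart (?t k) \<omega>) \<partial>P x))"
    using ik by (intro Bochner_Integration.integral_sum) auto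
  also have "\<dots> = 0" using mart_increment[OF t(1) t(2) grid_event[OF n T]] by simp
  finally have e: "(\<integral>\<omega>. mart T \<omega> - mart (?t (grid c r T n \<omega>)) \<omega> \<partial>P x) = 0" .
  have iT: "integrable (P x) (mart T)" using mart_integrable T by simp
  have "integrable (P x) (\<lambda>\<omega>. mart T \<omega> - (mart T \<omega> - mart (?t (grid c r T n \<omega>)) \<omega>))"
    using iT id by (rule Bochner_Integration.integrable_diff)
  then show ig: "integrable (P x) (\<lambda>\<omega>. mart (?t (grid c r T n \<omega>)) \<omega>)" by simp
  show "(\<integral>\<omega>. mart (?t (grid c r T n \<omega>)) \<omega> \<partial>P x) = 0"
    using Bochner_Integration.integral_diff[OF iT ig] e mart_expectation[of T x] T by simp
qed

text \<open>The grid times converge to the stopped time from above, \<open>u\<close> and the path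
  are continuous, and the time integral is continuous in its upper limit. The bound
  \<open>2 * C + ?J\<close>, which is the same for all grids, allows passing to the limit under the
  expectation.\<close>

lemma dynkin_stopped:
  assumes T: "0 < T"
  shows "integrable (P x) (\<lambda>\<omega>. u (X (stop c r T \<omega>) \<omega>))"
    and "integrable (P x) (\<lambda>\<omega>. LINT s:{0..stop c r T \<omega>}|lborel. classical_op a b u (X s \<omega>))"
    and "(\<integral>\<omega>. u (X (stop c r T \<omega>) \<omega>) \<partial>P x)
      = u x + (\<integral>\<omega>. (LINT s:{0..stop c r T \<omega>}|lborel. classical_op a b u (X s \<omega>)) \<partial>P x)"
proof -
  interpret prob_space "P x" by (rule prob)
  let ?g = "classical_op a b u"
  let ?t = "\<lambda>n \<omega>. real (grid c r T (Suc n) \<omega>) * T / real (Suc n)"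
  \<comment> \<open>Dominates the integral up to any random time not after \<open>T\<close>.\<close>
  let ?J = "\<lambda>\<omega>. LINT s:{0..T}|lborel. \<bar>?g (X s \<omega>)\<bar>"
  obtain C where C: "0 \<le> C" "\<And>x. \<bar>u x\<bar> \<le> C" using u_bounded by blast
  have ga: "(\<lambda>y. \<bar>?g y\<bar>) \<in> borel_measurable borel" using op_meas by measurable
  have st: "0 \<le> stop c r T \<omega>" "stop c r T \<omega> \<le> T" for \<omega> using stop_bounds T by auto
  have tb: "0 \<le> ?t n \<omega>" "?t n \<omega> \<le> T" for n \<omega>
    using grid_le[of "Suc n" T c r \<omega>] T by (auto simp: divide_le_eq simp del: of_nat_Suc)
  show i1: "integrable (P x) (\<lambda>\<omega>. u (X (stop c r T \<omega>) \<omega>))"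
    using st by (intro u_path_integrable) auto
  have pred: "Measurable.pred (path_alg \<Otimes>\<^sub>M borel) (\<lambda>(\<omega>, s). s \<in> {0..stop c r T \<omega>})"
    unfolding case_prod_beta atLeastAtMost_iff by measurable
  have m2: "(\<lambda>\<omega>. LINT s:{0..stop c r T \<omega>}|lborel. ?g (X s \<omega>)) \<in> borel_measurable (P x)"
    by (intro path_P path_integral_measurable[OF op_meas _ pred]) auto
  have iJ: "integrable (P x) ?J"
  proof (rule integrableI_bounded)
    show "?J \<in> borel_measurable (P x)" by (rule path_P[OF Icc_path_measurable[OF ga]])
    have "(\<integral>\<^sup>+\<omega>. ennreal (norm (?J \<omega>)) \<partial>P x) \<le> (\<integral>\<^sup>+\<omega>. (\<integral>\<^sup>+s\<in>{0..T}. ennreal \<bar>?g (X s \<omega>)\<bar> \<partial>lborel) \<partial>P x)"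
      unfolding set_lebesgue_integral_def
      by (intro nn_integral_mono order_trans[OF norm_integral_le_nn_integral]) (simp add: indicator_def)
    also have "\<dots> < \<infinity>" using T by (intro op_finite) simp
    finally show "(\<integral>\<^sup>+\<omega>. ennreal (norm (?J \<omega>)) \<partial>P x) < \<infinity>" .
  qed
  have ae: "AE \<omega> in P x. set_integrable lborel {0..T} (\<lambda>s. ?g (X s \<omega>))"
    using op_set_integrable_AE T by simp
  have dom: "\<bar>LINT s:{0..t}|lborel. ?g (X s \<omega>)\<bar> \<le> ?J \<omega>"
    if i: "set_integrable lborel {0..T} (\<lambda>s. ?g (X s \<omega>))" and "t \<le> T" for \<omega> t
  proof -
    have it: "set_integrable lborel {0..t} (\<lambda>s. ?g (X s \<omega>))" by (rule set_integrable_subset[OF i]) (use that in auto)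
    have "\<bar>LINT s:{0..t}|lborel. ?g (X s \<omega>)\<bar> \<le> (LINT s:{0..t}|lborel. \<bar>?g (X s \<omega>)\<bar>)"
      using set_integral_norm_bound[OF it] by simp
    also have "\<dots> \<le> ?J \<omega>"
      using set_integrable_abs[OF it] set_integrable_abs[OF i] that
      unfolding set_lebesgue_integral_def set_integrable_def
      by (intro integral_mono) (auto simp: indicator_def)
    finally show ?thesis .
  qed
  show i2: "integrable (P x) (\<lambda>\<omega>. LINT s:{0..stop c r T \<omega>}|lborel. ?g (X s \<omega>))"
    using iJ m2 by (rule Bochner_Integration.integrable_bound) (use ae dom st in \<open>auto elim!: eventually_mono intro!: order_trans[OF dom]\<close>)
  have lim: "AE \<omega> in P x. (\<lambda>n. mart (?t n \<omega>) \<omega>) \<longlonglongrightarrow> mart (stop c r T \<omega>) \<omega>"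
    using ae AE_space
  proof eventually_elim
    case (elim \<omega>)
    then have w: "\<omega> \<in> space M" and i: "set_integrable lborel {0..T} (\<lambda>s. ?g (X s \<omega>))" by auto
    have 1: "(\<lambda>n. u (X (?t n \<omega>) \<omega>)) \<longlonglongrightarrow> u (X (stop c r T \<omega>) \<omega>)"
      using X_grid_tendsto[OF T w] Ck_continuous[OF u(1)]
      by (intro continuous_on_tendsto_compose[where f=u and s=UNIV]) auto
    have 2: "(\<lambda>n. LINT s:{0..?t n \<omega>}|lborel. ?g (X s \<omega>)) \<longlonglongrightarrow> (LINT s:{0..stop c r T \<omega>}|lborel. ?g (X s \<omega>))"
      unfolding set_lebesgue_integral_def
    proof (rule integral_dominated_convergence)
      show "integrable lborel (\<lambda>s. norm (indicator {0..T} s *\<^sub>R ?g (X s \<omega>)))"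
        using i unfolding set_integrable_def by (rule integrable_norm)
      show "(\<lambda>s. indicator {0..stop c r T \<omega>} s *\<^sub>R ?g (X s \<omega>)) \<in> borel_measurable lborel"
        using path_measurable[OF op_meas w] by (auto simp: set_borel_measurable_def)
      show "(\<lambda>s. indicator {0..?t n \<omega>} s *\<^sub>R ?g (X s \<omega>)) \<in> borel_measurable lborel" for n
        using path_measurable[OF op_meas w, of "{0..?t n \<omega>}"] by (auto simp: set_borel_measurable_def)
      show "AE s in lborel. norm (indicator {0..?t n \<omega>} s *\<^sub>R ?g (X s \<omega>)) \<le> norm (indicator {0..T} s *\<^sub>R ?g (X s \<omega>))" for n
        using tb(2)[of n \<omega>] by (intro AE_I2) (auto simp: indicator_def)
      have "AE s in lborel. s \<noteq> stop c r T \<omega>" by (rule AE_lborel_singleton)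
      then show "AE s in lborel. (\<lambda>n. indicator {0..?t n \<omega>} s *\<^sub>R ?g (X s \<omega>)) \<longlonglongrightarrow> indicator {0..stop c r T \<omega>} s *\<^sub>R ?g (X s \<omega>)"
      proof eventually_elim
        case (elim s)
        have "\<forall>\<^sub>F n in sequentially. indicator {0..?t n \<omega>} s = (indicator {0..stop c r T \<omega>} s :: real)"
        proof (cases "s < stop c r T \<omega>")
          case True
          from order_tendstoD(1)[OF grid_tendsto[OF T] this] show ?thesis
            by eventually_elim (use True in \<open>auto simp: indicator_def\<close>)
        next
          case False
          with elim have "stop c r T \<omega> < s" by simp
          from order_tendstoD(2)[OF grid_tendsto[OF T] this] show ?thesis
            by eventually_elim (use False elim in \<open>auto simp: indicator_def\<close>)
        qed
        then have "\<forall>\<^sub>F n in sequentially. indicator {0..stop c r T \<omega>} s *\<^sub>R ?g (X s \<omega>) = indicator {0..?t n \<omega>} s *\<^sub>R ?g (X s \<omega>)"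
          by eventually_elim simp
        from Lim_transform_eventually[OF tendsto_const this] show ?case .
      qed
    qed
    show ?case unfolding mart_def by (intro tendsto_intros 1 2)
  qed
  have "(\<lambda>n. \<integral>\<omega>. mart (?t n \<omega>) \<omega> \<partial>P x) \<longlonglongrightarrow> (\<integral>\<omega>. mart (stop c r T \<omega>) \<omega> \<partial>P x)"
  proof (rule integral_dominated_convergence)
    show "integrable (P x) (\<lambda>\<omega>. 2 * C + ?J \<omega>)" using iJ by simp
    show "(\<lambda>\<omega>. mart (stop c r T \<omega>) \<omega>) \<in> borel_measurable (P x)"
      unfolding mart_def
      using m2 i1[THEN borel_measurable_integrable] u_path_integrable[of "\<lambda>_. 0" x, THEN borel_measurable_integrable]
      by (intro borel_measurable_diff) auto
    show "(\<lambda>\<omega>. mart (?t n \<omega>) \<omega>) \<in> borel_measurable (P x)" for n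
      using mart_grid(1)[of "Suc n" T x c r] T by (auto dest: borel_measurable_integrable)
    show "AE \<omega> in P x. norm (mart (?t n \<omega>) \<omega>) \<le> 2 * C + ?J \<omega>" for n
      using ae
    proof eventually_elim
      case (elim \<omega>)
      then show ?case
        unfolding mart_def real_norm_def using dom[OF elim tb(2)[of n \<omega>]] C(2)[of "X (?t n \<omega>) \<omega>"] C(2)[of "X 0 \<omega>"] by linarith
    qed
  qed (rule lim)
  moreover have "(\<integral>\<omega>. mart (?t n \<omega>) \<omega> \<partial>P x) = 0" for n by (rule mart_grid(2)[OF _ T]) simp
  ultimately have z: "(\<integral>\<omega>. mart (stop c r T \<omega>) \<omega> \<partial>P x) = 0"
    by (simp add: LIMSEQ_const_iff)
  have 0: "(\<integral>\<omega>. u (X 0 \<omega>) \<partial>P x) = (\<integral>\<omega>. u x \<partial>P x)"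
    using start[of x] u_path_integrable[of "\<lambda>_. 0" x, THEN borel_measurable_integrable]
    by (intro integral_cong_AE) auto
  have "(\<integral>\<omega>. mart (stop c r T \<omega>) \<omega> \<partial>P x) = (\<integral>\<omega>. u (X (stop c r T \<omega>) \<omega>) \<partial>P x) - (\<integral>\<omega>. u (X 0 \<omega>) \<partial>P x)
      - (\<integral>\<omega>. (LINT s:{0..stop c r T \<omega>}|lborel. ?g (X s \<omega>)) \<partial>P x)"
    unfolding mart_def using i1 i2 u_path_integrable[of "\<lambda>_. 0" x] by simp
  with z 0 prob_space show "(\<integral>\<omega>. u (X (stop c r T \<omega>) \<omega>) \<partial>P x)
      = u x + (\<integral>\<omega>. (LINT s:{0..stop c r T \<omega>}|lborel. ?g (X s \<omega>)) \<partial>P x)" by simp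
qed

end

end

section \<open>Exit estimates at arbitrary starting points\<close>

lemma has_derivative_translate:
  fixes u :: "real^'n \<Rightarrow> real"
  assumes "(u has_derivative D) (at (x - c))"
  shows "((\<lambda>y. u (y - c)) has_derivative D) (at x)"
proof -
  have "((\<lambda>y. y - c) has_derivative (\<lambda>h. h)) (at x)" by (auto intro!: derivative_eq_intros)
  from has_derivative_compose[OF this assms] show ?thesis .
qed

lemma partial_deriv_translate:
  fixes u :: "real^'n \<Rightarrow> real"
  assumes "u differentiable at (x - c)"
  shows "partial_deriv i (\<lambda>y. u (y - c)) x = partial_deriv i u (x - c)"
proof -
  have "(u has_derivative frechet_derivative u (at (x - c))) (at (x - c))"
    using assms frechet_derivative_works by blast
  from has_derivative_translate[OF this] show ?thesis
    unfolding partial_deriv_def by (simp add: frechet_derivative_at[symmetric])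
qed

lemma Ck_translate: "Ck k u \<Longrightarrow> Ck k (\<lambda>y. u (y - c))"
proof (induction k arbitrary: u)
  case 0
  then show ?case
    by (auto intro!: continuous_on_compose2[of UNIV u UNIV "\<lambda>y. y - c"] continuous_intros)
next
  case (Suc k)
  then have d: "u differentiable at x" for x by simp
  have "(\<lambda>y. u (y - c)) differentiable at x" for x
    using d[of "x - c"] has_derivative_translate unfolding differentiable_def by blast
  moreover have "partial_deriv i (\<lambda>y. u (y - c)) = (\<lambda>y. partial_deriv i u (y - c))" for i
    using partial_deriv_translate[OF d] by auto
  ultimately show ?case using Suc by simp
qed

lemma compactly_supported_translate:
  assumes "compactly_supported_in UNIV u"
  shows "compactly_supported_in UNIV (\<lambda>y. u (y - c))"
proof -
  have "{y. u (y - c) \<noteq> 0} = (+) c ` {y. u y \<noteq> 0}" by (force simp: image_iff algebra_simps)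
  then show ?thesis
    using assms by (simp add: compactly_supported_in_def closure_translation compact_translation)
qed

lemma classical_op_translate:
  assumes "Ck 2 u"
  shows "classical_op a b (\<lambda>y. u (y - c)) x = classical_op (\<lambda>y. a (y + c)) (\<lambda>y. b (y + c)) u (x - c)"
proof -
  have d: "u differentiable at x" "partial_deriv i u differentiable at x" for x i
    using assms by (simp_all add: numeral_2_eq_2)
  have "partial_deriv i (\<lambda>y. u (y - c)) = (\<lambda>y. partial_deriv i u (y - c))" for i
    using partial_deriv_translate[OF d(1)] by auto
  then show ?thesis
    unfolding diff_op_def by (simp add: partial_deriv_translate[OF d(2)])
qed

text \<open>The operator has variable coefficients, so moving the origin to \<open>c\<close> must
  move \<open>a\<close> and \<open>b\<close> as well. The filtration stays the same, and the process
  started at \<open>y\<close> becomes the one started at \<open>y + c\<close>.\<close>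

lemma (in quasi_diffusion) translate:
  "quasi_diffusion M (\<lambda>t \<omega>. X t \<omega> - c) F (\<lambda>y. P (y + c)) (\<lambda>y. a (y + c)) (\<lambda>y. b (y + c))"
proof (intro quasi_diffusion.intro quasi_diffusion_axioms.intro continuous_markov_process.intro)
  have vm: "(\<lambda>y. y - c) -` \<Gamma> \<in> sets borel" if "\<Gamma> \<in> sets borel" for \<Gamma> :: "(real^'n) set"
    using measurable_sets[OF _ that, of "\<lambda>y. y - c" borel] by simp
  fix t s :: real and x :: "real^'n" and \<Gamma> :: "(real^'n) set" and \<omega> and u :: "real^'n \<Rightarrow> real"
  show "prob_space (P (x + c))" by (rule prob)
  show "sets (P (x + c)) = sets M" by (rule sets_P)
  show "0 \<le> t \<Longrightarrow> subalgebra M (F t)" by (rule subalg)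
  show "0 \<le> s \<Longrightarrow> s \<le> t \<Longrightarrow> sets (F s) \<subseteq> sets (F t)" by (rule filtr)
  show "0 \<le> t \<Longrightarrow> (\<lambda>\<omega>. X t \<omega> - c) \<in> borel_measurable (F t)" using adapted by measurable
  show "\<omega> \<in> space M \<Longrightarrow> continuous_on {0..} (\<lambda>t. X t \<omega> - c)"
    using continuous by (intro continuous_intros)
  show "AE \<omega> in P (x + c). X 0 \<omega> - c = x" using start[of "x + c"] by eventually_elim simp
  show "0 \<le> t \<Longrightarrow> \<Gamma> \<in> sets borel \<Longrightarrow>
      (\<lambda>x. measure (P (x + c)) {\<omega> \<in> space M. X t \<omega> - c \<in> \<Gamma>}) \<in> borel_measurable borel"
    using measurable_compose[OF _ transition_measurable[OF _ vm], of "\<lambda>x. x + c" borel t \<Gamma>] by simp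
  show "AE \<omega> in P (x + c). real_cond_exp (P (x + c)) (F t) (\<lambda>\<omega>'. indicator \<Gamma> (X (t + s) \<omega>' - c)) \<omega>
      = measure (P (X t \<omega> - c + c)) {\<omega>' \<in> space M. X s \<omega>' - c \<in> \<Gamma>}"
    if "0 \<le> t" "0 \<le> s" "\<Gamma> \<in> sets borel"
  proof -
    have "(\<lambda>\<omega>'. indicator ((\<lambda>y. y - c) -` \<Gamma>) (X (t + s) \<omega>') :: real) = (\<lambda>\<omega>'. indicator \<Gamma> (X (t + s) \<omega>' - c))"
      by (auto simp: indicator_def)
    then show ?thesis using markov[OF that(1,2) vm[OF that(3)], of "x + c"] by simp
  qed
  show "\<exists>\<omega>'\<in>space M. \<forall>s\<ge>0. X s \<omega>' - c = X (t + s) \<omega> - c" if "0 \<le> t" "\<omega> \<in> space M"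
    using shift[OF that] by auto
  show "(\<integral>\<^sup>+\<omega>. (\<integral>\<^sup>+s\<in>{0..t}. ennreal (norm (b (X s \<omega> - c + c))) \<partial>lborel) \<partial>P (x + c)) < \<infinity>" if "0 \<le> t"
    using drift_integrable[OF that, of "x + c"] by simp
  show "u x = (LINT \<omega>|P (x + c). u (X t \<omega> - c))
      - (LINT \<omega>|P (x + c). (LINT s:{0..t}|lborel. classical_op (\<lambda>y. a (y + c)) (\<lambda>y. b (y + c)) u (X s \<omega> - c)))"
    if "0 \<le> t" "Ck 2 u" "compactly_supported_in UNIV u"
    using dynkin_formula[OF that(1) Ck_translate[OF that(2)] compactly_supported_translate[OF that(3)], of "x + c" c]
    by (simp add: classical_op_translate[OF that(2)])
qed

lemma nn_integral_lborel_translate: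
  fixes f :: "real^'n \<Rightarrow> ennreal"
  assumes "f \<in> borel_measurable borel"
  shows "(\<integral>\<^sup>+y. f (y + c) \<partial>lborel) = (\<integral>\<^sup>+y. f y \<partial>lborel)"
proof -
  have "(\<integral>\<^sup>+y. f y \<partial>lborel) = (\<integral>\<^sup>+y. f y \<partial>distr lborel borel ((+) c))" by (simp add: lborel_distr_plus)
  also have "\<dots> = (\<integral>\<^sup>+y. f (c + y) \<partial>lborel)" using assms by (intro nn_integral_distr) auto
  finally show ?thesis by (simp add: add.commute)
qed

lemma Lp_norm_translate:
  fixes f :: "real^'n \<Rightarrow> 'b::{real_normed_vector, second_countable_topology}"
  assumes [measurable]: "f \<in> borel_measurable borel" "S \<in> sets borel"
  shows "Lp_norm p ((\<lambda>y. y + c) -` S) (\<lambda>y. f (y + c)) = Lp_norm p S f"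
proof -
  have "(\<integral>\<^sup>+x\<in>(\<lambda>y. y + c) -` S. ennreal (norm (f (x + c)) powr p) \<partial>lborel)
    = (\<integral>\<^sup>+x. (\<lambda>x. ennreal (norm (f x) powr p) * indicator S x) (x + c) \<partial>lborel)"
    by (intro nn_integral_cong) (simp add: indicator_def)
  also have "\<dots> = (\<integral>\<^sup>+x\<in>S. ennreal (norm (f x) powr p) \<partial>lborel)"
    by (rule nn_integral_lborel_translate) measurable
  finally show ?thesis by (simp add: Lp_norm_def)
qed

lemma admissible_translate:
  assumes "admissible_coeffs \<delta> B a b"
  shows "admissible_coeffs \<delta> B (\<lambda>y. a (y + c)) (\<lambda>y. b (y + c))"
proof -
  have m[measurable]: "a \<in> borel_measurable borel" "b \<in> borel_measurable borel"
    using assms by (auto simp: admissible_coeffs_def)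
  have "(\<lambda>y. a (y + c)) \<in> borel_measurable borel" "(\<lambda>y. b (y + c)) \<in> borel_measurable borel" by measurable
  then show ?thesis
    using assms Lp_norm_translate[OF m(2), of UNIV "real CARD('a)" c] by (simp add: admissible_coeffs_def)
qed

text \<open>One constant \<open>N\<close> serves all centres \<open>c\<close>: the assumed estimate
  is uniform over all admissible coefficients, and translated coefficients are admissible with the
  same bound because the norm of the drift over the whole space is invariant.\<close>

lemma (in quasi_diffusion) exit_estimate_at:
  assumes adm: "admissible_coeffs \<delta> B a b" and est: "exit_estimate TYPE('w) TYPE('n) \<delta> B p"
  shows "\<exists>N>0. \<forall>c r f. 0 < r \<longrightarrow> f \<in> borel_measurable borel \<longrightarrow> (\<forall>x. 0 \<le> f x) \<longrightarrow>
    (\<integral>\<^sup>+\<omega>. (\<integral>\<^sup>+t\<in>before c r \<omega>. ennreal (f (X t \<omega>)) \<partial>lborel) \<partial>P c)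
      \<le> ennreal (N * r powr (2 - real CARD('n) / p)) * Lp_norm p (ball c r) f"
proof -
  obtain N where N: "0 < N" and e: "\<And>a b (M :: 'w measure) (X :: real \<Rightarrow> 'w \<Rightarrow> real^'n) F P R f.
        admissible_coeffs \<delta> B a b \<Longrightarrow> quasi_diffusion M X F P a b \<Longrightarrow>
        0 < R \<Longrightarrow> f \<in> borel_measurable borel \<Longrightarrow> (\<And>x. 0 \<le> f x) \<Longrightarrow>
           (\<integral>\<^sup>+\<omega>. (\<integral>\<^sup>+t\<in>before_exit X R \<omega>. ennreal (f (X t \<omega>)) \<partial>lborel) \<partial>P 0)
             \<le> ennreal (N * R powr (2 - real CARD('n) / p)) * Lp_norm p (ball 0 R) f"
    using est unfolding exit_estimate_def by blast
  show ?thesis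
  proof (intro exI[of _ N] conjI N allI impI)
    fix c :: "real^'n" and r :: real and f :: "real^'n \<Rightarrow> real"
    assume r: "0 < r" and f[measurable]: "f \<in> borel_measurable borel" and "\<forall>x. 0 \<le> f x"
    then have f0: "0 \<le> f x" for x by blast
    have fc: "(\<lambda>y. f (y + c)) \<in> borel_measurable borel" by measurable
    have bc: "(\<lambda>y. y + c) -` ball c r = ball 0 r" by (auto simp: dist_norm)
    have be: "before_exit (\<lambda>t \<omega>. X t \<omega> - c) r = before c r"
      by (simp add: fun_eq_iff before_exit_def before_def exit_from_def)
    show "(\<integral>\<^sup>+\<omega>. (\<integral>\<^sup>+t\<in>before c r \<omega>. ennreal (f (X t \<omega>)) \<partial>lborel) \<partial>P c)
      \<le> ennreal (N * r powr (2 - real CARD('n) / p)) * Lp_norm p (ball c r) f"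
      using e[OF admissible_translate[OF adm] translate r fc f0, of c] Lp_norm_translate[OF f, of "ball c r" p c]
      by (simp add: bc be)
  qed
qed

section \<open>The value at the stopped exit time\<close>

context continuous_markov_process
begin

text \<open>The random variable behind \<open>prob_solution\<close>. It is kept as a function of the
  path so that it can be shifted before any expectation is taken.\<close>

definition payoff :: "real \<Rightarrow> (real^'n \<Rightarrow> real) \<Rightarrow> (real^'n \<Rightarrow> real) \<Rightarrow> 'w \<Rightarrow> real" where
  "payoff r f g \<omega> = (LINT t:before 0 r \<omega>|lborel. f (X t \<omega>))
     + (if exit_from 0 r \<omega> < \<infinity> then g (X (real_of_ereal (exit_from 0 r \<omega>)) \<omega>) else 0)"

lemma real_exit_nonneg: "0 \<le> real_of_ereal (exit_from c r \<omega>)"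
  using exit_from_nonneg real_of_ereal_pos by blast

lemma exit_value_measurable:
  assumes g[measurable]: "g \<in> borel_measurable borel"
  shows "(\<lambda>\<omega>. if exit_from c r \<omega> < \<infinity> then g (X (real_of_ereal (exit_from c r \<omega>)) \<omega>) else (0::real)) \<in> borel_measurable path_alg"
proof -
  have [measurable]: "(\<lambda>\<omega>. X (real_of_ereal (exit_from c r \<omega>)) \<omega>) \<in> borel_measurable path_alg"
    by (rule X_joint') (auto simp: real_exit_nonneg)
  show ?thesis by measurable
qed

lemma before_integral_measurable:
  assumes "f \<in> borel_measurable borel"
  shows "(\<lambda>\<omega>. LINT t:before c r \<omega>|lborel. f (X t \<omega>) :: real) \<in> borel_measurable path_alg"
  by (rule path_integral_measurable[OF assms _ before_pred]) (auto simp: before_def)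

lemma before_nn_measurable:
  assumes "f \<in> borel_measurable borel"
  shows "(\<lambda>\<omega>. \<integral>\<^sup>+t\<in>before c r \<omega>. f (X t \<omega>) \<partial>lborel) \<in> borel_measurable path_alg"
  by (rule path_nn_measurable[OF assms _ before_pred]) (auto simp: before_def)

lemma payoff_measurable:
  assumes "f \<in> borel_measurable borel" "g \<in> borel_measurable borel"
  shows "payoff r f g \<in> borel_measurable path_alg"
  unfolding payoff_def[abs_def]
  by (intro borel_measurable_add before_integral_measurable exit_value_measurable assms)

lemma exit_shift:
  assumes w: "\<omega> \<in> space M" and t: "0 \<le> t" "ereal t < exit_from c r \<omega>"
  shows "exit_from c r \<omega> = ereal t + exit_from c r (theta t \<omega>)"
proof -
  note th = theta[OF t(1) w]
  have bt: "X s \<omega> \<in> ball c r" if "0 \<le> s" "s \<le> t" for s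
    using exit_from_gt_iff[OF w t(1)] t(2) that by auto
  show ?thesis
  proof (cases "exit_from c r (theta t \<omega>) < \<infinity>")
    case True
    from exit_from_attained[OF th(1) True] obtain \<tau> where \<tau>: "0 \<le> \<tau>" "exit_from c r (theta t \<omega>) = ereal \<tau>"
      "X \<tau> (theta t \<omega>) \<notin> ball c r" "\<And>s. 0 \<le> s \<Longrightarrow> s < \<tau> \<Longrightarrow> X s (theta t \<omega>) \<in> ball c r" by metis
    have "X (t + \<tau>) \<omega> \<notin> ball c r" using th(2)[OF \<tau>(1)] \<tau>(3) by simp
    then have "exit_from c r \<omega> \<le> ereal (t + \<tau>)" using t \<tau>(1) by (intro exit_from_le) auto
    moreover have "ereal (t + \<tau>) \<le> exit_from c r \<omega>"
      unfolding exit_from_eq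
    proof (rule INF_greatest)
      fix s assume "s \<in> {t. 0 \<le> t \<and> X t \<omega> \<notin> ball c r}"
      then have s: "0 \<le> s" "X s \<omega> \<notin> ball c r" by auto
      with bt have "t < s" by (meson not_le)
      then have "X (s - t) (theta t \<omega>) \<notin> ball c r" using th(2)[of "s - t"] s by simp
      then have "\<tau> \<le> s - t" using \<tau>(4)[of "s - t"] \<open>t < s\<close> by (meson diff_ge_0_iff_ge less_imp_le not_le)
      then show "ereal (t + \<tau>) \<le> ereal s" by simp
    qed
    ultimately show ?thesis using \<tau>(2) by simp
  next
    case False
    have "\<not> exit_from c r \<omega> < \<infinity>"
    proof
      assume "exit_from c r \<omega> < \<infinity>"
      from exit_from_attained[OF w this] obtain \<tau> where \<tau>: "0 \<le> \<tau>" "exit_from c r \<omega> = ereal \<tau>" "X \<tau> \<omega> \<notin> ball c r" by metis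
      then have "t \<le> \<tau>" using t(2) by simp
      then have "X (\<tau> - t) (theta t \<omega>) \<notin> ball c r" using th(2)[of "\<tau> - t"] \<tau> by simp
      then have "exit_from c r (theta t \<omega>) \<le> ereal (\<tau> - t)" using \<open>t \<le> \<tau>\<close> by (intro exit_from_le) auto
      then show False using False by auto
    qed
    then show ?thesis using False by simp
  qed
qed

text \<open>Before \<open>t\<close> only the running integral has accumulated, and the shifted path
  leaves the ball at the same place, \<open>t\<close> earlier. Pathwise integrability justifies
  splitting the running integral at \<open>t\<close>.\<close>

lemma payoff_shift:
  assumes w: "\<omega> \<in> space M" and t: "0 \<le> t" "ereal t < exit_from 0 r \<omega>"
    and i: "set_integrable lborel (before 0 r \<omega>) (\<lambda>s. f (X s \<omega>))"
  shows "payoff r f g \<omega> = (LINT s:before 0 r \<omega> \<inter> {0..t}|lborel. f (X s \<omega>)) + payoff r f g (theta t \<omega>)"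
proof -
  note th = theta[OF t(1) w]
  note ex = exit_shift[OF w t]
  have bs[measurable]: "before 0 r \<omega> \<in> sets borel" by (rule before_sets)
  have i1: "set_integrable lborel (before 0 r \<omega> \<inter> {0..t}) (\<lambda>s. f (X s \<omega>))"
    and i2: "set_integrable lborel (before 0 r \<omega> - {0..t}) (\<lambda>s. f (X s \<omega>))"
    and i3: "set_integrable lborel (before 0 r \<omega> \<inter> {t..}) (\<lambda>s. f (X s \<omega>))"
    by (rule set_integrable_subset[OF i]; auto)+
  have "(LINT s:before 0 r \<omega>|lborel. f (X s \<omega>))
      = (LINT s:before 0 r \<omega> \<inter> {0..t}|lborel. f (X s \<omega>)) + (LINT s:before 0 r \<omega> - {0..t}|lborel. f (X s \<omega>))"
    by (subst set_integral_Un[OF _ i1 i2, symmetric]) (auto simp: Un_Diff_Int Int_Diff_Un)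
  also have "(LINT s:before 0 r \<omega> - {0..t}|lborel. f (X s \<omega>)) = (LINT s:before 0 r \<omega> \<inter> {t..}|lborel. f (X s \<omega>))"
  proof -
    have "AE s in lborel. s \<noteq> t" by (rule AE_lborel_singleton)
    then have "AE s in lborel. indicator (before 0 r \<omega> - {0..t}) s *\<^sub>R f (X s \<omega>) = indicator (before 0 r \<omega> \<inter> {t..}) s *\<^sub>R f (X s \<omega>)"
      by eventually_elim (auto simp: indicator_def before_def)
    then show ?thesis
      using i2 i3 unfolding set_lebesgue_integral_def set_integrable_def by (intro integral_cong_AE) auto
  qed
  also have "\<dots> = (LINT s:before 0 r (theta t \<omega>)|lborel. f (X (t + s) \<omega>))"
  proof -
    have "t + s \<in> before 0 r \<omega> \<inter> {t..} \<longleftrightarrow> s \<in> before 0 r (theta t \<omega>)" for s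
      unfolding before_def ex using t(1)
      by (cases "exit_from 0 r (theta t \<omega>)") auto
    then show ?thesis
      unfolding set_lebesgue_integral_def
      by (subst lborel_integral_real_affine[where c=1 and t=t])
        (auto intro!: Bochner_Integration.integral_cong simp: indicator_def)
  qed
  also have "\<dots> = (LINT s:before 0 r (theta t \<omega>)|lborel. f (X s (theta t \<omega>)))"
    using before_sets by (intro set_lebesgue_integral_cong) (auto simp: th(2) before_def)
  finally have 1: "(LINT s:before 0 r \<omega>|lborel. f (X s \<omega>))
      = (LINT s:before 0 r \<omega> \<inter> {0..t}|lborel. f (X s \<omega>)) + (LINT s:before 0 r (theta t \<omega>)|lborel. f (X s (theta t \<omega>)))" .
  have 2: "X (real_of_ereal (exit_from 0 r \<omega>)) \<omega> = X (real_of_ereal (exit_from 0 r (theta t \<omega>))) (theta t \<omega>)"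
    if "exit_from 0 r \<omega> < \<infinity>"
  proof -
    have "real_of_ereal (exit_from 0 r \<omega>) = t + real_of_ereal (exit_from 0 r (theta t \<omega>))"
      using that exit_from_nonneg[of 0 r "theta t \<omega>"] unfolding ex by (cases "exit_from 0 r (theta t \<omega>)") auto
    then show ?thesis using th(2)[OF real_exit_nonneg] by simp
  qed
  have 3: "exit_from 0 r \<omega> < \<infinity> \<longleftrightarrow> exit_from 0 r (theta t \<omega>) < \<infinity>"
    unfolding ex by (cases "exit_from 0 r (theta t \<omega>)") auto
  show ?thesis unfolding payoff_def 1 using 2 3 by simp
qed

end

lemma Lp_norm_finite_iff: "Lp_norm p S f < \<infinity> \<longleftrightarrow> (\<integral>\<^sup>+x\<in>S. ennreal (norm (f x) powr p) \<partial>lborel) < \<infinity>"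
  unfolding Lp_norm_def Let_def by (auto simp: less_top)

context quasi_diffusion
begin

context
  fixes \<delta> B p R :: real and f :: "real^'n \<Rightarrow> real"
  assumes adm: "admissible_coeffs \<delta> B a b" and est: "exit_estimate TYPE('w) TYPE('n) \<delta> B p"
    and R: "0 < R"
    and f: "f \<in> borel_measurable borel" "Lp_norm p UNIV f < \<infinity>"
begin

text \<open>The exit estimate is available for balls centred at the starting point. A start
  \<open>y\<close> inside \<open>ball 0 R\<close> is covered by the larger ball of radius
  \<open>2 * R\<close> about \<open>y\<close>; from a start outside, the exit occurs at time 0 and
  the integral is empty.\<close>

lemma potential_finite:
  "(\<integral>\<^sup>+\<omega>. (\<integral>\<^sup>+t\<in>before 0 R \<omega>. ennreal \<bar>f (X t \<omega>)\<bar> \<partial>lborel) \<partial>P y) < \<infinity>"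
proof (cases "y \<in> ball 0 R")
  case True
  obtain N where N: "\<And>c r f. 0 < r \<Longrightarrow> f \<in> borel_measurable borel \<Longrightarrow> (\<forall>x. 0 \<le> f x) \<Longrightarrow>
    (\<integral>\<^sup>+\<omega>. (\<integral>\<^sup>+t\<in>before c r \<omega>. ennreal (f (X t \<omega>)) \<partial>lborel) \<partial>P c)
      \<le> ennreal (N * r powr (2 - real CARD('n) / p)) * Lp_norm p (ball c r) f"
    using exit_estimate_at[OF adm est] by blast
  have fa: "(\<lambda>x. \<bar>f x\<bar>) \<in> borel_measurable borel" using f by measurable
  have sub: "ball 0 R \<subseteq> ball y (2 * R)"
    using True by (intro subsetI) (auto simp: dist_norm norm_minus_commute intro: order_le_less_trans[OF norm_triangle_ineq4])
  have "before 0 R \<omega> \<subseteq> before y (2 * R) \<omega>" for \<omega>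
  proof -
    have "exit_from 0 R \<omega> \<le> exit_from y (2 * R) \<omega>"
      unfolding exit_from_eq using sub by (intro INF_superset_mono) auto
    then show ?thesis unfolding before_def by auto
  qed
  then have "(\<integral>\<^sup>+\<omega>. (\<integral>\<^sup>+t\<in>before 0 R \<omega>. ennreal \<bar>f (X t \<omega>)\<bar> \<partial>lborel) \<partial>P y)
    \<le> (\<integral>\<^sup>+\<omega>. (\<integral>\<^sup>+t\<in>before y (2 * R) \<omega>. ennreal \<bar>f (X t \<omega>)\<bar> \<partial>lborel) \<partial>P y)"
    by (intro nn_integral_mono mult_left_mono) (auto simp: indicator_def)
  also have "\<dots> \<le> ennreal (N * (2 * R) powr (2 - real CARD('n) / p)) * Lp_norm p (ball y (2 * R)) (\<lambda>x. \<bar>f x\<bar>)"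
    using R by (intro N fa) auto
  also have "\<dots> < \<infinity>"
  proof -
    have "(\<integral>\<^sup>+x\<in>ball y (2 * R). ennreal (norm \<bar>f x\<bar> powr p) \<partial>lborel) \<le> (\<integral>\<^sup>+x\<in>UNIV. ennreal (norm (f x) powr p) \<partial>lborel)"
      by (intro nn_integral_mono) (auto simp: indicator_def)
    also have "\<dots> < \<infinity>" using f(2) Lp_norm_finite_iff by blast
    finally have "Lp_norm p (ball y (2 * R)) (\<lambda>x. \<bar>f x\<bar>) < \<infinity>" by (simp only: Lp_norm_finite_iff)
    then show ?thesis by (simp add: ennreal_mult_less_top)
  qed
  finally show ?thesis .
next
  case False
  have "AE \<omega> in P y. (\<integral>\<^sup>+t\<in>before 0 R \<omega>. ennreal \<bar>f (X t \<omega>)\<bar> \<partial>lborel) = 0"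
    using start[of y] AE_space
  proof eventually_elim
    case (elim \<omega>)
    then have "exit_from 0 R \<omega> \<le> ereal 0" using False by (intro exit_from_le) auto
    then have "before 0 R \<omega> = {}" unfolding before_def by (auto simp: zero_ereal_def[symmetric] not_less intro: order_trans[of _ 0])
    then show ?case by simp
  qed
  then have "(\<integral>\<^sup>+\<omega>. (\<integral>\<^sup>+t\<in>before 0 R \<omega>. ennreal \<bar>f (X t \<omega>)\<bar> \<partial>lborel) \<partial>P y) = (\<integral>\<^sup>+\<omega>. 0 \<partial>P y)"
    by (rule nn_integral_cong_AE)
  then show ?thesis by simp
qed

lemma potential_AE: "AE \<omega> in P y. set_integrable lborel (before 0 R \<omega>) (\<lambda>s. f (X s \<omega>))"
proof -
  have fa: "(\<lambda>x. ennreal \<bar>f x\<bar>) \<in> borel_measurable borel" using f by measurable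
  have m: "(\<lambda>\<omega>. \<integral>\<^sup>+t\<in>before 0 R \<omega>. ennreal \<bar>f (X t \<omega>)\<bar> \<partial>lborel) \<in> borel_measurable (P y)"
    by (rule path_P[OF before_nn_measurable[OF fa]])
  have "(\<integral>\<^sup>+\<omega>. (\<integral>\<^sup>+t\<in>before 0 R \<omega>. ennreal \<bar>f (X t \<omega>)\<bar> \<partial>lborel) \<partial>P y) \<noteq> \<infinity>"
    using potential_finite[of y] by simp
  from nn_integral_PInf_AE[OF m this] AE_space show ?thesis
  proof eventually_elim
    case (elim \<omega>)
    then have w: "\<omega> \<in> space M" by simp
    have "(\<integral>\<^sup>+s. ennreal (norm (indicator (before 0 R \<omega>) s *\<^sub>R f (X s \<omega>))) \<partial>lborel)
      = (\<integral>\<^sup>+s\<in>before 0 R \<omega>. ennreal \<bar>f (X s \<omega>)\<bar> \<partial>lborel)"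
      by (intro nn_integral_cong) (simp add: indicator_def)
    also have "\<dots> < \<infinity>" using elim by (simp add: less_top)
    finally show ?case
      using path_measurable[OF f(1) w _ before_sets, of 0 R] unfolding set_integrable_def set_borel_measurable_def
      by (intro integrableI_bounded) (auto simp: before_def)
  qed
qed

lemma potential_abs_integrable: "integrable (P y) (\<lambda>\<omega>. LINT s:before 0 R \<omega>|lborel. \<bar>f (X s \<omega>)\<bar>)"
proof (rule integrableI_bounded)
  have fa: "(\<lambda>x. \<bar>f x\<bar>) \<in> borel_measurable borel" using f by measurable
  show "(\<lambda>\<omega>. LINT s:before 0 R \<omega>|lborel. \<bar>f (X s \<omega>)\<bar>) \<in> borel_measurable (P y)"
    by (rule path_P[OF before_integral_measurable[OF fa]])
  have "(\<integral>\<^sup>+\<omega>. ennreal (norm (LINT s:before 0 R \<omega>|lborel. \<bar>f (X s \<omega>)\<bar>)) \<partial>P y)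
      \<le> (\<integral>\<^sup>+\<omega>. (\<integral>\<^sup>+s\<in>before 0 R \<omega>. ennreal \<bar>f (X s \<omega>)\<bar> \<partial>lborel) \<partial>P y)"
    unfolding set_lebesgue_integral_def
    by (intro nn_integral_mono order_trans[OF norm_integral_le_nn_integral]) (simp add: indicator_def)
  also have "\<dots> < \<infinity>" by (rule potential_finite)
  finally show "(\<integral>\<^sup>+\<omega>. ennreal (norm (LINT s:before 0 R \<omega>|lborel. \<bar>f (X s \<omega>)\<bar>)) \<partial>P y) < \<infinity>" .
qed

lemma potential_dominated:
  assumes i: "set_integrable lborel (before 0 R \<omega>) (\<lambda>s. f (X s \<omega>))"
    and A: "A \<subseteq> before 0 R \<omega>" "A \<in> sets borel"
  shows "\<bar>LINT s:A|lborel. f (X s \<omega>)\<bar> \<le> (LINT s:before 0 R \<omega>|lborel. \<bar>f (X s \<omega>)\<bar>)"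
proof -
  have it: "set_integrable lborel A (\<lambda>s. f (X s \<omega>))" by (rule set_integrable_subset[OF i]) (use A in auto)
  have "\<bar>LINT s:A|lborel. f (X s \<omega>)\<bar> \<le> (LINT s:A|lborel. \<bar>f (X s \<omega>)\<bar>)"
    using set_integral_norm_bound[OF it] by simp
  also have "\<dots> \<le> (LINT s:before 0 R \<omega>|lborel. \<bar>f (X s \<omega>)\<bar>)"
    using set_integrable_abs[OF i] set_integrable_abs[OF it] A
    unfolding set_lebesgue_integral_def set_integrable_def
    by (intro integral_mono) (auto simp: indicator_def)
  finally show ?thesis .
qed

context
  fixes g :: "real^'n \<Rightarrow> real"
  assumes g: "g \<in> borel_measurable borel" "bounded (range g)"
begin

lemma g_bound: "\<exists>G\<ge>0. \<forall>x. \<bar>g x\<bar> \<le> G"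
  using g(2) unfolding bounded_iff by (auto intro: order_trans[OF abs_ge_zero])

lemma payoff_dominated:
  assumes G: "0 \<le> G" "\<forall>x. \<bar>g x\<bar> \<le> G"
    and i: "set_integrable lborel (before 0 R \<omega>) (\<lambda>s. f (X s \<omega>))"
  shows "\<bar>payoff R f g \<omega>\<bar> \<le> (LINT s:before 0 R \<omega>|lborel. \<bar>f (X s \<omega>)\<bar>) + G"
proof -
  have "\<bar>if exit_from 0 R \<omega> < \<infinity> then g (X (real_of_ereal (exit_from 0 R \<omega>)) \<omega>) else 0\<bar> \<le> G"
    using G by simp
  then show ?thesis
    unfolding payoff_def using potential_dominated[OF i order_refl before_sets] by linarith
qed

lemma payoff_integrable: "integrable (P y) (payoff R f g)"
proof -
  interpret prob_space "P y" by (rule prob)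
  obtain G where G: "0 \<le> G" "\<forall>x. \<bar>g x\<bar> \<le> G" using g_bound by blast
  have "integrable (P y) (\<lambda>\<omega>. (LINT s:before 0 R \<omega>|lborel. \<bar>f (X s \<omega>)\<bar>) + G)"
    using potential_abs_integrable by simp
  then show ?thesis
    using path_P[OF payoff_measurable[OF f(1) g(1)]]
  proof (rule Bochner_Integration.integrable_bound)
    show "AE \<omega> in P y. norm (payoff R f g \<omega>) \<le> norm ((LINT s:before 0 R \<omega>|lborel. \<bar>f (X s \<omega>)\<bar>) + G)"
      using potential_AE by eventually_elim (use payoff_dominated[OF G] in \<open>force intro: order_trans\<close>)
  qed
qed

text \<open>Let \<open>?W t\<close> be the gain up to \<open>t\<close> plus
  \<open>\<phi> (X t) + m\<close> minus the whole payoff, where \<open>m\<close> is the maximal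
  value of (mean payoff) minus \<open>\<phi>\<close>. Conditioning at a fixed time leaves
  \<open>\<phi> (X t) + m\<close> minus the mean payoff from \<open>X t\<close>, which is
  nonnegative by \<open>max\<close>. Its mean is thus nonnegative at grid times, and the claim is
  the same inequality at the stopped time.\<close>

lemma stopped_value:
  fixes \<phi> :: "real^'n \<Rightarrow> real"
  assumes T: "0 < T" and r: "0 < r" "r < r1" and sub: "ball x0 r1 \<subseteq> ball 0 R"
    and \<phi>m: "\<phi> \<in> borel_measurable borel" and \<phi>b: "bounded (range \<phi>)" and \<phi>c: "continuous_on (ball x0 r1) \<phi>"
    and max: "\<And>y. y \<in> ball x0 r1 \<Longrightarrow> (\<integral>\<omega>. payoff R f g \<omega> \<partial>P y) - \<phi> y \<le> (\<integral>\<omega>. payoff R f g \<omega> \<partial>P x0) - \<phi> x0"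
  shows "integrable (P x0) (\<lambda>\<omega>. LINT s:before 0 R \<omega> \<inter> {0..stop x0 r T \<omega>}|lborel. f (X s \<omega>))"
    and "integrable (P x0) (\<lambda>\<omega>. \<phi> (X (stop x0 r T \<omega>) \<omega>))"
    and "\<phi> x0 \<le> (\<integral>\<omega>. (LINT s:before 0 R \<omega> \<inter> {0..stop x0 r T \<omega>}|lborel. f (X s \<omega>)) \<partial>P x0) + (\<integral>\<omega>. \<phi> (X (stop x0 r T \<omega>) \<omega>) \<partial>P x0)"
proof -
  interpret prob_space "P x0" by (rule prob)
  let ?Z = "payoff R f g"
  define m where "m = (\<integral>\<omega>. ?Z \<omega> \<partial>P x0) - \<phi> x0"
  define J where "J \<omega> = (LINT s:before 0 R \<omega>|lborel. \<bar>f (X s \<omega>)\<bar>)" for \<omega>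
  define I where "I t \<omega> = (LINT s:before 0 R \<omega> \<inter> {0..t}|lborel. f (X s \<omega>))" for t \<omega>
  obtain G where G: "0 \<le> G" "\<forall>x. \<bar>g x\<bar> \<le> G" using g_bound by blast
  obtain K where K: "\<And>x. \<bar>\<phi> x\<bar> \<le> K" using \<phi>b by (auto simp: bounded_iff)
  have iJ: "integrable (P x0) J" unfolding J_def[abs_def] by (rule potential_abs_integrable)
  note ae = potential_AE[of x0]
  have bt: "before 0 R \<omega> \<inter> {0..t} \<in> sets borel" for \<omega> t using before_sets by auto
  have dI: "\<bar>I t \<omega>\<bar> \<le> J \<omega>" if "set_integrable lborel (before 0 R \<omega>) (\<lambda>s. f (X s \<omega>))" for t \<omega>
    unfolding I_def J_def by (rule potential_dominated[OF that _ bt]) simp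
  have pI: "(\<lambda>\<omega>. I (h \<omega>) \<omega>) \<in> borel_measurable path_alg" if [measurable]: "h \<in> borel_measurable path_alg" for h
  proof -
    have "Measurable.pred (path_alg \<Otimes>\<^sub>M borel) (\<lambda>(\<omega>, s). s \<in> before 0 R \<omega> \<inter> {0..h \<omega>})"
      using before_pred unfolding case_prod_beta Int_iff atLeastAtMost_iff by measurable
    then show ?thesis unfolding I_def by (intro path_integral_measurable f) (auto simp: before_def)
  qed
  have p\<phi>: "(\<lambda>\<omega>. \<phi> (X (h \<omega>) \<omega>)) \<in> borel_measurable path_alg" if "h \<in> borel_measurable path_alg" "\<And>\<omega>. 0 \<le> h \<omega>" for h
    using measurable_compose[OF X_joint'[OF that(1)] \<phi>m] that(2) by simp
  have iI: "integrable (P x0) (\<lambda>\<omega>. I (h \<omega>) \<omega>)" if "h \<in> borel_measurable path_alg" for h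
    using iJ path_P[OF pI[OF that]]
    by (rule Bochner_Integration.integrable_bound) (use ae dI in \<open>auto elim!: eventually_mono intro: order_trans[OF _ abs_ge_self]\<close>)
  have i\<phi>: "integrable (P x0) (\<lambda>\<omega>. \<phi> (X (h \<omega>) \<omega>))" if "h \<in> borel_measurable path_alg" "\<And>\<omega>. 0 \<le> h \<omega>" for h
    using K path_P[OF p\<phi>[OF that]] by (intro integrable_const_bound[where B=K]) auto
  have st: "0 \<le> stop x0 r T \<omega>" "stop x0 r T \<omega> \<le> T" for \<omega> using stop_bounds T by auto
  show i1: "integrable (P x0) (\<lambda>\<omega>. LINT s:before 0 R \<omega> \<inter> {0..stop x0 r T \<omega>}|lborel. f (X s \<omega>))"
    using iI[of "stop x0 r T"] unfolding I_def by simp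
  show i2: "integrable (P x0) (\<lambda>\<omega>. \<phi> (X (stop x0 r T \<omega>) \<omega>))"
    using i\<phi>[of "stop x0 r T"] st by simp
  let ?t = "\<lambda>n \<omega>. real (grid x0 r T (Suc n) \<omega>) * T / real (Suc n)"
  let ?W = "\<lambda>t \<omega>. I t \<omega> + \<phi> (X t \<omega>) + m - ?Z \<omega>"
  \<comment> \<open>Grid times come after the stopped time, so by then the path may have left the
    region where \<open>max\<close> applies, or even the large ball. Such paths contribute 0; on
    each path they are excluded only for finitely many grids, because at the stopped time itself the
    path is well inside \<open>ball x0 r1\<close>.\<close>
  define good where "good t \<omega> \<longleftrightarrow> ereal t < exit_from 0 R \<omega> \<and> X t \<omega> \<in> ball x0 r1" for t \<omega>
  define V where "V n \<omega> = (if good (?t n \<omega>) \<omega> then ?W (?t n \<omega>) \<omega> else 0)" for n \<omega>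
  have tm[measurable]: "?t n \<in> borel_measurable path_alg" for n by measurable
  have t0: "0 \<le> ?t n \<omega>" for n \<omega> using T by simp
  have iW: "integrable (P x0) (\<lambda>\<omega>. ?W (h \<omega>) \<omega>)" if "h \<in> borel_measurable path_alg" "\<And>\<omega>. 0 \<le> h \<omega>" for h
    using iI[OF that(1)] i\<phi>[OF that] payoff_integrable by auto
  have dW: "\<bar>?W t \<omega>\<bar> \<le> 2 * J \<omega> + (K + \<bar>m\<bar> + G)" if i: "set_integrable lborel (before 0 R \<omega>) (\<lambda>s. f (X s \<omega>))" for t \<omega>
    using dI[OF i, of t] payoff_dominated[OF G i] K[of "X t \<omega>"] unfolding J_def[symmetric] by linarith
  have step: "0 \<le> (\<integral>\<omega>. V n \<omega> \<partial>P x0)" for n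
  proof -
    let ?n = "Suc n"
    let ?k = "\<lambda>k. real k * T / real ?n"
    \<comment> \<open>The event that the \<open>k\<close>-th grid time is used and is good. It is
      known at that time, as the conditioning requires.\<close>
    define A where "A k = {\<omega> \<in> space M. grid x0 r T ?n \<omega> = k} \<inter> {\<omega> \<in> space M. \<forall>s\<in>{0..?k k}. X s \<omega> \<in> ball 0 R} \<inter> {\<omega> \<in> space M. X (?k k) \<omega> \<in> ball x0 r1}" for k
    have k0: "0 \<le> ?k k" for k using T by simp
    have AF: "A k \<in> sets (F (?k k))" if "k \<le> ?n" for k
      unfolding A_def
    proof (intro sets.Int)
      show "{\<omega> \<in> space M. grid x0 r T ?n \<omega> = k} \<in> sets (F (?k k))" by (rule grid_event[OF _ T that]) simp
      show "{\<omega> \<in> space M. \<forall>s\<in>{0..?k k}. X s \<omega> \<in> ball 0 R} \<in> sets (F (?k k))" by (rule ball_event_F[OF k0])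
      show "{\<omega> \<in> space M. X (?k k) \<omega> \<in> ball x0 r1} \<in> sets (F (?k k))"
        using measurable_sets[OF adapted[OF k0, of k], of "ball x0 r1"] space_F[OF k0]
        by (simp add: vimage_def Int_def conj_commute)
    qed
    have AP: "A k \<in> sets (P x0)" if "k \<le> ?n" for k using sets_F[OF k0 AF[OF that]] .
    have Ag: "\<omega> \<in> A k \<longleftrightarrow> grid x0 r T ?n \<omega> = k \<and> good (?k k) \<omega>" if "\<omega> \<in> space M" for \<omega> k
      using that exit_from_gt_iff[OF that k0[of k], of 0 R] unfolding A_def good_def by auto
    have dec: "V n \<omega> = (\<Sum>k\<le>?n. indicator (A k) \<omega> * ?W (?k k) \<omega>)" if w: "\<omega> \<in> space M" for \<omega>
    proof -
      have "(\<Sum>k\<le>?n. indicator (A k) \<omega> * ?W (?k k) \<omega>) = (\<Sum>k\<le>?n. if k = grid x0 r T ?n \<omega> then V n \<omega> else 0)"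
        unfolding V_def using Ag[OF w] by (intro sum.cong refl) (auto simp: indicator_def simp del: of_nat_Suc)
      then show ?thesis using grid_le[of ?n T x0 r \<omega>] T by simp
    qed
    have ik: "integrable (P x0) (\<lambda>\<omega>. indicator (A k) \<omega> * ?W (?k k) \<omega>)" if "k \<le> ?n" for k
      using integrable_mult_indicator[OF AP[OF that] iW[of "\<lambda>_. ?k k"]] k0[of k] by simp
    have pos: "0 \<le> (\<integral>\<omega>. indicator (A k) \<omega> * ?W (?k k) \<omega> \<partial>P x0)" if k: "k \<le> ?n" for k
    proof -
      let ?h = "?k k"
      have \<phi>i: "integrable (P x0) (\<lambda>\<omega>. indicator (A k) \<omega> * (\<phi> (X ?h \<omega>) + m))"
        using integrable_mult_indicator[OF AP[OF k], of "\<lambda>\<omega>. \<phi> (X ?h \<omega>) + m"] i\<phi>[of "\<lambda>_. ?h"] k0[of k] by simp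
      \<comment> \<open>The part of the payoff earned before the grid time cancels against
        \<open>I\<close>, leaving the payoff of the shifted path.\<close>
      have ae2: "AE \<omega> in P x0. indicator (A k) \<omega> * ?W ?h \<omega> = indicator (A k) \<omega> * (\<phi> (X ?h \<omega>) + m) - indicator (A k) \<omega> * ?Z (theta ?h \<omega>)"
        using ae AE_space
      proof eventually_elim
        case (elim \<omega>)
        then have w: "\<omega> \<in> space M" by simp
        show ?case
        proof (cases "\<omega> \<in> A k")
          case True
          then have "ereal ?h < exit_from 0 R \<omega>" using Ag[OF w] by (auto simp: good_def)
          from payoff_shift[OF w k0 this elim(1), of g] True show ?thesis by (simp add: I_def)
        qed simp
      qed
      have mZ: "(\<lambda>\<omega>. indicator (A k) \<omega> * ?Z (theta ?h \<omega>)) \<in> borel_measurable (P x0)"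
        using measurable_compose[OF theta_measurable_P[OF k0] payoff_measurable[OF f(1) g(1)]] AP[OF k]
        by (intro borel_measurable_times) auto
      have "integrable (P x0) (\<lambda>\<omega>. indicator (A k) \<omega> * (\<phi> (X ?h \<omega>) + m) - indicator (A k) \<omega> * ?W ?h \<omega>)"
        using \<phi>i ik[OF k] by (rule Bochner_Integration.integrable_diff)
      moreover have "AE \<omega> in P x0. indicator (A k) \<omega> * (\<phi> (X ?h \<omega>) + m) - indicator (A k) \<omega> * ?W ?h \<omega> = indicator (A k) \<omega> * ?Z (theta ?h \<omega>)"
        using ae2 by eventually_elim simp
      ultimately have iZ: "integrable (P x0) (\<lambda>\<omega>. indicator (A k) \<omega> * ?Z (theta ?h \<omega>))"
        using integrable_cong_AE[OF borel_measurable_integrable mZ] by blast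
      note mk = markov_integral[OF k0 AF[OF k] payoff_measurable[OF f(1) g(1)] payoff_integrable iZ]
      have "(\<integral>\<omega>. indicator (A k) \<omega> * ?W ?h \<omega> \<partial>P x0)
          = (\<integral>\<omega>. indicator (A k) \<omega> * (\<phi> (X ?h \<omega>) + m) - indicator (A k) \<omega> * ?Z (theta ?h \<omega>) \<partial>P x0)"
        using ae2 ik[OF k] \<phi>i iZ by (intro integral_cong_AE) auto
      also have "\<dots> = (\<integral>\<omega>. indicator (A k) \<omega> * (\<phi> (X ?h \<omega>) + m) \<partial>P x0) - (\<integral>\<omega>. indicator (A k) \<omega> * (\<integral>\<omega>'. ?Z \<omega>' \<partial>P (X ?h \<omega>)) \<partial>P x0)"
        using Bochner_Integration.integral_diff[OF \<phi>i iZ] mk(2) by simp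
      also have "\<dots> = (\<integral>\<omega>. indicator (A k) \<omega> * (\<phi> (X ?h \<omega>) + m) - indicator (A k) \<omega> * (\<integral>\<omega>'. ?Z \<omega>' \<partial>P (X ?h \<omega>)) \<partial>P x0)"
        using Bochner_Integration.integral_diff[OF \<phi>i mk(1)] by simp
      also have "0 \<le> \<dots>"
      proof (rule integral_nonneg_AE, rule AE_I2)
        fix \<omega>
        show "0 \<le> indicator (A k) \<omega> * (\<phi> (X ?h \<omega>) + m) - indicator (A k) \<omega> * (\<integral>\<omega>'. ?Z \<omega>' \<partial>P (X ?h \<omega>))"
        proof (cases "\<omega> \<in> A k")
          case True
          then have "X ?h \<omega> \<in> ball x0 r1" by (simp add: A_def)
          from max[OF this] True show ?thesis by (simp add: m_def)
        qed simp
      qed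
      finally show ?thesis .
    qed
    have "(\<integral>\<omega>. V n \<omega> \<partial>P x0) = (\<integral>\<omega>. (\<Sum>k\<le>?n. indicator (A k) \<omega> * ?W (?k k) \<omega>) \<partial>P x0)"
      by (intro Bochner_Integration.integral_cong) (auto simp: dec simp del: of_nat_Suc)
    also have "\<dots> = (\<Sum>k\<le>?n. (\<integral>\<omega>. indicator (A k) \<omega> * ?W (?k k) \<omega> \<partial>P x0))"
      using ik by (intro Bochner_Integration.integral_sum) auto
    also have "0 \<le> \<dots>" using pos by (intro sum_nonneg) auto
    finally show ?thesis .
  qed
  have lim: "AE \<omega> in P x0. (\<lambda>n. V n \<omega>) \<longlonglongrightarrow> ?W (stop x0 r T \<omega>) \<omega>"
    using ae start[of x0] AE_space
  proof eventually_elim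
    case (elim \<omega>)
    then have w: "\<omega> \<in> space M" and i: "set_integrable lborel (before 0 R \<omega>) (\<lambda>s. f (X s \<omega>))" by auto
    let ?\<rho> = "stop x0 r T \<omega>"
    have X0: "X 0 \<omega> \<in> ball x0 r" using elim r by simp
    have X\<rho>: "X ?\<rho> \<omega> \<in> ball x0 r1" using stop_cball[OF w T X0] r by auto
    have "\<forall>s\<in>{0..?\<rho>}. X s \<omega> \<in> ball 0 R"
    proof
      fix s assume "s \<in> {0..?\<rho>}"
      then consider "s = ?\<rho>" | "s \<in> before x0 r \<omega>" using stop_before[of T s x0 r \<omega>] T by force
      then show "X s \<omega> \<in> ball 0 R"
      proof cases
        case 2
        then have "X s \<omega> \<in> ball x0 r1" using before_mem[OF w 2] r by auto
        then show ?thesis using sub by blast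
      qed (use X\<rho> sub in blast)
    qed
    \<comment> \<open>Strictness is gained because the path is still in the open ball at the stopped
      time; it leaves room for the grid times after it.\<close>
    then have ex: "ereal ?\<rho> < exit_from 0 R \<omega>" using exit_from_gt_iff[OF w st(1)] by simp
    note gt = grid_tendsto[OF T, of x0 r \<omega>]
    have "\<forall>\<^sub>F n in sequentially. ereal (?t n \<omega>) < exit_from 0 R \<omega>"
      using gt ex by (intro order_tendstoD(2)[OF tendsto_ereal])
    moreover have XT: "(\<lambda>n. X (?t n \<omega>) \<omega>) \<longlonglongrightarrow> X ?\<rho> \<omega>" by (rule X_grid_tendsto[OF T w])
    then have "\<forall>\<^sub>F n in sequentially. X (?t n \<omega>) \<omega> \<in> ball x0 r1"
      using X\<rho> by (intro topological_tendstoD) auto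
    ultimately have ev: "\<forall>\<^sub>F n in sequentially. ?W (?t n \<omega>) \<omega> = V n \<omega>"
      by eventually_elim (simp add: V_def good_def)
    have 1: "(\<lambda>n. \<phi> (X (?t n \<omega>) \<omega>)) \<longlonglongrightarrow> \<phi> (X ?\<rho> \<omega>)"
      using \<phi>c X\<rho> by (intro isCont_tendsto_compose[OF _ XT]) (auto simp: continuous_on_eq_continuous_at)
    have 2: "(\<lambda>n. I (?t n \<omega>) \<omega>) \<longlonglongrightarrow> I ?\<rho> \<omega>"
      unfolding I_def set_lebesgue_integral_def
    proof (rule integral_dominated_convergence)
      show "integrable lborel (\<lambda>s. norm (indicator (before 0 R \<omega>) s *\<^sub>R f (X s \<omega>)))"
        using i unfolding set_integrable_def by (rule integrable_norm)
      have "(\<lambda>s. indicator (before 0 R \<omega> \<inter> {0..t}) s *\<^sub>R f (X s \<omega>)) \<in> borel_measurable lborel" for t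
        using path_measurable[OF f(1) w _ bt[of \<omega> t]] by (auto simp: set_borel_measurable_def before_def)
      then show "(\<lambda>s. indicator (before 0 R \<omega> \<inter> {0..?\<rho>}) s *\<^sub>R f (X s \<omega>)) \<in> borel_measurable lborel"
        "\<And>n. (\<lambda>s. indicator (before 0 R \<omega> \<inter> {0..?t n \<omega>}) s *\<^sub>R f (X s \<omega>)) \<in> borel_measurable lborel" by blast+
      show "AE s in lborel. norm (indicator (before 0 R \<omega> \<inter> {0..?t n \<omega>}) s *\<^sub>R f (X s \<omega>)) \<le> norm (indicator (before 0 R \<omega>) s *\<^sub>R f (X s \<omega>))" for n
        by (intro AE_I2) (auto simp: indicator_def)
      have "AE s in lborel. s \<noteq> ?\<rho>" by (rule AE_lborel_singleton)
      then show "AE s in lborel. (\<lambda>n. indicator (before 0 R \<omega> \<inter> {0..?t n \<omega>}) s *\<^sub>R f (X s \<omega>)) \<longlonglongrightarrow> indicator (before 0 R \<omega> \<inter> {0..?\<rho>}) s *\<^sub>R f (X s \<omega>)"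
      proof eventually_elim
        case (elim s)
        have "\<forall>\<^sub>F n in sequentially. indicator {0..?\<rho>} s = (indicator {0..?t n \<omega>} s :: real)"
        proof (cases "s < ?\<rho>")
          case True
          from order_tendstoD(1)[OF gt this] show ?thesis
            by eventually_elim (use True in \<open>auto simp: indicator_def\<close>)
        next
          case False
          with elim have "?\<rho> < s" by simp
          from order_tendstoD(2)[OF gt this] show ?thesis
            by eventually_elim (use False elim in \<open>auto simp: indicator_def\<close>)
        qed
        then have "\<forall>\<^sub>F n in sequentially. indicator (before 0 R \<omega> \<inter> {0..?\<rho>}) s *\<^sub>R f (X s \<omega>) = indicator (before 0 R \<omega> \<inter> {0..?t n \<omega>}) s *\<^sub>R f (X s \<omega>)"
          unfolding indicator_inter_arith by eventually_elim simp
        from Lim_transform_eventually[OF tendsto_const this] show ?case .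
      qed
    qed
    have "(\<lambda>n. ?W (?t n \<omega>) \<omega>) \<longlonglongrightarrow> ?W ?\<rho> \<omega>" by (intro tendsto_intros 1 2)
    from Lim_transform_eventually[OF this ev] show ?case .
  qed
  have Vm: "V n \<in> borel_measurable (P x0)" for n
  proof -
    have [measurable]: "(\<lambda>\<omega>. X (?t n \<omega>) \<omega>) \<in> borel_measurable path_alg"
      by (rule X_joint'[OF tm t0])
    have W: "(\<lambda>\<omega>. ?W (?t n \<omega>) \<omega>) \<in> borel_measurable path_alg"
      using pI[OF tm[of n]] p\<phi>[OF tm[of n] t0] payoff_measurable[OF f(1) g(1), of R]
      by (intro borel_measurable_diff borel_measurable_add borel_measurable_const)
    have "Measurable.pred path_alg (\<lambda>\<omega>. good (?t n \<omega>) \<omega>)"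
      unfolding good_def mem_ball by measurable
    then have "V n \<in> borel_measurable path_alg"
      unfolding V_def[abs_def] by (intro measurable_If W) (auto simp: pred_def)
    then show ?thesis by (rule path_P)
  qed
  have "(\<lambda>n. \<integral>\<omega>. V n \<omega> \<partial>P x0) \<longlonglongrightarrow> (\<integral>\<omega>. ?W (stop x0 r T \<omega>) \<omega> \<partial>P x0)"
  proof (rule integral_dominated_convergence)
    show "integrable (P x0) (\<lambda>\<omega>. 2 * J \<omega> + (K + \<bar>m\<bar> + G))" using iJ by simp
    show "(\<lambda>\<omega>. ?W (stop x0 r T \<omega>) \<omega>) \<in> borel_measurable (P x0)"
      using iW[of "stop x0 r T"] st by auto
    show "AE \<omega> in P x0. norm (V n \<omega>) \<le> 2 * J \<omega> + (K + \<bar>m\<bar> + G)" for n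
      using ae
    proof eventually_elim
      case (elim \<omega>)
      have "0 \<le> J \<omega>" using dI[OF elim, of 0] by linarith
      moreover have "0 \<le> K" using K[of 0] by linarith
      ultimately show ?case using dW[OF elim, of "?t n \<omega>"] G(1) by (simp add: V_def del: of_nat_Suc)
    qed
  qed (rule Vm lim)+
  then have "0 \<le> (\<integral>\<omega>. ?W (stop x0 r T \<omega>) \<omega> \<partial>P x0)"
    using step by (intro LIMSEQ_le_const) auto
  also have "\<dots> = (\<integral>\<omega>. I (stop x0 r T \<omega>) \<omega> \<partial>P x0) + (\<integral>\<omega>. \<phi> (X (stop x0 r T \<omega>) \<omega>) \<partial>P x0) + m - (\<integral>\<omega>. ?Z \<omega> \<partial>P x0)"
    using iI[of "stop x0 r T"] i2 payoff_integrable[of x0] prob_space by simp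
  finally show "\<phi> x0 \<le> (\<integral>\<omega>. (LINT s:before 0 R \<omega> \<inter> {0..stop x0 r T \<omega>}|lborel. f (X s \<omega>)) \<partial>P x0) + (\<integral>\<omega>. \<phi> (X (stop x0 r T \<omega>) \<omega>) \<partial>P x0)"
    unfolding m_def I_def by simp
qed

end

end

end

section \<open>Hoelder's inequality and the Sobolev inequality\<close>

text \<open>Powers of extended nonnegative numbers with the convention that exponent 0 gives 1 even
  at 0 and at infinity. Factors with exponent 0 then disappear from products, which happens at the
  outermost step of \<open>grid_lines\<close> and for \<open>p = 1\<close> in
  \<open>conv_Lp\<close>.\<close>

definition epow :: "ennreal \<Rightarrow> real \<Rightarrow> ennreal" where
  "epow x a = (if a = 0 then 1 else if x = \<infinity> then \<infinity> else ennreal (enn2real x powr a))"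

lemma epow_0[simp]: "epow x 0 = 1"
  by (simp add: epow_def)

lemma epow_1[simp]: "epow x 1 = x"
  by (cases x) (auto simp: epow_def)

lemma epow_zero_left: "0 < a \<Longrightarrow> epow 0 a = 0"
  by (simp add: epow_def)

lemma epow_top: "0 < a \<Longrightarrow> epow \<top> a = \<top>"
  by (simp add: epow_def)

lemma epow_ennreal: "0 < a \<Longrightarrow> 0 \<le> r \<Longrightarrow> epow (ennreal r) a = ennreal (r powr a)"
  by (simp add: epow_def)

lemma epow_eq_0_iff: "0 \<le> a \<Longrightarrow> epow x a = 0 \<longleftrightarrow> x = 0 \<and> 0 < a"
  by (cases x) (auto simp: epow_def)

lemma epow_mult:
  assumes x: "x \<noteq> 0" "x \<noteq> \<top>" and a: "0 \<le> a"
  shows "epow (x * y) a = epow x a * epow y a"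
proof (cases "a = 0")
  case False
  obtain r where r: "x = ennreal r" "0 < r"
    using x by (cases x) (auto simp: less_le)
  show ?thesis
  proof (cases y)
    case (real s)
    have "epow (x * y) a = ennreal ((r * s) powr a)"
      using r real False a by (simp add: ennreal_mult[symmetric] epow_ennreal)
    then show ?thesis
      using r real False a by (simp add: epow_ennreal powr_mult ennreal_mult)
  next
    case top
    then show ?thesis using r a False by (simp add: epow_top epow_ennreal ennreal_mult_top)
  qed
qed simp

lemma epow_add: "0 \<le> a \<Longrightarrow> 0 \<le> b \<Longrightarrow> epow x (a + b) = epow x a * epow x b"
proof (cases "a = 0 \<or> b = 0")
  case False
  assume "0 \<le> a" "0 \<le> b"
  with False have "0 < a" "0 < b" by auto
  then show ?thesis
    by (cases x) (auto simp: epow_top epow_ennreal powr_add ennreal_mult)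
qed auto

lemma epow_epow: "0 < a \<Longrightarrow> 0 < b \<Longrightarrow> epow (epow x a) b = epow x (a * b)"
  by (cases x) (auto simp: epow_top epow_ennreal powr_powr)

lemma epow_mono:
  assumes "0 \<le> a" "x \<le> y" shows "epow x a \<le> epow y a"
proof (cases "a = 0")
  case False
  with assms have a: "0 < a" by simp
  show ?thesis
  proof (cases y)
    case (real s)
    then obtain r where "x = ennreal r" "0 \<le> r" using assms by (cases x) (auto simp: top_unique)
    with real a assms show ?thesis by (simp add: epow_ennreal powr_mono2)
  qed (simp add: epow_top a)
qed simp

lemma epow_measurable[measurable]: "(\<lambda>x. epow x a) \<in> borel_measurable borel"
  unfolding epow_def by measurable

text \<open>Apply \<open>ln y \<le> y - 1\<close> to \<open>y = x j / S\<close>, where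
  \<open>S\<close> is the weighted mean: the weighted sum of the right-hand sides is 0.\<close>

lemma weighted_arith_geom_mean:
  fixes x \<alpha> :: "'j \<Rightarrow> real"
  assumes J: "finite J" and x: "\<And>j. j \<in> J \<Longrightarrow> 0 < x j" and \<alpha>: "\<And>j. j \<in> J \<Longrightarrow> 0 \<le> \<alpha> j" "(\<Sum>j\<in>J. \<alpha> j) = 1"
  shows "(\<Prod>j\<in>J. x j powr \<alpha> j) \<le> (\<Sum>j\<in>J. \<alpha> j * x j)"
proof -
  define S where "S = (\<Sum>j\<in>J. \<alpha> j * x j)"
  obtain k where k: "k \<in> J" "\<alpha> k \<noteq> 0" using \<alpha>(2) by (metis sum.neutral zero_neq_one)
  have "0 < \<alpha> k * x k" using k \<alpha>(1)[of k] x[of k] by simp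
  also have "\<dots> \<le> S" unfolding S_def using x \<alpha> by (intro member_le_sum[OF k(1) _ J]) (auto intro!: mult_nonneg_nonneg simp: less_imp_le)
  finally have S: "0 < S" .
  have "(\<Sum>j\<in>J. \<alpha> j * ln (x j / S)) \<le> (\<Sum>j\<in>J. \<alpha> j * (x j / S - 1))"
    using x \<alpha> S by (intro sum_mono mult_left_mono ln_le_minus_one) auto
  also have "\<dots> = (\<Sum>j\<in>J. \<alpha> j * x j) / S - (\<Sum>j\<in>J. \<alpha> j)"
    by (simp add: right_diff_distrib sum_subtractf sum_divide_distrib)
  also have "\<dots> = 0" using S \<alpha> by (simp add: S_def[symmetric])
  finally have "(\<Sum>j\<in>J. \<alpha> j * ln (x j)) - (\<Sum>j\<in>J. \<alpha> j) * ln S \<le> 0"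
  proof -
    have "\<alpha> j * ln (x j / S) = \<alpha> j * ln (x j) - \<alpha> j * ln S" if "j \<in> J" for j
      using x[OF that] S by (simp add: ln_div right_diff_distrib)
    then show "(\<Sum>j\<in>J. \<alpha> j * ln (x j / S)) \<le> 0 \<Longrightarrow> ?thesis"
      by (simp add: sum_subtractf sum_distrib_right cong: sum.cong)
  qed
  then have "exp (\<Sum>j\<in>J. \<alpha> j * ln (x j)) \<le> exp (ln S)" using \<alpha> by simp
  moreover have "(\<Prod>j\<in>J. x j powr \<alpha> j) = exp (\<Sum>j\<in>J. \<alpha> j * ln (x j))"
    unfolding exp_sum[OF J] by (intro prod.cong) (auto simp: powr_def dest: x)
  ultimately show ?thesis using S unfolding S_def by simp
qed

text \<open>An infinite entry of positive weight makes the right side infinite. A zero entry of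
  positive weight makes the left side zero, since \<open>0 * \<top> = 0\<close>. In the remaining
  case the entries of positive weight are positive reals, and those of weight zero count as 1 on the
  left and 0 on the right.\<close>

lemma epow_arith_geom_mean:
  assumes J: "finite J" and \<alpha>: "\<And>j. j \<in> J \<Longrightarrow> 0 \<le> \<alpha> j" "(\<Sum>j\<in>J. \<alpha> j) = 1"
  shows "(\<Prod>j\<in>J. epow (x j) (\<alpha> j)) \<le> (\<Sum>j\<in>J. ennreal (\<alpha> j) * x j)"
proof -
  consider (t) k where "k \<in> J" "0 < \<alpha> k" "x k = \<top>" | (z) k where "k \<in> J" "0 < \<alpha> k" "x k = 0"
    | (r) "\<And>k. k \<in> J \<Longrightarrow> 0 < \<alpha> k \<Longrightarrow> x k \<noteq> \<top> \<and> x k \<noteq> 0" by blast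
  then show ?thesis
  proof cases
    case t
    then have "ennreal (\<alpha> k) * x k = \<top>" by (simp add: ennreal_mult_top)
    moreover have "ennreal (\<alpha> k) * x k \<le> (\<Sum>j\<in>J. ennreal (\<alpha> j) * x j)"
      using t J by (intro member_le_sum) auto
    ultimately show ?thesis by (simp add: top_unique)
  next
    case z
    then have "(\<Prod>j\<in>J. epow (x j) (\<alpha> j)) = 0" using J by (auto intro!: prod_zero bexI[of _ k] simp: epow_zero_left)
    then show ?thesis by (simp only: zero_le)
  next
    case r
    define J' where "J' = {j \<in> J. 0 < \<alpha> j}"
    have J': "finite J'" "J' \<subseteq> J" using J by (auto simp: J'_def)
    have z: "\<alpha> j = 0" if "j \<in> J - J'" for j using that \<alpha>(1)[of j] by (auto simp: J'_def)
    have 1: "(\<Prod>j\<in>J. epow (x j) (\<alpha> j)) = (\<Prod>j\<in>J'. epow (x j) (\<alpha> j))"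
      using J J' z by (intro prod.mono_neutral_right) auto
    have 2: "(\<Sum>j\<in>J. ennreal (\<alpha> j) * x j) = (\<Sum>j\<in>J'. ennreal (\<alpha> j) * x j)"
      using J J' z by (intro sum.mono_neutral_right) auto
    have 3: "(\<Sum>j\<in>J'. \<alpha> j) = 1"
      using J J' z \<alpha>(2) by (metis sum.mono_neutral_right)
    define y where "y j = enn2real (x j)" for j
    have y: "x j = ennreal (y j)" "0 < y j" "0 < \<alpha> j" if "j \<in> J'" for j
    proof -
      have "x j \<noteq> \<top>" "x j \<noteq> 0" "0 < \<alpha> j" using that r by (auto simp: J'_def)
      then show "x j = ennreal (y j)" "0 < y j" "0 < \<alpha> j"
        unfolding y_def by (cases "x j"; auto simp: less_le)+
    qed
    have "(\<Prod>j\<in>J'. epow (x j) (\<alpha> j)) = (\<Prod>j\<in>J'. ennreal (y j powr \<alpha> j))"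
      using y by (intro prod.cong refl) (simp add: epow_ennreal less_imp_le)
    also have "\<dots> = ennreal (\<Prod>j\<in>J'. y j powr \<alpha> j)" by (simp add: prod_ennreal)
    also have "\<dots> \<le> ennreal (\<Sum>j\<in>J'. \<alpha> j * y j)"
      using J' y 3 by (intro ennreal_leI weighted_arith_geom_mean) (auto simp: less_imp_le)
    also have "\<dots> = (\<Sum>j\<in>J'. ennreal (\<alpha> j * y j))"
      using y by (intro sum_ennreal[symmetric]) (auto simp: less_imp_le)
    also have "\<dots> = (\<Sum>j\<in>J'. ennreal (\<alpha> j) * x j)"
      using y by (intro sum.cong refl) (simp add: ennreal_mult less_imp_le)
    finally show ?thesis unfolding 1 2 .
  qed
qed

text \<open>Each factor is normalised to integral one, and the weighted arithmetic-geometric mean is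
  integrated. A vanishing integral is treated first: the integrand is then zero almost everywhere.
  Only afterwards does an infinite integral make the right-hand product infinite.\<close>

lemma Hoelder_prod:
  assumes J: "finite J" and \<alpha>: "\<And>j. j \<in> J \<Longrightarrow> 0 \<le> \<alpha> j" "(\<Sum>j\<in>J. \<alpha> j) = 1"
    and f: "\<And>j. j \<in> J \<Longrightarrow> f j \<in> borel_measurable M"
  shows "(\<integral>\<^sup>+x. (\<Prod>j\<in>J. epow (f j x) (\<alpha> j)) \<partial>M) \<le> (\<Prod>j\<in>J. epow (\<integral>\<^sup>+x. f j x \<partial>M) (\<alpha> j))"
proof -
  define I where "I j = (\<integral>\<^sup>+x. f j x \<partial>M)" for j
  consider (z) k where "k \<in> J" "0 < \<alpha> k" "I k = 0"
    | (t) k where "k \<in> J" "0 < \<alpha> k" "I k = \<top>" "\<And>k. k \<in> J \<Longrightarrow> 0 < \<alpha> k \<Longrightarrow> I k \<noteq> 0"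
    | (r) "\<And>k. k \<in> J \<Longrightarrow> 0 < \<alpha> k \<Longrightarrow> I k \<noteq> \<top> \<and> I k \<noteq> 0" by blast
  then show ?thesis
  proof cases
    case z
    then have "AE x in M. f k x = 0" using nn_integral_0_iff_AE[OF f[OF z(1)]] by (simp add: I_def)
    then have "AE x in M. (\<Prod>j\<in>J. epow (f j x) (\<alpha> j)) = 0"
      by eventually_elim (use J z in \<open>auto intro!: prod_zero bexI[of _ k] simp: epow_zero_left\<close>)
    then have "(\<integral>\<^sup>+x. (\<Prod>j\<in>J. epow (f j x) (\<alpha> j)) \<partial>M) = (\<integral>\<^sup>+x. 0 \<partial>M)" by (rule nn_integral_cong_AE)
    then show ?thesis by simp
  next
    case t
    have "epow (I j) (\<alpha> j) \<noteq> 0" if "j \<in> J" for j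
      using t(4)[OF that] \<alpha>(1)[OF that] by (auto simp: epow_eq_0_iff less_le)
    then have "(\<Prod>j\<in>J - {k}. epow (I j) (\<alpha> j)) \<noteq> 0" using J by simp
    then have "(\<Prod>j\<in>J. epow (I j) (\<alpha> j)) = \<top>"
      using t J by (simp add: prod.remove[of J k] epow_top ennreal_top_mult)
    then show ?thesis by (simp add: I_def)
  next
    case r
    \<comment> \<open>A function of weight zero may have integral 0 or infinity; its power is 1
      anyway, so it is normalised by 1.\<close>
    define c where "c j = (if 0 < \<alpha> j then I j else 1)" for j
    have c: "c j \<noteq> 0" "c j \<noteq> \<top>" if "j \<in> J" for j using r[OF that] by (auto simp: c_def)
    have ee: "epow (f j x) (\<alpha> j) = epow (c j) (\<alpha> j) * epow (f j x / c j) (\<alpha> j)" if "j \<in> J" for j x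
    proof -
      have "f j x = c j * (f j x / c j)"
        using c[OF that] mult_divide_eq_ennreal[of "c j" "f j x"] by (simp add: ennreal_times_divide mult.commute)
      then show ?thesis using epow_mult[OF c[OF that] \<alpha>(1)[OF that]] by metis
    qed
    have "(\<integral>\<^sup>+x. (\<Prod>j\<in>J. epow (f j x) (\<alpha> j)) \<partial>M)
        = (\<integral>\<^sup>+x. (\<Prod>j\<in>J. epow (c j) (\<alpha> j)) * (\<Prod>j\<in>J. epow (f j x / c j) (\<alpha> j)) \<partial>M)"
      by (intro nn_integral_cong) (simp add: ee prod.distrib cong: prod.cong)
    also have "\<dots> \<le> (\<integral>\<^sup>+x. (\<Prod>j\<in>J. epow (c j) (\<alpha> j)) * (\<Sum>j\<in>J. ennreal (\<alpha> j) * (f j x / c j)) \<partial>M)"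
      by (intro nn_integral_mono mult_left_mono epow_arith_geom_mean J \<alpha>) auto
    also have "\<dots> = (\<Prod>j\<in>J. epow (c j) (\<alpha> j)) * (\<Sum>j\<in>J. \<integral>\<^sup>+x. ennreal (\<alpha> j) * (f j x / c j) \<partial>M)"
      using f by (subst nn_integral_cmult) (auto simp: nn_integral_sum)
    also have "(\<Sum>j\<in>J. \<integral>\<^sup>+x. ennreal (\<alpha> j) * (f j x / c j) \<partial>M) = (\<Sum>j\<in>J. ennreal (\<alpha> j))"
    proof (rule sum.cong[OF refl])
      fix j assume j: "j \<in> J"
      have "(\<integral>\<^sup>+x. ennreal (\<alpha> j) * (f j x / c j) \<partial>M) = ennreal (\<alpha> j) * (I j / c j)"
        using f[OF j] by (simp add: nn_integral_cmult nn_integral_divide I_def)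
      also have "\<dots> = ennreal (\<alpha> j)"
        using c[OF j] \<alpha>(1)[OF j] by (cases "0 < \<alpha> j") (auto simp: c_def ennreal_divide_self less_top)
      finally show "(\<integral>\<^sup>+x. ennreal (\<alpha> j) * (f j x / c j) \<partial>M) = ennreal (\<alpha> j)" .
    qed
    also have "\<dots> = 1" using \<alpha> by (simp add: sum_ennreal)
    also have "(\<Prod>j\<in>J. epow (c j) (\<alpha> j)) = (\<Prod>j\<in>J. epow (I j) (\<alpha> j))"
      using \<alpha>(1) by (intro prod.cong refl) (auto simp: c_def less_le)
    finally show ?thesis by (simp add: I_def)
  qed
qed

lemma Hoelder:
  assumes "0 \<le> s" "0 \<le> t" "s + t = 1" "f \<in> borel_measurable M" "g \<in> borel_measurable M"
  shows "(\<integral>\<^sup>+x. epow (f x) s * epow (g x) t \<partial>M) \<le> epow (\<integral>\<^sup>+x. f x \<partial>M) s * epow (\<integral>\<^sup>+x. g x \<partial>M) t"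
  using Hoelder_prod[of "{True, False}" "\<lambda>i. if i then s else t" "\<lambda>i. if i then f else g" M] assms
  by (simp split: if_splits)

text \<open>Gagliardo's argument by induction on the coordinates. Integrating over a new coordinate
  \<open>i\<close> leaves the line integral in direction \<open>i\<close> untouched, and Hoelder's
  inequality handles the other factors. The extra power of \<open>F\<close> is what makes the
  statement reproduce itself for \<open>F'\<close>, the integral of \<open>F\<close> over the new
  coordinate.\<close>

lemma grid_lines:
  fixes F :: "('i \<Rightarrow> real) \<Rightarrow> ennreal"
  assumes "finite s" "F \<in> borel_measurable (Pi\<^sub>M s (\<lambda>_. lborel))" "0 \<le> p" "(real (card s) - 1) * p \<le> 1"
  shows "(\<integral>\<^sup>+w. epow (F w) (1 - (real (card s) - 1) * p) * (\<Prod>i\<in>s. epow (\<integral>\<^sup>+t. F (w(i := t)) \<partial>lborel) p) \<partial>Pi\<^sub>M s (\<lambda>_. lborel))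
    \<le> epow (\<integral>\<^sup>+w. F w \<partial>Pi\<^sub>M s (\<lambda>_. lborel)) (1 + p)"
  using assms
proof (induction s arbitrary: F rule: finite_induct)
  case empty
  then show ?case by (simp add: PiM_empty nn_integral_count_space_finite)
next
  case (insert i s)
  interpret product_sigma_finite "\<lambda>_::'i. lborel :: real measure" by standard
  let ?M = "\<lambda>s. Pi\<^sub>M s (\<lambda>_::'i. lborel :: real measure)"
  note Fm[measurable] = insert.prems(1)
  have up: "(\<lambda>q. (fst q)(j := snd q)) \<in> measurable (?M K \<Otimes>\<^sub>M lborel) (?M (insert j K))" for j K
    by (rule measurable_fun_upd[where J=K]) auto
  have line: "(\<lambda>w. \<integral>\<^sup>+u. H (w(j := u)) \<partial>lborel) \<in> borel_measurable (?M K)"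
    if "H \<in> borel_measurable (?M (insert j K))" for H :: "('i \<Rightarrow> real) \<Rightarrow> ennreal" and j K
    using measurable_compose[OF up that] by (intro lborel.borel_measurable_nn_integral) (simp add: case_prod_beta)
  define F' where "F' w = (\<integral>\<^sup>+t. F (w(i := t)) \<partial>lborel)" for w
  have F'm: "F' \<in> borel_measurable (?M s)" unfolding F'_def[abs_def] by (rule line[OF Fm])
  have cs: "real (card (insert i s)) = real (card s) + 1" using insert.hyps by simp
  have sp: "real (card s) * p \<le> 1" using insert.prems(3) cs by simp
  have sp': "(real (card s) - 1) * p \<le> 1" using sp \<open>0 \<le> p\<close> by (simp add: left_diff_distrib)
  have linej: "(\<lambda>w. \<integral>\<^sup>+u. F (w(j := u)) \<partial>lborel) \<in> borel_measurable (?M (insert i s))" if "j \<in> insert i s" for j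
    using that Fm by (intro line) (simp add: insert_absorb)
  let ?G = "\<lambda>w. epow (F w) (1 - (real (card (insert i s)) - 1) * p) * (\<Prod>j\<in>insert i s. epow (\<integral>\<^sup>+t. F (w(j := t)) \<partial>lborel) p)"
  have Gm: "?G \<in> borel_measurable (?M (insert i s))"
    using linej by (intro borel_measurable_times_ennreal borel_measurable_prod_ennreal measurable_compose[OF _ epow_measurable] Fm) auto
  have inner: "(\<integral>\<^sup>+t. ?G (w(i := t)) \<partial>lborel)
      \<le> epow (F' w) (1 - (real (card s) - 1) * p) * (\<Prod>j\<in>s. epow (\<integral>\<^sup>+u. F' (w(j := u)) \<partial>lborel) p)"
    if w: "w \<in> space (?M s)" for w
  proof -
    have upi: "(\<lambda>t. w(i := t)) \<in> measurable lborel (?M (insert i s))"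
      using measurable_compose[OF measurable_Pair1'[OF w, of lborel] up] by simp
    define f where "f j t = (if j = i then F (w(i := t)) else (\<integral>\<^sup>+u. F (w(i := t, j := u)) \<partial>lborel))" for j t
    \<comment> \<open>Hoelder weights: \<open>p\<close> for each of the \<open>card s\<close> other
      line integrals, and the remaining \<open>1 - card s * p\<close> for \<open>F\<close>
      itself.\<close>
    define \<alpha> where "\<alpha> j = (if j = i then 1 - real (card s) * p else p)" for j
    have nj: "j \<noteq> i" if "j \<in> s" for j using that insert.hyps by auto
    have fm: "f j \<in> borel_measurable lborel" if "j \<in> insert i s" for j
    proof (cases "j = i")
      case True
      then have "f j = (\<lambda>t. F (w(i := t)))" by (simp add: f_def fun_eq_iff)
      then show ?thesis using measurable_compose[OF upi Fm] by (simp only:)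
    next
      case False
      then have "f j = (\<lambda>t. \<integral>\<^sup>+u. F (w(i := t, j := u)) \<partial>lborel)" by (simp add: f_def fun_eq_iff)
      then show ?thesis using measurable_compose[OF upi linej[OF that]] by (simp only:)
    qed
    have sum1: "(\<Sum>j\<in>insert i s. \<alpha> j) = 1"
    proof -
      have "(\<Sum>j\<in>s. \<alpha> j) = (\<Sum>j\<in>s. p)" using nj by (intro sum.cong) (auto simp: \<alpha>_def)
      then show ?thesis using insert.hyps by (simp add: \<alpha>_def)
    qed
    have "(\<integral>\<^sup>+t. ?G (w(i := t)) \<partial>lborel) = (\<integral>\<^sup>+t. epow (F' w) p * (\<Prod>j\<in>insert i s. epow (f j t) (\<alpha> j)) \<partial>lborel)"
    proof (rule nn_integral_cong)
      fix t
      have "(\<Prod>j\<in>s. epow (f j t) (\<alpha> j)) = (\<Prod>j\<in>s. epow (\<integral>\<^sup>+u. F (w(i := t, j := u)) \<partial>lborel) p)"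
        using nj by (intro prod.cong) (auto simp: f_def \<alpha>_def)
      then show "?G (w(i := t)) = epow (F' w) p * (\<Prod>j\<in>insert i s. epow (f j t) (\<alpha> j))"
        using insert.hyps by (simp add: cs f_def \<alpha>_def F'_def ac_simps)
    qed
    also have "\<dots> = epow (F' w) p * (\<integral>\<^sup>+t. (\<Prod>j\<in>insert i s. epow (f j t) (\<alpha> j)) \<partial>lborel)"
      using fm by (intro nn_integral_cmult borel_measurable_prod_ennreal measurable_compose[OF _ epow_measurable]) auto
    also have "\<dots> \<le> epow (F' w) p * (\<Prod>j\<in>insert i s. epow (\<integral>\<^sup>+t. f j t \<partial>lborel) (\<alpha> j))"
      using insert.hyps \<open>0 \<le> p\<close> sp fm sum1
      by (intro mult_left_mono Hoelder_prod) (auto simp: \<alpha>_def)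
    also have "(\<Prod>j\<in>insert i s. epow (\<integral>\<^sup>+t. f j t \<partial>lborel) (\<alpha> j))
        = epow (F' w) (1 - real (card s) * p) * (\<Prod>j\<in>s. epow (\<integral>\<^sup>+u. F' (w(j := u)) \<partial>lborel) p)"
    proof -
      \<comment> \<open>By Tonelli, integrating the line integral in direction \<open>j\<close> over
        coordinate \<open>i\<close> gives the line integral of \<open>F'\<close> in direction
        \<open>j\<close>.\<close>
      have "(\<integral>\<^sup>+t. f j t \<partial>lborel) = (\<integral>\<^sup>+u. F' (w(j := u)) \<partial>lborel)" if j: "j \<in> s" for j
      proof -
        have 2: "(\<lambda>q. w(i := fst q, j := snd q)) \<in> measurable (lborel \<Otimes>\<^sub>M lborel) (?M (insert i s))"
        proof (rule measurable_fun_upd)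
          show "insert i s = insert i s \<union> {j}" using j by auto
          show "(\<lambda>q. w(i := fst q)) \<in> measurable (lborel \<Otimes>\<^sub>M lborel) (?M (insert i s))"
            by (rule measurable_compose[OF measurable_fst upi])
        qed (rule measurable_snd)
        have "(\<integral>\<^sup>+t. f j t \<partial>lborel) = (\<integral>\<^sup>+t. (\<integral>\<^sup>+u. F (w(i := t, j := u)) \<partial>lborel) \<partial>lborel)"
          using nj[OF j] by (simp add: f_def)
        also have "\<dots> = (\<integral>\<^sup>+u. (\<integral>\<^sup>+t. F (w(i := t, j := u)) \<partial>lborel) \<partial>lborel)"
          using measurable_compose[OF 2 Fm] by (intro lborel_pair.Fubini'[symmetric]) (simp only: case_prod_beta')
        also have "\<dots> = (\<integral>\<^sup>+u. F' (w(j := u)) \<partial>lborel)"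
          unfolding F'_def using nj[OF j] by (simp add: fun_upd_twist)
        finally show ?thesis .
      qed
      then have "(\<Prod>j\<in>s. epow (\<integral>\<^sup>+t. f j t \<partial>lborel) (\<alpha> j)) = (\<Prod>j\<in>s. epow (\<integral>\<^sup>+u. F' (w(j := u)) \<partial>lborel) p)"
        using nj by (intro prod.cong) (auto simp: \<alpha>_def)
      then show ?thesis using insert.hyps by (simp add: f_def \<alpha>_def F'_def)
    qed
    also have "epow (F' w) p * (epow (F' w) (1 - real (card s) * p) * (\<Prod>j\<in>s. epow (\<integral>\<^sup>+u. F' (w(j := u)) \<partial>lborel) p))
        = epow (F' w) (1 - (real (card s) - 1) * p) * (\<Prod>j\<in>s. epow (\<integral>\<^sup>+u. F' (w(j := u)) \<partial>lborel) p)"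
    proof -
      \<comment> \<open>The two powers of \<open>F'\<close>, one from direction \<open>i\<close> and
        one from Hoelder's inequality, add up to the exponent of the induction hypothesis.\<close>
      have e: "1 - (real (card s) - 1) * p = p + (1 - real (card s) * p)" by (simp add: left_diff_distrib)
      have "epow (F' w) (p + (1 - real (card s) * p)) = epow (F' w) p * epow (F' w) (1 - real (card s) * p)"
        using \<open>0 \<le> p\<close> sp by (intro epow_add) auto
      then show ?thesis unfolding e by (simp only: mult.assoc)
    qed
    finally show ?thesis .
  qed
  have "(\<integral>\<^sup>+w. ?G w \<partial>?M (insert i s)) = (\<integral>\<^sup>+w. (\<integral>\<^sup>+t. ?G (w(i := t)) \<partial>lborel) \<partial>?M s)"
    by (rule product_nn_integral_insert[OF insert.hyps Gm])
  also have "\<dots> \<le> (\<integral>\<^sup>+w. epow (F' w) (1 - (real (card s) - 1) * p) * (\<Prod>j\<in>s. epow (\<integral>\<^sup>+u. F' (w(j := u)) \<partial>lborel) p) \<partial>?M s)"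
    by (rule nn_integral_mono[OF inner])
  also have "\<dots> \<le> epow (\<integral>\<^sup>+w. F' w \<partial>?M s) (1 + p)"
    by (rule insert.IH[OF F'm \<open>0 \<le> p\<close> sp'])
  also have "(\<integral>\<^sup>+w. F' w \<partial>?M s) = (\<integral>\<^sup>+w. F w \<partial>?M (insert i s))"
    unfolding F'_def by (rule product_nn_integral_insert[OF insert.hyps Fm, symmetric])
  finally show ?case .
qed

lemma prod_mono_ennreal:
  fixes f g :: "'j \<Rightarrow> ennreal"
  shows "(\<And>j. j \<in> J \<Longrightarrow> f j \<le> g j) \<Longrightarrow> prod f J \<le> prod g J"
  by (induction J rule: infinite_finite_induct) (auto intro: mult_mono)

text \<open>The power on the left is a product of \<open>n\<close> powers with exponent
  \<open>1 / (n - 1)\<close>, one for each direction, and each is bounded by the line integral in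
  its own direction.\<close>

lemma gagliardo_lines:
  fixes g v :: "real^'n \<Rightarrow> ennreal"
  assumes n: "2 \<le> CARD('n)" and g: "g \<in> borel_measurable borel"
    and v: "\<And>x b. b \<in> Basis \<Longrightarrow> v x \<le> (\<integral>\<^sup>+t. g (x + (t - x \<bullet> b) *\<^sub>R b) \<partial>lborel)"
  shows "(\<integral>\<^sup>+x. epow (v x) (real CARD('n) / (real CARD('n) - 1)) \<partial>lborel)
    \<le> epow (\<integral>\<^sup>+x. g x \<partial>lborel) (real CARD('n) / (real CARD('n) - 1))"
proof -
  let ?n = "real CARD('n)"
  let ?B = "Basis :: (real^'n) set"
  let ?M = "Pi\<^sub>M ?B (\<lambda>_. lborel :: real measure)"
  \<comment> \<open>For this value the free power of \<open>F\<close> in \<open>grid_lines\<close>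
    has exponent 0, and \<open>1 + p\<close> is the exponent on the right.\<close>
  define p where "p = 1 / (?n - 1)"
  have p: "0 < p" "(?n - 1) * p = 1" "1 + p = ?n / (?n - 1)" "?n * p = ?n / (?n - 1)"
    using n by (auto simp: p_def field_simps)
  define \<Phi> where "\<Phi> w = (\<Sum>b\<in>?B. w b *\<^sub>R b)" for w :: "real^'n \<Rightarrow> real"
  have \<Phi>m[measurable]: "\<Phi> \<in> measurable ?M borel" unfolding \<Phi>_def[abs_def] by measurable
  have lb: "(lborel :: (real^'n) measure) = distr ?M borel \<Phi>" unfolding \<Phi>_def[abs_def] by (rule lborel_eq)
  have coord: "\<Phi> w \<bullet> b = w b" if "b \<in> ?B" for w b
    unfolding \<Phi>_def using that by (simp add: inner_sum_left inner_Basis if_distrib cong: if_cong)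
  have upd: "\<Phi> (w(b := t)) = \<Phi> w + (t - \<Phi> w \<bullet> b) *\<^sub>R b" if b: "b \<in> ?B" for w b t
  proof -
    have "\<Phi> (w(b := t)) = t *\<^sub>R b + (\<Sum>c\<in>?B - {b}. w c *\<^sub>R c)"
      unfolding \<Phi>_def using b by (subst sum.remove[of _ b]) auto
    moreover have "\<Phi> w = w b *\<^sub>R b + (\<Sum>c\<in>?B - {b}. w c *\<^sub>R c)"
      unfolding \<Phi>_def using b by (subst sum.remove[of _ b]) auto
    ultimately show ?thesis unfolding coord[OF b] by (simp add: scaleR_diff_left)
  qed
  have Gm: "(\<lambda>w. g (\<Phi> w)) \<in> borel_measurable ?M" using g by measurable
  have "(\<integral>\<^sup>+x. epow (v x) (?n / (?n - 1)) \<partial>lborel)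
      \<le> (\<integral>\<^sup>+x. (\<Prod>b\<in>?B. epow (\<integral>\<^sup>+t. g (x + (t - x \<bullet> b) *\<^sub>R b) \<partial>lborel) p) \<partial>lborel)"
  proof (rule nn_integral_mono)
    fix x
    have "epow (v x) (?n / (?n - 1)) = (\<Prod>b\<in>?B. epow (v x) p)"
    proof -
      have "(\<Prod>b\<in>K. epow (v x) p) = epow (v x) (real (card K) * p)" if "finite K" for K :: "(real^'n) set"
        using that
      proof induction
        case (insert k K)
        then show ?case using epow_add[of p "real (card K) * p" "v x"] p(1) by (simp add: distrib_right)
      qed simp
      from this[of ?B] show ?thesis by (simp add: p(4))
    qed
    also have "\<dots> \<le> (\<Prod>b\<in>?B. epow (\<integral>\<^sup>+t. g (x + (t - x \<bullet> b) *\<^sub>R b) \<partial>lborel) p)"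
      using v p(1) by (intro prod_mono_ennreal epow_mono) auto
    finally show "epow (v x) (?n / (?n - 1)) \<le> (\<Prod>b\<in>?B. epow (\<integral>\<^sup>+t. g (x + (t - x \<bullet> b) *\<^sub>R b) \<partial>lborel) p)" .
  qed
  also have "\<dots> = (\<integral>\<^sup>+w. (\<Prod>b\<in>?B. epow (\<integral>\<^sup>+t. g (\<Phi> (w(b := t))) \<partial>lborel) p) \<partial>?M)"
  proof -
    have "(\<lambda>x. (\<Prod>b\<in>?B. epow (\<integral>\<^sup>+t. g (x + (t - x \<bullet> b) *\<^sub>R b) \<partial>lborel) p)) \<in> borel_measurable borel"
      using g by measurable
    then show ?thesis by (subst lb, subst nn_integral_distr) (auto simp: upd intro!: nn_integral_cong prod.cong)
  qed
  also have "\<dots> \<le> epow (\<integral>\<^sup>+w. g (\<Phi> w) \<partial>?M) (1 + p)"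
    using grid_lines[of ?B "\<lambda>w. g (\<Phi> w)" p] Gm p by simp
  also have "(\<integral>\<^sup>+w. g (\<Phi> w) \<partial>?M) = (\<integral>\<^sup>+x. g x \<partial>lborel)"
    using g by (subst lb, subst nn_integral_distr) auto
  finally show ?thesis by (simp add: p(3))
qed

section \<open>Calculus along coordinate lines and the Sobolev inequality\<close>

lemma partial_deriv_eq: "(u has_derivative D) (at x) \<Longrightarrow> partial_deriv i u x = D (axis i 1)"
  by (simp add: partial_deriv_def frechet_derivative_at[symmetric])

lemma has_derivative_partials:
  assumes "u differentiable (at x)"
  shows "(u has_derivative (\<lambda>h. \<Sum>i\<in>UNIV. h $ i * partial_deriv i u x)) (at (x :: real^'n))"
proof -
  let ?D = "frechet_derivative u (at x)"
  have d: "(u has_derivative ?D) (at x)" using assms frechet_derivative_works by blast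
  then have l: "linear ?D" using has_derivative_linear by blast
  have "?D h = (\<Sum>i\<in>UNIV. h $ i * partial_deriv i u x)" for h
  proof -
    have "?D h = ?D (\<Sum>i\<in>UNIV. h $ i *\<^sub>R axis i 1)"
      using basis_expansion[of h] by (simp add: scalar_mult_eq_scaleR)
    also have "\<dots> = (\<Sum>i\<in>UNIV. h $ i * partial_deriv i u x)"
      by (simp add: linear_sum[OF l] linear_cmul[OF l] partial_deriv_def)
    finally show ?thesis .
  qed
  then have "?D = (\<lambda>h. \<Sum>i\<in>UNIV. h $ i * partial_deriv i u x)" by (rule ext)
  with d show ?thesis by (simp only:)
qed

text \<open>At 0 the difference quotient has absolute value
  \<open>\<bar>h\<bar> powr (\<gamma> - 1)\<close>, which tends to 0 because
  \<open>\<gamma> > 1\<close>. So powers of \<open>\<bar>v\<bar>\<close> can be differentiated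
  directly, also where \<open>v\<close> vanishes.\<close>

lemma has_real_derivative_abs_powr:
  fixes s \<gamma> :: real
  assumes \<gamma>: "1 < \<gamma>"
  shows "((\<lambda>s. \<bar>s\<bar> powr \<gamma>) has_real_derivative \<gamma> * \<bar>s\<bar> powr (\<gamma> - 1) * sgn s) (at s)"
proof -
  consider "0 < s" | "s < 0" | "s = 0" by linarith
  then show ?thesis
  proof cases
    case 1
    have "((\<lambda>s. s powr \<gamma>) has_real_derivative \<gamma> * s powr (\<gamma> - 1)) (at s)"
      using 1 by (auto intro!: derivative_eq_intros)
    then have "((\<lambda>s. \<bar>s\<bar> powr \<gamma>) has_real_derivative \<gamma> * s powr (\<gamma> - 1)) (at s)"
      by (rule DERIV_cong_ev[OF refl _ refl, THEN iffD1, rotated])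
        (use eventually_nhds_in_open[of "{0<..}" s] 1 in \<open>auto elim!: eventually_mono\<close>)
    then show ?thesis using 1 by simp
  next
    case 2
    have "((\<lambda>s. (- s) powr \<gamma>) has_real_derivative \<gamma> * (- s) powr (\<gamma> - 1) * (- 1)) (at s)"
      using 2 by (auto intro!: derivative_eq_intros)
    then have "((\<lambda>s. \<bar>s\<bar> powr \<gamma>) has_real_derivative \<gamma> * (- s) powr (\<gamma> - 1) * (- 1)) (at s)"
      by (rule DERIV_cong_ev[OF refl _ refl, THEN iffD1, rotated])
        (use eventually_nhds_in_open[of "{..<0}" s] 2 in \<open>auto elim!: eventually_mono\<close>)
    then show ?thesis using 2 by simp
  next
    case 3
    have "((\<lambda>h. \<bar>h\<bar> powr (\<gamma> - 1)) \<longlongrightarrow> \<bar>0::real\<bar> powr (\<gamma> - 1)) (at 0)"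
      using \<gamma> by (intro tendsto_powr' tendsto_intros) auto
    then have "((\<lambda>h. \<bar>h\<bar> powr (\<gamma> - 1)) \<longlongrightarrow> (0::real)) (at 0)" using \<gamma> by simp
    moreover have "norm (\<bar>h\<bar> powr \<gamma> / h) = \<bar>h\<bar> powr (\<gamma> - 1)" if "h \<noteq> 0" for h :: real
      using that by (simp add: powr_diff)
    ultimately have "((\<lambda>h. norm (\<bar>h\<bar> powr \<gamma> / h)) \<longlongrightarrow> (0::real)) (at 0)"
      by (subst tendsto_cong[where g="\<lambda>h. \<bar>h\<bar> powr (\<gamma> - 1)"]) (auto simp: eventually_at_filter)
    then have "((\<lambda>h. \<bar>h\<bar> powr \<gamma> / h) \<longlongrightarrow> (0::real)) (at 0)" by (rule tendsto_norm_zero_cancel)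
    then show ?thesis using 3 \<gamma> by (simp add: has_field_derivative_def DERIV_def[unfolded has_field_derivative_def])
  qed
qed

lemma FTC_nn_bound:
  fixes H h :: "real \<Rightarrow> real"
  assumes H: "\<And>t. (H has_real_derivative h t) (at t)" and h: "continuous_on UNIV h"
    and a: "a \<le> t0" "H a = 0"
  shows "ennreal (H t0) \<le> (\<integral>\<^sup>+t. ennreal \<bar>h t\<bar> \<partial>lborel)"
proof -
  have "has_bochner_integral lborel (\<lambda>t. h t * indicator {a..t0} t) (H t0 - H a)"
    using a H h by (intro has_bochner_integral_FTC_Icc_real) (auto simp: continuous_on_eq_continuous_at)
  then have "H t0 = (\<integral>t. h t * indicator {a..t0} t \<partial>lborel)" using a by (simp add: has_bochner_integral_iff)
  then have "ennreal (H t0) \<le> ennreal (norm (\<integral>t. h t * indicator {a..t0} t \<partial>lborel))" by (intro ennreal_leI) simp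
  also have "\<dots> \<le> (\<integral>\<^sup>+t. ennreal (norm (h t * indicator {a..t0} t)) \<partial>lborel)" by (rule norm_integral_le_nn_integral)
  also have "\<dots> \<le> (\<integral>\<^sup>+t. ennreal \<bar>h t\<bar> \<partial>lborel)" by (intro nn_integral_mono ennreal_leI) (auto simp: indicator_def)
  finally show ?thesis .
qed

lemma compact_support_cball:
  assumes "compactly_supported_in UNIV v"
  obtains M where "0 < M" "\<And>x. M < norm x \<Longrightarrow> v (x :: real^'n) = 0"
proof -
  have "bounded (closure {x. v x \<noteq> 0})" using assms by (simp add: compactly_supported_in_def compact_imp_bounded)
  then obtain M where M: "0 < M" "\<And>x. x \<in> closure {x. v x \<noteq> 0} \<Longrightarrow> norm x \<le> M"
    unfolding bounded_pos by blast
  show ?thesis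
  proof (rule that[OF M(1)])
    fix x :: "real^'n" assume "M < norm x"
    then have "x \<notin> closure {x. v x \<noteq> 0}" using M(2)[of x] by auto
    then show "v x = 0" using closure_subset[of "{x. v x \<noteq> 0}"] by auto
  qed
qed

text \<open>\<open>\<bar>v\<bar> powr \<gamma>\<close> vanishes far out on the line through
  \<open>x\<close> in direction \<open>b\<close>, so its value at \<open>x\<close> is the integral
  of its derivative along the line.\<close>

lemma C1_line_bound:
  fixes v :: "real^'n \<Rightarrow> real"
  assumes v: "Ck 1 v" "compactly_supported_in UNIV v" and \<gamma>: "1 < \<gamma>" and b: "b \<in> Basis"
  shows "ennreal (\<bar>v x\<bar> powr \<gamma>) \<le> (\<integral>\<^sup>+t. (\<lambda>y. ennreal (\<gamma> * \<bar>v y\<bar> powr (\<gamma> - 1) * (\<Sum>i\<in>UNIV. \<bar>partial_deriv i v y\<bar>))) (x + (t - x \<bullet> b) *\<^sub>R b) \<partial>lborel)"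
proof -
  obtain i where i: "b = axis i 1" using b by (auto simp: Basis_vec_def)
  define ray where "ray t = x + (t - x \<bullet> b) *\<^sub>R b" for t
  have d: "v differentiable (at y)" and pc: "continuous_on UNIV (partial_deriv j v)" for y j using v by auto
  have vc: "continuous_on UNIV v" by (rule Ck_continuous[OF v(1)])
  have rayc: "continuous_on UNIV ray" unfolding ray_def by (intro continuous_intros)
  obtain M where M: "0 < M" "\<And>x. M < norm x \<Longrightarrow> v x = 0" using compact_support_cball[OF v(2)] by metis
  have fl: "((\<lambda>t. v (ray t)) has_real_derivative partial_deriv i v (ray t)) (at t)" for t
  proof -
    have "(ray has_derivative (\<lambda>h. h *\<^sub>R b)) (at t)" unfolding ray_def by (auto intro!: derivative_eq_intros)
    from has_derivative_compose[OF this has_derivative_partials[OF d]]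
    have "((\<lambda>t. v (ray t)) has_derivative (\<lambda>h. \<Sum>j\<in>UNIV. (h *\<^sub>R b) $ j * partial_deriv j v (ray t))) (at t)" .
    moreover have "(\<Sum>j\<in>UNIV. (h *\<^sub>R b) $ j * partial_deriv j v (ray t)) = partial_deriv i v (ray t) * h" for h
    proof -
      have "(\<Sum>j\<in>UNIV. (h *\<^sub>R b) $ j * partial_deriv j v (ray t)) = (\<Sum>j\<in>UNIV. if j = i then partial_deriv j v (ray t) * h else 0)"
        unfolding i by (intro sum.cong) (auto simp: axis_def)
      then show ?thesis by simp
    qed
    ultimately show ?thesis by (simp add: has_field_derivative_def)
  qed
  define h where "h t = \<gamma> * \<bar>v (ray t)\<bar> powr (\<gamma> - 1) * sgn (v (ray t)) * partial_deriv i v (ray t)" for t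
  have H: "((\<lambda>t. \<bar>v (ray t)\<bar> powr \<gamma>) has_real_derivative h t) (at t)" for t
    unfolding h_def by (rule DERIV_chain2[OF has_real_derivative_abs_powr[OF \<gamma>] fl])
  have hc: "continuous_on UNIV h"
  proof -
    have "continuous_on UNIV (\<lambda>s::real. \<bar>s\<bar> powr (\<gamma> - 1) * sgn s)"
    proof -
      have "isCont (\<lambda>s::real. \<bar>s\<bar> powr (\<gamma> - 1) * sgn s) s" for s
      proof (cases "s = 0")
        case False
        then show ?thesis by (intro continuous_intros isCont_sgn) auto
      next
        case True
        have "((\<lambda>h. \<bar>h\<bar> powr (\<gamma> - 1)) \<longlongrightarrow> \<bar>0::real\<bar> powr (\<gamma> - 1)) (at 0)"
          using \<gamma> by (intro tendsto_powr' tendsto_intros) auto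
        then have "((\<lambda>h. \<bar>h\<bar> powr (\<gamma> - 1)) \<longlongrightarrow> (0::real)) (at 0)" using \<gamma> by simp
        then have "((\<lambda>h. \<bar>h\<bar> powr (\<gamma> - 1) * sgn h) \<longlongrightarrow> (0::real)) (at 0)"
          by (rule Lim_null_comparison[rotated]) (auto simp: abs_mult abs_sgn_eq)
        then show ?thesis using True by (simp add: isCont_def)
      qed
      then show ?thesis by (simp add: continuous_on_eq_continuous_at)
    qed
    from continuous_on_compose2[OF this continuous_on_compose2[OF vc rayc]]
    have 1: "continuous_on UNIV (\<lambda>t. \<bar>v (ray t)\<bar> powr (\<gamma> - 1) * sgn (v (ray t)))" by simp
    have 2: "continuous_on UNIV (\<lambda>t. partial_deriv i v (ray t))" using continuous_on_compose2[OF pc rayc] by simp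
    have "continuous_on UNIV (\<lambda>t. \<gamma> * ((\<bar>v (ray t)\<bar> powr (\<gamma> - 1) * sgn (v (ray t))) * partial_deriv i v (ray t)))"
      by (rule continuous_on_mult[OF continuous_on_const continuous_on_mult[OF 1 2]])
    then show ?thesis by (simp add: h_def[abs_def] mult.assoc)
  qed
  \<comment> \<open>A parameter before \<open>x\<close> at which the ray has already left the
    support: the coordinate of \<open>ray a\<close> along \<open>b\<close> is \<open>a\<close>, and
    \<open>\<bar>a\<bar> > M\<close>.\<close>
  define a where "a = min (x \<bullet> b) (- M - 1)"
  have "ray t \<bullet> b = t" for t using b by (simp add: ray_def inner_add_left inner_Basis)
  then have "\<bar>t\<bar> \<le> norm (ray t)" for t using Basis_le_norm[OF b, of "ray t"] by simp
  then have "M < norm (ray a)" using M(1) unfolding a_def by (smt (verit))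
  then have "\<bar>v (ray a)\<bar> powr \<gamma> = 0" using M(2) by simp
  from FTC_nn_bound[OF H hc _ this, of "x \<bullet> b"]
  have "ennreal (\<bar>v (ray (x \<bullet> b))\<bar> powr \<gamma>) \<le> (\<integral>\<^sup>+t. ennreal \<bar>h t\<bar> \<partial>lborel)" by (simp add: a_def)
  also have "\<dots> \<le> (\<integral>\<^sup>+t. (\<lambda>y. ennreal (\<gamma> * \<bar>v y\<bar> powr (\<gamma> - 1) * (\<Sum>i\<in>UNIV. \<bar>partial_deriv i v y\<bar>))) (ray t) \<partial>lborel)"
  proof (intro nn_integral_mono ennreal_leI)
    fix t
    have "\<bar>h t\<bar> \<le> \<gamma> * \<bar>v (ray t)\<bar> powr (\<gamma> - 1) * \<bar>partial_deriv i v (ray t)\<bar>"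
      unfolding h_def abs_mult using \<gamma> by (auto simp: abs_sgn_eq)
    also have "\<dots> \<le> \<gamma> * \<bar>v (ray t)\<bar> powr (\<gamma> - 1) * (\<Sum>i\<in>UNIV. \<bar>partial_deriv i v (ray t)\<bar>)"
      using \<gamma> by (intro mult_left_mono member_le_sum) auto
    finally show "\<bar>h t\<bar> \<le> \<gamma> * \<bar>v (ray t)\<bar> powr (\<gamma> - 1) * (\<Sum>i\<in>UNIV. \<bar>partial_deriv i v (ray t)\<bar>)" .
  qed
  finally show ?thesis by (simp add: ray_def)
qed

lemma nn_integral_powr_compact_support:
  fixes v :: "real^'n \<Rightarrow> real"
  assumes "continuous_on UNIV v" "compactly_supported_in UNIV v" and q: "0 < q"
  shows "(\<integral>\<^sup>+x. ennreal (\<bar>v x\<bar> powr q) \<partial>lborel) < \<infinity>"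
proof -
  let ?K = "closure {x. v x \<noteq> 0}"
  have K: "compact ?K" using assms(2) by (simp add: compactly_supported_in_def)
  obtain C where C: "0 \<le> C" "\<And>x. \<bar>v x\<bar> \<le> C" using bounded_compact_support[OF assms(1) K order_refl] by metis
  have "(\<integral>\<^sup>+x. ennreal (\<bar>v x\<bar> powr q) \<partial>lborel) \<le> (\<integral>\<^sup>+x. ennreal (C powr q) * indicator ?K x \<partial>lborel)"
  proof (rule nn_integral_mono)
    fix x
    show "ennreal (\<bar>v x\<bar> powr q) \<le> ennreal (C powr q) * indicator ?K x"
    proof (cases "v x = 0")
      case False
      then have "x \<in> ?K" using closure_subset[of "{x. v x \<noteq> 0}"] by blast
      then show ?thesis using C q by (simp add: powr_mono2 ennreal_leI)
    qed simp
  qed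
  also have "\<dots> = ennreal (C powr q) * emeasure lborel ?K" by (rule nn_integral_cmult_indicator) simp
  also have "\<dots> < \<infinity>" using emeasure_compact_finite[OF K] by (simp add: ennreal_mult_less_top)
  finally show ?thesis .
qed

text \<open>The case of exponent 1 is applied to \<open>\<bar>v\<bar> powr \<gamma>\<close>.
  Hoelder's inequality then makes the integral of \<open>\<bar>v\<bar> powr q\<close> appear on the
  right with a smaller power than on the left, and it is divided out; compact support makes it
  finite.\<close>

lemma sobolev_inequality:
  fixes v :: "real^'n \<Rightarrow> real"
  assumes v: "Ck 1 v" "compactly_supported_in UNIV v" and n: "2 \<le> CARD('n)" and p: "1 < p" "p < real CARD('n)"
    and q: "q = real CARD('n) * p / (real CARD('n) - p)"
  shows "epow (\<integral>\<^sup>+x. ennreal (\<bar>v x\<bar> powr q) \<partial>lborel) (1 / q)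
    \<le> ennreal (p * (real CARD('n) - 1) / (real CARD('n) - p))
      * epow (\<integral>\<^sup>+x. ennreal ((\<Sum>i\<in>UNIV. \<bar>partial_deriv i v x\<bar>) powr p) \<partial>lborel) (1 / p)"
proof -
  let ?n = "real CARD('n)"
  \<comment> \<open>The value for which both \<open>\<gamma> * n / (n - 1)\<close> and
    \<open>(\<gamma> - 1) * p / (p - 1)\<close> are equal to \<open>q\<close>, so that left and
    right contain the same integral.\<close>
  define \<gamma> where "\<gamma> = p * (?n - 1) / (?n - p)"
  define A where "A = (\<integral>\<^sup>+x. ennreal (\<bar>v x\<bar> powr q) \<partial>lborel)"
  define G where "G x = (\<Sum>i\<in>UNIV. \<bar>partial_deriv i v x\<bar>)" for x
  define D where "D = (\<integral>\<^sup>+x. ennreal (G x powr p) \<partial>lborel)"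
  have n1: "1 < ?n" using n by simp
  have \<gamma>: "1 < \<gamma>" using p n1 by (simp add: \<gamma>_def field_simps)
  have q0: "0 < q" using p n1 by (simp add: q)
  have e1: "\<gamma> * (?n / (?n - 1)) = q" using p n1 by (simp add: \<gamma>_def q mult.commute)
  have e2: "q * (1 - 1 / p) = \<gamma> - 1" using p n1 by (simp add: \<gamma>_def q field_simps)
  have e3: "(?n - 1) / ?n - (1 - 1 / p) = 1 / q" using p n1 by (simp add: q field_simps)
  have vm: "v \<in> borel_measurable borel" by (rule Ck_borel[OF v(1)])
  have Gm: "G \<in> borel_measurable borel"
  proof -
    have "partial_deriv i v \<in> borel_measurable borel" for i using v(1) by (intro Ck_borel[of 0]) simp
    then show ?thesis unfolding G_def[abs_def] by measurable
  qed
  have G0: "0 \<le> G x" for x by (simp add: G_def sum_nonneg)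
  have gm: "(\<lambda>y. ennreal (\<gamma> * \<bar>v y\<bar> powr (\<gamma> - 1) * G y)) \<in> borel_measurable borel" using vm Gm by measurable
  have Afin: "A < \<infinity>" unfolding A_def by (rule nn_integral_powr_compact_support[OF Ck_continuous[OF v(1)] v(2) q0])
  have "A = (\<integral>\<^sup>+x. epow (ennreal (\<bar>v x\<bar> powr \<gamma>)) (?n / (?n - 1)) \<partial>lborel)"
    unfolding A_def using n1 by (intro nn_integral_cong) (simp add: epow_ennreal powr_powr e1 del: times_divide_eq_right)
  also have "\<dots> \<le> epow (\<integral>\<^sup>+y. ennreal (\<gamma> * \<bar>v y\<bar> powr (\<gamma> - 1) * G y) \<partial>lborel) (?n / (?n - 1))"
    unfolding G_def by (rule gagliardo_lines[OF n gm[unfolded G_def] C1_line_bound[OF v \<gamma>]])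
  finally have 1: "A \<le> epow (\<integral>\<^sup>+y. ennreal (\<gamma> * \<bar>v y\<bar> powr (\<gamma> - 1) * G y) \<partial>lborel) (?n / (?n - 1))" .
  have "(\<integral>\<^sup>+y. ennreal (\<gamma> * \<bar>v y\<bar> powr (\<gamma> - 1) * G y) \<partial>lborel)
      = (\<integral>\<^sup>+y. ennreal \<gamma> * (epow (ennreal (\<bar>v y\<bar> powr q)) (1 - 1 / p) * epow (ennreal (G y powr p)) (1 / p)) \<partial>lborel)"
  proof (rule nn_integral_cong)
    fix y
    have "epow (ennreal (\<bar>v y\<bar> powr q)) (1 - 1 / p) = ennreal (\<bar>v y\<bar> powr (\<gamma> - 1))"
      using p by (simp add: epow_ennreal powr_powr e2)
    moreover have "epow (ennreal (G y powr p)) (1 / p) = ennreal (G y)"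
      using p G0[of y] by (simp add: epow_ennreal powr_powr)
    ultimately show "ennreal (\<gamma> * \<bar>v y\<bar> powr (\<gamma> - 1) * G y) = ennreal \<gamma> * (epow (ennreal (\<bar>v y\<bar> powr q)) (1 - 1 / p) * epow (ennreal (G y powr p)) (1 / p))"
      using \<gamma> G0[of y] by (simp add: ennreal_mult mult.assoc)
  qed
  also have "\<dots> = ennreal \<gamma> * (\<integral>\<^sup>+y. epow (ennreal (\<bar>v y\<bar> powr q)) (1 - 1 / p) * epow (ennreal (G y powr p)) (1 / p) \<partial>lborel)"
  proof (rule nn_integral_cmult)
    note vm[measurable] Gm[measurable]
    show "(\<lambda>y. epow (ennreal (\<bar>v y\<bar> powr q)) (1 - 1 / p) * epow (ennreal (G y powr p)) (1 / p)) \<in> borel_measurable lborel"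
      unfolding measurable_lborel2 by measurable
  qed
  also have "\<dots> \<le> ennreal \<gamma> * (epow A (1 - 1 / p) * epow D (1 / p))"
    unfolding A_def D_def using p vm Gm by (intro mult_left_mono Hoelder) auto
  finally have 2: "(\<integral>\<^sup>+y. ennreal (\<gamma> * \<bar>v y\<bar> powr (\<gamma> - 1) * G y) \<partial>lborel) \<le> ennreal \<gamma> * (epow A (1 - 1 / p) * epow D (1 / p))" .
  have 3: "A \<le> epow (ennreal \<gamma> * (epow A (1 - 1 / p) * epow D (1 / p))) (?n / (?n - 1))"
    using n1 by (intro order_trans[OF 1] epow_mono 2) simp
  have "epow A (1 / q) \<le> ennreal \<gamma> * epow D (1 / p)"
  proof (cases D)
    case top
    then show ?thesis using p \<gamma> by (simp add: epow_top ennreal_mult_top)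
  next
    case (real d)
    obtain \<alpha> where \<alpha>: "A = ennreal \<alpha>" "0 \<le> \<alpha>" using Afin by (cases A) auto
    show ?thesis
    proof (cases "\<alpha> = 0")
      case True
      then show ?thesis using \<alpha> q0 by (simp add: epow_zero_left)
    next
      case False
      then have a: "0 < \<alpha>" using \<alpha> by simp
      let ?d = "d powr (1 / p)"
      have "ennreal \<alpha> \<le> ennreal ((\<gamma> * (\<alpha> powr (1 - 1 / p) * ?d)) powr (?n / (?n - 1)))"
        using 3 \<alpha> real p n1 \<gamma> by (simp add: epow_ennreal ennreal_mult[symmetric])
      then have "\<alpha> \<le> (\<gamma> * (\<alpha> powr (1 - 1 / p) * ?d)) powr (?n / (?n - 1))" by (simp add: ennreal_le_iff)
      then have "\<alpha> powr ((?n - 1) / ?n) \<le> ((\<gamma> * (\<alpha> powr (1 - 1 / p) * ?d)) powr (?n / (?n - 1))) powr ((?n - 1) / ?n)"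
        using a n1 by (intro powr_mono2) auto
      also have "\<dots> = \<gamma> * (\<alpha> powr (1 - 1 / p) * ?d)"
        using n1 \<gamma> by (simp add: powr_powr)
      finally have "\<alpha> powr ((?n - 1) / ?n) / \<alpha> powr (1 - 1 / p) \<le> \<gamma> * ?d"
        using a by (simp add: divide_le_eq ac_simps)
      then have "\<alpha> powr (1 / q) \<le> \<gamma> * ?d" by (simp add: powr_diff[symmetric] e3)
      then show ?thesis
        using \<alpha> real q0 p \<gamma> by (simp add: epow_ennreal ennreal_mult[symmetric] ennreal_leI)
    qed
  qed
  then show ?thesis unfolding A_def D_def G_def \<gamma>_def .
qed

section \<open>Mollifiers\<close>

text \<open>The standard flat function \<open>exp (- 1 / s)\<close>, extended by 0, times powers of
  \<open>1 / s\<close>. The powers make the family closed under differentiation up to linear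
  combinations.\<close>

definition hexp :: "nat \<Rightarrow> real \<Rightarrow> real" where
  "hexp m s = (if 0 < s then (1 / s) ^ m * exp (- (1 / s)) else 0)"

lemma hexp_tendsto_0: "((\<lambda>k. (1 / k) ^ m * exp (- (1 / k))) \<longlongrightarrow> (0::real)) (at_right 0)"
proof -
  have "((\<lambda>x::real. x ^ m * exp (- x)) \<longlongrightarrow> 0) at_top"
    using tendsto_power_div_exp_0[of m] by (simp add: exp_minus divide_inverse)
  from filterlim_compose[OF this filterlim_inverse_at_top_right] show ?thesis
    by (simp add: inverse_eq_divide)
qed

lemma hexp_deriv:
  "(hexp m has_real_derivative - real m * hexp (Suc m) s + hexp (m + 2) s) (at s)"
proof -
  consider "0 < s" | "s < 0" | "s = 0" by linarith
  then show ?thesis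
  proof cases
    case 1
    let ?r = "1 / s"
    have r: "((\<lambda>s. 1 / s) has_real_derivative - (?r\<^sup>2)) (at s)"
      using 1 by (auto intro!: derivative_eq_intros simp: power2_eq_square)
    have p: "((\<lambda>s. (1 / s) ^ m) has_real_derivative real m * (- (?r\<^sup>2) * ?r ^ (m - Suc 0))) (at s)"
      using DERIV_power[OF r, of m] by simp
    have e: "((\<lambda>s. exp (- (1 / s))) has_real_derivative exp (- ?r) * - (- (?r\<^sup>2))) (at s)"
      by (rule DERIV_chain2[OF DERIV_exp DERIV_minus[OF r]])
    have "real m * (- (?r\<^sup>2) * ?r ^ (m - Suc 0)) * exp (- ?r) + exp (- ?r) * - (- (?r\<^sup>2)) * ?r ^ m
      = - real m * hexp (Suc m) s + hexp (m + 2) s"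
    proof -
      define q where "q = 1 / s"
      have "hexp k s = q ^ k * exp (- q)" for k using 1 by (simp add: hexp_def q_def)
      then show ?thesis
        unfolding q_def[symmetric] by (cases m) (simp_all add: power2_eq_square algebra_simps)
    qed
    with DERIV_mult[OF p e] have "((\<lambda>s. (1 / s) ^ m * exp (- (1 / s))) has_real_derivative - real m * hexp (Suc m) s + hexp (m + 2) s) (at s)"
      by (simp only:)
    then show ?thesis
      by (rule has_field_derivative_transform_within_open[where S="{0<..}"]) (use 1 in \<open>auto simp: hexp_def\<close>)
  next
    case 2
    have "((\<lambda>s. 0) has_real_derivative - real m * hexp (Suc m) s + hexp (m + 2) s) (at s)"
      using 2 by (simp add: hexp_def)
    then show ?thesis
      by (rule has_field_derivative_transform_within_open[where S="{..<0}"]) (use 2 in \<open>auto simp: hexp_def\<close>)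
  next
    case 3
    \<comment> \<open>From the right, the difference quotient at 0 is the function of index
      \<open>Suc m\<close>, which again tends to 0; from the left it vanishes.\<close>
    have "((\<lambda>k. hexp m k / k) \<longlongrightarrow> 0) (at_right 0)"
      using hexp_tendsto_0[of "Suc m"]
      by (subst tendsto_cong[where g="\<lambda>k. (1 / k) ^ Suc m * exp (- (1 / k))"])
        (auto simp: eventually_at_right_field hexp_def field_simps intro!: exI[of _ 1])
    moreover have "((\<lambda>k. hexp m k / k) \<longlongrightarrow> 0) (at_left 0)"
      by (subst tendsto_cong[where g="\<lambda>k. 0"])
        (auto simp: eventually_at_left_field hexp_def intro!: exI[of _ "-1"])
    ultimately have "((\<lambda>k. hexp m k / k) \<longlongrightarrow> 0) (at 0)" using filterlim_split_at by blast
    then show ?thesis using 3 by (simp add: DERIV_def hexp_def)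
  qed
qed

lemma hexp_nonneg: "0 \<le> hexp m s"
  by (simp add: hexp_def)

text \<open>A class closed under partial derivatives: differentiating a bump gives bumps of higher
  index times coordinates. Membership therefore yields \<open>Ck k\<close> for all \<open>k\<close>
  without computing any higher derivative.\<close>

inductive smooth :: "(real^'n \<Rightarrow> real) \<Rightarrow> bool" where
  const: "smooth (\<lambda>_. c)"
| coord: "smooth (\<lambda>x. x $ i)"
| bump: "smooth (\<lambda>x. hexp m (r - (x - c) \<bullet> (x - c)))"
| add: "smooth u \<Longrightarrow> smooth v \<Longrightarrow> smooth (\<lambda>x. u x + v x)"
| mult: "smooth u \<Longrightarrow> smooth v \<Longrightarrow> smooth (\<lambda>x. u x * v x)"

lemma smooth_derivative:
  fixes u :: "real^'n \<Rightarrow> real"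
  shows "smooth u \<Longrightarrow> \<exists>D. (\<forall>i. smooth (D i)) \<and> (\<forall>x. (u has_derivative (\<lambda>h. \<Sum>i\<in>UNIV. h $ i * D i x)) (at x))"
proof (induction rule: smooth.induct)
  case (const c)
  show ?case by (intro exI[of _ "\<lambda>i x. 0"]) (auto intro: smooth.const)
next
  case (coord i)
  have "((\<lambda>x. x $ i) has_derivative (\<lambda>h. \<Sum>j\<in>UNIV. h $ j * (if j = i then 1 else 0))) (at x)" for x :: "real^'n"
    using bounded_linear_imp_has_derivative[OF bounded_linear_vec_nth[of i]] by (simp add: if_distrib cong: if_cong)
  then show ?case
    by (intro exI[of _ "\<lambda>j x. if j = i then 1 else 0"]) (auto intro: smooth.const)
next
  case (bump m r c)
  let ?in = "\<lambda>x::real^'n. r - (x - c) \<bullet> (x - c)"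
  let ?D = "\<lambda>i x. (- real m * hexp (Suc m) (?in x) + hexp (m + 2) (?in x)) * (- 2 * (x $ i + - (c $ i)))"
  have "smooth (?D i)" for i
    by (intro smooth.mult smooth.add smooth.const smooth.coord smooth.bump)
  moreover have "((\<lambda>x. hexp m (?in x)) has_derivative (\<lambda>h. \<Sum>i\<in>UNIV. h $ i * ?D i x)) (at x)" for x
  proof -
    have "(?in has_derivative (\<lambda>h. - (2 * ((x - c) \<bullet> h)))) (at x)"
      by (auto intro!: derivative_eq_intros simp: inner_commute)
    from has_derivative_compose[OF this hexp_deriv[of m "?in x", unfolded has_field_derivative_def]]
    have "((\<lambda>x. hexp m (?in x)) has_derivative (\<lambda>h. (- real m * hexp (Suc m) (?in x) + hexp (m + 2) (?in x)) * - (2 * ((x - c) \<bullet> h)))) (at x)" .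
    moreover have "A * - (2 * ((x - c) \<bullet> h)) = (\<Sum>i\<in>UNIV. h $ i * (A * (- 2 * (x $ i + - (c $ i)))))" for A h
      unfolding inner_vec_def sum_distrib_left sum_negf[symmetric]
      by (intro sum.cong) (simp_all add: algebra_simps)
    ultimately show ?thesis by (simp only:)
  qed
  ultimately show ?case by (intro exI[of _ ?D]) blast
next
  case (add u v)
  then obtain D E where D: "\<And>i. smooth (D i)" "\<And>x. (u has_derivative (\<lambda>h. \<Sum>i\<in>UNIV. h $ i * D i x)) (at x)"
    and E: "\<And>i. smooth (E i)" "\<And>x. (v has_derivative (\<lambda>h. \<Sum>i\<in>UNIV. h $ i * E i x)) (at x)" by blast
  have "((\<lambda>x. u x + v x) has_derivative (\<lambda>h. \<Sum>i\<in>UNIV. h $ i * (D i x + E i x))) (at x)" for x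
    using has_derivative_add[OF D(2) E(2), of x] by (simp add: distrib_left sum.distrib)
  then show ?case using D(1) E(1) by (intro exI[of _ "\<lambda>i x. D i x + E i x"]) (auto intro: smooth.add)
next
  case (mult u v)
  then obtain D E where D: "\<And>i. smooth (D i)" "\<And>x. (u has_derivative (\<lambda>h. \<Sum>i\<in>UNIV. h $ i * D i x)) (at x)"
    and E: "\<And>i. smooth (E i)" "\<And>x. (v has_derivative (\<lambda>h. \<Sum>i\<in>UNIV. h $ i * E i x)) (at x)" by blast
  have "((\<lambda>x. u x * v x) has_derivative (\<lambda>h. \<Sum>i\<in>UNIV. h $ i * (u x * E i x + D i x * v x))) (at x)" for x
    using has_derivative_mult[OF D(2) E(2), of x]
    by (simp add: distrib_left sum.distrib sum_distrib_left sum_distrib_right ac_simps)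
  then show ?case using D(1) E(1) mult.hyps
    by (intro exI[of _ "\<lambda>i x. u x * E i x + D i x * v x"]) (auto intro!: smooth.add smooth.mult)
qed

lemma smooth_Ck: "smooth u \<Longrightarrow> Ck k (u :: real^'n \<Rightarrow> real)"
proof (induction k arbitrary: u)
  case 0
  from smooth_derivative[OF this] have "u differentiable (at x)" for x unfolding differentiable_def by blast
  then show ?case by (auto simp: continuous_on_eq_continuous_at intro: differentiable_imp_continuous_within)
next
  case (Suc k)
  from smooth_derivative[OF Suc.prems] obtain D where
    D: "\<And>i. smooth (D i)" "\<And>x. (u has_derivative (\<lambda>h. \<Sum>i\<in>UNIV. h $ i * D i x)) (at x)" by blast
  have "partial_deriv i u = D i" for i
  proof
    fix x
    have "(\<Sum>j\<in>UNIV. (axis i 1 :: real^'n) $ j * D j x) = (\<Sum>j\<in>UNIV. if j = i then D j x else 0)"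
      by (intro sum.cong) (auto simp: axis_def)
    then show "partial_deriv i u x = D i x" using partial_deriv_eq[OF D(2)] by simp
  qed
  moreover have "u differentiable (at x)" for x using D(2) unfolding differentiable_def by blast
  ultimately show ?case using Suc.IH D(1) by simp
qed

definition bump_mass :: "'n::finite itself \<Rightarrow> real \<Rightarrow> real" where
  "bump_mass _ \<epsilon> = enn2real (\<integral>\<^sup>+z. ennreal (hexp 0 (\<epsilon>\<^sup>2 - (z :: real^'n) \<bullet> z)) \<partial>lborel)"

text \<open>Written with \<open>z - 0\<close> so that it has literally the form of the introduction
  rule \<open>bump\<close> with centre 0.\<close>

definition mollifier :: "real \<Rightarrow> real^'n \<Rightarrow> real" where
  "mollifier \<epsilon> z = (1 / bump_mass TYPE('n) \<epsilon>) * hexp 0 (\<epsilon>\<^sup>2 - (z - 0) \<bullet> (z - 0))"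

lemma mollifier_smooth: "smooth (mollifier \<epsilon>)"
  unfolding mollifier_def[abs_def] by (intro smooth.mult smooth.const smooth.bump)

lemma mollifier_Ck: "Ck k (mollifier \<epsilon>)"
  by (rule smooth_Ck[OF mollifier_smooth])

lemma mollifier_nonneg: "0 \<le> mollifier \<epsilon> z"
  by (simp add: mollifier_def bump_mass_def hexp_nonneg)

lemma mollifier_uminus: "mollifier \<epsilon> (- z) = mollifier \<epsilon> z"
  by (simp add: mollifier_def)

lemma mollifier_outside: "0 < \<epsilon> \<Longrightarrow> \<epsilon> \<le> norm z \<Longrightarrow> mollifier \<epsilon> z = 0"
  using power_mono[of \<epsilon> "norm z" 2] by (simp add: mollifier_def hexp_def power2_norm_eq_inner)

lemma compactly_supportedI:
  fixes u :: "real^'n \<Rightarrow> real"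
  assumes "compact K" "\<And>x. x \<notin> K \<Longrightarrow> u x = 0"
  shows "compactly_supported_in K u"
proof -
  have "closure {x. u x \<noteq> 0} \<subseteq> K" using assms by (intro closure_minimal compact_imp_closed) auto
  then show ?thesis
    using assms(1) unfolding compactly_supported_in_def by (metis closed_closure compact_Int_closed inf.absorb_iff2)
qed

lemma compactly_supported_mono: "compactly_supported_in S u \<Longrightarrow> S \<subseteq> T \<Longrightarrow> compactly_supported_in T u"
  by (auto simp: compactly_supported_in_def)

lemma mollifier_support: "0 < \<epsilon> \<Longrightarrow> compactly_supported_in (cball 0 \<epsilon>) (mollifier \<epsilon>)"
  by (rule compactly_supportedI) (auto intro!: mollifier_outside)

text \<open>The normalising mass is finite because the bump is at most 1 and lives on a ball, and
  nonzero because the bump is positive on an open ball, which is not a null set.\<close>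

lemma mollifier_integral:
  assumes e: "0 < \<epsilon>"
  shows "(\<integral>\<^sup>+z. ennreal (mollifier \<epsilon> (z :: real^'n)) \<partial>lborel) = 1"
proof -
  let ?h = "\<lambda>z::real^'n. hexp 0 (\<epsilon>\<^sup>2 - z \<bullet> z)"
  define I where "I = (\<integral>\<^sup>+z. ennreal (?h z) \<partial>lborel)"
  have hm: "?h \<in> borel_measurable borel"
    using Ck_borel[OF smooth_Ck[OF smooth.bump[of 0 "\<epsilon>\<^sup>2" "0::real^'n"]]] by simp
  have le: "?h z \<le> 1" for z by (simp add: hexp_def)
  have out: "?h z = 0" if "z \<notin> cball 0 \<epsilon>" for z
    using that e power_mono[of \<epsilon> "norm z" 2] by (simp add: hexp_def power2_norm_eq_inner)
  have "I \<le> (\<integral>\<^sup>+z. indicator (cball 0 \<epsilon>) (z :: real^'n) \<partial>lborel)"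
    unfolding I_def
  proof (rule nn_integral_mono)
    fix z :: "real^'n"
    show "ennreal (?h z) \<le> indicator (cball 0 \<epsilon>) z"
    proof (cases "z \<in> cball 0 \<epsilon>")
      case True
      then show ?thesis using ennreal_leI[OF le[of z]] by simp
    next
      case False
      then have "?h z = 0" by (rule out)
      then show ?thesis by simp
    qed
  qed
  also have "\<dots> < \<infinity>" using emeasure_compact_finite[OF compact_cball[of "0::real^'n" \<epsilon>]] by simp
  finally have fin: "I < \<infinity>" .
  have pos: "I \<noteq> 0"
  proof
    assume "I = 0"
    then have "AE z in lborel. ennreal (?h z) = 0" unfolding I_def using hm by (subst (asm) nn_integral_0_iff_AE) auto
    then have "AE z in lborel. z \<notin> ball (0::real^'n) \<epsilon>"
    proof eventually_elim
      case (elim z)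
      show ?case
      proof
        assume "z \<in> ball 0 \<epsilon>"
        then have "0 < \<epsilon>\<^sup>2 - z \<bullet> z"
          using power_strict_mono[of "norm z" \<epsilon> 2] by (simp add: power2_norm_eq_inner)
        then have "0 < ?h z" by (simp add: hexp_def)
        with elim show False by (simp add: ennreal_eq_0_iff)
      qed
    qed
    then have "ball (0::real^'n) \<epsilon> \<in> null_sets lborel" by (subst AE_iff_null_sets) auto
    then have "negligible (ball (0::real^'n) \<epsilon>)" by (simp add: negligible_iff_null_sets null_sets_completionI)
    then show False using open_not_negligible[OF open_ball, of "0::real^'n" \<epsilon>] e by simp
  qed
  have mass: "ennreal (bump_mass TYPE('n) \<epsilon>) = I" unfolding bump_mass_def I_def[symmetric] using fin by simp
  then have mp: "0 < bump_mass TYPE('n) \<epsilon>" using pos by (metis bump_mass_def enn2real_nonneg ennreal_0 less_le)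
  have "(\<integral>\<^sup>+z. ennreal (mollifier \<epsilon> (z :: real^'n)) \<partial>lborel) = (\<integral>\<^sup>+z. ennreal (1 / bump_mass TYPE('n) \<epsilon>) * ennreal (?h z) \<partial>lborel)"
    using mp by (intro nn_integral_cong) (simp add: mollifier_def ennreal_mult[symmetric] hexp_nonneg)
  also have "\<dots> = ennreal (1 / bump_mass TYPE('n) \<epsilon>) * I"
    unfolding I_def using hm by (intro nn_integral_cmult) auto
  also have "\<dots> = 1" unfolding mass[symmetric] using mp by (simp add: ennreal_mult[symmetric])
  finally show ?thesis .
qed

section \<open>Convolution with mollifiers\<close>

text \<open>All regularity comes from \<open>K\<close>: derivatives fall on the kernel, and
  \<open>w\<close> need only be integrable.\<close>

definition conv :: "(real^'n \<Rightarrow> real) \<Rightarrow> (real^'n \<Rightarrow> real) \<Rightarrow> real^'n \<Rightarrow> real" where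
  "conv w K x = (\<integral>y. w y * K (x - y) \<partial>lborel)"

lemma conv_integrable:
  fixes w K :: "real^'n \<Rightarrow> real"
  assumes w: "integrable lborel w" and K: "continuous_on UNIV K" "compactly_supported_in UNIV K"
  shows "integrable lborel (\<lambda>y. w y * K (x - y))"
proof -
  obtain C where C: "0 \<le> C" "\<And>x. \<bar>K x\<bar> \<le> C"
    using bounded_compact_support[OF K(1) _ order_refl] K(2) unfolding compactly_supported_in_def by metis
  have [measurable]: "w \<in> borel_measurable borel" using w by auto
  have [measurable]: "K \<in> borel_measurable borel" using K(1) by (rule borel_measurable_continuous_onI)
  show ?thesis
  proof (rule Bochner_Integration.integrable_bound[of lborel "\<lambda>y. C * w y"])
    show "AE y in lborel. norm (w y * K (x - y)) \<le> norm (C * w y)"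
      using C by (intro AE_I2) (auto simp: abs_mult mult.commute[of C] intro!: mult_left_mono)
  qed (use w in auto)
qed

lemma uniformly_continuous_compact_support:
  fixes u :: "real^'n \<Rightarrow> real"
  assumes "continuous_on UNIV u" "compactly_supported_in UNIV u" "0 < e"
  obtains d where "0 < d" "\<And>y z. norm (y - z) < d \<Longrightarrow> \<bar>u y - u z\<bar> < e"
proof -
  obtain M where M: "0 < M" "\<And>x. M < norm x \<Longrightarrow> u x = 0" using compact_support_cball[OF assms(2)] by metis
  have "uniformly_continuous_on (cball 0 (M + 1)) u"
    by (intro compact_uniformly_continuous continuous_on_subset[OF assms(1)]) auto
  then obtain d where d: "0 < d" "\<And>y z. y \<in> cball 0 (M + 1) \<Longrightarrow> z \<in> cball 0 (M + 1) \<Longrightarrow> dist y z < d \<Longrightarrow> dist (u y) (u z) < e"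
    using assms(3) unfolding uniformly_continuous_on_def by metis
  show ?thesis
  \<comment> \<open>At distance below 1, two points either both lie in the ball of radius
    \<open>M + 1\<close>, or both lie outside the ball of radius \<open>M\<close>, where
    \<open>u\<close> is 0.\<close>
  proof (rule that[of "min d 1"])
    fix y z :: "real^'n" assume yz: "norm (y - z) < min d 1"
    show "\<bar>u y - u z\<bar> < e"
    proof (cases "norm y \<le> M + 1 \<and> norm z \<le> M + 1")
      case True
      then show ?thesis using d(2)[of y z] yz by (simp add: dist_norm)
    next
      case False
      then have "M < norm y \<and> M < norm z"
        using yz norm_triangle_sub[of y z] norm_triangle_sub[of z y] by (auto simp: norm_minus_commute)
      then show ?thesis using M(2) assms(3) by simp
    qed
  qed (use d in auto)
qed

lemma C1_taylor:
  fixes K :: "real^'n \<Rightarrow> real"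
  assumes d: "\<And>x. K differentiable (at x)"
    and e: "\<And>i y z. norm (y - z) < d \<Longrightarrow> \<bar>partial_deriv i K y - partial_deriv i K z\<bar> \<le> e"
    and h: "norm h < d"
  shows "\<bar>K (z + h) - K z - (\<Sum>i\<in>UNIV. h $ i * partial_deriv i K z)\<bar> \<le> real CARD('n) * e * norm h"
proof -
  have dl: "((\<lambda>t. K (z + t *\<^sub>R h)) has_real_derivative (\<Sum>i\<in>UNIV. h $ i * partial_deriv i K (z + t *\<^sub>R h))) (at t)" for t
  proof -
    have "((\<lambda>t. z + t *\<^sub>R h) has_derivative (\<lambda>s. s *\<^sub>R h)) (at t)" by (auto intro!: derivative_eq_intros)
    from has_derivative_compose[OF this has_derivative_partials[OF d]]
    have "((\<lambda>t. K (z + t *\<^sub>R h)) has_derivative (\<lambda>s. \<Sum>i\<in>UNIV. (s *\<^sub>R h) $ i * partial_deriv i K (z + t *\<^sub>R h))) (at t)" .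
    moreover have "(\<Sum>i\<in>UNIV. (s *\<^sub>R h) $ i * partial_deriv i K (z + t *\<^sub>R h))
      = (\<Sum>i\<in>UNIV. h $ i * partial_deriv i K (z + t *\<^sub>R h)) * s" for s
      unfolding sum_distrib_right by (intro sum.cong) (simp_all add: ac_simps)
    ultimately show ?thesis unfolding has_field_derivative_def by (simp only:)
  qed
  obtain t where t: "0 < t" "t < 1" "K (z + h) - K z = (\<Sum>i\<in>UNIV. h $ i * partial_deriv i K (z + t *\<^sub>R h))"
    using MVT2[of 0 1 "\<lambda>t. K (z + t *\<^sub>R h)" "\<lambda>t. \<Sum>i\<in>UNIV. h $ i * partial_deriv i K (z + t *\<^sub>R h)"] dl by auto
  have "K (z + h) - K z - (\<Sum>i\<in>UNIV. h $ i * partial_deriv i K z)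
    = (\<Sum>i\<in>UNIV. h $ i * (partial_deriv i K (z + t *\<^sub>R h) - partial_deriv i K z))"
    unfolding t(3) by (simp add: sum_subtractf right_diff_distrib)
  also have "\<bar>\<dots>\<bar> \<le> (\<Sum>i\<in>(UNIV::'n set). norm h * e)"
  proof (intro order_trans[OF sum_abs] sum_mono)
    fix i
    have "norm (z + t *\<^sub>R h - z) < d" using t h mult_left_le_one_le[of "norm h" t] by simp
    then show "\<bar>h $ i * (partial_deriv i K (z + t *\<^sub>R h) - partial_deriv i K z)\<bar> \<le> norm h * e"
      unfolding abs_mult using e component_le_norm_cart[of h i] by (intro mult_mono) auto
  qed
  finally show ?thesis by (simp add: ac_simps)
qed

text \<open>The partial derivatives of \<open>K\<close> are uniformly continuous, so the Taylor
  remainder of \<open>K\<close> is small relative to the increment, uniformly in the base point, and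
  can be integrated against \<open>\<bar>w\<bar>\<close>.\<close>

lemma conv_has_derivative:
  fixes w K :: "real^'n \<Rightarrow> real"
  assumes w: "integrable lborel w" and K: "Ck 1 K" "compactly_supported_in UNIV K"
  shows "(conv w K has_derivative (\<lambda>h. \<Sum>i\<in>UNIV. h $ i * conv w (partial_deriv i K) x)) (at x)"
proof -
  have d: "K differentiable (at y)" and pc: "continuous_on UNIV (partial_deriv i K)" for y i using K by auto
  have ps: "compactly_supported_in UNIV (partial_deriv i K)" for i
    using K(2) support_partial_deriv[of i K] unfolding compactly_supported_in_def
    by (metis closed_closure compact_Int_closed inf.absorb_iff2 subset_UNIV)
  note iK = conv_integrable[OF w Ck_continuous[OF K(1)] K(2)] and ip = conv_integrable[OF w pc ps]
  define W where "W = (\<integral>y. \<bar>w y\<bar> \<partial>lborel)"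
  have W: "0 \<le> W" by (simp add: W_def)
  have bl: "bounded_linear (\<lambda>h. \<Sum>i\<in>UNIV. h $ i * conv w (partial_deriv i K) x)"
    by (intro bounded_linear_sum bounded_linear_mult_const bounded_linear_vec_nth)
  moreover have "\<exists>d>0. \<forall>y\<in>UNIV. norm (y - x) < d \<longrightarrow>
      norm (conv w K y - conv w K x - (\<Sum>i\<in>UNIV. (y - x) $ i * conv w (partial_deriv i K) x)) \<le> e * norm (y - x)"
    if e: "0 < e" for e
  proof -
    \<comment> \<open>Cancels the factor \<open>CARD('n)\<close> of the Taylor estimate and the mass
      \<open>W\<close> of \<open>w\<close>; the added 1 covers \<open>W = 0\<close>.\<close>
    define e' where "e' = e / (real CARD('n) * (W + 1))"
    have e': "0 < e'" using e W by (simp add: e'_def)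
    have "\<exists>d>0. \<forall>y z. norm (y - z) < d \<longrightarrow> \<bar>partial_deriv i K y - partial_deriv i K z\<bar> < e'" for i
      using uniformly_continuous_compact_support[OF pc ps e'] by metis
    then obtain D where D: "\<And>i. 0 < D i" "\<And>i y z. norm (y - z) < D i \<Longrightarrow> \<bar>partial_deriv i K y - partial_deriv i K z\<bar> < e'" by metis
    define d0 where "d0 = Min (range D)"
    have d0: "0 < d0" "d0 \<le> D i" for i using D(1) by (auto simp: d0_def)
    have D': "norm (y - z) < d0 \<Longrightarrow> \<bar>partial_deriv i K y - partial_deriv i K z\<bar> \<le> e'" for i y z
      using D(2)[of y z i] d0(2)[of i] by fastforce
    have "norm (conv w K y - conv w K x - (\<Sum>i\<in>UNIV. (y - x) $ i * conv w (partial_deriv i K) x)) \<le> e * norm (y - x)"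
      if y: "norm (y - x) < d0" for y
    proof -
      let ?h = "y - x"
      let ?R = "\<lambda>z. K (z + ?h) - K z - (\<Sum>i\<in>UNIV. ?h $ i * partial_deriv i K z)"
      have ee: "w q * K (y - q) - w q * K (x - q) - (\<Sum>i\<in>UNIV. ?h $ i * (w q * partial_deriv i K (x - q))) = w q * ?R (x - q)" for q
        by (simp add: right_diff_distrib sum_distrib_left algebra_simps)
      have "integrable lborel (\<lambda>q. w q * K (y - q) - w q * K (x - q) - (\<Sum>i\<in>UNIV. ?h $ i * (w q * partial_deriv i K (x - q))))"
        using iK ip by (intro Bochner_Integration.integrable_diff Bochner_Integration.integrable_sum integrable_mult_right) auto
      then have iR: "integrable lborel (\<lambda>q. w q * ?R (x - q))" unfolding ee .
      have R: "\<bar>?R z\<bar> \<le> real CARD('n) * e' * norm ?h" for z by (rule C1_taylor[OF d D' y])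
      have "conv w K y - conv w K x - (\<Sum>i\<in>UNIV. ?h $ i * conv w (partial_deriv i K) x)
          = (\<integral>q. w q * K (y - q) - w q * K (x - q) - (\<Sum>i\<in>UNIV. ?h $ i * (w q * partial_deriv i K (x - q))) \<partial>lborel)"
        unfolding conv_def using iK ip by (simp add: Bochner_Integration.integral_sum)
      also have "\<dots> = (\<integral>q. w q * ?R (x - q) \<partial>lborel)" unfolding ee ..
      finally have E: "conv w K y - conv w K x - (\<Sum>i\<in>UNIV. ?h $ i * conv w (partial_deriv i K) x) = (\<integral>q. w q * ?R (x - q) \<partial>lborel)" .
      then have "norm (conv w K y - conv w K x - (\<Sum>i\<in>UNIV. ?h $ i * conv w (partial_deriv i K) x))
          \<le> (\<integral>q. \<bar>w q\<bar> * (real CARD('n) * e' * norm ?h) \<partial>lborel)"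
      proof (simp only:, intro Bochner_Integration.integral_norm_bound_integral)
        show "integrable lborel (\<lambda>q. \<bar>w q\<bar> * (real CARD('n) * e' * norm ?h))" using w by simp
        show "norm (w q * ?R (x - q)) \<le> \<bar>w q\<bar> * (real CARD('n) * e' * norm ?h)" for q
          unfolding real_norm_def abs_mult by (intro mult_left_mono R) simp
      qed (rule iR)
      also have "\<dots> = W * (real CARD('n) * e' * norm ?h)" by (simp add: W_def)
      also have "\<dots> = e * (W / (W + 1)) * norm ?h" using W by (simp add: e'_def)
      also have "\<dots> \<le> e * 1 * norm ?h" using W e by (intro mult_right_mono mult_left_mono) auto
      finally show ?thesis by simp
    qed
    then show ?thesis using d0(1) by (intro exI[of _ d0]) auto
  qed
  ultimately show ?thesis unfolding has_derivative_within_alt by blast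
qed

lemma partial_deriv_conv:
  fixes w K :: "real^'n \<Rightarrow> real"
  assumes "integrable lborel w" "Ck 1 K" "compactly_supported_in UNIV K"
  shows "partial_deriv i (conv w K) = conv w (partial_deriv i K)"
proof
  fix x
  have "(\<Sum>j\<in>UNIV. (axis i 1 :: real^'n) $ j * conv w (partial_deriv j K) x) = (\<Sum>j\<in>UNIV. if j = i then conv w (partial_deriv j K) x else 0)"
    by (intro sum.cong) (auto simp: axis_def)
  then show "partial_deriv i (conv w K) x = conv w (partial_deriv i K) x"
    using partial_deriv_eq[OF conv_has_derivative[OF assms]] by simp
qed

lemma Ck_conv:
  fixes w K :: "real^'n \<Rightarrow> real"
  assumes w: "integrable lborel w"
  shows "(\<And>k. Ck k K) \<Longrightarrow> compactly_supported_in UNIV K \<Longrightarrow> Ck k (conv w K)"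
proof (induction k arbitrary: K)
  case 0
  have "conv w K differentiable (at x)" for x
    using conv_has_derivative[OF w 0] unfolding differentiable_def by blast
  then show ?case by (auto simp: continuous_on_eq_continuous_at intro: differentiable_imp_continuous_within)
next
  case (Suc k)
  have "conv w K differentiable (at x)" for x
    using conv_has_derivative[OF w Suc.prems] unfolding differentiable_def by blast
  moreover have "compactly_supported_in UNIV (partial_deriv i K)" for i
    using Suc.prems(2) support_partial_deriv[of i K] unfolding compactly_supported_in_def
    by (metis closed_closure compact_Int_closed inf.absorb_iff2 subset_UNIV)
  moreover have "Ck m (partial_deriv i K)" for i m using Suc.prems(1)[of "Suc m"] by simp
  ultimately show ?case using Suc.IH by (simp add: partial_deriv_conv[OF w Suc.prems])
qed

lemma mollifier_measurable[measurable]: "mollifier \<epsilon> \<in> borel_measurable borel"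
  by (rule Ck_borel[OF mollifier_Ck[of 0]])

lemma mollifier_shift_nn:
  assumes "0 < \<epsilon>"
  shows "(\<integral>\<^sup>+y. ennreal (mollifier \<epsilon> (x - y)) \<partial>lborel) = 1" "(\<integral>\<^sup>+y. ennreal (mollifier \<epsilon> (y - x)) \<partial>lborel) = 1"
proof -
  have "(\<integral>\<^sup>+y. ennreal (mollifier \<epsilon> (y + - x)) \<partial>lborel) = 1"
    using nn_integral_lborel_translate[of "\<lambda>y. ennreal (mollifier \<epsilon> y)" "- x"] mollifier_integral[OF assms, where ?'n='a] by simp
  then show 1: "(\<integral>\<^sup>+y. ennreal (mollifier \<epsilon> (y - x)) \<partial>lborel) = 1" by simp
  have "mollifier \<epsilon> (x - y) = mollifier \<epsilon> (y - x)" for y using mollifier_uminus[of \<epsilon> "y - x"] by simp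
  then show "(\<integral>\<^sup>+y. ennreal (mollifier \<epsilon> (x - y)) \<partial>lborel) = 1" using 1 by simp
qed

lemma mollifier_shift:
  assumes "0 < \<epsilon>"
  shows "has_bochner_integral lborel (\<lambda>y. mollifier \<epsilon> (x - y)) 1"
  using mollifier_shift_nn(1)[OF assms, of x] mollifier_nonneg
  by (intro has_bochner_integral_nn_integral) auto

lemma conv_local:
  fixes w :: "real^'n \<Rightarrow> real"
  assumes \<epsilon>: "0 < \<epsilon>" and w: "integrable lborel w" and e: "\<And>y. norm (y - x) < \<epsilon> \<Longrightarrow> \<bar>w y - w x\<bar> \<le> e"
  shows "\<bar>conv w (mollifier \<epsilon>) x - w x\<bar> \<le> e"
proof -
  have K: "integrable lborel (\<lambda>y. mollifier \<epsilon> (x - y))" "(\<integral>y. mollifier \<epsilon> (x - y) \<partial>lborel) = 1"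
    using mollifier_shift[OF \<epsilon>, of x] by (auto simp: has_bochner_integral_iff)
  have i: "integrable lborel (\<lambda>y. w y * mollifier \<epsilon> (x - y))"
    using mollifier_Ck[of 0 \<epsilon>] compactly_supported_mono[OF mollifier_support[OF \<epsilon>]] by (intro conv_integrable w) auto
  have "conv w (mollifier \<epsilon>) x - w x = (\<integral>y. w y * mollifier \<epsilon> (x - y) \<partial>lborel) - (\<integral>y. w x * mollifier \<epsilon> (x - y) \<partial>lborel)"
    using K by (simp add: conv_def)
  also have "\<dots> = (\<integral>y. w y * mollifier \<epsilon> (x - y) - w x * mollifier \<epsilon> (x - y) \<partial>lborel)"
    using i K by (intro Bochner_Integration.integral_diff[symmetric]) auto
  also have "norm \<dots> \<le> (\<integral>y. e * mollifier \<epsilon> (x - y) \<partial>lborel)"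
  proof (intro Bochner_Integration.integral_norm_bound_integral)
    fix y
    show "norm (w y * mollifier \<epsilon> (x - y) - w x * mollifier \<epsilon> (x - y)) \<le> e * mollifier \<epsilon> (x - y)"
    proof (cases "norm (y - x) < \<epsilon>")
      case True
      have "norm (w y * mollifier \<epsilon> (x - y) - w x * mollifier \<epsilon> (x - y)) = \<bar>w y - w x\<bar> * mollifier \<epsilon> (x - y)"
        using mollifier_nonneg[of \<epsilon> "x - y"] by (simp add: left_diff_distrib[symmetric] abs_mult)
      then show ?thesis using e[OF True] mollifier_nonneg[of \<epsilon> "x - y"] by (simp add: mult_right_mono)
    next
      case False
      then show ?thesis using mollifier_outside[OF \<epsilon>, of "x - y"] by (simp add: norm_minus_commute)
    qed
  qed (use i K in auto)
  finally show ?thesis using K by simp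
qed

text \<open>The kernel has mass one, so splitting it as a power \<open>1 / p\<close> times a power
  \<open>1 - 1 / p\<close> and using Hoelder's inequality bounds the \<open>p\<close>-th power
  pointwise by the mollification of \<open>\<bar>w\<bar> powr p\<close>; Tonelli's theorem does the
  rest.\<close>

lemma conv_Lp:
  fixes w :: "real^'n \<Rightarrow> real"
  assumes \<epsilon>: "0 < \<epsilon>" and wm[measurable]: "w \<in> borel_measurable borel" and p: "1 \<le> p"
  shows "(\<integral>\<^sup>+x. ennreal (\<bar>conv w (mollifier \<epsilon>) x\<bar> powr p) \<partial>lborel) \<le> (\<integral>\<^sup>+x. ennreal (\<bar>w x\<bar> powr p) \<partial>lborel)"
proof -
  let ?K = "mollifier \<epsilon>"
  have pt: "ennreal (\<bar>conv w ?K x\<bar> powr p) \<le> (\<integral>\<^sup>+y. ennreal (\<bar>w y\<bar> powr p) * ennreal (?K (x - y)) \<partial>lborel)" for x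
  proof -
    have "ennreal \<bar>conv w ?K x\<bar> \<le> (\<integral>\<^sup>+y. ennreal (norm (w y * ?K (x - y))) \<partial>lborel)"
      unfolding conv_def using norm_integral_le_nn_integral[of lborel "\<lambda>y. w y * ?K (x - y)"] by simp
    also have "\<dots> = (\<integral>\<^sup>+y. epow (ennreal (\<bar>w y\<bar> powr p) * ennreal (?K (x - y))) (1 / p) * epow (ennreal (?K (x - y))) (1 - 1 / p) \<partial>lborel)"
    proof (rule nn_integral_cong)
      fix y
      let ?k = "?K (x - y)"
      have k: "0 \<le> ?k" by (rule mollifier_nonneg)
      show "ennreal (norm (w y * ?k)) = epow (ennreal (\<bar>w y\<bar> powr p) * ennreal ?k) (1 / p) * epow (ennreal ?k) (1 - 1 / p)"
      \<comment> \<open>For \<open>p = 1\<close> the second exponent is 0 and \<open>epow\<close>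
        gives 1, also where the kernel vanishes; the rules for \<open>powr\<close> would give 0
        there.\<close>
      proof (cases "p = 1")
        case True
        then show ?thesis using k by (simp add: abs_mult ennreal_mult)
      next
        case False
        then have p1: "1 < p" using p by simp
        have "epow (ennreal (\<bar>w y\<bar> powr p) * ennreal ?k) (1 / p) = ennreal ((\<bar>w y\<bar> powr p * ?k) powr (1 / p))"
          using p k by (simp add: ennreal_mult[symmetric] epow_ennreal)
        also have "(\<bar>w y\<bar> powr p * ?k) powr (1 / p) = \<bar>w y\<bar> * ?k powr (1 / p)"
          using p k by (simp add: powr_mult powr_powr)
        finally have "epow (ennreal (\<bar>w y\<bar> powr p) * ennreal ?k) (1 / p) * epow (ennreal ?k) (1 - 1 / p)
          = ennreal (\<bar>w y\<bar> * ?k powr (1 / p) * ?k powr (1 - 1 / p))"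
          using p1 k by (simp add: epow_ennreal ennreal_mult)
        also have "\<bar>w y\<bar> * ?k powr (1 / p) * ?k powr (1 - 1 / p) = \<bar>w y\<bar> * ?k"
          using k by (simp add: mult.assoc powr_add[symmetric])
        finally show ?thesis using k by (simp add: abs_mult)
      qed
    qed
    also have "\<dots> \<le> epow (\<integral>\<^sup>+y. ennreal (\<bar>w y\<bar> powr p) * ennreal (?K (x - y)) \<partial>lborel) (1 / p) * epow (\<integral>\<^sup>+y. ennreal (?K (x - y)) \<partial>lborel) (1 - 1 / p)"
      using p by (intro Hoelder) auto
    also have "\<dots> = epow (\<integral>\<^sup>+y. ennreal (\<bar>w y\<bar> powr p) * ennreal (?K (x - y)) \<partial>lborel) (1 / p)"
      unfolding mollifier_shift_nn(1)[OF \<epsilon>] by (simp add: epow_def)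
    finally have "epow (ennreal \<bar>conv w ?K x\<bar>) p \<le> epow (epow (\<integral>\<^sup>+y. ennreal (\<bar>w y\<bar> powr p) * ennreal (?K (x - y)) \<partial>lborel) (1 / p)) p"
      using p by (intro epow_mono) auto
    then show ?thesis using p by (simp add: epow_epow epow_ennreal)
  qed
  have "(\<integral>\<^sup>+x. ennreal (\<bar>conv w ?K x\<bar> powr p) \<partial>lborel) \<le> (\<integral>\<^sup>+x. (\<integral>\<^sup>+y. ennreal (\<bar>w y\<bar> powr p) * ennreal (?K (x - y)) \<partial>lborel) \<partial>lborel)"
    by (rule nn_integral_mono[OF pt])
  also have "\<dots> = (\<integral>\<^sup>+y. (\<integral>\<^sup>+x. ennreal (\<bar>w y\<bar> powr p) * ennreal (?K (x - y)) \<partial>lborel) \<partial>lborel)"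
    by (intro lborel_pair.Fubini'[symmetric]) simp
  also have "\<dots> = (\<integral>\<^sup>+y. ennreal (\<bar>w y\<bar> powr p) \<partial>lborel)"
    by (simp add: nn_integral_cmult mollifier_shift_nn(2)[OF \<epsilon>])
  finally show ?thesis .
qed

section \<open>Density of continuous functions and convergence of mollifications in
  \<open>L_p\<close>\<close>

lemma powr_add_le:
  fixes x y :: real
  assumes p: "0 < p" shows "\<bar>x + y\<bar> powr p \<le> 2 powr p * (\<bar>x\<bar> powr p + \<bar>y\<bar> powr p)"
proof -
  have "\<bar>x + y\<bar> powr p \<le> (2 * max \<bar>x\<bar> \<bar>y\<bar>) powr p" using p by (intro powr_mono2) auto
  also have "\<dots> = 2 powr p * (max \<bar>x\<bar> \<bar>y\<bar>) powr p" by (simp add: powr_mult)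
  also have "\<dots> \<le> 2 powr p * (\<bar>x\<bar> powr p + \<bar>y\<bar> powr p)" by (intro mult_left_mono) (auto simp: max_def)
  finally show ?thesis .
qed

text \<open>A crude substitute for Minkowski's inequality. It works with the \<open>p\<close>-th
  powers themselves, and the constant is harmless because only convergence to 0 is at stake.\<close>

lemma Lp_add_le:
  fixes x y :: "'a \<Rightarrow> real"
  assumes p: "0 < p" and [measurable]: "x \<in> borel_measurable M" "y \<in> borel_measurable M"
  shows "(\<integral>\<^sup>+z. ennreal (\<bar>x z + y z\<bar> powr p) \<partial>M)
    \<le> ennreal (2 powr p) * ((\<integral>\<^sup>+z. ennreal (\<bar>x z\<bar> powr p) \<partial>M) + (\<integral>\<^sup>+z. ennreal (\<bar>y z\<bar> powr p) \<partial>M))"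
proof -
  have "(\<integral>\<^sup>+z. ennreal (\<bar>x z + y z\<bar> powr p) \<partial>M) \<le> (\<integral>\<^sup>+z. ennreal (2 powr p) * (ennreal (\<bar>x z\<bar> powr p) + ennreal (\<bar>y z\<bar> powr p)) \<partial>M)"
    using powr_add_le[OF p] by (intro nn_integral_mono) (simp add: ennreal_plus[symmetric] ennreal_mult[symmetric] ennreal_leI del: ennreal_plus)
  also have "\<dots> = ennreal (2 powr p) * ((\<integral>\<^sup>+z. ennreal (\<bar>x z\<bar> powr p) \<partial>M) + (\<integral>\<^sup>+z. ennreal (\<bar>y z\<bar> powr p) \<partial>M))"
    by (simp add: nn_integral_cmult nn_integral_add)
  finally show ?thesis .
qed

lemma continuous_approximation_AE:
  fixes w :: "real^'n \<Rightarrow> real"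
  assumes "w \<in> borel_measurable borel"
  obtains g where "\<And>n. continuous_on UNIV (g n)" "AE x in lborel. (\<lambda>n::nat. g n x) \<longlonglongrightarrow> w x"
proof -
  have "w \<in> borel_measurable (lebesgue_on UNIV)" using assms by (intro measurable_restrict_space1 measurable_completion) simp
  then have "w measurable_on UNIV" by (simp add: measurable_on_iff_borel_measurable)
  then obtain N g where g: "negligible N" "\<And>n. continuous_on UNIV (g n)" "\<And>x. x \<notin> N \<Longrightarrow> (\<lambda>n::nat. g n x) \<longlonglongrightarrow> w x"
    unfolding measurable_on_def by auto
  have "AE x in lebesgue. x \<notin> N" using g(1) by (intro AE_not_in) (simp add: negligible_iff_null_sets)
  then have "AE x in lborel. x \<notin> N" by (simp add: AE_completion_iff)
  then have "AE x in lborel. (\<lambda>n::nat. g n x) \<longlonglongrightarrow> w x" by eventually_elim (rule g(3))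
  with g(2) show ?thesis by (rule that)
qed

text \<open>Almost everywhere approximation by continuous functions comes without a dominating
  function. So \<open>w\<close> is first truncated at a height \<open>k\<close>, and the continuous
  approximants are truncated and cut off in the same way; dominated convergence applies at both
  steps.\<close>

lemma Lp_density:
  fixes w :: "real^'n \<Rightarrow> real"
  assumes p: "1 \<le> p" and wm[measurable]: "w \<in> borel_measurable borel" and w0: "\<And>x. M < norm x \<Longrightarrow> w x = 0"
    and fin: "(\<integral>\<^sup>+x. ennreal (\<bar>w x\<bar> powr p) \<partial>lborel) < \<infinity>" and e: "0 < (e::ennreal)"
  shows "\<exists>v. continuous_on UNIV v \<and> (\<forall>x. M + 1 < norm x \<longrightarrow> v x = 0) \<and> (\<integral>\<^sup>+x. ennreal (\<bar>w x - v x\<bar> powr p) \<partial>lborel) < e"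
proof -
  define clip where "clip k s = max (- real k) (min (real k) s)" for k s
  have clip: "\<bar>clip k s\<bar> \<le> real k" "\<bar>s - clip k s\<bar> \<le> \<bar>s\<bar>" "clip k 0 = 0" for k s by (auto simp: clip_def)
  have clipm[measurable]: "clip k \<in> borel_measurable borel" for k unfolding clip_def by measurable
  have clipc: "continuous_on UNIV (clip k)" for k unfolding clip_def by (intro continuous_intros)
  have p0: "0 < p" using p by simp
  define C where "C = ennreal (2 powr p)"
  have C: "C \<noteq> 0" "C \<noteq> \<top>" by (auto simp: C_def)
  \<comment> \<open>Two errors below \<open>e'\<close>, combined with the constant \<open>C\<close>
    of \<open>Lp_add_le\<close>, stay within \<open>e\<close>.\<close>
  define e' where "e' = e / (2 * C)"
  have "2 * C \<noteq> \<top>" using C by (auto simp: ennreal_mult_eq_top_iff)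
  then have e': "0 < e'" using e by (auto simp: e'_def zero_less_iff_neq_zero)
  have e'2: "C * (e' + e') \<le> e"
  proof -
    have "C * (e' + e') = (2 * C) * e'" by (simp add: mult_2[symmetric] ac_simps)
    also have "\<dots> \<le> e" unfolding e'_def using \<open>2 * C \<noteq> \<top>\<close> C
      by (simp add: ennreal_times_divide mult.commute[of "2 * C"] mult_divide_eq_ennreal)
    finally show ?thesis .
  qed
  have "(\<lambda>k. \<integral>\<^sup>+x. ennreal (\<bar>w x - clip k (w x)\<bar> powr p) \<partial>lborel) \<longlonglongrightarrow> (\<integral>\<^sup>+x. 0 \<partial>(lborel :: (real^'n) measure))"
  proof (rule nn_integral_dominated_convergence[where w="\<lambda>x. ennreal (\<bar>w x\<bar> powr p)"])
    show "AE x in lborel. ennreal (\<bar>w x - clip k (w x)\<bar> powr p) \<le> ennreal (\<bar>w x\<bar> powr p)" for k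
      using clip(2) p by (intro AE_I2 ennreal_leI powr_mono2) auto
    show "AE x in lborel. (\<lambda>k. ennreal (\<bar>w x - clip k (w x)\<bar> powr p)) \<longlonglongrightarrow> 0"
    proof (rule AE_I2)
      fix x
      obtain k0 :: nat where k0: "\<bar>w x\<bar> \<le> real k0" using real_arch_simple by blast
      have "\<forall>\<^sub>F k in sequentially. 0 = ennreal (\<bar>w x - clip k (w x)\<bar> powr p)"
        using eventually_ge_at_top[of k0]
      proof eventually_elim
        case (elim k)
        then have "\<bar>w x\<bar> \<le> real k" using k0 by (meson of_nat_le_iff order_trans)
        then have "clip k (w x) = w x" by (auto simp: clip_def)
        then show ?case using p by simp
      qed
      from Lim_transform_eventually[OF tendsto_const this] show "(\<lambda>k. ennreal (\<bar>w x - clip k (w x)\<bar> powr p)) \<longlonglongrightarrow> 0" .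
    qed
  qed (use fin in auto)
  then have "\<forall>\<^sub>F k in sequentially. (\<integral>\<^sup>+x. ennreal (\<bar>w x - clip k (w x)\<bar> powr p) \<partial>lborel) < e'"
    using e' by (intro order_tendstoD(2)) auto
  then obtain k where k: "(\<integral>\<^sup>+x. ennreal (\<bar>w x - clip k (w x)\<bar> powr p) \<partial>lborel) < e'"
    by (auto simp: eventually_sequentially)
  obtain g where g: "\<And>n. continuous_on UNIV (g n)" "AE x in lborel. (\<lambda>n::nat. g n x) \<longlonglongrightarrow> w x"
    using continuous_approximation_AE[OF wm] by metis
  \<comment> \<open>Continuous, 1 where \<open>w\<close> may be nonzero, and 0 beyond radius
    \<open>M + 1\<close>.\<close>
  define cut where "cut x = max 0 (min 1 (M + 1 - norm x))" for x :: "real^'n"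
  have cut: "0 \<le> cut x" "cut x \<le> 1" "M + 1 < norm x \<Longrightarrow> cut x = 0" "norm x \<le> M \<Longrightarrow> cut x = 1" for x by (auto simp: cut_def)
  have cutc: "continuous_on UNIV cut" unfolding cut_def by (intro continuous_intros)
  define v where "v n x = cut x * clip k (g n x)" for n x
  have vc: "continuous_on UNIV (v n)" for n
    unfolding v_def using continuous_on_compose2[OF clipc g(1)] by (intro continuous_on_mult cutc) auto
  have [measurable]: "v n \<in> borel_measurable borel" for n using vc by (rule borel_measurable_continuous_onI)
  have v0: "v n x = 0" if "M + 1 < norm x" for n x using cut(3)[OF that] by (simp add: v_def)
  have "(\<lambda>n. \<integral>\<^sup>+x. ennreal (\<bar>clip k (w x) - v n x\<bar> powr p) \<partial>lborel) \<longlonglongrightarrow> (\<integral>\<^sup>+x. 0 \<partial>(lborel :: (real^'n) measure))"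
  proof (rule nn_integral_dominated_convergence[where w="\<lambda>x. ennreal ((2 * real k) powr p) * indicator (cball 0 (M + 1)) x"])
    show "AE x in lborel. ennreal (\<bar>clip k (w x) - v n x\<bar> powr p) \<le> ennreal ((2 * real k) powr p) * indicator (cball 0 (M + 1)) x" for n
    proof (rule AE_I2)
      fix x
      show "ennreal (\<bar>clip k (w x) - v n x\<bar> powr p) \<le> ennreal ((2 * real k) powr p) * indicator (cball 0 (M + 1)) x"
      proof (cases "norm x \<le> M + 1")
        case True
        have "\<bar>v n x\<bar> \<le> 1 * real k" unfolding v_def abs_mult using cut clip by (intro mult_mono) auto
        then have "\<bar>clip k (w x) - v n x\<bar> \<le> 2 * real k" using clip(1)[of k "w x"] by linarith
        then have "\<bar>clip k (w x) - v n x\<bar> powr p \<le> (2 * real k) powr p" using p by (intro powr_mono2) auto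
        then show ?thesis using True by (simp add: ennreal_leI)
      next
        case False
        then show ?thesis using v0[of x n] w0[of x] clip(3) by simp
      qed
    qed
    show "(\<integral>\<^sup>+x. ennreal ((2 * real k) powr p) * indicator (cball 0 (M + 1)) (x :: real^'n) \<partial>lborel) < \<infinity>"
      using emeasure_compact_finite[OF compact_cball[of "0::real^'n" "M + 1"]]
      by (simp add: nn_integral_cmult_indicator ennreal_mult_less_top)
    show "AE x in lborel. (\<lambda>n. ennreal (\<bar>clip k (w x) - v n x\<bar> powr p)) \<longlonglongrightarrow> 0"
      using g(2)
    proof eventually_elim
      case (elim x)
      have "(\<lambda>n. clip k (g n x)) \<longlonglongrightarrow> clip k (w x)"
        using clipc elim by (intro continuous_on_tendsto_compose[of UNIV "clip k"]) auto
      then have "(\<lambda>n. v n x) \<longlonglongrightarrow> cut x * clip k (w x)" unfolding v_def by (intro tendsto_intros)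
      moreover have "cut x * clip k (w x) = clip k (w x)"
        using cut(4)[of x] w0[of x] clip(3) by (cases "norm x \<le> M") auto
      ultimately have "(\<lambda>n. \<bar>clip k (w x) - v n x\<bar>) \<longlonglongrightarrow> \<bar>clip k (w x) - clip k (w x)\<bar>"
        by (intro tendsto_intros) simp
      then have "(\<lambda>n. \<bar>clip k (w x) - v n x\<bar> powr p) \<longlonglongrightarrow> 0 powr p"
        using p by (intro tendsto_powr' tendsto_const) auto
      from tendsto_ennrealI[OF this] show ?case using p by simp
    qed
    show "(\<lambda>x. ennreal (\<bar>clip k (w x) - v n x\<bar> powr p)) \<in> borel_measurable lborel" for n
      unfolding measurable_lborel2 by measurable
    show "(\<lambda>x. ennreal ((2 * real k) powr p) * indicator (cball 0 (M + 1)) (x :: real^'n)) \<in> borel_measurable lborel"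
      by (intro borel_measurable_times_ennreal borel_measurable_indicator borel_measurable_const) simp
  qed (rule borel_measurable_const)
  then have "\<forall>\<^sub>F n in sequentially. (\<integral>\<^sup>+x. ennreal (\<bar>clip k (w x) - v n x\<bar> powr p) \<partial>lborel) < e'"
    using e' by (intro order_tendstoD(2)) auto
  then obtain n where n: "(\<integral>\<^sup>+x. ennreal (\<bar>clip k (w x) - v n x\<bar> powr p) \<partial>lborel) < e'"
    by (auto simp: eventually_sequentially)
  have "(\<integral>\<^sup>+x. ennreal (\<bar>w x - v n x\<bar> powr p) \<partial>lborel)
    = (\<integral>\<^sup>+x. ennreal (\<bar>(w x - clip k (w x)) + (clip k (w x) - v n x)\<bar> powr p) \<partial>lborel)" by simp
  also have "\<dots> \<le> C * ((\<integral>\<^sup>+x. ennreal (\<bar>w x - clip k (w x)\<bar> powr p) \<partial>lborel) + (\<integral>\<^sup>+x. ennreal (\<bar>clip k (w x) - v n x\<bar> powr p) \<partial>lborel))"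
    unfolding C_def by (rule Lp_add_le[OF p0]) measurable
  also have "\<dots> < C * (e' + e')"
    using C add_strict_mono[OF k n] by (intro ennreal_mult_strict_left_mono) (auto simp: less_top zero_less_iff_neq_zero)
  also have "\<dots> \<le> e" by (rule e'2)
  finally show ?thesis using vc v0 by (intro exI[of _ "v n"]) auto
qed

text \<open>For \<open>p \<ge> 1\<close> one has
  \<open>\<bar>w\<bar> \<le> 1 + \<bar>w\<bar> powr p\<close>, and the 1 is charged only on the ball
  that carries \<open>w\<close>, which has finite measure.\<close>

lemma integrable_of_Lp:
  fixes w :: "real^'n \<Rightarrow> real"
  assumes p: "1 \<le> p" and [measurable]: "w \<in> borel_measurable borel" and w0: "\<And>x. M < norm x \<Longrightarrow> w x = 0"
    and fin: "(\<integral>\<^sup>+x. ennreal (\<bar>w x\<bar> powr p) \<partial>lborel) < \<infinity>"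
  shows "integrable lborel w"
proof (rule integrableI_bounded)
  have "(\<integral>\<^sup>+x. ennreal (norm (w x)) \<partial>lborel) \<le> (\<integral>\<^sup>+x. indicator (cball 0 M) x + ennreal (\<bar>w x\<bar> powr p) \<partial>lborel)"
  proof (rule nn_integral_mono)
    fix x
    show "ennreal (norm (w x)) \<le> indicator (cball 0 M) x + ennreal (\<bar>w x\<bar> powr p)"
    proof (cases "\<bar>w x\<bar> \<le> 1")
      case True
      show ?thesis
      proof (cases "norm x \<le> M")
        case True
        have "ennreal (norm (w x)) \<le> 1" using \<open>\<bar>w x\<bar> \<le> 1\<close> ennreal_leI[of "\<bar>w x\<bar>" 1] by simp
        also have "\<dots> \<le> indicator (cball 0 M) x + ennreal (\<bar>w x\<bar> powr p)" using True by (simp add: add_increasing2)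
        finally show ?thesis .
      qed (use w0 in simp)
    next
      case False
      then have "\<bar>w x\<bar> powr 1 \<le> \<bar>w x\<bar> powr p" using p by (intro powr_mono) auto
      then have "ennreal (norm (w x)) \<le> ennreal (\<bar>w x\<bar> powr p)" using False by (intro ennreal_leI) simp
      also have "\<dots> \<le> indicator (cball 0 M) x + ennreal (\<bar>w x\<bar> powr p)" by (rule add_increasing) simp_all
      finally show ?thesis .
    qed
  qed
  also have "\<dots> = emeasure lborel (cball (0::real^'n) M) + (\<integral>\<^sup>+x. ennreal (\<bar>w x\<bar> powr p) \<partial>lborel)"
    by (subst nn_integral_add) (auto intro!: borel_measurable_indicator)
  also have "\<dots> < \<infinity>" using fin emeasure_compact_finite[OF compact_cball[of "0::real^'n" M]] by (simp add: ennreal_add_less_top)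
  finally show "(\<integral>\<^sup>+x. ennreal (norm (w x)) \<partial>lborel) < \<infinity>" .
qed simp

lemma conv_outside:
  fixes w :: "real^'n \<Rightarrow> real"
  assumes \<epsilon>: "0 < \<epsilon>" and w0: "\<And>x. M < norm x \<Longrightarrow> w x = 0" and x: "M + \<epsilon> < norm x"
  shows "conv w (mollifier \<epsilon>) x = 0"
proof -
  have z: "w y * mollifier \<epsilon> (x - y) = 0" for y
  proof (cases "M < norm y")
    case False
    then have "\<epsilon> \<le> norm (x - y)" using x norm_triangle_sub[of x y] by linarith
    then show ?thesis using mollifier_outside[OF \<epsilon>, of "x - y"] by simp
  qed (simp add: w0)
  show ?thesis unfolding conv_def z by simp
qed

lemma conv_diff:
  fixes w v :: "real^'n \<Rightarrow> real"
  assumes \<epsilon>: "0 < \<epsilon>" and "integrable lborel w" "integrable lborel v"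
  shows "conv (\<lambda>y. w y - v y) (mollifier \<epsilon>) x = conv w (mollifier \<epsilon>) x - conv v (mollifier \<epsilon>) x"
proof -
  have "integrable lborel (\<lambda>y. u y * mollifier \<epsilon> (x - y))" if "integrable lborel u" for u
    using that mollifier_Ck[of 0 \<epsilon>] compactly_supported_mono[OF mollifier_support[OF \<epsilon>]] by (intro conv_integrable) auto
  then show ?thesis unfolding conv_def using assms by (simp add: left_diff_distrib)
qed

lemma Ck_conv_mollifier:
  "0 < \<epsilon> \<Longrightarrow> integrable lborel w \<Longrightarrow> Ck k (conv w (mollifier \<epsilon>))"
  by (intro Ck_conv mollifier_Ck compactly_supported_mono[OF mollifier_support]) auto

lemma ennreal_add_less_le_mono:
  fixes x y x' y' :: ennreal
  assumes "x < x'" "y \<le> y'" "y' < \<top>"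
  shows "x + y < x' + y'"
proof -
  have "x + y \<le> y' + x" using assms(2) by (simp add: add.commute add_right_mono)
  also have "\<dots> < y' + x'" using assms by (simp add: ennreal_add_left_cancel_less)
  finally show ?thesis by (simp add: add.commute)
qed

text \<open>Convolution does not increase the \<open>L_p\<close> norm, so \<open>w\<close> may be
  replaced by a close continuous \<open>v\<close> of compact support, whose mollifications converge
  uniformly and stay in a fixed ball.\<close>

lemma mollify_Lp_tendsto:
  fixes w :: "real^'n \<Rightarrow> real"
  assumes p: "1 \<le> p" and wm[measurable]: "w \<in> borel_measurable borel" and w0: "\<And>x. M < norm x \<Longrightarrow> w x = 0"
    and fin: "(\<integral>\<^sup>+x. ennreal (\<bar>w x\<bar> powr p) \<partial>lborel) < \<infinity>"
  shows "(\<lambda>n. \<integral>\<^sup>+x. ennreal (\<bar>conv w (mollifier (1 / real (Suc n))) x - w x\<bar> powr p) \<partial>lborel) \<longlonglongrightarrow> 0"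
proof (rule order_tendstoI)
  fix e :: ennreal assume e: "0 < e"
  let ?\<epsilon> = "\<lambda>n. 1 / real (Suc n)"
  have \<epsilon>: "0 < ?\<epsilon> n" "?\<epsilon> n \<le> 1" for n by auto
  have p0: "0 < p" using p by simp
  have iw: "integrable lborel w" by (rule integrable_of_Lp[OF p wm w0 fin])
  define C where "C = ennreal (2 powr p)"
  have C: "C \<noteq> 0" "C \<noteq> \<top>" by (auto simp: C_def)
  \<comment> \<open>Collects the constants when \<open>Lp_add_le\<close> is used twice to split the
    error into three terms.\<close>
  define D where "D = C + C * C + C * C"
  have D: "D \<noteq> 0" "D \<noteq> \<top>" using C by (auto simp: D_def ennreal_mult_eq_top_iff)
  \<comment> \<open>The minimum with 1 keeps \<open>e'\<close> finite when \<open>e\<close> is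
    infinite; finiteness is what makes the strict inequality survive addition.\<close>
  define e' where "e' = min 1 (e / D)"
  have e': "0 < e'" using e D by (auto simp: e'_def zero_less_iff_neq_zero ennreal_zero_less_divide)
  have e'2: "D * e' \<le> e"
  proof -
    have "D * e' \<le> D * (e / D)" by (intro mult_left_mono) (auto simp: e'_def)
    also have "\<dots> = e" using D by (simp add: ennreal_times_divide mult.commute[of D] mult_divide_eq_ennreal)
    finally show ?thesis .
  qed
  have e't: "e' < \<top>" by (auto simp: e'_def min_less_iff_disj)
  obtain v where v: "continuous_on UNIV v" "\<And>x. M + 1 < norm x \<Longrightarrow> v x = 0" "(\<integral>\<^sup>+x. ennreal (\<bar>w x - v x\<bar> powr p) \<partial>lborel) < e'"
    using Lp_density[OF p wm w0 fin e'] by blast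
  have vm[measurable]: "v \<in> borel_measurable borel" using v(1) by (rule borel_measurable_continuous_onI)
  have vs: "compactly_supported_in UNIV v"
    by (rule compactly_supported_mono[OF compactly_supportedI[of "cball 0 (M + 1)"]]) (use v(2) in auto)
  have iv: "integrable lborel v"
    by (rule integrable_of_Lp[OF p vm v(2) nn_integral_powr_compact_support[OF v(1) vs p0]])
  define V where "V = emeasure lborel (cball (0::real^'n) (M + 2))"
  have V: "V < \<top>" using emeasure_compact_finite[OF compact_cball[of "0::real^'n" "M + 2"]] by (simp add: V_def)
  \<comment> \<open>A uniform error small enough to remain small after integration over the ball of
    radius \<open>M + 2\<close>, which contains the supports of \<open>v\<close> and of its
    mollifications.\<close>
  obtain \<eta> where \<eta>: "0 < \<eta>" "ennreal (\<eta> powr p) * V \<le> e'"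
  proof -
    obtain c where c: "0 < c" "ennreal c * V \<le> e'"
    proof -
      obtain f where f: "e' = ennreal f" "0 < f" using e' e't by (cases e') auto
      obtain V' where V': "V = ennreal V'" "0 \<le> V'" using V by (cases V) auto
      show ?thesis
      proof (rule that[of "f / (V' + 1)"])
        show "0 < f / (V' + 1)" using f V' by simp
        have "f / (V' + 1) * V' \<le> f" using f V' by (simp add: field_simps)
        then show "ennreal (f / (V' + 1)) * V \<le> e'" using f V' by (simp add: ennreal_mult[symmetric] ennreal_leI)
      qed
    qed
    show ?thesis
      using c p by (intro that[of "c powr (1 / p)"]) (auto simp: powr_powr)
  qed
  obtain d where d: "0 < d" "\<And>y z. norm (y - z) < d \<Longrightarrow> \<bar>v y - v z\<bar> < \<eta>"
    using uniformly_continuous_compact_support[OF v(1) vs \<eta>(1)] by metis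
  have "\<forall>\<^sub>F n in sequentially. ?\<epsilon> n < d"
    using order_tendstoD(2)[OF LIMSEQ_inverse_real_of_nat d(1)] by (simp add: inverse_eq_divide)
  then show "\<forall>\<^sub>F n in sequentially. (\<integral>\<^sup>+x. ennreal (\<bar>conv w (mollifier (?\<epsilon> n)) x - w x\<bar> powr p) \<partial>lborel) < e"
  proof eventually_elim
    case (elim n)
    let ?c = "\<lambda>u. conv u (mollifier (?\<epsilon> n))"
    have cm[measurable]: "?c u \<in> borel_measurable borel" if "integrable lborel u" for u
      by (rule Ck_borel[OF Ck_conv_mollifier[OF \<epsilon>(1) that, of 0]])
    have cw[measurable]: "?c w \<in> borel_measurable borel" and cv[measurable]: "?c v \<in> borel_measurable borel"
      by (rule cm[OF iw], rule cm[OF iv])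
    have 1: "(\<integral>\<^sup>+x. ennreal (\<bar>?c w x - ?c v x\<bar> powr p) \<partial>lborel) < e'"
    proof -
      have "(\<integral>\<^sup>+x. ennreal (\<bar>?c w x - ?c v x\<bar> powr p) \<partial>lborel) = (\<integral>\<^sup>+x. ennreal (\<bar>?c (\<lambda>y. w y - v y) x\<bar> powr p) \<partial>lborel)"
        by (simp only: conv_diff[OF \<epsilon>(1) iw iv])
      also have "\<dots> \<le> (\<integral>\<^sup>+x. ennreal (\<bar>w x - v x\<bar> powr p) \<partial>lborel)" by (rule conv_Lp[OF \<epsilon>(1) _ p]) measurable
      finally show ?thesis using v(3) by simp
    qed
    have 2: "(\<integral>\<^sup>+x. ennreal (\<bar>?c v x - v x\<bar> powr p) \<partial>lborel) \<le> e'"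
    proof -
      have "(\<integral>\<^sup>+x. ennreal (\<bar>?c v x - v x\<bar> powr p) \<partial>lborel) \<le> (\<integral>\<^sup>+x. ennreal (\<eta> powr p) * indicator (cball 0 (M + 2)) (x :: real^'n) \<partial>lborel)"
      proof (rule nn_integral_mono)
        fix x
        show "ennreal (\<bar>?c v x - v x\<bar> powr p) \<le> ennreal (\<eta> powr p) * indicator (cball 0 (M + 2)) x"
        proof (cases "norm x \<le> M + 2")
          case True
          have "\<bar>?c v x - v x\<bar> \<le> \<eta>"
            using d(2) elim by (intro conv_local \<epsilon> iv) (meson less_imp_le less_trans)
          then show ?thesis using True p by (simp add: ennreal_leI powr_mono2)
        next
          case False
          then have "M + 1 + ?\<epsilon> n < norm x" using \<epsilon>(2)[of n] by linarith
          then have "?c v x = 0" by (intro conv_outside[OF \<epsilon>(1) v(2)]) auto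
          then show ?thesis using v(2)[of x] False by simp
        qed
      qed
      also have "\<dots> = ennreal (\<eta> powr p) * V" unfolding V_def by (rule nn_integral_cmult_indicator) simp
      finally show ?thesis using \<eta>(2) by simp
    qed
    have 3: "(\<integral>\<^sup>+x. ennreal (\<bar>v x - w x\<bar> powr p) \<partial>lborel) < e'" using v(3) by (simp add: abs_minus_commute)
    have "(\<integral>\<^sup>+x. ennreal (\<bar>?c w x - w x\<bar> powr p) \<partial>lborel)
      = (\<integral>\<^sup>+x. ennreal (\<bar>(?c w x - ?c v x) + ((?c v x - v x) + (v x - w x))\<bar> powr p) \<partial>lborel)" by simp
    also have "\<dots> \<le> C * ((\<integral>\<^sup>+x. ennreal (\<bar>?c w x - ?c v x\<bar> powr p) \<partial>lborel) + (\<integral>\<^sup>+x. ennreal (\<bar>(?c v x - v x) + (v x - w x)\<bar> powr p) \<partial>lborel))"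
      unfolding C_def by (rule Lp_add_le[OF p0]) measurable
    also have "\<dots> \<le> C * ((\<integral>\<^sup>+x. ennreal (\<bar>?c w x - ?c v x\<bar> powr p) \<partial>lborel) + C * ((\<integral>\<^sup>+x. ennreal (\<bar>?c v x - v x\<bar> powr p) \<partial>lborel) + (\<integral>\<^sup>+x. ennreal (\<bar>v x - w x\<bar> powr p) \<partial>lborel)))"
      unfolding C_def by (intro mult_left_mono add_left_mono Lp_add_le[OF p0]) measurable
    also have "\<dots> < C * (e' + C * (e' + e'))"
    proof -
      have "C * ((\<integral>\<^sup>+x. ennreal (\<bar>?c v x - v x\<bar> powr p) \<partial>lborel) + (\<integral>\<^sup>+x. ennreal (\<bar>v x - w x\<bar> powr p) \<partial>lborel)) \<le> C * (e' + e')"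
        using 2 3 by (intro mult_left_mono add_mono) auto
      moreover have "C * (e' + e') < \<top>" using C e't by (simp add: ennreal_mult_less_top less_top ennreal_add_less_top)
      ultimately have "(\<integral>\<^sup>+x. ennreal (\<bar>?c w x - ?c v x\<bar> powr p) \<partial>lborel) + C * ((\<integral>\<^sup>+x. ennreal (\<bar>?c v x - v x\<bar> powr p) \<partial>lborel) + (\<integral>\<^sup>+x. ennreal (\<bar>v x - w x\<bar> powr p) \<partial>lborel))
        < e' + C * (e' + e')"
        by (rule ennreal_add_less_le_mono[OF 1])
      then show ?thesis using C by (intro ennreal_mult_strict_left_mono) (auto simp: less_top zero_less_iff_neq_zero)
    qed
    also have "\<dots> = D * e'" by (simp add: D_def distrib_left distrib_right ac_simps)
    also have "\<dots> \<le> e" by (rule e'2)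
    finally show ?case .
  qed
qed simp

section \<open>Approximation of Sobolev functions\<close>

lemma partial_deriv_cong_open:
  assumes "open U" "x \<in> U" "\<And>y. y \<in> U \<Longrightarrow> u y = v y" "v differentiable (at x)"
  shows "partial_deriv i u x = partial_deriv i v x"
proof -
  have d: "(v has_derivative frechet_derivative v (at x)) (at x)" using assms(4) frechet_derivative_works by blast
  have "(u has_derivative frechet_derivative v (at x)) (at x)"
    by (rule has_derivative_transform_within_open[OF d assms(1,2)]) (simp add: assms(3))
  then show ?thesis using partial_deriv_eq[OF d] partial_deriv_eq by metis
qed

lemma partial_deriv_even:
  fixes K :: "real^'n \<Rightarrow> real"
  assumes "\<And>x. K differentiable (at x)" and even: "\<And>z. K (- z) = K z"
  shows "partial_deriv i K (- z) = - partial_deriv i K z"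
proof -
  have "((\<lambda>z::real^'n. - z) has_derivative (\<lambda>h. - h)) (at z)" by (auto intro!: derivative_eq_intros)
  from has_derivative_compose[OF this, of K "frechet_derivative K (at (- z))"] assms(1)
  have "((\<lambda>z. K (- z)) has_derivative (\<lambda>h. frechet_derivative K (at (- z)) (- h))) (at z)"
    using frechet_derivative_works by blast
  then have d: "(K has_derivative (\<lambda>h. frechet_derivative K (at (- z)) (- h))) (at z)" by (simp add: even)
  have "linear (frechet_derivative K (at (- z)))"
    using assms(1) frechet_derivative_works has_derivative_linear by blast
  from linear_neg[OF this, of "axis i 1"] show ?thesis
    using partial_deriv_eq[OF d, of i] unfolding partial_deriv_def[of i K "- z"] by simp
qed

lemma Ck_mult_1:
  fixes u v :: "real^'n \<Rightarrow> real"
  assumes "Ck 1 u" "Ck 1 v"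
  shows "Ck 1 (\<lambda>x. u x * v x)" and "partial_deriv i (\<lambda>x. u x * v x) x = u x * partial_deriv i v x + partial_deriv i u x * v x"
proof -
  have d: "u differentiable (at x)" "v differentiable (at x)" and c: "continuous_on UNIV (partial_deriv j u)" "continuous_on UNIV (partial_deriv j v)" for x j
    using assms by auto
  have "(u has_derivative frechet_derivative u (at x)) (at x)" "(v has_derivative frechet_derivative v (at x)) (at x)" for x
    using d frechet_derivative_works by blast+
  from has_derivative_mult[OF this]
  have D: "((\<lambda>x. u x * v x) has_derivative (\<lambda>h. u x * frechet_derivative v (at x) h + frechet_derivative u (at x) h * v x)) (at x)" for x .
  then have p: "partial_deriv j (\<lambda>x. u x * v x) x = u x * partial_deriv j v x + partial_deriv j u x * v x" for j x
    using partial_deriv_eq[OF D] by (simp add: partial_deriv_def)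
  show "partial_deriv i (\<lambda>x. u x * v x) x = u x * partial_deriv i v x + partial_deriv i u x * v x" by (rule p)
  have "partial_deriv j (\<lambda>x. u x * v x) = (\<lambda>x. u x * partial_deriv j v x + partial_deriv j u x * v x)" for j
    using p by auto
  moreover have "continuous_on UNIV u" "continuous_on UNIV v" using Ck_continuous assms by blast+
  moreover have "(\<lambda>x. u x * v x) differentiable (at x)" for x using D unfolding differentiable_def by blast
  ultimately show "Ck 1 (\<lambda>x. u x * v x)"
    using c by (auto intro!: continuous_intros)
qed

lemma Ck_diff_1:
  fixes u v :: "real^'n \<Rightarrow> real"
  assumes "Ck 1 u" "Ck 1 v"
  shows "Ck 1 (\<lambda>x. u x - v x)" and "partial_deriv i (\<lambda>x. u x - v x) x = partial_deriv i u x - partial_deriv i v x"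
proof -
  have d: "u differentiable (at x)" "v differentiable (at x)" and c: "continuous_on UNIV (partial_deriv j u)" "continuous_on UNIV (partial_deriv j v)" for x j
    using assms by auto
  have "(u has_derivative frechet_derivative u (at x)) (at x)" "(v has_derivative frechet_derivative v (at x)) (at x)" for x
    using d frechet_derivative_works by blast+
  from has_derivative_diff[OF this]
  have D: "((\<lambda>x. u x - v x) has_derivative (\<lambda>h. frechet_derivative u (at x) h - frechet_derivative v (at x) h)) (at x)" for x .
  then have p: "partial_deriv j (\<lambda>x. u x - v x) x = partial_deriv j u x - partial_deriv j v x" for j x
    using partial_deriv_eq[OF D] by (simp add: partial_deriv_def)
  show "partial_deriv i (\<lambda>x. u x - v x) x = partial_deriv i u x - partial_deriv i v x" by (rule p)
  have "partial_deriv j (\<lambda>x. u x - v x) = (\<lambda>x. partial_deriv j u x - partial_deriv j v x)" for j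
    using p by auto
  moreover have "(\<lambda>x. u x - v x) differentiable (at x)" for x using D unfolding differentiable_def by blast
  ultimately show "Ck 1 (\<lambda>x. u x - v x)"
    using c by (auto intro!: continuous_intros)
qed

lemma powr_sum_le:
  fixes x :: "'j \<Rightarrow> real"
  assumes J: "finite J" and p: "0 < p" and x: "\<And>j. j \<in> J \<Longrightarrow> 0 \<le> x j"
  shows "(\<Sum>j\<in>J. x j) powr p \<le> real (card J) powr p * (\<Sum>j\<in>J. x j powr p)"
proof (cases "J = {}")
  case False
  define m where "m = Max (x ` J)"
  have m: "x j \<le> m" if "j \<in> J" for j using that J by (simp add: m_def)
  have "m \<in> x ` J" unfolding m_def using J False by (intro Max_in) auto
  then obtain k where k: "k \<in> J" "x k = m" by blast
  have "(\<Sum>j\<in>J. x j) \<le> real (card J) * m" using sum_bounded_above[of J x m] m by simp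
  then have "(\<Sum>j\<in>J. x j) powr p \<le> (real (card J) * m) powr p" using p x by (intro powr_mono2) (auto intro: sum_nonneg)
  also have "\<dots> = real (card J) powr p * x k powr p" using k x by (simp add: powr_mult)
  also have "\<dots> \<le> real (card J) powr p * (\<Sum>j\<in>J. x j powr p)"
    using k J by (intro mult_left_mono member_le_sum) auto
  finally show ?thesis .
qed (use p in simp)

text \<open>The mollifier centred at \<open>x\<close> is used as test function. It is even, so
  differentiating in \<open>y\<close> instead of \<open>x\<close> costs a sign, which cancels the
  one in the definition of the weak derivative. Multiplying by the indicator of \<open>U\<close>
  changes nothing, since the test function vanishes outside \<open>U\<close>.\<close>

lemma weak_partial_conv:
  fixes u v :: "real^'n \<Rightarrow> real"
  assumes wk: "weak_partial_deriv S i u v" and \<epsilon>: "0 < \<epsilon>" and sub: "cball x \<epsilon> \<subseteq> U" "U \<subseteq> S"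
  shows "conv (\<lambda>y. indicator U y * u y) (partial_deriv i (mollifier \<epsilon>)) x = conv (\<lambda>y. indicator U y * v y) (mollifier \<epsilon>) x"
proof -
  let ?K = "mollifier \<epsilon> :: real^'n \<Rightarrow> real"
  have Kd: "?K differentiable (at z)" for z using mollifier_Ck[of 1 \<epsilon>] by auto
  define \<zeta> where "\<zeta> y = ?K (y - x)" for y
  have \<zeta>K: "\<zeta> y = ?K (x - y)" for y using mollifier_uminus[of \<epsilon> "y - x"] by (simp add: \<zeta>_def)
  have p\<zeta>: "partial_deriv i \<zeta> y = - partial_deriv i ?K (x - y)" for y
    unfolding \<zeta>_def partial_deriv_translate[OF Kd]
    using partial_deriv_even[OF Kd mollifier_uminus, of i "x - y"] by simp
  have "compactly_supported_in (cball x \<epsilon>) \<zeta>"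
  proof (rule compactly_supportedI)
    fix y assume "y \<notin> cball x \<epsilon>"
    then show "\<zeta> y = 0" unfolding \<zeta>K using mollifier_outside[OF \<epsilon>, of "x - y"] by (simp add: dist_norm)
  qed simp
  then have c: "compactly_supported_in S \<zeta>" using sub by (blast intro: compactly_supported_mono)
  have "\<forall>k. Ck k \<zeta>" unfolding \<zeta>_def[abs_def] by (intro allI Ck_translate mollifier_Ck)
  with wk c have eq: "(LINT y:S|lborel. u y * partial_deriv i \<zeta> y) = - (LINT y:S|lborel. v y * \<zeta> y)"
    unfolding weak_partial_deriv_def by blast
  have out: "\<zeta> y = 0 \<and> partial_deriv i \<zeta> y = 0" if "y \<notin> U" for y
  proof -
    have "y \<notin> closure {y. \<zeta> y \<noteq> 0}"
      using that sub(1) \<open>compactly_supported_in (cball x \<epsilon>) \<zeta>\<close> by (auto simp: compactly_supported_in_def)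
    then show ?thesis using partial_deriv_outside_support closure_subset[of "{y. \<zeta> y \<noteq> 0}"] by blast
  qed
  have "(LINT y:S|lborel. u y * partial_deriv i \<zeta> y) = (\<integral>y. - ((indicator U y * u y) * partial_deriv i ?K (x - y)) \<partial>lborel)"
    unfolding set_lebesgue_integral_def
  proof (rule Bochner_Integration.integral_cong[OF refl])
    fix y
    show "indicator S y *\<^sub>R (u y * partial_deriv i \<zeta> y) = - ((indicator U y * u y) * partial_deriv i ?K (x - y))"
      using out[of y] p\<zeta>[of y] sub(2) by (cases "y \<in> U") auto
  qed
  also have "\<dots> = - conv (\<lambda>y. indicator U y * u y) (partial_deriv i ?K) x" by (simp add: conv_def)
  finally have 1: "(LINT y:S|lborel. u y * partial_deriv i \<zeta> y) = - conv (\<lambda>y. indicator U y * u y) (partial_deriv i ?K) x" .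
  have "(LINT y:S|lborel. v y * \<zeta> y) = conv (\<lambda>y. indicator U y * v y) ?K x"
    unfolding set_lebesgue_integral_def conv_def
  proof (rule Bochner_Integration.integral_cong[OF refl])
    fix y
    show "indicator S y *\<^sub>R (v y * \<zeta> y) = indicator U y * v y * ?K (x - y)"
      using out[of y] \<zeta>K[of y] sub(2) by (cases "y \<in> U") auto
  qed
  with 1 eq show ?thesis by simp
qed

lemma epow_tendsto_0:
  fixes x :: "nat \<Rightarrow> ennreal"
  assumes a: "0 < a" and x: "x \<longlonglongrightarrow> 0"
  shows "(\<lambda>n. epow (x n) a) \<longlonglongrightarrow> 0"
proof -
  have ev: "\<forall>\<^sub>F n in sequentially. x n < \<top>" using x by (rule order_tendstoD(2)) simp
  have "(\<lambda>n. enn2real (x n)) \<longlonglongrightarrow> 0" using tendsto_enn2real[of x 0] x by simp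
  then have "(\<lambda>n. enn2real (x n) powr a) \<longlonglongrightarrow> 0 powr a"
    using a by (intro tendsto_powr' tendsto_const) auto
  then have "(\<lambda>n. ennreal (enn2real (x n) powr a)) \<longlonglongrightarrow> 0"
    using a tendsto_ennrealI[of _ 0] by simp
  moreover have "\<forall>\<^sub>F n in sequentially. ennreal (enn2real (x n) powr a) = epow (x n) a"
    using ev by eventually_elim (use a in \<open>auto simp: epow_def\<close>)
  ultimately show ?thesis by (rule Lim_transform_eventually)
qed

text \<open>The case \<open>p = 1\<close>, applied to the \<open>p\<close>-th powers. Convergence
  makes these integrable only from some index \<open>N\<close> on, hence the shift of the
  sequence.\<close>

lemma Lp_tendsto_AE_subseq:
  fixes x :: "nat \<Rightarrow> 'a \<Rightarrow> real"
  assumes p: "0 < p" and m[measurable]: "\<And>n. x n \<in> borel_measurable M"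
    and lim: "(\<lambda>n. \<integral>\<^sup>+z. ennreal (\<bar>x n z\<bar> powr p) \<partial>M) \<longlonglongrightarrow> 0"
  shows "\<exists>\<sigma>::nat \<Rightarrow> nat. strict_mono \<sigma> \<and> (AE z in M. (\<lambda>k. x (\<sigma> k) z) \<longlonglongrightarrow> 0)"
proof -
  have "\<forall>\<^sub>F n in sequentially. (\<integral>\<^sup>+z. ennreal (\<bar>x n z\<bar> powr p) \<partial>M) < \<top>"
    using lim by (rule order_tendstoD(2)) simp
  then obtain N where N: "\<And>n. N \<le> n \<Longrightarrow> (\<integral>\<^sup>+z. ennreal (\<bar>x n z\<bar> powr p) \<partial>M) < \<top>"
    unfolding eventually_sequentially by blast
  define y where "y n z = \<bar>x (n + N) z\<bar> powr p" for n z
  have [measurable]: "y n \<in> borel_measurable M" for n unfolding y_def by measurable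
  have iy: "integrable M (y n)" for n
    using N[of "n + N"] by (intro integrableI_nonneg) (auto simp: y_def)
  have "ennreal (\<integral>z. norm (y n z) \<partial>M) = (\<integral>\<^sup>+z. ennreal (\<bar>x (n + N) z\<bar> powr p) \<partial>M)" for n
    using nn_integral_eq_integral[OF integrable_norm[OF iy[of n]]] by (simp add: y_def)
  then have "(\<lambda>n. ennreal (\<integral>z. norm (y n z) \<partial>M)) \<longlonglongrightarrow> 0"
    using LIMSEQ_ignore_initial_segment[OF lim, of N] by simp
  then have "(\<lambda>n. \<integral>z. norm (y n z) \<partial>M) \<longlonglongrightarrow> 0"
    by (subst (asm) ennreal_tendsto_0_iff) auto
  from tendsto_L1_AE_subseq[OF iy this] obtain \<rho> :: "nat \<Rightarrow> nat"
    where \<rho>: "strict_mono \<rho>" "AE z in M. (\<lambda>k. y (\<rho> k) z) \<longlonglongrightarrow> 0" by blast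
  have "strict_mono (\<lambda>k. \<rho> k + N)" using \<rho>(1) by (auto simp: strict_mono_def)
  moreover have "AE z in M. (\<lambda>k. x (\<rho> k + N) z) \<longlonglongrightarrow> 0"
    using \<rho>(2)
  proof eventually_elim
    case (elim z)
    then have "(\<lambda>k. y (\<rho> k) z powr (1 / p)) \<longlonglongrightarrow> 0 powr (1 / p)"
      using p by (intro tendsto_powr' tendsto_const) (auto simp: y_def)
    then have "(\<lambda>k. \<bar>x (\<rho> k + N) z\<bar>) \<longlonglongrightarrow> 0" using p by (simp add: y_def powr_powr)
    then show ?case by (simp add: tendsto_rabs_zero_iff)
  qed
  ultimately show ?thesis by blast
qed

section \<open>Mollified approximations of a fixed Sobolev function\<close>

context
  fixes S :: "(real^'n) set" and p q r r1 r2 :: real and x0 :: "real^'n" and \<phi> :: "real^'n \<Rightarrow> real"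
    and D\<phi> :: "'n \<Rightarrow> real^'n \<Rightarrow> real" and D2\<phi> :: "'n \<Rightarrow> 'n \<Rightarrow> real^'n \<Rightarrow> real"
  assumes sob: "sobolev2 p S \<phi> D\<phi> D2\<phi>" and \<phi>c: "continuous_on S \<phi>"
    and n2: "2 \<le> CARD('n)" and p: "1 < p" "p < real CARD('n)" and q: "q = real CARD('n) * p / (real CARD('n) - p)"
    and rr: "0 < r" "r < r1" "r1 < r2" and sub: "ball x0 r2 \<subseteq> S"
begin

text \<open>Outside \<open>S\<close> nothing is known about \<open>\<phi>\<close>, while
  \<open>conv\<close> needs a function integrable over the whole space. The three radii serve
  different purposes: functions are cut off at \<open>r2\<close>, derivatives of mollifications are
  mollified derivatives within \<open>r1\<close>, and convergence is claimed within
  \<open>r\<close>.\<close>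

definition cut :: "(real^'n \<Rightarrow> real) \<Rightarrow> real^'n \<Rightarrow> real" where
  "cut u y = indicator (ball x0 r2) y * u y"

definition mol :: "nat \<Rightarrow> real^'n \<Rightarrow> real" where
  "mol n = mollifier (1 / real (Suc n))"

definition approx :: "nat \<Rightarrow> real^'n \<Rightarrow> real" where
  "approx n = conv (cut \<phi>) (mol n)"

lemma cut_outside: "norm x0 + r2 < norm y \<Longrightarrow> cut u y = 0"
  using norm_triangle_sub[of y x0] by (auto simp: cut_def indicator_def dist_norm norm_minus_commute)

lemma cut_props:
  assumes "u \<in> Lp_on p S"
  shows "cut u \<in> borel_measurable borel" "(\<integral>\<^sup>+x. ennreal (\<bar>cut u x\<bar> powr p) \<partial>lborel) < \<infinity>" "integrable lborel (cut u)"
proof -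
  have e: "cut u = (\<lambda>y. indicator (ball x0 r2) y * (indicator S y * u y))"
    using sub by (auto simp: cut_def fun_eq_iff indicator_def)
  show m: "cut u \<in> borel_measurable borel"
  proof -
    have iS: "(\<lambda>y. indicator S y * u y) \<in> borel_measurable borel"
      using assms by (simp add: Lp_on_def set_borel_measurable_def)
    show ?thesis unfolding e by (rule borel_measurable_times[OF borel_measurable_indicator iS]) simp
  qed
  have "(\<integral>\<^sup>+x. ennreal (\<bar>cut u x\<bar> powr p) \<partial>lborel) \<le> (\<integral>\<^sup>+x\<in>S. ennreal (norm (u x) powr p) \<partial>lborel)"
    using sub by (intro nn_integral_mono) (auto simp: cut_def indicator_def)
  also have "\<dots> < \<infinity>" using assms unfolding Lp_on_def by (simp only: Lp_norm_finite_iff mem_Collect_eq)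
  finally show f: "(\<integral>\<^sup>+x. ennreal (\<bar>cut u x\<bar> powr p) \<partial>lborel) < \<infinity>" .
  show "integrable lborel (cut u)"
    using p by (intro integrable_of_Lp[OF _ m cut_outside f]) auto
qed

lemma cut_lim:
  assumes "u \<in> Lp_on p S"
  shows "(\<lambda>n. \<integral>\<^sup>+x. ennreal (\<bar>conv (cut u) (mol n) x - cut u x\<bar> powr p) \<partial>lborel) \<longlonglongrightarrow> 0"
  unfolding mol_def using p cut_props[OF assms] by (intro mollify_Lp_tendsto[OF _ _ cut_outside]) auto

lemma sob_Lp: "\<phi> \<in> Lp_on p S" "D\<phi> i \<in> Lp_on p S" "D2\<phi> i j \<in> Lp_on p S"
  using sob by (auto simp: sobolev2_def)

lemma conv_cut_Ck: "u \<in> Lp_on p S \<Longrightarrow> Ck k (conv (cut u) (mol n))"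
  unfolding mol_def by (intro Ck_conv_mollifier cut_props) auto

lemma conv_cut_measurable: "u \<in> Lp_on p S \<Longrightarrow> conv (cut u) (mol n) \<in> borel_measurable borel"
  by (rule Ck_borel[OF conv_cut_Ck[of _ 0]])

lemma approx_Ck: "Ck k (approx n)"
  unfolding approx_def by (rule conv_cut_Ck[OF sob_Lp(1)])

lemma approx_support: "compactly_supported_in UNIV (approx n)"
proof -
  have "compactly_supported_in (cball 0 (norm x0 + r2 + 1)) (approx n)"
  proof (rule compactly_supportedI)
    fix x :: "real^'n" assume "x \<notin> cball 0 (norm x0 + r2 + 1)"
    then have "norm x0 + r2 + 1 < norm x" by simp
    moreover have "1 / real (Suc n) \<le> 1" by simp
    ultimately have "norm x0 + r2 + 1 / real (Suc n) < norm x" by linarith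
    then show "approx n x = 0"
      unfolding approx_def mol_def by (intro conv_outside[OF _ cut_outside]) auto
  qed simp
  then show ?thesis by (rule compactly_supported_mono) simp
qed

lemma conv_partial:
  assumes wk: "weak_partial_deriv S i u v" and u: "u \<in> Lp_on p S"
    and n: "1 / real (Suc n) < r2 - r1" and x: "x \<in> ball x0 r1"
  shows "partial_deriv i (conv (cut u) (mol n)) x = conv (cut v) (mol n) x"
proof -
  have e: "0 < 1 / real (Suc n)" by simp
  have "cball x (1 / real (Suc n)) \<subseteq> ball x0 r2"
  proof
    fix y assume "y \<in> cball x (1 / real (Suc n))"
    then show "y \<in> ball x0 r2" using x n dist_triangle[of x0 y x] by (simp add: dist_commute)
  qed
  from weak_partial_conv[OF wk e this sub]
  have "conv (cut u) (partial_deriv i (mol n)) x = conv (cut v) (mol n) x"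
    unfolding cut_def[abs_def] mol_def .
  moreover have "partial_deriv i (conv (cut u) (mol n)) = conv (cut u) (partial_deriv i (mol n))"
    unfolding mol_def
    by (intro partial_deriv_conv cut_props[OF u] mollifier_Ck compactly_supported_mono[OF mollifier_support[OF e]]) auto
  ultimately show ?thesis by simp
qed

lemma approx_partial:
  assumes n: "1 / real (Suc n) < r2 - r1" and x: "x \<in> ball x0 r1"
  shows "partial_deriv i (approx n) x = conv (cut (D\<phi> i)) (mol n) x"
  unfolding approx_def using sob by (intro conv_partial[OF _ sob_Lp(1) n x]) (auto simp: sobolev2_def)

lemma approx_partial2:
  assumes n: "1 / real (Suc n) < r2 - r1" and x: "x \<in> ball x0 r1"
  shows "partial_deriv i (partial_deriv j (approx n)) x = conv (cut (D2\<phi> i j)) (mol n) x"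
proof -
  have "conv (cut (D\<phi> j)) (mol n) differentiable (at x)" using conv_cut_Ck[OF sob_Lp(2), of 1] by simp
  then have "partial_deriv i (partial_deriv j (approx n)) x = partial_deriv i (conv (cut (D\<phi> j)) (mol n)) x"
    using approx_partial[OF n] by (intro partial_deriv_cong_open[OF open_ball x]) auto
  also have "\<dots> = conv (cut (D2\<phi> i j)) (mol n) x"
    using sob by (intro conv_partial[OF _ sob_Lp(2) n x]) (auto simp: sobolev2_def)
  finally show ?thesis .
qed

lemma eps_eventually: "0 < d \<Longrightarrow> \<forall>\<^sub>F n in sequentially. 1 / real (Suc n) < d"
  using order_tendstoD(2)[OF LIMSEQ_inverse_real_of_nat] by (simp add: inverse_eq_divide)

text \<open>Uniform convergence is special to \<open>\<phi>\<close> itself, which is taken in its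
  continuous version; the derivatives converge in integral norms only.\<close>

lemma approx_uniform:
  assumes e: "0 < e"
  shows "\<forall>\<^sub>F n in sequentially. \<forall>x\<in>cball x0 r. \<bar>approx n x - \<phi> x\<bar> \<le> e"
proof -
  have "cball x0 r1 \<subseteq> ball x0 r2" using rr by auto
  then have "continuous_on (cball x0 r1) \<phi>" using sub \<phi>c by (blast intro: continuous_on_subset)
  then have "uniformly_continuous_on (cball x0 r1) \<phi>" by (intro compact_uniformly_continuous) auto
  then obtain d where d: "0 < d" "\<And>y z. y \<in> cball x0 r1 \<Longrightarrow> z \<in> cball x0 r1 \<Longrightarrow> dist y z < d \<Longrightarrow> dist (\<phi> y) (\<phi> z) < e"
    using e unfolding uniformly_continuous_on_def by metis
  \<comment> \<open>Mollification at a point of \<open>cball x0 r\<close> then sees only points of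
    \<open>cball x0 r1\<close>, where the modulus of continuity holds.\<close>
  have "0 < min d (r1 - r)" using d rr by simp
  from eps_eventually[OF this] show ?thesis
  proof eventually_elim
    case (elim n)
    show ?case
    proof
      fix x assume x: "x \<in> cball x0 r"
      have cx: "cut \<phi> y = \<phi> y" if "y \<in> cball x0 r1" for y using that rr by (simp add: cut_def)
      have "\<bar>approx n x - cut \<phi> x\<bar> \<le> e"
        unfolding approx_def mol_def
      proof (rule conv_local)
        fix y assume y: "norm (y - x) < 1 / real (Suc n)"
        then have "dist x y < min d (r1 - r)" using elim by (simp add: dist_norm norm_minus_commute)
        then have "y \<in> cball x0 r1" "dist y x < d"
          using x dist_triangle[of x0 y x] by (auto simp: dist_commute)
        moreover have "x \<in> cball x0 r1" using x rr by auto
        ultimately show "\<bar>cut \<phi> y - cut \<phi> x\<bar> \<le> e" using d(2)[of y x] by (simp add: cx dist_real_def)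
      qed (use cut_props[OF sob_Lp(1)] in auto)
      moreover have "x \<in> cball x0 r1" using x rr by auto
      ultimately show "\<bar>approx n x - \<phi> x\<bar> \<le> e" by (simp add: cx)
    qed
  qed
qed

lemma approx_D2_Lp:
  "(\<lambda>n. \<integral>\<^sup>+x\<in>ball x0 r. ennreal (\<bar>partial_deriv i (partial_deriv j (approx n)) x - D2\<phi> i j x\<bar> powr p) \<partial>lborel) \<longlonglongrightarrow> 0"
proof (rule tendsto_sandwich[OF _ _ tendsto_const cut_lim[OF sob_Lp(3)]])
  have "0 < r2 - r1" using rr by simp
  from eps_eventually[OF this]
  show "\<forall>\<^sub>F n in sequentially. (\<integral>\<^sup>+x\<in>ball x0 r. ennreal (\<bar>partial_deriv i (partial_deriv j (approx n)) x - D2\<phi> i j x\<bar> powr p) \<partial>lborel)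
    \<le> (\<integral>\<^sup>+x. ennreal (\<bar>conv (cut (D2\<phi> i j)) (mol n) x - cut (D2\<phi> i j) x\<bar> powr p) \<partial>lborel)"
  proof eventually_elim
    case (elim n)
    show ?case
    proof (rule nn_integral_mono)
      fix x
      show "ennreal (\<bar>partial_deriv i (partial_deriv j (approx n)) x - D2\<phi> i j x\<bar> powr p) * indicator (ball x0 r) x
        \<le> ennreal (\<bar>conv (cut (D2\<phi> i j)) (mol n) x - cut (D2\<phi> i j) x\<bar> powr p)"
        using approx_partial2[OF elim, of x i j] rr by (cases "x \<in> ball x0 r") (auto simp: cut_def)
    qed
  qed
qed auto

text \<open>A smooth cutoff for \<open>ball x0 r1\<close>; the gradients of the approximations are
  identified only there, while the Sobolev inequality asks for compact support.\<close>

definition chi :: "real^'n \<Rightarrow> real" where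
  "chi x = hexp 0 (r1\<^sup>2 - (x - x0) \<bullet> (x - x0))"

lemma chi_Ck: "Ck k chi"
  unfolding chi_def[abs_def] by (rule smooth_Ck[OF smooth.bump])

lemma chi_outside: "x \<notin> ball x0 r1 \<Longrightarrow> chi x = 0"
  using rr power_mono[of r1 "norm (x - x0)" 2]
  by (simp add: chi_def hexp_def power2_norm_eq_inner dist_norm norm_minus_commute)

lemma chi_support: "compactly_supported_in UNIV chi"
  by (rule compactly_supported_mono[OF compactly_supportedI[of "cball x0 r1"]]) (auto intro!: chi_outside)

lemma chi_partial_outside: "x \<notin> ball x0 r1 \<Longrightarrow> partial_deriv j chi x = 0"
proof -
  assume x: "x \<notin> ball x0 r1"
  \<comment> \<open>outside the ball \<open>chi\<close> attains its minimum\<close>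
  have d: "(chi has_derivative frechet_derivative chi (at x)) (at x)"
    using chi_Ck[of 1] frechet_derivative_works by auto
  have "frechet_derivative chi (at x) = (\<lambda>h. 0)"
    by (rule differential_zero_maxmin[of x UNIV chi, OF _ _ d])
      (use chi_outside[OF x] hexp_nonneg in \<open>auto simp: chi_def\<close>)
  then show ?thesis by (simp add: partial_deriv_def)
qed

lemma chi_bounds:
  obtains c C where "0 < c" "0 < C" "\<And>x. x \<in> ball x0 r \<Longrightarrow> c \<le> chi x" "\<And>x. \<bar>chi x\<bar> \<le> C" "\<And>j x. \<bar>partial_deriv j chi x\<bar> \<le> C"
proof -
  have K: "compact (closure {x. chi x \<noteq> 0})" using chi_support by (simp add: compactly_supported_in_def)
  have "continuous_on UNIV (partial_deriv j chi)" for j using chi_Ck[of 1] by simp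
  then have "\<exists>C. \<forall>x. \<bar>partial_deriv j chi x\<bar> \<le> C" for j
    using bounded_compact_support[OF _ K support_partial_deriv] by metis
  then obtain Cj where Cj: "\<And>j x. \<bar>partial_deriv j chi x\<bar> \<le> Cj j" by metis
  define C where "C = (\<Sum>j\<in>UNIV. \<bar>Cj j\<bar>) + 1"
  have "\<bar>partial_deriv j chi x\<bar> \<le> C" for j x
    using Cj[where j=j and x=x] member_le_sum[of j UNIV "\<lambda>j. \<bar>Cj j\<bar>"] by (fastforce simp: C_def)
  moreover have C1: "1 \<le> C" by (simp add: C_def sum_nonneg)
  moreover have "\<bar>chi x\<bar> \<le> C" for x
  proof -
    have "\<bar>chi x\<bar> \<le> 1" by (simp add: chi_def hexp_def)
    then show ?thesis using C1 by linarith
  qed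
  \<comment> \<open>The value of \<open>chi\<close> at distance \<open>r\<close> from
    \<open>x0\<close>; \<open>chi\<close> decreases with the distance.\<close>
  moreover define c where "c = exp (- (1 / (r1\<^sup>2 - r\<^sup>2)))"
  have "c \<le> chi x" if "x \<in> ball x0 r" for x
  proof -
    have 1: "0 < r1\<^sup>2 - r\<^sup>2" using rr power_strict_mono[of r r1 2] by simp
    have "norm (x - x0) \<le> r" using that by (simp add: dist_norm norm_minus_commute)
    from power_mono[OF this, of 2] have "(x - x0) \<bullet> (x - x0) \<le> r\<^sup>2"
      by (simp add: power2_norm_eq_inner)
    then have 2: "r1\<^sup>2 - r\<^sup>2 \<le> r1\<^sup>2 - (x - x0) \<bullet> (x - x0)" by simp
    then have "1 / (r1\<^sup>2 - (x - x0) \<bullet> (x - x0)) \<le> 1 / (r1\<^sup>2 - r\<^sup>2)" using 1 by (intro divide_left_mono) auto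
    then show ?thesis using 1 2 by (simp add: chi_def hexp_def c_def)
  qed
  moreover have "0 < c" by (simp add: c_def)
  ultimately show ?thesis by (intro that[of c C]) auto
qed

text \<open>The Sobolev inequality asks for \<open>Ck 1\<close>, so it cannot be applied to the
  difference from \<open>D\<phi> i\<close>. It is applied to the cut-off difference of two
  approximations instead, which gives a Cauchy estimate in \<open>L_q\<close>. Fatou's lemma along a
  subsequence converging almost everywhere replaces one approximation by \<open>D\<phi> i\<close>,
  and on \<open>ball x0 r\<close> the cutoff is divided out.\<close>

lemma approx_D_Lq:
  "(\<lambda>n. \<integral>\<^sup>+x\<in>ball x0 r. ennreal (\<bar>partial_deriv i (approx n) x - D\<phi> i x\<bar> powr q) \<partial>lborel) \<longlonglongrightarrow> 0"
proof -
  let ?n = "real CARD('n)"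
  define g where "g n = conv (cut (D\<phi> i)) (mol n)" for n
  define gj where "gj j n = conv (cut (D2\<phi> j i)) (mol n)" for j n
  define G where "G = cut (D\<phi> i)"
  define Gj where "Gj j = cut (D2\<phi> j i)" for j
  have q0: "0 < q" using p by (simp add: q)
  have p0: "0 < p" "1 \<le> p" using p by auto
  have meas[measurable]: "g n \<in> borel_measurable borel" "gj j n \<in> borel_measurable borel"
    "G \<in> borel_measurable borel" "Gj j \<in> borel_measurable borel" for n j
    unfolding g_def gj_def G_def Gj_def using conv_cut_measurable cut_props(1) sob_Lp by blast+
  let ?I = "\<lambda>u::real^'n \<Rightarrow> real. \<integral>\<^sup>+x. ennreal (\<bar>u x\<bar> powr p) \<partial>lborel"
  define E where "E n = ?I (\<lambda>x. g n x - G x) + (\<Sum>j\<in>UNIV. ?I (\<lambda>x. gj j n x - Gj j x))" for n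
  have gl: "(\<lambda>n. ?I (\<lambda>x. g n x - G x)) \<longlonglongrightarrow> 0" unfolding g_def G_def by (rule cut_lim[OF sob_Lp(2)])
  have "(\<lambda>n. ?I (\<lambda>x. gj j n x - Gj j x)) \<longlonglongrightarrow> 0" for j unfolding gj_def Gj_def by (rule cut_lim[OF sob_Lp(3)])
  then have "(\<lambda>n. \<Sum>j\<in>UNIV. ?I (\<lambda>x. gj j n x - Gj j x)) \<longlonglongrightarrow> (\<Sum>j\<in>(UNIV::'n set). 0)" by (intro tendsto_sum) auto
  with gl have E0: "E \<longlonglongrightarrow> 0" unfolding E_def[abs_def] using tendsto_add[of _ "0::ennreal" sequentially _ 0] by simp
  \<comment> \<open>Tail supremum of the \<open>L_p\<close> errors: it bounds the error of the
    second approximation too, uniformly in its index, and so survives the limit inferior.\<close>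
  define S' where "S' n = (SUP m\<in>{n..}. E m)" for n
  have S0: "S' \<longlonglongrightarrow> 0"
  proof -
    have "decseq S'" unfolding S'_def decseq_def by (auto intro!: SUP_subset_mono)
    from LIMSEQ_INF[OF this] have "S' \<longlonglongrightarrow> limsup E" unfolding limsup_INF_SUP S'_def .
    then show ?thesis using lim_imp_Limsup[OF _ E0] by simp
  qed
  have ES: "E m \<le> S' n" if "n \<le> m" for n m unfolding S'_def using that by (intro SUP_upper) auto
  obtain c C where cC: "0 < c" "0 < C" "\<And>x. x \<in> ball x0 r \<Longrightarrow> c \<le> chi x" "\<And>x. \<bar>chi x\<bar> \<le> C" "\<And>j x. \<bar>partial_deriv j chi x\<bar> \<le> C"
    by (rule chi_bounds) blast
  have "0 < r2 - r1" using rr by simp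
  then obtain N0 where N0: "\<And>n. N0 \<le> n \<Longrightarrow> 1 / real (Suc n) < r2 - r1"
    using eps_eventually unfolding eventually_sequentially by blast
  define d where "d n m x = partial_deriv i (approx n) x - partial_deriv i (approx m) x" for n m x
  define v where "v n m x = chi x * d n m x" for n m x
  have C1: "Ck 1 (partial_deriv i (approx n))" for n using approx_Ck[of "Suc 1" n] by simp
  have dC: "Ck 1 (d n m)" for n m unfolding d_def[abs_def] by (rule Ck_diff_1(1)[OF C1 C1])
  have vC: "Ck 1 (v n m)" for n m unfolding v_def[abs_def] by (rule Ck_mult_1(1)[OF chi_Ck dC])
  have vout: "v n m x = 0" if "x \<notin> ball x0 r1" for n m x using chi_outside[OF that] by (simp add: v_def)
  have vs: "compactly_supported_in UNIV (v n m)" for n m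
    by (rule compactly_supported_mono[OF compactly_supportedI[of "cball x0 r1"]]) (auto intro!: vout)
  have dg: "d n m x = g n x - g m x" if "N0 \<le> n" "N0 \<le> m" "x \<in> ball x0 r1" for n m x
    using that approx_partial[OF N0] by (simp add: d_def g_def)
  have dgj: "partial_deriv j (d n m) x = gj j n x - gj j m x" if "N0 \<le> n" "N0 \<le> m" "x \<in> ball x0 r1" for n m x j
    unfolding d_def[abs_def] Ck_diff_1(2)[OF C1 C1] using that approx_partial2[OF N0] by (simp add: gj_def)
  let ?t = "\<lambda>n m j x. \<bar>g n x - g m x\<bar> + \<bar>gj j n x - gj j m x\<bar>"
  have pv: "\<bar>partial_deriv j (v n m) x\<bar> \<le> C * ?t n m j x" if nm: "N0 \<le> n" "N0 \<le> m" for n m j x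
  proof (cases "x \<in> ball x0 r1")
    case True
    have "\<bar>partial_deriv j (v n m) x\<bar> \<le> \<bar>chi x\<bar> * \<bar>gj j n x - gj j m x\<bar> + \<bar>partial_deriv j chi x\<bar> * \<bar>g n x - g m x\<bar>"
      unfolding v_def[abs_def] Ck_mult_1(2)[OF chi_Ck dC] dg[OF nm True] dgj[OF nm True] abs_mult[symmetric]
      by (rule abs_triangle_ineq)
    also have "\<dots> \<le> C * \<bar>gj j n x - gj j m x\<bar> + C * \<bar>g n x - g m x\<bar>"
      using cC(4,5) by (intro add_mono mult_right_mono) auto
    finally show ?thesis by (simp add: distrib_left)
  next
    case False
    then have "partial_deriv j (v n m) x = 0"
      unfolding v_def[abs_def] Ck_mult_1(2)[OF chi_Ck dC] using chi_outside chi_partial_outside by simp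
    then show ?thesis using cC(2) by simp
  qed
  \<comment> \<open>Constants of the gradient estimate: \<open>C powr p\<close> from the cutoff, a
    power of the dimension from the sum over \<open>j\<close>, a factor \<open>2 powr p\<close> from
    adding the two differences; \<open>K3\<close> adds the sum over \<open>j\<close> again and the
    comparison with the limits.\<close>
  define K2 where "K2 = ennreal (C powr p * (?n powr p * 2 powr p))"
  define K3 where "K3 = K2 * (of_nat CARD('n) * ennreal (2 powr p))"
  have two: "?I (\<lambda>x. u x - w x) \<le> ennreal (2 powr p) * (?I (\<lambda>x. u x - z x) + ?I (\<lambda>x. w x - z x))"
    if [measurable]: "u \<in> borel_measurable borel" "w \<in> borel_measurable borel" "z \<in> borel_measurable borel" for u w z
  proof -
    have "?I (\<lambda>x. u x - w x) = ?I (\<lambda>x. (u x - z x) + (z x - w x))" by simp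
    also have "\<dots> \<le> ennreal (2 powr p) * (?I (\<lambda>x. u x - z x) + ?I (\<lambda>x. z x - w x))"
      by (rule Lp_add_le[OF p0(1)]) measurable
    finally show ?thesis by (simp only: abs_minus_commute[of "z _" "w _"])
  qed
  have grad: "(\<integral>\<^sup>+x. ennreal ((\<Sum>j\<in>UNIV. \<bar>partial_deriv j (v n m) x\<bar>) powr p) \<partial>lborel) \<le> K3 * (E n + E m)"
    if nm: "N0 \<le> n" "N0 \<le> m" for n m
  proof -
    have pt: "(\<Sum>j\<in>UNIV. \<bar>partial_deriv j (v n m) x\<bar>) powr p
      \<le> C powr p * (?n powr p * 2 powr p) * (\<Sum>j\<in>UNIV. \<bar>g n x - g m x\<bar> powr p + \<bar>gj j n x - gj j m x\<bar> powr p)" for x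
    proof -
      have "(\<Sum>j\<in>UNIV. \<bar>partial_deriv j (v n m) x\<bar>) \<le> C * (\<Sum>j\<in>UNIV. ?t n m j x)"
        unfolding sum_distrib_left using pv[OF nm] by (intro sum_mono)
      then have "(\<Sum>j\<in>UNIV. \<bar>partial_deriv j (v n m) x\<bar>) powr p \<le> (C * (\<Sum>j\<in>UNIV. ?t n m j x)) powr p"
        using p0 by (intro powr_mono2) (auto intro: sum_nonneg)
      also have "\<dots> = C powr p * (\<Sum>j\<in>UNIV. ?t n m j x) powr p"
        by (rule powr_mult)
      also have "\<dots> \<le> C powr p * (?n powr p * (\<Sum>j\<in>UNIV. ?t n m j x powr p))"
        using p0 by (intro mult_left_mono powr_sum_le) auto
      also have "\<dots> \<le> C powr p * (?n powr p * (\<Sum>j\<in>UNIV. 2 powr p * (\<bar>g n x - g m x\<bar> powr p + \<bar>gj j n x - gj j m x\<bar> powr p)))"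
      proof (intro mult_left_mono sum_mono)
        fix j
        show "?t n m j x powr p \<le> 2 powr p * (\<bar>g n x - g m x\<bar> powr p + \<bar>gj j n x - gj j m x\<bar> powr p)"
          using powr_add_le[OF p0(1), of "\<bar>g n x - g m x\<bar>" "\<bar>gj j n x - gj j m x\<bar>"] by simp
      qed auto
      finally show ?thesis by (simp add: sum_distrib_left mult.assoc)
    qed
    have "(\<integral>\<^sup>+x. ennreal ((\<Sum>j\<in>UNIV. \<bar>partial_deriv j (v n m) x\<bar>) powr p) \<partial>lborel)
      \<le> (\<integral>\<^sup>+x. K2 * (\<Sum>j\<in>UNIV. ennreal (\<bar>g n x - g m x\<bar> powr p) + ennreal (\<bar>gj j n x - gj j m x\<bar> powr p)) \<partial>lborel)"
    proof (rule nn_integral_mono)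
      fix x
      have "ennreal ((\<Sum>j\<in>UNIV. \<bar>partial_deriv j (v n m) x\<bar>) powr p)
        \<le> ennreal (C powr p * (?n powr p * 2 powr p) * (\<Sum>j\<in>UNIV. \<bar>g n x - g m x\<bar> powr p + \<bar>gj j n x - gj j m x\<bar> powr p))"
        by (rule ennreal_leI[OF pt])
      also have "\<dots> = K2 * ennreal (\<Sum>j\<in>UNIV. \<bar>g n x - g m x\<bar> powr p + \<bar>gj j n x - gj j m x\<bar> powr p)"
        unfolding K2_def by (rule ennreal_mult) (auto intro!: sum_nonneg add_nonneg_nonneg)
      also have "ennreal (\<Sum>j\<in>UNIV. \<bar>g n x - g m x\<bar> powr p + \<bar>gj j n x - gj j m x\<bar> powr p)
        = (\<Sum>j\<in>UNIV. ennreal (\<bar>g n x - g m x\<bar> powr p) + ennreal (\<bar>gj j n x - gj j m x\<bar> powr p))"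
        by (simp add: sum_ennreal[symmetric])
      finally show "ennreal ((\<Sum>j\<in>UNIV. \<bar>partial_deriv j (v n m) x\<bar>) powr p)
        \<le> K2 * (\<Sum>j\<in>UNIV. ennreal (\<bar>g n x - g m x\<bar> powr p) + ennreal (\<bar>gj j n x - gj j m x\<bar> powr p))" .
    qed
    also have "\<dots> = K2 * (\<Sum>j\<in>UNIV. ?I (\<lambda>x. g n x - g m x) + ?I (\<lambda>x. gj j n x - gj j m x))"
      by (simp add: nn_integral_cmult nn_integral_sum nn_integral_add)
    also have "\<dots> \<le> K2 * (\<Sum>j\<in>(UNIV::'n set). ennreal (2 powr p) * (E n + E m))"
    proof (intro mult_left_mono sum_mono)
      fix j
      have e: "?I (\<lambda>x. g n x - G x) + ?I (\<lambda>x. gj j n x - Gj j x) \<le> E n" for n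
        unfolding E_def by (intro add_left_mono member_le_sum) auto
      have "?I (\<lambda>x. g n x - g m x) + ?I (\<lambda>x. gj j n x - gj j m x)
        \<le> ennreal (2 powr p) * (?I (\<lambda>x. g n x - G x) + ?I (\<lambda>x. g m x - G x))
          + ennreal (2 powr p) * (?I (\<lambda>x. gj j n x - Gj j x) + ?I (\<lambda>x. gj j m x - Gj j x))"
        by (intro add_mono two meas)
      also have "\<dots> = ennreal (2 powr p) * ((?I (\<lambda>x. g n x - G x) + ?I (\<lambda>x. gj j n x - Gj j x)) + (?I (\<lambda>x. g m x - G x) + ?I (\<lambda>x. gj j m x - Gj j x)))"
        by (simp add: distrib_left ac_simps)
      also have "\<dots> \<le> ennreal (2 powr p) * (E n + E m)"
        by (intro mult_left_mono add_mono e) auto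
      finally show "?I (\<lambda>x. g n x - g m x) + ?I (\<lambda>x. gj j n x - gj j m x) \<le> ennreal (2 powr p) * (E n + E m)" .
    qed auto
    also have "\<dots> = K3 * (E n + E m)" by (simp add: K3_def mult.assoc)
    finally show ?thesis .
  qed
  define Cs where "Cs = ennreal (p * (?n - 1) / (?n - p))"
  have "0 < p * (?n - 1) / (?n - p)" using p by (intro divide_pos_pos mult_pos_pos) auto
  then have Cs: "Cs \<noteq> 0" "Cs \<noteq> \<top>" by (auto simp: Cs_def ennreal_eq_0_iff)
  have "K3 = ennreal (C powr p * (?n powr p * 2 powr p) * (?n * 2 powr p))"
    by (simp add: K3_def K2_def ennreal_of_nat_eq_real_of_nat ennreal_mult[symmetric])
  moreover have "0 < C powr p * (?n powr p * 2 powr p) * (?n * 2 powr p)"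
    using cC(2) p by (intro mult_pos_pos) auto
  ultimately have K3: "K3 \<noteq> 0" "K3 \<noteq> \<top>" by (auto simp: ennreal_eq_0_iff)
  \<comment> \<open>The Sobolev inequality and the gradient bound, raised to the power
    \<open>q\<close> in order to remove the root.\<close>
  define Kf where "Kf = epow Cs q * epow K3 (q / p)"
  have Kf: "Kf < \<top>"
    using Cs K3 unfolding Kf_def by (cases Cs; cases K3) (auto simp: epow_def ennreal_mult_less_top)
  have vq: "(\<integral>\<^sup>+x. ennreal (\<bar>v n m x\<bar> powr q) \<partial>lborel) \<le> Kf * epow (E n + E m) (q / p)" if nm: "N0 \<le> n" "N0 \<le> m" for n m
  proof -
    have "epow (\<integral>\<^sup>+x. ennreal (\<bar>v n m x\<bar> powr q) \<partial>lborel) (1 / q) \<le> Cs * epow (K3 * (E n + E m)) (1 / p)"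
      unfolding Cs_def
      by (rule order_trans[OF sobolev_inequality[OF vC vs n2 p q] mult_left_mono[OF epow_mono[OF _ grad[OF nm]]]]) (use p in auto)
    then have "epow (epow (\<integral>\<^sup>+x. ennreal (\<bar>v n m x\<bar> powr q) \<partial>lborel) (1 / q)) q \<le> epow (Cs * epow (K3 * (E n + E m)) (1 / p)) q"
      using q0 by (intro epow_mono) auto
    also have "\<dots> = epow Cs q * epow (epow (K3 * (E n + E m)) (1 / p)) q" using q0 by (intro epow_mult Cs) auto
    also have "epow (epow (K3 * (E n + E m)) (1 / p)) q = epow (K3 * (E n + E m)) (q / p)" using q0 p0 by (simp add: epow_epow)
    also have "\<dots> = epow K3 (q / p) * epow (E n + E m) (q / p)" using q0 p0 by (intro epow_mult K3) auto
    finally show ?thesis using q0 by (simp add: epow_epow Kf_def mult.assoc)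
  qed
  obtain \<sigma> where \<sigma>: "strict_mono \<sigma>" "AE x in lborel. (\<lambda>k. g (\<sigma> k) x - G x) \<longlonglongrightarrow> 0"
    using Lp_tendsto_AE_subseq[OF p0(1) _ gl] by auto
  have lim: "(\<integral>\<^sup>+x. ennreal (\<bar>chi x * (g n x - G x)\<bar> powr q) \<partial>lborel) \<le> Kf * epow (S' n + S' n) (q / p)" if n: "N0 \<le> n" for n
  proof -
    have \<chi>m[measurable]: "chi \<in> borel_measurable borel" by (rule Ck_borel[OF chi_Ck[of 0]])
    \<comment> \<open>Along \<open>\<sigma>\<close> the second approximation converges almost
      everywhere to \<open>G\<close>, so the integrand is a genuine limit, written as a limit
      inferior for Fatou's lemma.\<close>
    have "(\<integral>\<^sup>+x. ennreal (\<bar>chi x * (g n x - G x)\<bar> powr q) \<partial>lborel)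
      = (\<integral>\<^sup>+x. liminf (\<lambda>k. ennreal (\<bar>chi x * (g n x - g (\<sigma> k) x)\<bar> powr q)) \<partial>lborel)"
    proof (rule nn_integral_cong_AE)
      show "AE x in lborel. ennreal (\<bar>chi x * (g n x - G x)\<bar> powr q) = liminf (\<lambda>k. ennreal (\<bar>chi x * (g n x - g (\<sigma> k) x)\<bar> powr q))"
        using \<sigma>(2)
      proof eventually_elim
        case (elim x)
        have "(\<lambda>k. chi x * ((g n x - G x) - (g (\<sigma> k) x - G x))) \<longlonglongrightarrow> chi x * ((g n x - G x) - 0)"
          by (intro tendsto_intros elim)
        then have "(\<lambda>k. chi x * (g n x - g (\<sigma> k) x)) \<longlonglongrightarrow> chi x * (g n x - G x)" by simp
        from tendsto_rabs[OF this]
        have "(\<lambda>k. \<bar>chi x * (g n x - g (\<sigma> k) x)\<bar>) \<longlonglongrightarrow> \<bar>chi x * (g n x - G x)\<bar>" .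
        then have "(\<lambda>k. \<bar>chi x * (g n x - g (\<sigma> k) x)\<bar> powr q) \<longlonglongrightarrow> \<bar>chi x * (g n x - G x)\<bar> powr q"
          using q0 by (intro tendsto_powr' tendsto_const) auto
        from lim_imp_Liminf[OF _ tendsto_ennrealI[OF this]] show ?case by simp
      qed
    qed
    also have "\<dots> \<le> liminf (\<lambda>k. \<integral>\<^sup>+x. ennreal (\<bar>chi x * (g n x - g (\<sigma> k) x)\<bar> powr q) \<partial>lborel)"
      by (rule nn_integral_liminf) measurable
    also have "\<dots> \<le> Kf * epow (S' n + S' n) (q / p)"
    proof (rule Liminf_le)
      show "\<forall>\<^sub>F k in sequentially. (\<integral>\<^sup>+x. ennreal (\<bar>chi x * (g n x - g (\<sigma> k) x)\<bar> powr q) \<partial>lborel) \<le> Kf * epow (S' n + S' n) (q / p)"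
        using eventually_ge_at_top[of n]
      proof eventually_elim
        case (elim k)
        then have k: "n \<le> \<sigma> k" using seq_suble[OF \<sigma>(1), of k] by simp
        have eq: "chi x * (g n x - g (\<sigma> k) x) = v n (\<sigma> k) x" for x
          using dg[OF n order_trans[OF n k], of x] chi_outside[of x] by (cases "x \<in> ball x0 r1") (auto simp: v_def)
        have "(\<integral>\<^sup>+x. ennreal (\<bar>chi x * (g n x - g (\<sigma> k) x)\<bar> powr q) \<partial>lborel) \<le> Kf * epow (E n + E (\<sigma> k)) (q / p)"
          unfolding eq by (rule vq[OF n order_trans[OF n k]])
        also have "\<dots> \<le> Kf * epow (S' n + S' n) (q / p)"
          using q0 p0 k by (intro mult_left_mono epow_mono add_mono ES) auto
        finally show ?case .
      qed
    qed simp
    finally show ?thesis .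
  qed
  let ?c = "ennreal ((1 / c) powr q)"
  have fin: "(\<integral>\<^sup>+x\<in>ball x0 r. ennreal (\<bar>partial_deriv i (approx n) x - D\<phi> i x\<bar> powr q) \<partial>lborel) \<le> ?c * (Kf * epow (S' n + S' n) (q / p))"
    if n: "N0 \<le> n" for n
  proof -
    have [measurable]: "chi \<in> borel_measurable borel" by (rule Ck_borel[OF chi_Ck[of 0]])
    have "(\<integral>\<^sup>+x\<in>ball x0 r. ennreal (\<bar>partial_deriv i (approx n) x - D\<phi> i x\<bar> powr q) \<partial>lborel)
      \<le> (\<integral>\<^sup>+x. ?c * ennreal (\<bar>chi x * (g n x - G x)\<bar> powr q) \<partial>lborel)"
    proof (rule nn_integral_mono)
      fix x
      show "ennreal (\<bar>partial_deriv i (approx n) x - D\<phi> i x\<bar> powr q) * indicator (ball x0 r) x \<le> ?c * ennreal (\<bar>chi x * (g n x - G x)\<bar> powr q)"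
      proof (cases "x \<in> ball x0 r")
        case True
        then have x: "x \<in> ball x0 r1" "x \<in> ball x0 r2" using rr by auto
        have e: "partial_deriv i (approx n) x - D\<phi> i x = g n x - G x"
          using approx_partial[OF N0[OF n] x(1)] x(2) by (simp add: g_def G_def cut_def)
        have "\<bar>g n x - G x\<bar> = 1 / c * (c * \<bar>g n x - G x\<bar>)" using cC(1) by simp
        also have "\<dots> \<le> 1 / c * (chi x * \<bar>g n x - G x\<bar>)"
          using cC(1) cC(3)[OF True] by (intro mult_left_mono mult_right_mono) auto
        also have "\<dots> = 1 / c * \<bar>chi x * (g n x - G x)\<bar>"
          using cC(1) cC(3)[OF True] by (simp add: abs_mult)
        finally have "\<bar>g n x - G x\<bar> powr q \<le> (1 / c * \<bar>chi x * (g n x - G x)\<bar>) powr q"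
          using q0 by (intro powr_mono2) auto
        also have "\<dots> = (1 / c) powr q * \<bar>chi x * (g n x - G x)\<bar> powr q" by (rule powr_mult)
        finally show ?thesis using True unfolding e by (simp add: ennreal_mult[symmetric] ennreal_leI)
      qed simp
    qed
    also have "\<dots> = ?c * (\<integral>\<^sup>+x. ennreal (\<bar>chi x * (g n x - G x)\<bar> powr q) \<partial>lborel)"
      by (rule nn_integral_cmult) measurable
    also have "\<dots> \<le> ?c * (Kf * epow (S' n + S' n) (q / p))" by (intro mult_left_mono lim n) simp
    finally show ?thesis .
  qed
  have "(\<lambda>n. S' n + S' n) \<longlonglongrightarrow> 0" using tendsto_add[OF S0 S0] by simp
  then have "(\<lambda>n. epow (S' n + S' n) (q / p)) \<longlonglongrightarrow> 0" using q0 p0 by (intro epow_tendsto_0) auto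
  then have "(\<lambda>n. ?c * (Kf * epow (S' n + S' n) (q / p))) \<longlonglongrightarrow> ?c * (Kf * 0)"
    using Kf by (intro ennreal_tendsto_cmult) auto
  then have L: "(\<lambda>n. ?c * (Kf * epow (S' n + S' n) (q / p))) \<longlonglongrightarrow> 0" by simp
  show ?thesis
    by (rule tendsto_sandwich[OF _ _ tendsto_const L])
      (use fin in \<open>auto simp: eventually_sequentially intro!: exI[of _ N0]\<close>)
qed

end

section \<open>Convergence of the generator along the approximation\<close>

lemma Lp_norm_epow:
  assumes "0 < p"
  shows "Lp_norm p S f = epow (\<integral>\<^sup>+x\<in>S. ennreal (norm (f x) powr p) \<partial>lborel) (1 / p)"
  using assms unfolding Lp_norm_def Let_def epow_def by simp

lemma diff_op_difference:
  fixes a :: "real^'n \<Rightarrow> real^'n^'n"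
  assumes a: "a x \<in> sym_spectrum_in \<delta>" and d: "0 < \<delta>"
  shows "\<bar>diff_op a b Du D2u x - diff_op a b Dv D2v x\<bar>
    \<le> 1 / \<delta> * (\<Sum>i\<in>UNIV. \<Sum>j\<in>UNIV. \<bar>D2u i j x - D2v i j x\<bar>) + norm (b x) * (\<Sum>i\<in>UNIV. \<bar>Du i x - Dv i x\<bar>)"
proof -
  have "diff_op a b Du D2u x - diff_op a b Dv D2v x
    = 1 / 2 * (\<Sum>i\<in>UNIV. \<Sum>j\<in>UNIV. a x $ i $ j * (D2u i j x - D2v i j x)) + (\<Sum>i\<in>UNIV. b x $ i * (Du i x - Dv i x))"
    by (simp add: diff_op_def right_diff_distrib sum_subtractf)
  also have "\<bar>\<dots>\<bar> \<le> 1 / 2 * \<bar>\<Sum>i\<in>UNIV. \<Sum>j\<in>UNIV. a x $ i $ j * (D2u i j x - D2v i j x)\<bar> + \<bar>\<Sum>i\<in>UNIV. b x $ i * (Du i x - Dv i x)\<bar>"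
    by linarith
  also have "\<dots> \<le> 1 * (1 / \<delta> * (\<Sum>i\<in>UNIV. \<Sum>j\<in>UNIV. \<bar>D2u i j x - D2v i j x\<bar>)) + norm (b x) * (\<Sum>i\<in>UNIV. \<bar>Du i x - Dv i x\<bar>)"
  proof (intro add_mono mult_mono)
    show "\<bar>\<Sum>i\<in>UNIV. \<Sum>j\<in>UNIV. a x $ i $ j * (D2u i j x - D2v i j x)\<bar> \<le> 1 / \<delta> * (\<Sum>i\<in>UNIV. \<Sum>j\<in>UNIV. \<bar>D2u i j x - D2v i j x\<bar>)"
      unfolding sum_distrib_left
    proof (intro order_trans[OF sum_abs] sum_mono)
      fix i j
      show "\<bar>a x $ i $ j * (D2u i j x - D2v i j x)\<bar> \<le> 1 / \<delta> * \<bar>D2u i j x - D2v i j x\<bar>"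
        unfolding abs_mult by (intro mult_right_mono spectrum_entry_bound[OF a d]) simp
    qed
    show "\<bar>\<Sum>i\<in>UNIV. b x $ i * (Du i x - Dv i x)\<bar> \<le> norm (b x) * (\<Sum>i\<in>UNIV. \<bar>Du i x - Dv i x\<bar>)"
      unfolding sum_distrib_left
    proof (intro order_trans[OF sum_abs] sum_mono)
      fix i
      show "\<bar>b x $ i * (Du i x - Dv i x)\<bar> \<le> norm (b x) * \<bar>Du i x - Dv i x\<bar>"
        unfolding abs_mult by (intro mult_right_mono component_le_norm_cart) simp
    qed
  qed auto
  finally show ?thesis by simp
qed

text \<open>Hoelder's inequality with weights \<open>p / n\<close> and \<open>p / q\<close>. They
  add up to one precisely for the Sobolev exponent \<open>q\<close>, so \<open>L_n\<close>, with
  \<open>n\<close> the dimension, is the matching class for the drift.\<close>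

lemma drift_error_bound:
  fixes b :: "real^'n \<Rightarrow> real^'n" and e :: "real^'n \<Rightarrow> real"
  assumes [measurable]: "b \<in> borel_measurable borel" "e \<in> borel_measurable borel"
    and p: "1 < p" "p < real CARD('n)" and q: "q = real CARD('n) * p / (real CARD('n) - p)"
  shows "(\<integral>\<^sup>+x. ennreal ((norm (b x) * \<bar>e x\<bar>) powr p) \<partial>lborel)
    \<le> epow (\<integral>\<^sup>+x. ennreal (norm (b x) powr real CARD('n)) \<partial>lborel) (p / real CARD('n))
      * epow (\<integral>\<^sup>+x. ennreal (\<bar>e x\<bar> powr q) \<partial>lborel) (p / q)"
proof -
  let ?n = "real CARD('n)"
  have q0: "0 < q" using p by (simp add: q)
  have s: "p / ?n + p / q = 1" using p by (simp add: q field_simps)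
  have "(\<integral>\<^sup>+x. ennreal ((norm (b x) * \<bar>e x\<bar>) powr p) \<partial>lborel)
    = (\<integral>\<^sup>+x. epow (ennreal (norm (b x) powr ?n)) (p / ?n) * epow (ennreal (\<bar>e x\<bar> powr q)) (p / q) \<partial>lborel)"
    using p q0 by (intro nn_integral_cong) (simp add: epow_ennreal powr_powr powr_mult ennreal_mult)
  also have "\<dots> \<le> epow (\<integral>\<^sup>+x. ennreal (norm (b x) powr ?n) \<partial>lborel) (p / ?n) * epow (\<integral>\<^sup>+x. ennreal (\<bar>e x\<bar> powr q) \<partial>lborel) (p / q)"
    using p q0 s by (intro Hoelder) auto
  finally show ?thesis .
qed

text \<open>By \<open>le\<close>, replacing \<open>f x + c\<close> by
  \<open>- diff_op a b D\<phi> D2\<phi> x\<close> can only increase the positive part. What remains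
  is the operator applied to the difference of derivatives: the second derivatives converge in
  \<open>L_p\<close>, and the first ones in \<open>L_q\<close>, which
  \<open>drift_error_bound\<close> converts into \<open>L_p\<close> after multiplication by the
  drift.\<close>

lemma generator_error:
  fixes S :: "(real^'n) set" and p q r r1 r2 :: real and x0 :: "real^'n" and \<phi> f :: "real^'n \<Rightarrow> real"
  assumes sob: "sobolev2 p S \<phi> D\<phi> D2\<phi>" and \<phi>c: "continuous_on S \<phi>"
    and n2: "2 \<le> CARD('n)" and p: "1 < p" "p < real CARD('n)"
    and rr: "0 < r" "r < r1" "r1 < r2" and sub: "ball x0 r2 \<subseteq> S"
    and adm: "admissible_coeffs \<delta> B a b" and d: "0 < \<delta>"
    and le: "AE x in lborel. x \<in> ball x0 r \<longrightarrow> diff_op a b D\<phi> D2\<phi> x + f x \<le> - c"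
  shows "(\<lambda>n. \<integral>\<^sup>+x. ennreal ((indicator (ball x0 r) x * max 0 (f x + classical_op a b (approx r2 x0 \<phi> n) x + c)) powr p) \<partial>lborel) \<longlonglongrightarrow> 0"
proof -
  let ?n = "real CARD('n)"
  define q where "q = ?n * p / (?n - p)"
  have q0: "0 < q" using p by (simp add: q_def)
  have p0: "0 < p" using p by simp
  note ctx = sob \<phi>c n2 p q_def rr sub
  define v where "v n = approx r2 x0 \<phi> n" for n
  let ?U = "ball x0 r"
  have bm[measurable]: "b \<in> borel_measurable borel" using adm by (simp add: admissible_coeffs_def)
  have a: "a x \<in> sym_spectrum_in \<delta>" for x using adm by (simp add: admissible_coeffs_def)
  define Bn where "Bn = (\<integral>\<^sup>+x. ennreal (norm (b x) powr ?n) \<partial>lborel)"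
  have Bn: "Bn < \<top>"
  proof -
    have "Lp_norm ?n UNIV b < \<infinity>" using adm by (auto simp: admissible_coeffs_def intro: order_le_less_trans)
    then have "(\<integral>\<^sup>+x\<in>UNIV. ennreal (norm (b x) powr ?n) \<partial>lborel) < \<infinity>" by (simp only: Lp_norm_finite_iff)
    then show ?thesis by (simp add: Bn_def)
  qed
  define e1 where "e1 i n x = indicator ?U x * (partial_deriv i (v n) x - D\<phi> i x)" for i n x
  define e2 where "e2 i j n x = indicator ?U x * (partial_deriv i (partial_deriv j (v n)) x - D2\<phi> i j x)" for i j n x
  have Ck: "Ck 2 (v n)" for n unfolding v_def by (rule approx_Ck[OF ctx])
  have pm: "partial_deriv i (v n) \<in> borel_measurable borel" "partial_deriv i (partial_deriv j (v n)) \<in> borel_measurable borel" for i j n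
    using Ck[of n] by (auto simp: numeral_2_eq_2 intro: Ck_borel[of "Suc 0"] Ck_borel[of 0])
  have US: "?U \<subseteq> S" using rr sub by (auto simp: subset_eq)
  have rm: "(\<lambda>x. indicator ?U x * u x) \<in> borel_measurable borel" if "u \<in> Lp_on p S" for u
  proof -
    have iS: "(\<lambda>y. indicator S y * u y) \<in> borel_measurable borel"
      using that by (simp add: Lp_on_def set_borel_measurable_def)
    have "(\<lambda>x. indicator ?U x * (indicator S x * u x)) \<in> borel_measurable borel"
      by (rule borel_measurable_times[OF borel_measurable_indicator iS]) simp
    moreover have "(\<lambda>x. indicator ?U x * (indicator S x * u x)) = (\<lambda>x. indicator ?U x * u x)"
      using US by (auto simp: fun_eq_iff indicator_def)
    ultimately show ?thesis by (simp only:)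
  qed
  have em[measurable]: "e1 i n \<in> borel_measurable borel" "e2 i j n \<in> borel_measurable borel" for i j n
  proof -
    have iU: "indicator ?U \<in> borel_measurable (borel :: (real^'n) measure)" by (rule borel_measurable_indicator) simp
    show "e1 i n \<in> borel_measurable borel"
      unfolding e1_def[abs_def] right_diff_distrib
      by (intro borel_measurable_diff borel_measurable_times[OF iU] pm rm sob_Lp[OF ctx])
    show "e2 i j n \<in> borel_measurable borel"
      unfolding e2_def[abs_def] right_diff_distrib
      by (intro borel_measurable_diff borel_measurable_times[OF iU] pm rm sob_Lp[OF ctx])
  qed
  have e1q: "(\<lambda>n. \<integral>\<^sup>+x. ennreal (\<bar>e1 i n x\<bar> powr q) \<partial>lborel) \<longlonglongrightarrow> 0" for i
  proof -
    have "(\<integral>\<^sup>+x. ennreal (\<bar>e1 i n x\<bar> powr q) \<partial>lborel) = (\<integral>\<^sup>+x\<in>?U. ennreal (\<bar>partial_deriv i (v n) x - D\<phi> i x\<bar> powr q) \<partial>lborel)" for n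
      using q0 by (intro nn_integral_cong) (auto simp: e1_def indicator_def)
    then show ?thesis unfolding v_def using approx_D_Lq[OF ctx] by simp
  qed
  have e2p: "(\<lambda>n. \<integral>\<^sup>+x. ennreal (\<bar>e2 i j n x\<bar> powr p) \<partial>lborel) \<longlonglongrightarrow> 0" for i j
  proof -
    have "(\<integral>\<^sup>+x. ennreal (\<bar>e2 i j n x\<bar> powr p) \<partial>lborel) = (\<integral>\<^sup>+x\<in>?U. ennreal (\<bar>partial_deriv i (partial_deriv j (v n)) x - D2\<phi> i j x\<bar> powr p) \<partial>lborel)" for n
      using p0 by (intro nn_integral_cong) (auto simp: e2_def indicator_def)
    then show ?thesis unfolding v_def using approx_D2_Lp[OF ctx] by simp
  qed
  \<comment> \<open>Each of the two nested sums costs one factor of the dimension to the power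
    \<open>p\<close>, the splitting into two terms costs \<open>2 powr p\<close>, and
    \<open>1 / \<delta>\<close> bounds the entries of \<open>a\<close>.\<close>
  define K1 where "K1 = ennreal (2 powr p * ((1 / \<delta>) powr p * (?n powr p * ?n powr p)))"
  define K2 where "K2 = ennreal (2 powr p * ?n powr p)"
  let ?h = "\<lambda>n x. indicator ?U x * max 0 (f x + classical_op a b (v n) x + c)"
  have pt: "AE x in lborel. ennreal (?h n x powr p)
    \<le> K1 * (\<Sum>i\<in>UNIV. \<Sum>j\<in>UNIV. ennreal (\<bar>e2 i j n x\<bar> powr p)) + K2 * (\<Sum>i\<in>UNIV. ennreal ((norm (b x) * \<bar>e1 i n x\<bar>) powr p))" for n
    using le
  proof eventually_elim
    case (elim x)
    show ?case
    proof (cases "x \<in> ?U")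
      case True
      let ?s2 = "\<Sum>i\<in>UNIV. \<Sum>j\<in>UNIV. \<bar>e2 i j n x\<bar>" and ?s1 = "\<Sum>i\<in>UNIV. \<bar>e1 i n x\<bar>"
      have s: "0 \<le> ?s2" "0 \<le> ?s1" by (intro sum_nonneg; simp)+
      have "?h n x \<le> \<bar>classical_op a b (v n) x - diff_op a b D\<phi> D2\<phi> x\<bar>" using elim True by simp
      also have "\<dots> \<le> 1 / \<delta> * ?s2 + norm (b x) * ?s1"
        using diff_op_difference[of a x \<delta>, OF a d] True by (simp add: e1_def e2_def)
      finally have "?h n x powr p \<le> \<bar>1 / \<delta> * ?s2 + norm (b x) * ?s1\<bar> powr p"
        using p0 by (intro powr_mono2) auto
      also have "\<dots> \<le> 2 powr p * (\<bar>1 / \<delta> * ?s2\<bar> powr p + \<bar>norm (b x) * ?s1\<bar> powr p)" by (rule powr_add_le[OF p0])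
      also have "\<bar>1 / \<delta> * ?s2\<bar> powr p = (1 / \<delta>) powr p * ?s2 powr p" using d s by (simp add: abs_mult powr_mult powr_divide)
      also have "?s2 powr p \<le> ?n powr p * (\<Sum>i\<in>UNIV. ?n powr p * (\<Sum>j\<in>UNIV. \<bar>e2 i j n x\<bar> powr p))"
        by (rule order_trans[OF powr_sum_le[OF _ p0]]) (auto intro!: mult_left_mono sum_mono powr_sum_le[OF _ p0] sum_nonneg)
      also have "\<bar>norm (b x) * ?s1\<bar> powr p = norm (b x) powr p * ?s1 powr p" using s by (simp add: abs_mult powr_mult)
      also have "?s1 powr p \<le> ?n powr p * (\<Sum>i\<in>UNIV. \<bar>e1 i n x\<bar> powr p)" by (rule powr_sum_le[OF _ p0]) auto
      finally have "?h n x powr p \<le> 2 powr p * ((1 / \<delta>) powr p * (?n powr p * (\<Sum>i\<in>UNIV. ?n powr p * (\<Sum>j\<in>UNIV. \<bar>e2 i j n x\<bar> powr p)))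
          + norm (b x) powr p * (?n powr p * (\<Sum>i\<in>UNIV. \<bar>e1 i n x\<bar> powr p)))"
        by (simp add: mult_left_mono add_mono)
      also have "\<dots> = 2 powr p * ((1 / \<delta>) powr p * (?n powr p * ?n powr p)) * (\<Sum>i\<in>UNIV. \<Sum>j\<in>UNIV. \<bar>e2 i j n x\<bar> powr p)
          + 2 powr p * ?n powr p * (\<Sum>i\<in>UNIV. (norm (b x) * \<bar>e1 i n x\<bar>) powr p)"
        by (simp add: powr_mult sum_distrib_left distrib_left ac_simps)
      finally have "ennreal (?h n x powr p) \<le> ennreal \<dots>" by (rule ennreal_leI)
      also have "\<dots> = K1 * (\<Sum>i\<in>UNIV. \<Sum>j\<in>UNIV. ennreal (\<bar>e2 i j n x\<bar> powr p)) + K2 * (\<Sum>i\<in>UNIV. ennreal ((norm (b x) * \<bar>e1 i n x\<bar>) powr p))"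
        unfolding K1_def K2_def by (simp add: sum_nonneg ennreal_plus ennreal_mult sum_ennreal)
      finally show ?thesis .
    next
      case False
      then have "ennreal (?h n x powr p) = 0" using p0 by simp
      then show ?thesis by (simp only: zero_le)
    qed
  qed
  let ?J = "\<lambda>n. K1 * (\<Sum>i\<in>UNIV. \<Sum>j\<in>UNIV. \<integral>\<^sup>+x. ennreal (\<bar>e2 i j n x\<bar> powr p) \<partial>lborel)
    + K2 * (\<Sum>i\<in>UNIV. epow Bn (p / ?n) * epow (\<integral>\<^sup>+x. ennreal (\<bar>e1 i n x\<bar> powr q) \<partial>lborel) (p / q))"
  have bound: "(\<integral>\<^sup>+x. ennreal (?h n x powr p) \<partial>lborel) \<le> ?J n" for n
  proof -
    have "(\<integral>\<^sup>+x. ennreal (?h n x powr p) \<partial>lborel)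
      \<le> (\<integral>\<^sup>+x. K1 * (\<Sum>i\<in>UNIV. \<Sum>j\<in>UNIV. ennreal (\<bar>e2 i j n x\<bar> powr p)) + K2 * (\<Sum>i\<in>UNIV. ennreal ((norm (b x) * \<bar>e1 i n x\<bar>) powr p)) \<partial>lborel)"
      by (rule nn_integral_mono_AE[OF pt])
    also have "\<dots> = K1 * (\<Sum>i\<in>UNIV. \<Sum>j\<in>UNIV. \<integral>\<^sup>+x. ennreal (\<bar>e2 i j n x\<bar> powr p) \<partial>lborel)
        + K2 * (\<Sum>i\<in>UNIV. \<integral>\<^sup>+x. ennreal ((norm (b x) * \<bar>e1 i n x\<bar>) powr p) \<partial>lborel)"
      by (simp add: nn_integral_add nn_integral_cmult nn_integral_sum del: sum_ennreal)
    also have "\<dots> \<le> ?J n"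
      unfolding Bn_def by (intro add_left_mono mult_left_mono sum_mono drift_error_bound[OF bm em(1) p q_def]) auto
    finally show ?thesis .
  qed
  have "(\<lambda>n. \<Sum>i\<in>UNIV. \<Sum>j\<in>UNIV. \<integral>\<^sup>+x. ennreal (\<bar>e2 i j n x\<bar> powr p) \<partial>lborel) \<longlonglongrightarrow> (\<Sum>i\<in>(UNIV::'n set). \<Sum>j\<in>(UNIV::'n set). 0)"
    by (intro tendsto_sum e2p)
  then have 1: "(\<lambda>n. K1 * (\<Sum>i\<in>UNIV. \<Sum>j\<in>UNIV. \<integral>\<^sup>+x. ennreal (\<bar>e2 i j n x\<bar> powr p) \<partial>lborel)) \<longlonglongrightarrow> K1 * 0"
    by (intro ennreal_tendsto_cmult) (auto simp: K1_def)
  have "epow Bn (p / ?n) < \<top>" using Bn by (auto simp: epow_def)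
  then have "(\<lambda>n. epow Bn (p / ?n) * epow (\<integral>\<^sup>+x. ennreal (\<bar>e1 i n x\<bar> powr q) \<partial>lborel) (p / q)) \<longlonglongrightarrow> epow Bn (p / ?n) * 0" for i
    using p0 q0 by (intro ennreal_tendsto_cmult epow_tendsto_0 e1q) auto
  then have "(\<lambda>n. \<Sum>i\<in>UNIV. epow Bn (p / ?n) * epow (\<integral>\<^sup>+x. ennreal (\<bar>e1 i n x\<bar> powr q) \<partial>lborel) (p / q)) \<longlonglongrightarrow> (\<Sum>i\<in>(UNIV::'n set). 0)"
    by (intro tendsto_sum) simp
  then have 2: "(\<lambda>n. K2 * (\<Sum>i\<in>UNIV. epow Bn (p / ?n) * epow (\<integral>\<^sup>+x. ennreal (\<bar>e1 i n x\<bar> powr q) \<partial>lborel) (p / q))) \<longlonglongrightarrow> K2 * 0"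
    by (intro ennreal_tendsto_cmult) (auto simp: K2_def)
  have J: "?J \<longlonglongrightarrow> 0" using tendsto_add[OF 1 2] by simp
  show ?thesis
    unfolding v_def[symmetric]
    by (rule tendsto_sandwich[OF _ _ tendsto_const J]) (auto intro!: always_eventually bound)
qed

section \<open>The maximum principle\<close>

text \<open>On the right, \<open>ennreal\<close> truncates negative values, so this is the integral
  of the positive part. Without integrability the left side is 0 by convention.\<close>

lemma ennreal_integral_le_nn_integral:
  "ennreal (integral\<^sup>L M f) \<le> (\<integral>\<^sup>+x. ennreal (f x) \<partial>M)"
proof (cases "integrable M f")
  case True
  then have i: "integrable M (\<lambda>x. max 0 (f x))" by auto
  have "integral\<^sup>L M f \<le> (\<integral>x. max 0 (f x) \<partial>M)" using True i by (intro integral_mono) auto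
  then have "ennreal (integral\<^sup>L M f) \<le> ennreal (\<integral>x. max 0 (f x) \<partial>M)" by (rule ennreal_leI)
  also have "\<dots> = (\<integral>\<^sup>+x. ennreal (max 0 (f x)) \<partial>M)" using i by (intro nn_integral_eq_integral[symmetric]) auto
  also have "\<dots> = (\<integral>\<^sup>+x. ennreal (f x) \<partial>M)" by (intro nn_integral_cong) (simp add: max_def ennreal_neg)
  finally show ?thesis .
qed (simp add: not_integrable_integral_eq)

context quasi_diffusion
begin

text \<open>A continuous path started at the centre stays in the ball for a positive time.\<close>

lemma exit_positive_time:
  assumes r: "0 < r"
  shows "(\<integral>\<^sup>+\<omega>. (\<integral>\<^sup>+t\<in>before c r \<omega>. 1 \<partial>lborel) \<partial>P c) \<noteq> 0"
proof
  interpret prob_space "P c" by (rule prob)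
  assume z: "(\<integral>\<^sup>+\<omega>. (\<integral>\<^sup>+t\<in>before c r \<omega>. 1 \<partial>lborel) \<partial>P c) = 0"
  have m: "(\<lambda>\<omega>. \<integral>\<^sup>+t\<in>before c r \<omega>. 1 \<partial>lborel) \<in> borel_measurable (P c)"
    using path_P[OF before_nn_measurable[of "\<lambda>_. 1" c r]] by simp
  have "AE \<omega> in P c. (\<integral>\<^sup>+t\<in>before c r \<omega>. 1 \<partial>lborel) = 0"
    using z nn_integral_0_iff_AE[OF m] by simp
  with start[of c] AE_space have "AE \<omega> in P c. False"
  proof eventually_elim
    case (elim \<omega>)
    then have w: "\<omega> \<in> space M" by simp
    have pos: "0 < stop c r 1 \<omega>" using elim r by (intro stop_pos[OF w]) auto
    have "ennreal (stop c r 1 \<omega>) = (\<integral>\<^sup>+t. indicator {0..<stop c r 1 \<omega>} t \<partial>lborel)"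
      using pos by simp
    also have "\<dots> \<le> (\<integral>\<^sup>+t\<in>before c r \<omega>. 1 \<partial>lborel)"
      using stop_before[of 1 _ c r \<omega>] by (intro nn_integral_mono) (auto simp: indicator_def)
    finally show ?case using elim pos by (simp add: ennreal_eq_0_iff)
  qed
  then show False by simp
qed

text \<open>In dimension one an exponent below \<open>1\<close> is impossible: the occupation measure of an interval
  of length \<open>h\<close> would be of order \<open>h\<close> to a power larger than \<open>1\<close>, hence identically zero.\<close>

lemma exponent_gt_1:
  assumes adm: "admissible_coeffs \<delta> B a b" and est: "exit_estimate TYPE('w) TYPE('n) \<delta> B p"
    and p: "real CARD('n) / 2 < p" "p < real CARD('n)"
  shows "2 \<le> CARD('n)" "1 < p"
proof -
  have "CARD('n) \<noteq> 1"
  proof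
    assume one: "CARD('n) = 1"
    then obtain i :: 'n where i: "UNIV = {i}" using card_1_singletonE by blast
    have p01: "0 < p" "p < 1" using p one by auto
    obtain N where N: "0 < N" "\<And>c r f. 0 < r \<Longrightarrow> f \<in> borel_measurable borel \<Longrightarrow> (\<forall>x. 0 \<le> f x) \<Longrightarrow>
      (\<integral>\<^sup>+\<omega>. (\<integral>\<^sup>+t\<in>before c r \<omega>. ennreal (f (X t \<omega>)) \<partial>lborel) \<partial>P c)
        \<le> ennreal (N * r powr (2 - real CARD('n) / p)) * Lp_norm p (ball c r) f"
      using exit_estimate_at[OF adm est] by blast
    \<comment> \<open>In dimension one these are intervals of length \<open>2 / n\<close>, and the
      \<open>n\<close> of them with \<open>k < n\<close> cover the unit ball.\<close>
    define A where "A n k = cbox (vec (2 * real k / real n - 1) :: real^'n) (vec (2 * real (Suc k) / real n - 1))" for n k :: nat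
    have vol: "emeasure lborel (A n k) \<le> ennreal (2 / real n)" if n: "0 < n" for n k
    proof -
      have "emeasure lborel (A n k) = ennreal (\<Prod>b\<in>(Basis :: (real^'n) set). (vec (2 * real (Suc k) / real n - 1) - vec (2 * real k / real n - 1)) \<bullet> b)"
        unfolding A_def by (rule emeasure_lborel_cbox) (auto simp: Basis_vec_def inner_axis divide_right_mono)
      also have "(\<Prod>b\<in>(Basis :: (real^'n) set). (vec (2 * real (Suc k) / real n - 1) - vec (2 * real k / real n - 1)) \<bullet> b)
        = (\<Prod>b\<in>(Basis :: (real^'n) set). 2 / real n)"
        using n by (intro prod.cong) (auto simp: Basis_vec_def inner_axis inner_diff_left diff_divide_distrib[symmetric])
      also have "\<dots> = 2 / real n" using one by simp
      finally show ?thesis by simp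
    qed
    have occ: "(\<integral>\<^sup>+\<omega>. (\<integral>\<^sup>+t\<in>before 0 1 \<omega>. indicator (A n k) (X t \<omega>) \<partial>lborel) \<partial>P 0) \<le> ennreal (N * (2 / real n) powr (1 / p))"
      if n: "0 < n" for n k
    proof -
      have "(\<integral>\<^sup>+\<omega>. (\<integral>\<^sup>+t\<in>before 0 1 \<omega>. indicator (A n k) (X t \<omega>) \<partial>lborel) \<partial>P 0)
          = (\<integral>\<^sup>+\<omega>. (\<integral>\<^sup>+t\<in>before 0 1 \<omega>. ennreal (indicator (A n k) (X t \<omega>)) \<partial>lborel) \<partial>P 0)"
        by (simp add: ennreal_indicator)
      also have "\<dots> \<le> ennreal (N * 1 powr (2 - real CARD('n) / p)) * Lp_norm p (ball 0 1) (indicator (A n k) :: real^'n \<Rightarrow> real)"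
        by (intro N(2)) (auto simp: A_def)
      also have "\<dots> \<le> ennreal N * epow (ennreal (2 / real n)) (1 / p)"
      proof -
        have "(\<integral>\<^sup>+x\<in>ball 0 1. ennreal (norm (indicator (A n k) x :: real) powr p) \<partial>lborel) \<le> (\<integral>\<^sup>+x. indicator (A n k) x \<partial>lborel)"
          using p01 by (intro nn_integral_mono) (auto simp: indicator_def)
        also have "\<dots> \<le> ennreal (2 / real n)" using vol[OF n, of k] by (simp add: A_def)
        finally show ?thesis
          using p01 by (simp add: Lp_norm_epow mult_left_mono epow_mono)
      qed
      also have "\<dots> = ennreal (N * (2 / real n) powr (1 / p))" using p01 N(1) by (simp add: epow_ennreal ennreal_mult)
      finally show ?thesis .
    qed
    have cover: "\<exists>k<n. x \<in> A n k" if n: "0 < n" and x: "x \<in> ball 0 1" for n and x :: "real^'n"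
    proof -
      define k where "k = nat \<lfloor>(x $ i + 1) * real n / 2\<rfloor>"
      have xi: "\<bar>x $ i\<bar> < 1" using x component_le_norm_cart[of x i] by simp
      then have xi': "0 \<le> x $ i + 1" "x $ i + 1 < 2" by linarith+
      have s: "0 \<le> (x $ i + 1) * real n / 2" "(x $ i + 1) * real n / 2 < real n"
        using xi' mult_strict_right_mono[OF xi'(2), of "real n"] n by auto
      have k: "real k \<le> (x $ i + 1) * real n / 2" "(x $ i + 1) * real n / 2 < real (Suc k)"
        unfolding k_def using s(1) by linarith+
      then have "k < n" using s(2) by linarith
      moreover have "2 * real k / real n - 1 \<le> x $ i" "x $ i \<le> 2 * real (Suc k) / real n - 1"
        using k n by (auto simp: field_simps)
      then have "x \<in> A n k" unfolding A_def mem_box_cart using i by (metis UNIV_I singletonD vec_component)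
      ultimately show ?thesis by blast
    qed
    let ?T = "\<integral>\<^sup>+\<omega>. (\<integral>\<^sup>+t\<in>before 0 1 \<omega>. 1 \<partial>lborel) \<partial>P 0"
    have T: "?T \<le> ennreal (real n * (N * (2 / real n) powr (1 / p)))" if n: "0 < n" for n
    proof -
      have hm: "(\<lambda>y. indicator (A n k) y :: ennreal) \<in> borel_measurable borel" for k
        by (rule borel_measurable_indicator) (simp add: A_def)
      have "?T \<le> (\<integral>\<^sup>+\<omega>. (\<Sum>k<n. \<integral>\<^sup>+t\<in>before 0 1 \<omega>. indicator (A n k) (X t \<omega>) \<partial>lborel) \<partial>P 0)"
      proof (rule nn_integral_mono)
        fix \<omega> assume "\<omega> \<in> space (P 0)"
        then have w: "\<omega> \<in> space M" by simp
        have m: "(\<lambda>t. indicator (A n k) (X t \<omega>) * indicator (before 0 1 \<omega>) t :: ennreal) \<in> borel_measurable lborel" for k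
        proof -
          have "(\<lambda>y. indicator (A n k) y :: real) \<in> borel_measurable borel"
            by (rule borel_measurable_indicator) (simp add: A_def)
          from path_measurable[OF this w _ before_sets, of 0 1]
          have "(\<lambda>t. indicator (before 0 1 \<omega>) t *\<^sub>R (indicator (A n k) (X t \<omega>) :: real)) \<in> borel_measurable lborel"
            by (auto simp: set_borel_measurable_def before_def)
          then have "(\<lambda>t. ennreal (indicator (before 0 1 \<omega>) t *\<^sub>R (indicator (A n k) (X t \<omega>) :: real))) \<in> borel_measurable lborel" by simp
          moreover have "ennreal (indicator (before 0 1 \<omega>) t *\<^sub>R (indicator (A n k) (X t \<omega>) :: real)) = indicator (A n k) (X t \<omega>) * indicator (before 0 1 \<omega>) t" for t
            by (simp add: indicator_def)
          ultimately show ?thesis by (simp only:)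
        qed
        have "(\<integral>\<^sup>+t\<in>before 0 1 \<omega>. 1 \<partial>lborel) \<le> (\<integral>\<^sup>+t. (\<Sum>k<n. indicator (A n k) (X t \<omega>) * indicator (before 0 1 \<omega>) t) \<partial>lborel)"
        proof (rule nn_integral_mono)
          fix t
          show "1 * indicator (before 0 1 \<omega>) t \<le> (\<Sum>k<n. indicator (A n k) (X t \<omega>) * indicator (before 0 1 \<omega>) t :: ennreal)"
          proof (cases "t \<in> before 0 1 \<omega>")
            case True
            then obtain k where k: "k < n" "X t \<omega> \<in> A n k" using cover[OF n before_mem[OF w True]] by blast
            have "(indicator (A n k) (X t \<omega>) * indicator (before 0 1 \<omega>) t :: ennreal) \<le> (\<Sum>k<n. indicator (A n k) (X t \<omega>) * indicator (before 0 1 \<omega>) t)"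
              using k by (intro member_le_sum) auto
            then show ?thesis using True k by simp
          qed simp
        qed
        also have "\<dots> = (\<Sum>k<n. \<integral>\<^sup>+t\<in>before 0 1 \<omega>. indicator (A n k) (X t \<omega>) \<partial>lborel)"
          using m by (intro nn_integral_sum) auto
        finally show "(\<integral>\<^sup>+t\<in>before 0 1 \<omega>. 1 \<partial>lborel) \<le> (\<Sum>k<n. \<integral>\<^sup>+t\<in>before 0 1 \<omega>. indicator (A n k) (X t \<omega>) \<partial>lborel)" .
      qed
      also have "\<dots> = (\<Sum>k<n. \<integral>\<^sup>+\<omega>. (\<integral>\<^sup>+t\<in>before 0 1 \<omega>. indicator (A n k) (X t \<omega>) \<partial>lborel) \<partial>P 0)"
        by (intro nn_integral_sum path_P before_nn_measurable hm)
      also have "\<dots> \<le> (\<Sum>k<n. ennreal (N * (2 / real n) powr (1 / p)))" by (intro sum_mono occ n)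
      also have "\<dots> = ennreal (real n * (N * (2 / real n) powr (1 / p)))"
        using N(1) by (simp add: ennreal_of_nat_eq_real_of_nat ennreal_mult)
      finally show ?thesis .
    qed
    \<comment> \<open>Each interval is occupied for a mean time of order \<open>n\<close> to the
      power \<open>- 1 / p\<close>, and \<open>1 / p > 1\<close> makes the sum of the
      \<open>n\<close> bounds tend to 0.\<close>
    have "(\<lambda>n. real (Suc n) * (N * (2 / real (Suc n)) powr (1 / p))) \<longlonglongrightarrow> 0"
    proof -
      have e: "real (Suc n) * (N * (2 / real (Suc n)) powr (1 / p)) = N * 2 powr (1 / p) * (1 / real (Suc n)) powr (1 / p - 1)" for n
        using p01 by (simp add: powr_divide powr_diff del: of_nat_Suc)
      have "(\<lambda>n. (1 / real (Suc n)) powr (1 / p - 1)) \<longlonglongrightarrow> 0 powr (1 / p - 1)"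
        using p01 LIMSEQ_inverse_real_of_nat by (intro tendsto_powr' tendsto_const) (auto simp: inverse_eq_divide)
      then have "(\<lambda>n. N * 2 powr (1 / p) * (1 / real (Suc n)) powr (1 / p - 1)) \<longlonglongrightarrow> N * 2 powr (1 / p) * 0"
        using p01 by (intro tendsto_mult tendsto_const) simp
      then show ?thesis unfolding e by simp
    qed
    from tendsto_ennrealI[OF this] have "(\<lambda>n. ennreal (real (Suc n) * (N * (2 / real (Suc n)) powr (1 / p)))) \<longlonglongrightarrow> 0" by simp
    then have "?T \<le> 0" by (rule LIMSEQ_le_const) (use T in blast)
    then show False using exit_positive_time[of 1 0] by simp
  qed
  then show "2 \<le> CARD('n)" using zero_less_card_finite[where 'a='n] by linarith
  then show "1 < p" using p(1) by simp
qed

text \<open>The number \<open>c\<close> times the mean of the stopped time is fixed and positive,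
  but comparing \<open>stopped_value\<close> with Dynkin's formula for the mollifications bounds a
  fixed fraction of it by a quantity tending to zero. The two exponents have separate tasks:
  \<open>p\<close> makes the potential of \<open>f\<close> finite, \<open>d0\<close> controls the
  error of the generator.\<close>

lemma no_strict_subsolution:
  fixes f g \<phi> :: "real^'n \<Rightarrow> real"
  assumes adm: "admissible_coeffs \<delta> B a b" and \<delta>: "0 < \<delta>"
    and d0: "exit_estimate TYPE('w) TYPE('n) \<delta> B d0" "real CARD('n) / 2 < d0" "d0 < real CARD('n)"
    and est: "exit_estimate TYPE('w) TYPE('n) \<delta> B p"
    and R: "0 < R" and f: "f \<in> borel_measurable borel" "Lp_norm p UNIV f < \<infinity>"
    and g: "g \<in> borel_measurable borel" "bounded (range g)"
    and sob: "sobolev2 d0 (ball 0 R) \<phi> D\<phi> D2\<phi>" and \<phi>c: "continuous_on (ball 0 R) \<phi>"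
    and s: "0 < s" "cball x0 s \<subseteq> ball 0 R"
    and max: "\<And>y. y \<in> ball x0 s \<Longrightarrow> (\<integral>\<omega>. payoff R f g \<omega> \<partial>P y) - \<phi> y \<le> (\<integral>\<omega>. payoff R f g \<omega> \<partial>P x0) - \<phi> x0"
    and c: "0 < c" and le: "AE x in lborel. x \<in> ball x0 s \<longrightarrow> diff_op a b D\<phi> D2\<phi> x + f x \<le> - c"
  shows False
proof -
  interpret prob_space "P x0" by (rule prob)
  note n2 = exponent_gt_1[OF adm d0]
  \<comment> \<open>The path is stopped on leaving the ball of radius \<open>r\<close>;
    \<open>r1\<close> and \<open>s\<close> leave room for mollification, and \<open>s\<close> is
    also the radius within which \<open>max\<close> and \<open>le\<close> are assumed.\<close>
  define r where "r = s / 3"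
  define r1 where "r1 = 2 * s / 3"
  have rr: "0 < r" "r < r1" "r1 < s" "r < s" using s by (auto simp: r_def r1_def)
  have subs: "ball x0 s \<subseteq> ball 0 R" using s(2) by auto
  have subr: "ball x0 r \<subseteq> ball 0 R" using subs rr by (auto simp: subset_eq)
  define v where "v n = approx s x0 \<phi> n" for n
  note ctx = sob \<phi>c n2(1) n2(2) d0(3) refl rr(1-3) subs
  have vC: "Ck 2 (v n)" "compactly_supported_in UNIV (v n)" for n
    unfolding v_def by (rule approx_Ck[OF ctx], rule approx_support[OF ctx])
  \<comment> \<open>\<open>stopped_value\<close> wants a bounded Borel function on the whole space.
    The closed ball is compact and contained in the domain of continuity, so the cut-off function is
    bounded, and it agrees with \<open>\<phi>\<close> wherever the stopped path can be.\<close>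
  define \<phi>' where "\<phi>' x = indicator (cball x0 s) x * \<phi> x" for x
  have \<phi>cs: "continuous_on (cball x0 s) \<phi>" using \<phi>c s(2) by (rule continuous_on_subset)
  have \<phi>'m: "\<phi>' \<in> borel_measurable borel"
    using borel_measurable_continuous_on_indicator[OF _ \<phi>cs] by (simp add: \<phi>'_def[abs_def])
  have "bounded (\<phi> ` cball x0 s)" using \<phi>cs by (intro compact_imp_bounded compact_continuous_image) auto
  then obtain K where "\<forall>y\<in>\<phi> ` cball x0 s. norm y \<le> K" unfolding bounded_iff by blast
  then have K: "\<bar>\<phi> x\<bar> \<le> K" if "x \<in> cball x0 s" for x using that by auto
  have \<phi>'b: "bounded (range \<phi>')"
    unfolding bounded_iff using K by (intro exI[of _ "max K 0"]) (auto simp: \<phi>'_def indicator_def le_max_iff_disj)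
  have \<phi>'eq: "\<phi>' x = \<phi> x" if "x \<in> cball x0 s" for x using that by (simp add: \<phi>'_def)
  have \<phi>'c: "continuous_on (ball x0 s) \<phi>'"
    by (rule continuous_on_eq[OF continuous_on_subset[OF \<phi>cs]]) (auto simp: \<phi>'eq)
  have max': "(\<integral>\<omega>. payoff R f g \<omega> \<partial>P y) - \<phi>' y \<le> (\<integral>\<omega>. payoff R f g \<omega> \<partial>P x0) - \<phi>' x0" if "y \<in> ball x0 s" for y
    using max[OF that] that s(1) by (simp add: \<phi>'eq)
  let ?\<rho> = "stop x0 r 1"
  note sv = stopped_value[OF adm est R f g zero_less_one rr(1) rr(4) subs \<phi>'m \<phi>'b \<phi>'c max']
  define If where "If \<omega> = (LINT t:before 0 R \<omega> \<inter> {0..?\<rho> \<omega>}|lborel. f (X t \<omega>))" for \<omega>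
  define Iv where "Iv n \<omega> = (LINT t:{0..?\<rho> \<omega>}|lborel. classical_op a b (v n) (X t \<omega>))" for n \<omega>
  have iIf: "integrable (P x0) If" and i\<phi>: "integrable (P x0) (\<lambda>\<omega>. \<phi>' (X (?\<rho> \<omega>) \<omega>))"
    and A: "\<phi>' x0 \<le> (\<integral>\<omega>. If \<omega> \<partial>P x0) + (\<integral>\<omega>. \<phi>' (X (?\<rho> \<omega>) \<omega>) \<partial>P x0)"
    using sv unfolding If_def by auto
  note dy = dynkin_stopped[OF adm \<delta> vC(1) vC(2) zero_less_one, where x=x0 and c=x0 and r=r]
  have ivX: "integrable (P x0) (\<lambda>\<omega>. v n (X (?\<rho> \<omega>) \<omega>))" and iIv: "integrable (P x0) (Iv n)"
    and Dn: "(\<integral>\<omega>. v n (X (?\<rho> \<omega>) \<omega>) \<partial>P x0) = v n x0 + (\<integral>\<omega>. Iv n \<omega> \<partial>P x0)" for n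
    using dy unfolding Iv_def by blast+
  have st: "0 \<le> ?\<rho> \<omega>" "?\<rho> \<omega> \<le> 1" for \<omega> using stop_bounds[of 1 x0 r \<omega>] by auto
  have i\<rho>: "integrable (P x0) ?\<rho>"
    using st path_P[OF stop_measurable] by (intro integrable_const_bound[where B=1]) auto
  \<comment> \<open>The derivatives of the mollifications are controlled on \<open>ball x0 r\<close>
    only; the path does not leave this ball before the stopped time, so the cut is invisible along
    it.\<close>
  define h where "h n x = indicator (ball x0 r) x * max 0 (f x + classical_op a b (v n) x + c)" for n x
  have am: "a \<in> borel_measurable borel" "b \<in> borel_measurable borel" using adm by (auto simp: admissible_coeffs_def)
  have lm[measurable]: "classical_op a b (v n) \<in> borel_measurable borel" for n by (rule classical_op_measurable[OF am vC(1)])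
  note f(1)[measurable]
  have hm: "h n \<in> borel_measurable borel" for n
    unfolding h_def[abs_def] by (intro borel_measurable_times borel_measurable_indicator) measurable
  have d0p: "0 < d0" using n2(2) by simp
  have Jlim: "(\<lambda>n. \<integral>\<^sup>+x. ennreal (h n x powr d0) \<partial>lborel) \<longlonglongrightarrow> 0"
    unfolding h_def v_def
  proof (rule generator_error[OF sob \<phi>c n2(1) n2(2) d0(3) rr(1-3) subs adm \<delta>])
    show "AE x in lborel. x \<in> ball x0 r \<longrightarrow> diff_op a b D\<phi> D2\<phi> x + f x \<le> - c"
      using le by eventually_elim (use rr in auto)
  qed
  obtain N where N: "0 < N" "\<And>c r f. 0 < r \<Longrightarrow> f \<in> borel_measurable borel \<Longrightarrow> (\<forall>x. 0 \<le> f x) \<Longrightarrow>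
      (\<integral>\<^sup>+\<omega>. (\<integral>\<^sup>+t\<in>before c r \<omega>. ennreal (f (X t \<omega>)) \<partial>lborel) \<partial>P c)
        \<le> ennreal (N * r powr (2 - real CARD('n) / d0)) * Lp_norm d0 (ball c r) f"
    using exit_estimate_at[OF adm d0(1)] by blast
  \<comment> \<open>The exit estimate for \<open>h n\<close> with exponent
    \<open>d0\<close>.\<close>
  define \<kappa> where "\<kappa> n = ennreal (N * r powr (2 - real CARD('n) / d0)) * epow (\<integral>\<^sup>+x. ennreal (h n x powr d0) \<partial>lborel) (1 / d0)" for n
  have \<kappa>0: "\<kappa> \<longlonglongrightarrow> 0"
  proof -
    have "(\<lambda>n. epow (\<integral>\<^sup>+x. ennreal (h n x powr d0) \<partial>lborel) (1 / d0)) \<longlonglongrightarrow> 0"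
      using d0p by (intro epow_tendsto_0 Jlim) simp
    then have "\<kappa> \<longlonglongrightarrow> ennreal (N * r powr (2 - real CARD('n) / d0)) * 0"
      unfolding \<kappa>_def by (intro ennreal_tendsto_cmult) auto
    then show ?thesis by simp
  qed
  have h\<kappa>: "(\<integral>\<^sup>+\<omega>. (\<integral>\<^sup>+t\<in>before x0 r \<omega>. ennreal (h n (X t \<omega>)) \<partial>lborel) \<partial>P x0) \<le> \<kappa> n" for n
  proof -
    have "(\<integral>\<^sup>+\<omega>. (\<integral>\<^sup>+t\<in>before x0 r \<omega>. ennreal (h n (X t \<omega>)) \<partial>lborel) \<partial>P x0)
      \<le> ennreal (N * r powr (2 - real CARD('n) / d0)) * Lp_norm d0 (ball x0 r) (h n)"
      by (intro N(2) rr(1) hm) (simp add: h_def)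
    also have "\<dots> \<le> \<kappa> n"
      unfolding \<kappa>_def Lp_norm_epow[OF d0p] using d0p
      by (intro mult_left_mono epow_mono nn_integral_mono) (auto simp: indicator_def h_def)
    finally show ?thesis .
  qed
  define Y where "Y n \<omega> = If \<omega> + Iv n \<omega> + c * ?\<rho> \<omega>" for n \<omega>
  have Yle: "AE \<omega> in P x0. ennreal (Y n \<omega>) \<le> (\<integral>\<^sup>+t\<in>before x0 r \<omega>. ennreal (h n (X t \<omega>)) \<partial>lborel)" for n
    using potential_AE[OF adm est R f, where y=x0] op_set_integrable_AE[OF adm \<delta> vC(1)[of n] vC(2)[of n] zero_le_one, where x=x0] AE_space
  proof eventually_elim
    case (elim \<omega>)
    then have w: "\<omega> \<in> space M" by simp
    \<comment> \<open>The right end is removed because the path may be on the boundary of the ball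
      there, outside the reach of \<open>h n\<close>. A single time is a null set, so the integrals
      do not change.\<close>
    let ?I = "{0..<?\<rho> \<omega>}"
    have sub1: "?I \<subseteq> before x0 r \<omega>" using stop_before[of 1 _ x0 r \<omega>] by auto
    have "exit_from x0 r \<omega> \<le> exit_from 0 R \<omega>"
      unfolding exit_from_eq using subr by (intro INF_superset_mono) auto
    then have sub2: "?I \<subseteq> before 0 R \<omega>" using sub1 unfolding before_def by (auto intro: less_le_trans)
    have if1: "set_integrable lborel ?I (\<lambda>t. f (X t \<omega>))"
      by (rule set_integrable_subset[OF elim(1)]) (use sub2 in auto)
    have if2: "set_integrable lborel (before 0 R \<omega> \<inter> {0..?\<rho> \<omega>}) (\<lambda>t. f (X t \<omega>))"
      by (rule set_integrable_subset[OF elim(1)]) (use before_sets in auto)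
    have iv1: "set_integrable lborel ?I (\<lambda>t. classical_op a b (v n) (X t \<omega>))"
      and iv2: "set_integrable lborel {0..?\<rho> \<omega>} (\<lambda>t. classical_op a b (v n) (X t \<omega>))"
      by (rule set_integrable_subset[OF elim(2)]; use st[of \<omega>] in auto)+
    have ne: "AE t in lborel. t \<noteq> ?\<rho> \<omega>" by (rule AE_lborel_singleton)
    have "AE t in lborel. indicator (before 0 R \<omega> \<inter> {0..?\<rho> \<omega>}) t *\<^sub>R f (X t \<omega>) = indicator ?I t *\<^sub>R f (X t \<omega>)"
      using ne by eventually_elim (use sub2 in \<open>auto simp: indicator_def\<close>)
    then have 1: "If \<omega> = (LINT t:?I|lborel. f (X t \<omega>))"
      using if1 if2 unfolding If_def set_lebesgue_integral_def set_integrable_def by (intro integral_cong_AE) auto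
    have "AE t in lborel. indicator {0..?\<rho> \<omega>} t *\<^sub>R classical_op a b (v n) (X t \<omega>) = indicator ?I t *\<^sub>R classical_op a b (v n) (X t \<omega>)"
      using ne by eventually_elim (auto simp: indicator_def)
    then have 2: "Iv n \<omega> = (LINT t:?I|lborel. classical_op a b (v n) (X t \<omega>))"
      using iv1 iv2 unfolding Iv_def set_lebesgue_integral_def set_integrable_def by (intro integral_cong_AE) auto
    have ic: "set_integrable lborel ?I (\<lambda>t. c)" unfolding set_integrable_def using st[of \<omega>] by simp
    have 3: "c * ?\<rho> \<omega> = (LINT t:?I|lborel. c)" using st[of \<omega>] by (simp add: set_lebesgue_integral_def)
    have "Y n \<omega> = (LINT t:?I|lborel. f (X t \<omega>) + classical_op a b (v n) (X t \<omega>) + c)"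
      unfolding Y_def 1 2 3 using if1 iv1 ic by (simp add: set_integral_add)
    then have "ennreal (Y n \<omega>) \<le> (\<integral>\<^sup>+t. ennreal (indicator ?I t *\<^sub>R (f (X t \<omega>) + classical_op a b (v n) (X t \<omega>) + c)) \<partial>lborel)"
      unfolding set_lebesgue_integral_def using ennreal_integral_le_nn_integral by (simp only:)
    also have "\<dots> \<le> (\<integral>\<^sup>+t\<in>before x0 r \<omega>. ennreal (h n (X t \<omega>)) \<partial>lborel)"
    proof (rule nn_integral_mono)
      fix t
      show "ennreal (indicator ?I t *\<^sub>R (f (X t \<omega>) + classical_op a b (v n) (X t \<omega>) + c)) \<le> ennreal (h n (X t \<omega>)) * indicator (before x0 r \<omega>) t"
      proof (cases "t \<in> ?I")
        case True
        then have b: "t \<in> before x0 r \<omega>" using sub1 by blast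
        have "f (X t \<omega>) + classical_op a b (v n) (X t \<omega>) + c \<le> h n (X t \<omega>)"
          using before_mem[OF w b] by (simp add: h_def)
        then show ?thesis using True b by (simp add: ennreal_leI)
      qed simp
    qed
    finally show ?case .
  qed
  have EY: "ennreal (\<integral>\<omega>. Y n \<omega> \<partial>P x0) \<le> \<kappa> n" for n
  proof -
    have "ennreal (\<integral>\<omega>. Y n \<omega> \<partial>P x0) \<le> (\<integral>\<^sup>+\<omega>. ennreal (Y n \<omega>) \<partial>P x0)" by (rule ennreal_integral_le_nn_integral)
    also have "\<dots> \<le> (\<integral>\<^sup>+\<omega>. (\<integral>\<^sup>+t\<in>before x0 r \<omega>. ennreal (h n (X t \<omega>)) \<partial>lborel) \<partial>P x0)" by (rule nn_integral_mono_AE[OF Yle])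
    also note h\<kappa>
    finally show ?thesis .
  qed
  define \<mu> where "\<mu> = c * (\<integral>\<omega>. ?\<rho> \<omega> \<partial>P x0)"
  have \<mu>: "0 < \<mu>"
  proof -
    have "AE \<omega> in P x0. 0 < ?\<rho> \<omega>"
      using start[of x0] AE_space by eventually_elim (use rr in \<open>auto intro!: stop_pos\<close>)
    moreover have "emeasure (P x0) (space (P x0)) \<noteq> 0" by (simp only: emeasure_space_1) simp
    ultimately have "(\<integral>\<omega>. 0 \<partial>P x0) < (\<integral>\<omega>. ?\<rho> \<omega> \<partial>P x0)"
      using i\<rho> by (intro integral_less_AE_space) auto
    then have "0 < (\<integral>\<omega>. ?\<rho> \<omega> \<partial>P x0)" by simp
    then show ?thesis using c by (simp add: \<mu>_def)
  qed
  \<comment> \<open>Error budget: replacing \<open>\<phi>\<close> by its mollification costs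
    \<open>\<mu> / 4\<close> at the stopped point and \<open>\<mu> / 4\<close> at \<open>x0\<close>.
    Half of \<open>\<mu>\<close> remains as a lower bound for the mean of \<open>Y n\<close>,
    against the upper bound \<open>\<kappa> n\<close>.\<close>
  have "\<forall>\<^sub>F n in sequentially. \<kappa> n < ennreal (\<mu> / 2)" using \<kappa>0 \<mu> by (intro order_tendstoD(2)) auto
  moreover have "\<forall>\<^sub>F n in sequentially. \<forall>x\<in>cball x0 r. \<bar>v n x - \<phi> x\<bar> \<le> \<mu> / 4"
    unfolding v_def using \<mu> by (intro approx_uniform[OF ctx]) simp
  ultimately have "\<forall>\<^sub>F n in sequentially. False"
  proof eventually_elim
    case (elim n)
    have "(\<integral>\<omega>. \<phi>' (X (?\<rho> \<omega>) \<omega>) \<partial>P x0) \<le> (\<integral>\<omega>. v n (X (?\<rho> \<omega>) \<omega>) + \<mu> / 4 \<partial>P x0)"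
    proof (rule integral_mono_AE[OF i\<phi>])
      show "integrable (P x0) (\<lambda>\<omega>. v n (X (?\<rho> \<omega>) \<omega>) + \<mu> / 4)" using ivX by simp
      show "AE \<omega> in P x0. \<phi>' (X (?\<rho> \<omega>) \<omega>) \<le> v n (X (?\<rho> \<omega>) \<omega>) + \<mu> / 4"
        using start[of x0] AE_space
      proof eventually_elim
        case w: (elim \<omega>)
        have in_r: "X (?\<rho> \<omega>) \<omega> \<in> cball x0 r" using w rr by (intro stop_cball) auto
        then have in_s: "X (?\<rho> \<omega>) \<omega> \<in> cball x0 s" using rr by auto
        show ?case using bspec[OF elim(2) in_r] unfolding \<phi>'eq[OF in_s] by linarith
      qed
    qed
    also have "\<dots> = v n x0 + (\<integral>\<omega>. Iv n \<omega> \<partial>P x0) + \<mu> / 4" using ivX Dn prob_space by simp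
    finally have 1: "(\<integral>\<omega>. \<phi>' (X (?\<rho> \<omega>) \<omega>) \<partial>P x0) \<le> v n x0 + (\<integral>\<omega>. Iv n \<omega> \<partial>P x0) + \<mu> / 4" .
    have "\<bar>v n x0 - \<phi> x0\<bar> \<le> \<mu> / 4" using elim(2) rr by auto
    moreover have "\<phi>' x0 = \<phi> x0" using s by (simp add: \<phi>'eq)
    ultimately have 2: "v n x0 \<le> \<phi>' x0 + \<mu> / 4" by linarith
    have "(\<integral>\<omega>. Y n \<omega> \<partial>P x0) = (\<integral>\<omega>. If \<omega> \<partial>P x0) + (\<integral>\<omega>. Iv n \<omega> \<partial>P x0) + \<mu>"
      unfolding Y_def \<mu>_def using iIf iIv i\<rho> by simp
    with A 1 2 have "\<mu> / 2 \<le> (\<integral>\<omega>. Y n \<omega> \<partial>P x0)" by linarith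
    then have "ennreal (\<mu> / 2) \<le> \<kappa> n" using EY[of n] by (meson ennreal_leI order_trans)
    with elim(1) show False by simp
  qed
  then show False by simp
qed

end

text \<open>The essential supremum decreases with the ball, so it converges to its infimum over
  small radii. The comparison of two balls uses measurability on the smaller one, which is where the
  bound \<open>e0\<close> comes in.\<close>

lemma esssup_ball_tendsto:
  fixes F :: "real^'n \<Rightarrow> ereal"
  assumes e0: "0 < e0" and F: "\<And>e. 0 < e \<Longrightarrow> e < e0 \<Longrightarrow> F \<in> borel_measurable (restrict_space lborel (ball x0 e))"
  shows "((\<lambda>e. esssup (restrict_space lborel (ball x0 e)) F) \<longlongrightarrow> (INF e\<in>{0<..<e0}. esssup (restrict_space lborel (ball x0 e)) F)) (at_right 0)"
proof -
  let ?s = "\<lambda>e. esssup (restrict_space lborel (ball x0 e)) F"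
  have mono: "?s e \<le> ?s e'" if "0 < e" "e \<le> e'" "e' < e0" for e e'
  proof (rule esssup_I)
    show "F \<in> borel_measurable (restrict_space lborel (ball x0 e))" using that by (intro F) auto
    have "AE x in restrict_space lborel (ball x0 e'). F x \<le> ?s e'" by (rule esssup_AE)
    then have "AE x in lborel. x \<in> ball x0 e' \<longrightarrow> F x \<le> ?s e'" by (simp add: AE_restrict_space_iff)
    then show "AE x in restrict_space lborel (ball x0 e). F x \<le> ?s e'"
      using that by (subst AE_restrict_space_iff) (auto elim!: eventually_mono)
  qed
  have ev: "\<forall>\<^sub>F e in at_right 0. 0 < e \<and> e < e1" if "0 < e1" for e1 :: real
    using that by (auto simp: eventually_at_right_field intro!: exI[of _ e1])
  show ?thesis
  proof (rule order_tendstoI)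
    fix y assume y: "y < (INF e\<in>{0<..<e0}. ?s e)"
    show "\<forall>\<^sub>F e in at_right 0. y < ?s e"
      using ev[OF e0]
    proof eventually_elim
      case (elim e)
      then have "(INF e\<in>{0<..<e0}. ?s e) \<le> ?s e" by (intro INF_lower) auto
      with y show ?case by (rule less_le_trans)
    qed
  next
    fix y assume "(INF e\<in>{0<..<e0}. ?s e) < y"
    then obtain e1 where e1: "0 < e1" "e1 < e0" "?s e1 < y" unfolding INF_less_iff by auto
    show "\<forall>\<^sub>F e in at_right 0. ?s e < y"
      using ev[OF e1(1)]
    proof eventually_elim
      case (elim e)
      then have "?s e \<le> ?s e1" using e1 by (intro mono) auto
      then show ?case using e1(3) by (rule le_less_trans)
    qed
  qed
qed

section \<open>From the probabilistic solution to the mean of a Borel payoff\<close>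

context quasi_diffusion
begin

lemma exit_point_cball:
  assumes w: "\<omega> \<in> space M" and X0: "X 0 \<omega> \<in> ball c r" and fin: "exit_from c r \<omega> < \<infinity>"
  shows "X (real_of_ereal (exit_from c r \<omega>)) \<omega> \<in> cball c r"
proof -
  obtain \<tau> where \<tau>: "0 \<le> \<tau>" "exit_from c r \<omega> = ereal \<tau>" using exit_from_attained[OF w fin] by metis
  \<comment> \<open>Truncating after the exit time makes the stopped time equal to it, so
    \<open>stop_cball\<close> applies.\<close>
  have "ereal (stop c r (\<tau> + 1) \<omega>) = ereal \<tau>" using stop_eq[of "\<tau> + 1" c r \<omega>] \<tau> by simp
  then show ?thesis using stop_cball[OF w _ X0, of "\<tau> + 1"] \<tau> by simp
qed

text \<open>Off \<open>cball 0 R\<close> the function \<open>g\<close> is arbitrary, so the exit value need not be measurable on the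
  null event that the path starts there. If it is not, the convention for the Bochner integral
  makes its expectation \<open>0\<close> for every starting point, which amounts to \<open>g = 0\<close>.\<close>

lemma prob_solution_payoff:
  assumes adm: "admissible_coeffs \<delta> B a b" and est: "exit_estimate TYPE('w) TYPE('n) \<delta> B p" and R: "0 < R"
    and g: "set_borel_measurable borel (cball 0 R) g" "bounded (g ` cball 0 R)"
    and f: "f \<in> Lp_on p (ball 0 R)"
  shows "\<exists>g'. g' \<in> borel_measurable borel \<and> bounded (range g') \<and>
    (\<forall>y\<in>ball 0 R. prob_solution X P R f g y = (\<integral>\<omega>. payoff R (\<lambda>x. indicator (ball 0 R) x * f x) g' \<omega> \<partial>P y))"
proof -
  let ?f = "\<lambda>x. indicator (ball 0 R) x * f x"
  define G where "G \<omega> = (if exit_time X R \<omega> < \<infinity> then g (X (real_of_ereal (exit_time X R \<omega>)) \<omega>) else 0)" for \<omega>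
  define g' where "g' = (if G \<in> borel_measurable M then (\<lambda>x. indicator (cball 0 R) x * g x) else (\<lambda>x. 0))"
  have fm: "?f \<in> borel_measurable borel" using f by (simp add: Lp_on_def set_borel_measurable_def)
  have fL: "Lp_norm p UNIV ?f < \<infinity>"
  proof -
    have "(\<integral>\<^sup>+x\<in>UNIV. ennreal (norm (?f x) powr p) \<partial>lborel) \<le> (\<integral>\<^sup>+x\<in>ball 0 R. ennreal (norm (f x) powr p) \<partial>lborel)"
      by (intro nn_integral_mono) (auto simp: indicator_def)
    also have "\<dots> < \<infinity>" using f unfolding Lp_on_def by (simp only: Lp_norm_finite_iff mem_Collect_eq)
    finally show ?thesis by (simp only: Lp_norm_finite_iff)
  qed
  have gm: "g' \<in> borel_measurable borel" using g(1) by (simp add: g'_def set_borel_measurable_def)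
  obtain K where "\<forall>y\<in>g ` cball 0 R. norm y \<le> K" using g(2) unfolding bounded_iff by blast
  then have K: "\<bar>g x\<bar> \<le> K" if "x \<in> cball 0 R" for x using that by auto
  have K': "\<bar>g' x\<bar> \<le> max K 0" for x using K[of x] by (auto simp: g'_def indicator_def le_max_iff_disj)
  then have gb: "bounded (range g')" unfolding bounded_iff by auto
  define G' where "G' \<omega> = (if exit_from 0 R \<omega> < \<infinity> then g' (X (real_of_ereal (exit_from 0 R \<omega>)) \<omega>) else 0)" for \<omega>
  have G'm: "G' \<in> borel_measurable path_alg" unfolding G'_def[abs_def] by (rule exit_value_measurable[OF gm])
  have eq: "prob_solution X P R f g y = (\<integral>\<omega>. payoff R ?f g' \<omega> \<partial>P y)" if y: "y \<in> ball 0 R" for y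
  proof -
    interpret prob_space "P y" by (rule prob)
    have iG': "integrable (P y) G'"
      using path_P[OF G'm] K' by (intro integrable_const_bound[where B="max K 0"]) (auto simp: G'_def)
    have iF: "integrable (P y) (\<lambda>\<omega>. LINT t:before 0 R \<omega>|lborel. ?f (X t \<omega>))"
      using potential_abs_integrable[OF adm est R fm fL] path_P[OF before_integral_measurable[OF fm]]
    proof (rule Bochner_Integration.integrable_bound)
      show "AE \<omega> in P y. norm (LINT t:before 0 R \<omega>|lborel. ?f (X t \<omega>)) \<le> norm (LINT t:before 0 R \<omega>|lborel. \<bar>?f (X t \<omega>)\<bar>)"
        using potential_AE[OF adm est R fm fL, where y=y]
      proof eventually_elim
        case (elim \<omega>)
        from potential_dominated[OF adm est R fm fL elim order_refl before_sets]
        show ?case by (simp only: real_norm_def)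
      qed
    qed
    have be: "before_exit X R \<omega> = before 0 R \<omega>" for \<omega> by (simp add: before_exit_def before_def exit_from_0)
    have 1: "(\<integral>\<omega>. (LINT t:before_exit X R \<omega>|lborel. f (X t \<omega>)) \<partial>P y) = (\<integral>\<omega>. (LINT t:before 0 R \<omega>|lborel. ?f (X t \<omega>)) \<partial>P y)"
    proof (intro Bochner_Integration.integral_cong refl)
      fix \<omega> assume "\<omega> \<in> space (P y)"
      then have w: "\<omega> \<in> space M" by simp
      show "(LINT t:before_exit X R \<omega>|lborel. f (X t \<omega>)) = (LINT t:before 0 R \<omega>|lborel. ?f (X t \<omega>))"
        unfolding be by (intro set_lebesgue_integral_cong) (use before_sets before_mem[OF w, of _ 0 R] in auto)
    qed
    have 2: "(\<integral>\<omega>. G \<omega> \<partial>P y) = (\<integral>\<omega>. G' \<omega> \<partial>P y)"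
    proof (cases "G \<in> borel_measurable M")
      case True
      have "AE \<omega> in P y. G \<omega> = G' \<omega>"
        using start[of y] AE_space
      proof eventually_elim
        case (elim \<omega>)
        then show ?case using exit_point_cball[of \<omega> 0 R] y True
          by (auto simp: G_def G'_def g'_def exit_from_0)
      qed
      moreover have "G \<in> borel_measurable (P y)" using True measurable_cong_sets[OF sets_P refl] by blast
      ultimately show ?thesis using path_P[OF G'm] by (intro integral_cong_AE) auto
    next
      case False
      then have "G \<notin> borel_measurable (P y)" using measurable_cong_sets[OF sets_P refl] by blast
      then have "\<not> integrable (P y) G" using borel_measurable_integrable by blast
      then show ?thesis using False by (simp add: not_integrable_integral_eq G'_def g'_def cong: if_cong)
    qed
    have "(\<integral>\<omega>. payoff R ?f g' \<omega> \<partial>P y) = (\<integral>\<omega>. (LINT t:before 0 R \<omega>|lborel. ?f (X t \<omega>)) \<partial>P y) + (\<integral>\<omega>. G' \<omega> \<partial>P y)"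
      unfolding payoff_def G'_def[symmetric] by (rule Bochner_Integration.integral_add[OF iF iG'])
    then show ?thesis unfolding prob_solution_def G_def[symmetric] using 1 2 by simp
  qed
  show ?thesis using gm gb eq by (intro exI[of _ g']) auto
qed

end

theorem theorem6p10:
  fixes \<delta> B d0 p R :: real
    and a :: "real^'n \<Rightarrow> real^'n^'n"
    and b :: "real^'n \<Rightarrow> real^'n"
    and M :: "'w measure"
    and X :: "real \<Rightarrow> 'w \<Rightarrow> real^'n"
    and F :: "real \<Rightarrow> 'w measure"
    and P :: "real^'n \<Rightarrow> 'w measure"
    and f g \<phi> :: "real^'n \<Rightarrow> real"
    and D\<phi> :: "'n \<Rightarrow> real^'n \<Rightarrow> real"
    and D2\<phi> :: "'n \<Rightarrow> 'n \<Rightarrow> real^'n \<Rightarrow> real"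
    and x0 :: "real^'n"
  assumes "0 < \<delta>" and "\<delta> < 1" and "0 < B"
    and "krylov_exponent TYPE('w) TYPE('n) \<delta> B d0"
    and "admissible_coeffs \<delta> B a b"
    and "quasi_diffusion M X F P a b"
    and "0 < R" and "d0 \<le> p"
    and "set_borel_measurable borel (cball 0 (2 * R)) g" and "bounded (g ` cball 0 (2 * R))"
    and "f \<in> Lp_on p (ball 0 (2 * R))"
    and "sobolev2 d0 (ball 0 (2 * R)) \<phi> D\<phi> D2\<phi>" and "continuous_on (ball 0 (2 * R)) \<phi>"
    and "x0 \<in> ball 0 (2 * R)"
    and "\<forall>\<^sub>F x in nhds x0. prob_solution X P (2 * R) f g x - \<phi> x
                          \<le> prob_solution X P (2 * R) f g x0 - \<phi> x0"
  shows "\<exists>l. ((\<lambda>\<epsilon>. esssup (restrict_space lborel (ball x0 \<epsilon>))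
                        (\<lambda>x. ereal (diff_op a b D\<phi> D2\<phi> x + f x))) \<longlongrightarrow> l) (at_right 0)
             \<and> l \<ge> 0"
proof -
  interpret quasi_diffusion M X F P a b by fact
  note adm = assms(5) and sob = assms(12)
  let ?D = "ball 0 (2 * R) :: (real^'n) set"
  let ?U = "\<lambda>x. diff_op a b D\<phi> D2\<phi> x + f x"
  let ?f = "\<lambda>x. indicator ?D x * f x"
  have R2: "0 < 2 * R" using assms(7) by simp
  have kry: "real CARD('n) / 2 < d0" "d0 < real CARD('n)" "\<And>p. d0 \<le> p \<Longrightarrow> exit_estimate TYPE('w) TYPE('n) \<delta> B p"
    using assms(4) by (auto simp: krylov_exponent_def)
  obtain e0 where e0: "0 < e0" "ball x0 e0 \<subseteq> ?D"
    using assms(14) open_ball[of 0 "2 * R"] unfolding open_contains_ball by blast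
  have am: "a \<in> borel_measurable borel" "b \<in> borel_measurable borel" using adm by (auto simp: admissible_coeffs_def)
  have Lpm: "(\<lambda>x. indicator ?D x * u x) \<in> borel_measurable borel" if "u \<in> Lp_on q ?D" for u q
    using that by (simp add: Lp_on_def set_borel_measurable_def)
  have fm: "?f \<in> borel_measurable borel" by (rule Lpm[OF assms(11)])
  \<comment> \<open>\<open>f\<close> and the generalized derivatives are measurable only after
    restriction to the domain; \<open>V\<close> is a Borel function on the whole space that agrees
    there with the expression in question.\<close>
  define V where "V x = diff_op a b (\<lambda>i x. indicator ?D x * D\<phi> i x) (\<lambda>i j x. indicator ?D x * D2\<phi> i j x) x + ?f x" for x
  have Vm: "V \<in> borel_measurable borel"
  proof -
    have "(\<lambda>x. indicator ?D x * D\<phi> i x) \<in> borel_measurable borel" "(\<lambda>x. indicator ?D x * D2\<phi> i j x) \<in> borel_measurable borel" for i j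
      using sob by (auto simp: sobolev2_def intro: Lpm)
    then show ?thesis
      unfolding V_def[abs_def] by (intro borel_measurable_add[OF diff_op_measurable fm] am)
  qed
  have VU: "V x = ?U x" if "x \<in> ?D" for x using that by (simp add: V_def diff_op_def)
  have meas: "(\<lambda>x. ereal (?U x)) \<in> borel_measurable (restrict_space lborel (ball x0 e))" if "0 < e" "e < e0" for e
  proof -
    have "(\<lambda>x. ereal (V x)) \<in> borel_measurable (restrict_space lborel (ball x0 e))"
      using Vm by (intro measurable_restrict_space1) simp
    moreover have "x \<in> ?D" if "x \<in> ball x0 e" for x
    proof -
      have "x \<in> ball x0 e0" using that \<open>e < e0\<close> by simp
      then show ?thesis using e0(2) by blast
    qed
    ultimately show ?thesis
      by (subst measurable_cong[where g="\<lambda>x. ereal (V x)"]) (auto simp: space_restrict_space VU)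
  qed
  let ?l = "INF e\<in>{0<..<e0}. esssup (restrict_space lborel (ball x0 e)) (\<lambda>x. ereal (?U x))"
  have lim: "((\<lambda>e. esssup (restrict_space lborel (ball x0 e)) (\<lambda>x. ereal (?U x))) \<longlongrightarrow> ?l) (at_right 0)"
    by (rule esssup_ball_tendsto[OF e0(1) meas])
  have "0 \<le> ?l"
  proof (rule ccontr)
    assume "\<not> 0 \<le> ?l"
    then have "?l < 0" by simp
    then obtain e where e: "0 < e" "e < e0" "esssup (restrict_space lborel (ball x0 e)) (\<lambda>x. ereal (?U x)) < 0"
      unfolding INF_less_iff by auto
    \<comment> \<open>The essential supremum may be \<open>-\<infinity>\<close>. A real number
      strictly between it and 0 supplies the finite constant \<open>c = - z\<close>.\<close>
    obtain z where z: "esssup (restrict_space lborel (ball x0 e)) (\<lambda>x. ereal (?U x)) < ereal z" "ereal z < 0"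
      using ereal_dense2[OF e(3)] by blast
    have "AE x in restrict_space lborel (ball x0 e). ereal (?U x) \<le> esssup (restrict_space lborel (ball x0 e)) (\<lambda>x. ereal (?U x))"
      by (rule esssup_AE)
    then have le: "AE x in lborel. x \<in> ball x0 e \<longrightarrow> ereal (?U x) \<le> esssup (restrict_space lborel (ball x0 e)) (\<lambda>x. ereal (?U x))"
      by (simp add: AE_restrict_space_iff)
    obtain d where d: "0 < d" "\<And>y. dist y x0 < d \<Longrightarrow> prob_solution X P (2 * R) f g y - \<phi> y \<le> prob_solution X P (2 * R) f g x0 - \<phi> x0"
      using assms(15) unfolding eventually_nhds_metric by blast
    \<comment> \<open>Within radius \<open>e / 2\<close> the differential inequality holds and the
      closed ball stays in the domain; within radius \<open>d\<close> the maximum at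
      \<open>x0\<close> holds.\<close>
    define s where "s = min (e / 2) d"
    have s: "0 < s" "s < e" "s \<le> d" using e d by (auto simp: s_def)
    have sD: "cball x0 s \<subseteq> ?D"
    proof -
      have "cball x0 s \<subseteq> ball x0 e0" using s e by auto
      then show ?thesis using e0(2) by blast
    qed
    obtain g' where g': "g' \<in> borel_measurable borel" "bounded (range g')"
      "\<And>y. y \<in> ?D \<Longrightarrow> prob_solution X P (2 * R) f g y = (\<integral>\<omega>. payoff (2 * R) ?f g' \<omega> \<partial>P y)"
      using prob_solution_payoff[OF adm kry(3)[OF assms(8)] R2 assms(9,10,11)] by blast
    show False
    proof (rule no_strict_subsolution[OF adm assms(1) kry(3)[OF order_refl] kry(1,2) kry(3)[OF assms(8)] R2 fm _ g'(1,2) sob assms(13) s(1) sD])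
      have "(\<integral>\<^sup>+x\<in>UNIV. ennreal (norm (?f x) powr p) \<partial>lborel) \<le> (\<integral>\<^sup>+x\<in>?D. ennreal (norm (f x) powr p) \<partial>lborel)"
        by (intro nn_integral_mono) (auto simp: indicator_def)
      also have "\<dots> < \<infinity>" using assms(11) unfolding Lp_on_def by (simp only: Lp_norm_finite_iff mem_Collect_eq)
      finally show "Lp_norm p UNIV ?f < \<infinity>" by (simp only: Lp_norm_finite_iff)
      show "(\<integral>\<omega>. payoff (2 * R) ?f g' \<omega> \<partial>P y) - \<phi> y \<le> (\<integral>\<omega>. payoff (2 * R) ?f g' \<omega> \<partial>P x0) - \<phi> x0" if "y \<in> ball x0 s" for y
        using d(2)[of y] that s sD assms(14) g'(3)[of y] g'(3)[of x0] by (auto simp: dist_commute subset_eq)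
      show "0 < - z" using z(2) by simp
      show "AE x in lborel. x \<in> ball x0 s \<longrightarrow> diff_op a b D\<phi> D2\<phi> x + ?f x \<le> - (- z)"
        using le
      proof eventually_elim
        case (elim x)
        show ?case
        proof
          assume x: "x \<in> ball x0 s"
          then have "x \<in> ?D" using sD by (meson ball_subset_cball subsetD)
          moreover have "x \<in> ball x0 e" using x s by auto
          with elim z(1) have "ereal (?U x) \<le> ereal z" by (meson le_less_trans less_imp_le)
          ultimately show "diff_op a b D\<phi> D2\<phi> x + ?f x \<le> - (- z)" by simp
        qed
      qed
    qed
  qed
  with lim show ?thesis by blast
qed

end
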